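(* Let $(\mathcal C,\otimes,\mathbf 1,c)$ be a braided finite tensor category over an algebraically closed field $\Bbbk$, and let $(\mathcal M,\triangleright,e)$ be a nonzero, exact, indecomposable, braided finite left $\mathcal C$-module category. If $\mathcal M$ is weakly factorizable, then $\mathcal M$ has trivial symmetric center.
   Context: Conventions: $\Bbbk$ is an algebraically closed field; categories are $\Bbbk$-linear abelian, functors are $\Bbbk$-linear and right exact; monoidal and module categories are written as if strict. A finite tensor category is a finite $\Bbbk$-linear abelian rigid monoidal category with $\otimes$ bilinear and $\mathrm{End}(\mathbf 1)\cong\Bbbk$; $X^*$ is the left dual, with $\mathrm{coev}^L_X:\mathbf 1\to X\otimes X^*$. A braiding is a natural isomorphism $c_{X,Y}:X\otimes Y\to Y\otimes X$ with $c_{X\otimes Y,Z}=(c_{X,Z}\otimes \mathrm{id}_Y)(\mathrm{id}_X\otimes c_{Y,Z})$ and $c_{X,Y\otimes Z}=(\mathrm{id}_Y\otimes c_{X,Z})(c_{X,Y}\otimes\mathrm{id}_Z)$. A (finite) left $\mathcal C$-module category $(\mathcal M,\triangleright)$ is a finite abelian category with an action bifunctor $\triangleright$, bilinear on morphisms, such that $(-\triangleright M)$ is exact for each $M$. It is exact if $P\triangleright M$ is projective for all projective $P\in\mathcal C$ and all $M\in\mathcal M$. It is braided if equipped with a natural isomorphism $e_{X,M}:X\triangleright M\to X\triangleright M$ such that $e_{X\otimes Y,M}=(\mathrm{id}_X\triangleright e_{Y,M})(c_{Y,X}\triangleright\mathrm{id}_M)(\mathrm{id}_Y\triangleright e_{X,M})(c_{Y,X}^{-1}\triangleright\mathrm{id}_M)$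 and $e_{X,Y\triangleright M}=(c_{Y,X}\triangleright\mathrm{id}_M)(\mathrm{id}_Y\triangleright e_{X,M})(c_{X,Y}\triangleright\mathrm{id}_M)$. Internal Homs: $\underline{\mathrm{Hom}}(M,-):\mathcal M\to\mathcal C$ is the right adjoint of $(-\triangleright M)$; $\mathrm{coev}_{\mathbf 1,M}:\mathbf 1\to\underline{\mathrm{Hom}}(M,M)$ is the adjunct of $\mathrm{id}_M$ and $\mathrm{ev}_{M,N}:\underline{\mathrm{Hom}}(M,N)\triangleright M\to N$ the counit. There is a canonical isomorphism $X\otimes\underline{\mathrm{Hom}}(M,N)\cong\underline{\mathrm{Hom}}(M,X\triangleright N)$ (adjunct of $\mathrm{id}_X\triangleright\mathrm{ev}_{M,N}$). Put $\mathtt E_{\mathcal C}=\int_{X\in\mathcal C}X\otimes X^*$ and $\mathtt E_{\mathcal M}=\int_{M\in\mathcal M}\underline{\mathrm{Hom}}(M,M)$ (ends in $\mathcal C$), with canonical morphisms $\pi_{\mathcal C}(X):\mathtt E_{\mathcal C}\to X\otimes X^*$ and $\pi_{\mathcal M}(M):\mathtt E_{\mathcal M}\to\underline{\mathrm{Hom}}(M,M)$. Universal copairing: $\omega_{\mathcal M}:\mathbf 1\to\mathtt E_{\mathcal C}\otimes\mathtt E_{\mathcal M}$ is the unique morphism such that for all $X\in\mathcal C$, $M\in\mathcal M$, $(\pi_{\mathcal C}(X)\otimes\pi_{\mathcal M}(M))\circ\omega_{\mathcal M}$ equals the composite $\mathbf 1\xrightarrow{\mathrm{coev}^L_X\otimes\mathrm{coev}_{\mathbf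 1,M}}X\otimes X^*\otimes\underline{\mathrm{Hom}}(M,M)\cong X\otimes\underline{\mathrm{Hom}}(M,X^*\triangleright M)\xrightarrow{\mathrm{id}\otimes\underline{\mathrm{Hom}}(\mathrm{id},e_{X^*,M})}X\otimes\underline{\mathrm{Hom}}(M,X^*\triangleright M)\cong X\otimes X^*\otimes\underline{\mathrm{Hom}}(M,M)$. Weakly factorizable: the linear map $\Omega_{\mathcal M}:\mathrm{Hom}_{\mathcal C}(\mathtt E_{\mathcal C},\mathbf 1)\to\mathrm{Hom}_{\mathcal C}(\mathbf 1,\mathtt E_{\mathcal M})$, $f\mapsto(f\otimes\mathrm{id}_{\mathtt E_{\mathcal M}})\circ\omega_{\mathcal M}$, is bijective. Symmetric center: $\mathcal Z_2(\mathcal M)$ is the full subcategory of $\mathcal C$ on the objects $X$ with $e_{X,M}=\mathrm{id}_{X\triangleright M}$ for all $M\in\mathcal M$. It is trivial if $\mathcal Z_2(\mathcal M)\simeq\mathsf{FdVec}$, the category of finite-dimensional $\Bbbk$-vector spaces. *)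

theory Defs
  imports "HOL-Computational_Algebra.Polynomial" "HOL-Algebra.Module"
begin

section \<open>Linear categories\<close>

text \<open>
  Arrows carry their source and target, so distinct Hom-spaces are disjoint. As usual in HOL, a
  category is small relative to the type universe: objects and arrows form sets over arbitrary types.
\<close>

definition scalar_ring :: "'k :: field ring" where
  "scalar_ring = \<lparr>carrier = UNIV, monoid.mult = (*), one = 1, zero = 0, add = (+)\<rparr>"

record ('o, 'm, 'k) lcat =
  obj :: "'o set"
  arr :: "'m set"
  src :: "'m \<Rightarrow> 'o"
  tgt :: "'m \<Rightarrow> 'o"
  ident :: "'o \<Rightarrow> 'm"
  cmp :: "'m \<Rightarrow> 'm \<Rightarrow> 'm"  (infixr \<open>\<cdot>\<index>\<close> 65)
  zero_arr :: "'o \<Rightarrow> 'o \<Rightarrow> 'm"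
  add_arr :: "'m \<Rightarrow> 'm \<Rightarrow> 'm"
  scale_arr :: "'k \<Rightarrow> 'm \<Rightarrow> 'm"

definition Hom :: "('o, 'm, 'k, 'z) lcat_scheme \<Rightarrow> 'o \<Rightarrow> 'o \<Rightarrow> 'm set" where
  "Hom C A B = {f \<in> arr C. src C f = A \<and> tgt C f = B}"

text \<open>The ring multiplication required by the record type of modules is a dummy.\<close>

definition hom_space :: "('o, 'm, 'k, 'z) lcat_scheme \<Rightarrow> 'o \<Rightarrow> 'o \<Rightarrow> ('k, 'm) module" where
  "hom_space C A B =
     \<lparr>carrier = Hom C A B, monoid.mult = (\<lambda>_ _. undefined), one = undefined,
      zero = zero_arr C A B, add = add_arr C, module.smult = scale_arr C\<rparr>"

locale linear_category =
  fixes C :: "('o, 'm, 'k :: field, 'z) lcat_scheme" (structure)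
  assumes src_obj: "f \<in> arr C \<Longrightarrow> src C f \<in> obj C"
    and tgt_obj: "f \<in> arr C \<Longrightarrow> tgt C f \<in> obj C"
    and ident_Hom: "A \<in> obj C \<Longrightarrow> ident C A \<in> Hom C A A"
    and cmp_Hom: "\<lbrakk>f \<in> Hom C A B; g \<in> Hom C B D\<rbrakk> \<Longrightarrow> g \<cdot> f \<in> Hom C A D"
    and cmp_ident_right: "f \<in> Hom C A B \<Longrightarrow> f \<cdot> ident C A = f"
    and cmp_ident_left: "f \<in> Hom C A B \<Longrightarrow> ident C B \<cdot> f = f"
    and cmp_assoc: "\<lbrakk>f \<in> Hom C A B; g \<in> Hom C B D; h \<in> Hom C D E\<rbrakk> \<Longrightarrow> (h \<cdot> g) \<cdot> f = h \<cdot> (g \<cdot> f)"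
    and hom_space_module:
      "\<lbrakk>A \<in> obj C; B \<in> obj C\<rbrakk> \<Longrightarrow> Module.module (scalar_ring :: 'k ring) (hom_space C A B)"
    and cmp_add_left:
      "\<lbrakk>f \<in> Hom C A B; g \<in> Hom C B D; h \<in> Hom C B D\<rbrakk>
        \<Longrightarrow> add_arr C g h \<cdot> f = add_arr C (g \<cdot> f) (h \<cdot> f)"
    and cmp_add_right:
      "\<lbrakk>f \<in> Hom C A B; g \<in> Hom C A B; h \<in> Hom C B D\<rbrakk>
        \<Longrightarrow> h \<cdot> add_arr C f g = add_arr C (h \<cdot> f) (h \<cdot> g)"
    and cmp_scale_left:
      "\<lbrakk>f \<in> Hom C A B; g \<in> Hom C B D\<rbrakk> \<Longrightarrow> scale_arr C a g \<cdot> f = scale_arr C a (g \<cdot> f)"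
    and cmp_scale_right:
      "\<lbrakk>f \<in> Hom C A B; g \<in> Hom C B D\<rbrakk> \<Longrightarrow> g \<cdot> scale_arr C a f = scale_arr C a (g \<cdot> f)"

definition fin_dim :: "('k :: field, 'v, 'z) module_scheme \<Rightarrow> bool" where
  "fin_dim V \<longleftrightarrow>
     (\<exists>B. finite B \<and> B \<subseteq> carrier V \<and>
        (\<forall>v \<in> carrier V. \<exists>a :: 'v \<Rightarrow> 'k. v = (\<Oplus>\<^bsub>V\<^esub>b\<in>B. a b \<odot>\<^bsub>V\<^esub> b)))"

definition is_inverse :: "('o, 'm, 'k, 'z) lcat_scheme \<Rightarrow> 'm \<Rightarrow> 'm \<Rightarrow> bool" where
  "is_inverse C f g \<longleftrightarrow>
     f \<in> arr C \<and> g \<in> Hom C (tgt C f) (src C f) \<and>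
     g \<cdot>\<^bsub>C\<^esub> f = ident C (src C f) \<and> f \<cdot>\<^bsub>C\<^esub> g = ident C (tgt C f)"

definition is_iso :: "('o, 'm, 'k, 'z) lcat_scheme \<Rightarrow> 'm \<Rightarrow> bool" where
  "is_iso C f \<longleftrightarrow> (\<exists>g. is_inverse C f g)"

definition inv_arr :: "('o, 'm, 'k, 'z) lcat_scheme \<Rightarrow> 'm \<Rightarrow> 'm" where
  "inv_arr C f = (THE g. is_inverse C f g)"

definition Iso :: "('o, 'm, 'k, 'z) lcat_scheme \<Rightarrow> 'o \<Rightarrow> 'o \<Rightarrow> 'm set" where
  "Iso C A B = {f \<in> Hom C A B. is_iso C f}"

section \<open>Finite abelian categories\<close>

definition zero_object :: "('o, 'm, 'k, 'z) lcat_scheme \<Rightarrow> 'o \<Rightarrow> bool" where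
  "zero_object C Z \<longleftrightarrow>
     Z \<in> obj C \<and> (\<forall>A \<in> obj C. (\<exists>!f. f \<in> Hom C Z A) \<and> (\<exists>!f. f \<in> Hom C A Z))"

definition is_mono :: "('o, 'm, 'k, 'z) lcat_scheme \<Rightarrow> 'm \<Rightarrow> bool" where
  "is_mono C f \<longleftrightarrow>
     f \<in> arr C \<and>
     (\<forall>A \<in> obj C. \<forall>g \<in> Hom C A (src C f). \<forall>h \<in> Hom C A (src C f).
        f \<cdot>\<^bsub>C\<^esub> g = f \<cdot>\<^bsub>C\<^esub> h \<longrightarrow> g = h)"

definition is_epi :: "('o, 'm, 'k, 'z) lcat_scheme \<Rightarrow> 'm \<Rightarrow> bool" where
  "is_epi C f \<longleftrightarrow>
     f \<in> arr C \<and>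
     (\<forall>A \<in> obj C. \<forall>g \<in> Hom C (tgt C f) A. \<forall>h \<in> Hom C (tgt C f) A.
        g \<cdot>\<^bsub>C\<^esub> f = h \<cdot>\<^bsub>C\<^esub> f \<longrightarrow> g = h)"

definition is_kernel :: "('o, 'm, 'k, 'z) lcat_scheme \<Rightarrow> 'm \<Rightarrow> 'm \<Rightarrow> bool" where
  "is_kernel C f k \<longleftrightarrow>
     f \<in> arr C \<and> k \<in> arr C \<and> tgt C k = src C f \<and>
     f \<cdot>\<^bsub>C\<^esub> k = zero_arr C (src C k) (tgt C f) \<and>
     (\<forall>h \<in> arr C. tgt C h = src C f \<and> f \<cdot>\<^bsub>C\<^esub> h = zero_arr C (src C h) (tgt C f) \<longrightarrow>
        (\<exists>!u. u \<in> Hom C (src C h) (src C k) \<and> k \<cdot>\<^bsub>C\<^esub> u = h))"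

definition is_cokernel :: "('o, 'm, 'k, 'z) lcat_scheme \<Rightarrow> 'm \<Rightarrow> 'm \<Rightarrow> bool" where
  "is_cokernel C f q \<longleftrightarrow>
     f \<in> arr C \<and> q \<in> arr C \<and> src C q = tgt C f \<and>
     q \<cdot>\<^bsub>C\<^esub> f = zero_arr C (src C f) (tgt C q) \<and>
     (\<forall>h \<in> arr C. src C h = tgt C f \<and> h \<cdot>\<^bsub>C\<^esub> f = zero_arr C (src C f) (tgt C h) \<longrightarrow>
        (\<exists>!u. u \<in> Hom C (tgt C q) (tgt C h) \<and> u \<cdot>\<^bsub>C\<^esub> q = h))"

definition short_exact :: "('o, 'm, 'k, 'z) lcat_scheme \<Rightarrow> 'm \<Rightarrow> 'm \<Rightarrow> bool" where
  "short_exact C f g \<longleftrightarrow> is_kernel C g f \<and> is_cokernel C f g"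

definition is_biproduct ::
  "('o, 'm, 'k, 'z) lcat_scheme \<Rightarrow> 'o \<Rightarrow> 'o \<Rightarrow> 'o \<Rightarrow> 'm \<Rightarrow> 'm \<Rightarrow> 'm \<Rightarrow> 'm \<Rightarrow> bool" where
  "is_biproduct C A B P i j p q \<longleftrightarrow>
     i \<in> Hom C A P \<and> j \<in> Hom C B P \<and> p \<in> Hom C P A \<and> q \<in> Hom C P B \<and>
     p \<cdot>\<^bsub>C\<^esub> i = ident C A \<and> q \<cdot>\<^bsub>C\<^esub> j = ident C B \<and>
     q \<cdot>\<^bsub>C\<^esub> i = zero_arr C A B \<and> p \<cdot>\<^bsub>C\<^esub> j = zero_arr C B A \<and>
     add_arr C (i \<cdot>\<^bsub>C\<^esub> p) (j \<cdot>\<^bsub>C\<^esub> q) = ident C P"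

locale abelian_category = linear_category +
  assumes ex_zero_object: "\<exists>Z. zero_object C Z"
    and ex_biproduct: "\<lbrakk>A \<in> obj C; B \<in> obj C\<rbrakk> \<Longrightarrow> \<exists>P \<in> obj C. \<exists>i j p q. is_biproduct C A B P i j p q"
    and ex_kernel: "f \<in> arr C \<Longrightarrow> \<exists>k. is_kernel C f k"
    and ex_cokernel: "f \<in> arr C \<Longrightarrow> \<exists>q. is_cokernel C f q"
    and mono_normal: "is_mono C f \<Longrightarrow> \<exists>g. is_kernel C g f"
    and epi_conormal: "is_epi C f \<Longrightarrow> \<exists>g. is_cokernel C g f"

definition simple_object :: "('o, 'm, 'k, 'z) lcat_scheme \<Rightarrow> 'o \<Rightarrow> bool" where
  "simple_object C S \<longleftrightarrow>
     S \<in> obj C \<and> \<not> zero_object C S \<and>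
     (\<forall>f. is_mono C f \<and> tgt C f = S \<longrightarrow> zero_object C (src C f) \<or> is_iso C f)"

inductive has_finite_length :: "('o, 'm, 'k, 'z) lcat_scheme \<Rightarrow> 'o \<Rightarrow> bool" for C where
  zero: "zero_object C Z \<Longrightarrow> has_finite_length C Z"
| extend: "\<lbrakk>has_finite_length C (src C f); short_exact C f g; simple_object C (tgt C g)\<rbrakk>
    \<Longrightarrow> has_finite_length C (tgt C f)"

definition projective :: "('o, 'm, 'k, 'z) lcat_scheme \<Rightarrow> 'o \<Rightarrow> bool" where
  "projective C P \<longleftrightarrow>
     P \<in> obj C \<and>
     (\<forall>g f. is_epi C g \<and> f \<in> Hom C P (tgt C g) \<longrightarrow> (\<exists>h \<in> Hom C P (src C g). g \<cdot>\<^bsub>C\<^esub> h = f))"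

locale finite_abelian_category = abelian_category +
  assumes Hom_fin_dim: "\<lbrakk>A \<in> obj C; B \<in> obj C\<rbrakk> \<Longrightarrow> fin_dim (hom_space C A B)"
    and finite_length: "A \<in> obj C \<Longrightarrow> has_finite_length C A"
    and enough_projectives:
      "A \<in> obj C \<Longrightarrow> \<exists>f. is_epi C f \<and> tgt C f = A \<and> projective C (src C f)"
    and finitely_many_simples:
      "\<exists>R. finite R \<and> R \<subseteq> obj C \<and> (\<forall>S. simple_object C S \<longrightarrow> (\<exists>T \<in> R. Iso C S T \<noteq> {}))"

section \<open>Functors and equivalences\<close>

record ('o, 'm, 'p, 'q) ftor =
  on_obj :: "'o \<Rightarrow> 'p"
  on_arr :: "'m \<Rightarrow> 'q"

definition id_ftor :: "('o, 'm, 'o, 'm) ftor" where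
  "id_ftor = \<lparr>on_obj = (\<lambda>A. A), on_arr = (\<lambda>f. f)\<rparr>"

definition comp_ftor ::
  "('p, 'q, 'r, 's) ftor \<Rightarrow> ('o, 'm, 'p, 'q) ftor \<Rightarrow> ('o, 'm, 'r, 's) ftor" where
  "comp_ftor G F = \<lparr>on_obj = on_obj G \<circ> on_obj F, on_arr = on_arr G \<circ> on_arr F\<rparr>"

definition linear_functor ::
  "('o, 'm, 'k, 'z) lcat_scheme \<Rightarrow> ('p, 'q, 'k, 'y) lcat_scheme \<Rightarrow> ('o, 'm, 'p, 'q) ftor \<Rightarrow> bool" where
  "linear_functor C D F \<longleftrightarrow>
     (\<forall>A \<in> obj C. on_obj F A \<in> obj D \<and> on_arr F (ident C A) = ident D (on_obj F A)) \<and>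
     (\<forall>A \<in> obj C. \<forall>B \<in> obj C. \<forall>f \<in> Hom C A B.
        on_arr F f \<in> Hom D (on_obj F A) (on_obj F B) \<and>
        (\<forall>a. on_arr F (scale_arr C a f) = scale_arr D a (on_arr F f)) \<and>
        (\<forall>g \<in> Hom C A B. on_arr F (add_arr C f g) = add_arr D (on_arr F f) (on_arr F g)) \<and>
        (\<forall>E \<in> obj C. \<forall>g \<in> Hom C B E. on_arr F (g \<cdot>\<^bsub>C\<^esub> f) = on_arr F g \<cdot>\<^bsub>D\<^esub> on_arr F f))"

definition exact_functor ::
  "('o, 'm, 'k, 'z) lcat_scheme \<Rightarrow> ('p, 'q, 'k, 'y) lcat_scheme \<Rightarrow> ('o, 'm, 'p, 'q) ftor \<Rightarrow> bool" where
  "exact_functor C D F \<longleftrightarrow>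
     linear_functor C D F \<and>
     (\<forall>f g. short_exact C f g \<longrightarrow> short_exact D (on_arr F f) (on_arr F g))"

definition natural_iso ::
  "('o, 'm, 'k, 'z) lcat_scheme \<Rightarrow> ('p, 'q, 'k, 'y) lcat_scheme \<Rightarrow>
   ('o, 'm, 'p, 'q) ftor \<Rightarrow> ('o, 'm, 'p, 'q) ftor \<Rightarrow> ('o \<Rightarrow> 'q) \<Rightarrow> bool" where
  "natural_iso C D F G \<eta> \<longleftrightarrow>
     (\<forall>A \<in> obj C. \<eta> A \<in> Iso D (on_obj F A) (on_obj G A)) \<and>
     (\<forall>f \<in> arr C. on_arr G f \<cdot>\<^bsub>D\<^esub> \<eta> (src C f) = \<eta> (tgt C f) \<cdot>\<^bsub>D\<^esub> on_arr F f)"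

definition equivalence ::
  "('o, 'm, 'k, 'z) lcat_scheme \<Rightarrow> ('p, 'q, 'k, 'y) lcat_scheme \<Rightarrow> ('o, 'm, 'p, 'q) ftor \<Rightarrow> bool" where
  "equivalence C D F \<longleftrightarrow>
     linear_functor C D F \<and>
     (\<exists>G \<eta> \<epsilon>. linear_functor D C G \<and>
        natural_iso C C id_ftor (comp_ftor G F) \<eta> \<and> natural_iso D D (comp_ftor F G) id_ftor \<epsilon>)"

definition full_subcategory :: "('o, 'm, 'k, 'z) lcat_scheme \<Rightarrow> 'o set \<Rightarrow> ('o, 'm, 'k, 'z) lcat_scheme" where
  "full_subcategory C S = C\<lparr>obj := S, arr := {f \<in> arr C. src C f \<in> S \<and> tgt C f \<in> S}\<rparr>"

definition linear_map ::
  "('k :: field, 'v, 'y) module_scheme \<Rightarrow> ('k, 'w, 'z) module_scheme \<Rightarrow> ('v \<Rightarrow> 'w) \<Rightarrow> bool" where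
  "linear_map V W f \<longleftrightarrow>
     f \<in> carrier V \<rightarrow> carrier W \<and>
     (\<forall>x \<in> carrier V. \<forall>y \<in> carrier V. f (x \<oplus>\<^bsub>V\<^esub> y) = f x \<oplus>\<^bsub>W\<^esub> f y) \<and>
     (\<forall>a. \<forall>x \<in> carrier V. f (a \<odot>\<^bsub>V\<^esub> x) = a \<odot>\<^bsub>W\<^esub> f x)"

text \<open>
  The category of all finite-dimensional vector spaces whose underlying set consists of sequences
  of scalars, with arbitrary vector space operations. Every finite-dimensional vector space is
  isomorphic to one of this kind. Arrows are triples (domain, extensional linear map, codomain).
\<close>

definition FdVec ::
  "(('k :: field, nat \<Rightarrow> 'k) module,
    ('k, nat \<Rightarrow> 'k) module \<times> ((nat \<Rightarrow> 'k) \<Rightarrow> nat \<Rightarrow> 'k) \<times> ('k, nat \<Rightarrow> 'k) module, 'k) lcat" where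
  "FdVec =
     (let Ob = {V. Module.module (scalar_ring :: 'k ring) V \<and> fin_dim V} in
     \<lparr>obj = Ob,
      arr = {(V, f, W). V \<in> Ob \<and> W \<in> Ob \<and> linear_map V W f \<and> f \<in> extensional (carrier V)},
      src = (\<lambda>(V, f, W). V),
      tgt = (\<lambda>(V, f, W). W),
      ident = (\<lambda>V. (V, \<lambda>x \<in> carrier V. x, V)),
      cmp = (\<lambda>(V, g, W) (U, f, _). (U, compose (carrier U) g f, W)),
      zero_arr = (\<lambda>V W. (V, \<lambda>x \<in> carrier V. \<zero>\<^bsub>W\<^esub>, W)),
      add_arr = (\<lambda>(V, f, W) (_, g, _). (V, \<lambda>x \<in> carrier V. f x \<oplus>\<^bsub>W\<^esub> g x, W)),
      scale_arr = (\<lambda>a (V, f, W). (V, \<lambda>x \<in> carrier V. a \<odot>\<^bsub>W\<^esub> f x, W))\<rparr>)"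

section \<open>Braided finite tensor categories\<close>

record ('o, 'm, 'k) moncat = "('o, 'm, 'k) lcat" +
  tens_obj :: "'o \<Rightarrow> 'o \<Rightarrow> 'o"  (infixr \<open>\<otimes>\<^sub>o\<index>\<close> 75)
  tens_arr :: "'m \<Rightarrow> 'm \<Rightarrow> 'm"  (infixr \<open>\<otimes>\<^sub>m\<index>\<close> 75)
  unit_obj :: "'o"  (\<open>\<I>\<index>\<close>)
  associator :: "'o \<Rightarrow> 'o \<Rightarrow> 'o \<Rightarrow> 'm"
  lunitor :: "'o \<Rightarrow> 'm"
  runitor :: "'o \<Rightarrow> 'm"

record ('o, 'm, 'k) braided_moncat = "('o, 'm, 'k) moncat" +
  braiding :: "'o \<Rightarrow> 'o \<Rightarrow> 'm"

locale linear_monoidal_category = linear_category C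
  for C :: "('o, 'm, 'k :: field, 'z) moncat_scheme" (structure) +
  assumes unit_obj: "\<I> \<in> obj C"
    and tens_obj: "\<lbrakk>X \<in> obj C; Y \<in> obj C\<rbrakk> \<Longrightarrow> X \<otimes>\<^sub>o Y \<in> obj C"
    and tens_arr:
      "\<lbrakk>f \<in> Hom C X X'; g \<in> Hom C Y Y'\<rbrakk> \<Longrightarrow> f \<otimes>\<^sub>m g \<in> Hom C (X \<otimes>\<^sub>o Y) (X' \<otimes>\<^sub>o Y')"
    and tens_ident:
      "\<lbrakk>X \<in> obj C; Y \<in> obj C\<rbrakk> \<Longrightarrow> ident C X \<otimes>\<^sub>m ident C Y = ident C (X \<otimes>\<^sub>o Y)"
    and tens_cmp:
      "\<lbrakk>f \<in> Hom C X X'; f' \<in> Hom C X' X''; g \<in> Hom C Y Y'; g' \<in> Hom C Y' Y''\<rbrakk>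
        \<Longrightarrow> (f' \<cdot> f) \<otimes>\<^sub>m (g' \<cdot> g) = (f' \<otimes>\<^sub>m g') \<cdot> (f \<otimes>\<^sub>m g)"
    and tens_add_left:
      "\<lbrakk>f \<in> Hom C X X'; f' \<in> Hom C X X'; g \<in> Hom C Y Y'\<rbrakk>
        \<Longrightarrow> add_arr C f f' \<otimes>\<^sub>m g = add_arr C (f \<otimes>\<^sub>m g) (f' \<otimes>\<^sub>m g)"
    and tens_add_right:
      "\<lbrakk>f \<in> Hom C X X'; g \<in> Hom C Y Y'; g' \<in> Hom C Y Y'\<rbrakk>
        \<Longrightarrow> f \<otimes>\<^sub>m add_arr C g g' = add_arr C (f \<otimes>\<^sub>m g) (f \<otimes>\<^sub>m g')"
    and tens_scale_left:
      "\<lbrakk>f \<in> Hom C X X'; g \<in> Hom C Y Y'\<rbrakk> \<Longrightarrow> scale_arr C a f \<otimes>\<^sub>m g = scale_arr C a (f \<otimes>\<^sub>m g)"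
    and tens_scale_right:
      "\<lbrakk>f \<in> Hom C X X'; g \<in> Hom C Y Y'\<rbrakk> \<Longrightarrow> f \<otimes>\<^sub>m scale_arr C a g = scale_arr C a (f \<otimes>\<^sub>m g)"
    and associator_Iso:
      "\<lbrakk>X \<in> obj C; Y \<in> obj C; Z \<in> obj C\<rbrakk>
        \<Longrightarrow> associator C X Y Z \<in> Iso C ((X \<otimes>\<^sub>o Y) \<otimes>\<^sub>o Z) (X \<otimes>\<^sub>o (Y \<otimes>\<^sub>o Z))"
    and associator_natural:
      "\<lbrakk>f \<in> Hom C X X'; g \<in> Hom C Y Y'; h \<in> Hom C Z Z'\<rbrakk>
        \<Longrightarrow> associator C X' Y' Z' \<cdot> ((f \<otimes>\<^sub>m g) \<otimes>\<^sub>m h) = (f \<otimes>\<^sub>m (g \<otimes>\<^sub>m h)) \<cdot> associator C X Y Z"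
    and lunitor_Iso: "X \<in> obj C \<Longrightarrow> lunitor C X \<in> Iso C (\<I> \<otimes>\<^sub>o X) X"
    and lunitor_natural:
      "f \<in> Hom C X X' \<Longrightarrow> lunitor C X' \<cdot> (ident C \<I> \<otimes>\<^sub>m f) = f \<cdot> lunitor C X"
    and runitor_Iso: "X \<in> obj C \<Longrightarrow> runitor C X \<in> Iso C (X \<otimes>\<^sub>o \<I>) X"
    and runitor_natural:
      "f \<in> Hom C X X' \<Longrightarrow> runitor C X' \<cdot> (f \<otimes>\<^sub>m ident C \<I>) = f \<cdot> runitor C X"
    and pentagon:
      "\<lbrakk>W \<in> obj C; X \<in> obj C; Y \<in> obj C; Z \<in> obj C\<rbrakk>
        \<Longrightarrow> associator C W X (Y \<otimes>\<^sub>o Z) \<cdot> associator C (W \<otimes>\<^sub>o X) Y Z =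
            (ident C W \<otimes>\<^sub>m associator C X Y Z) \<cdot> associator C W (X \<otimes>\<^sub>o Y) Z \<cdot>
            (associator C W X Y \<otimes>\<^sub>m ident C Z)"
    and triangle:
      "\<lbrakk>X \<in> obj C; Y \<in> obj C\<rbrakk>
        \<Longrightarrow> (ident C X \<otimes>\<^sub>m lunitor C Y) \<cdot> associator C X \<I> Y = runitor C X \<otimes>\<^sub>m ident C Y"

definition is_left_dual ::
  "('o, 'm, 'k, 'z) moncat_scheme \<Rightarrow> 'o \<Rightarrow> 'o \<Rightarrow> 'm \<Rightarrow> 'm \<Rightarrow> bool" where
  "is_left_dual C X D ev coev \<longleftrightarrow>
     D \<in> obj C \<and>
     ev \<in> Hom C (D \<otimes>\<^sub>o\<^bsub>C\<^esub> X) \<I>\<^bsub>C\<^esub> \<and>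
     coev \<in> Hom C \<I>\<^bsub>C\<^esub> (X \<otimes>\<^sub>o\<^bsub>C\<^esub> D) \<and>
     runitor C X \<cdot>\<^bsub>C\<^esub> (ident C X \<otimes>\<^sub>m\<^bsub>C\<^esub> ev) \<cdot>\<^bsub>C\<^esub> associator C X D X \<cdot>\<^bsub>C\<^esub>
       (coev \<otimes>\<^sub>m\<^bsub>C\<^esub> ident C X) \<cdot>\<^bsub>C\<^esub> inv_arr C (lunitor C X) = ident C X \<and>
     lunitor C D \<cdot>\<^bsub>C\<^esub> (ev \<otimes>\<^sub>m\<^bsub>C\<^esub> ident C D) \<cdot>\<^bsub>C\<^esub> inv_arr C (associator C D X D) \<cdot>\<^bsub>C\<^esub>
       (ident C D \<otimes>\<^sub>m\<^bsub>C\<^esub> coev) \<cdot>\<^bsub>C\<^esub> inv_arr C (runitor C D) = ident C D"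

text \<open>A right dual of \<open>X\<close> is an object of which \<open>X\<close> is a left dual.\<close>

locale finite_tensor_category =
  linear_monoidal_category C + finite_abelian_category C
  for C :: "('o, 'm, 'k :: field, 'z) moncat_scheme" (structure) +
  assumes ex_left_dual: "X \<in> obj C \<Longrightarrow> \<exists>D ev coev. is_left_dual C X D ev coev"
    and ex_right_dual: "X \<in> obj C \<Longrightarrow> \<exists>D \<in> obj C. \<exists>ev coev. is_left_dual C D X ev coev"
    and End_unit: "bij_betw (\<lambda>a. scale_arr C a (ident C \<I>)) UNIV (Hom C \<I> \<I>)"

locale braided_finite_tensor_category = finite_tensor_category C
  for C :: "('o, 'm, 'k :: field, 'z) braided_moncat_scheme" (structure) +
  assumes braiding_Iso:
      "\<lbrakk>X \<in> obj C; Y \<in> obj C\<rbrakk> \<Longrightarrow> braiding C X Y \<in> Iso C (X \<otimes>\<^sub>o Y) (Y \<otimes>\<^sub>o X)"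
    and braiding_natural:
      "\<lbrakk>f \<in> Hom C X X'; g \<in> Hom C Y Y'\<rbrakk>
        \<Longrightarrow> braiding C X' Y' \<cdot> (f \<otimes>\<^sub>m g) = (g \<otimes>\<^sub>m f) \<cdot> braiding C X Y"
    and braiding_tens_left:
      "\<lbrakk>X \<in> obj C; Y \<in> obj C; Z \<in> obj C\<rbrakk>
        \<Longrightarrow> braiding C (X \<otimes>\<^sub>o Y) Z =
            associator C Z X Y \<cdot> (braiding C X Z \<otimes>\<^sub>m ident C Y) \<cdot> inv_arr C (associator C X Z Y) \<cdot>
            (ident C X \<otimes>\<^sub>m braiding C Y Z) \<cdot> associator C X Y Z"
    and braiding_tens_right:
      "\<lbrakk>X \<in> obj C; Y \<in> obj C; Z \<in> obj C\<rbrakk>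
        \<Longrightarrow> braiding C X (Y \<otimes>\<^sub>o Z) =
            inv_arr C (associator C Y Z X) \<cdot> (ident C Y \<otimes>\<^sub>m braiding C X Z) \<cdot> associator C Y X Z \<cdot>
            (braiding C X Y \<otimes>\<^sub>m ident C Z) \<cdot> inv_arr C (associator C X Y Z)"

section \<open>Braided finite module categories\<close>

record ('o, 'm, 'p, 'q, 'k) modcat = "('p, 'q, 'k) lcat" +
  act_obj :: "'o \<Rightarrow> 'p \<Rightarrow> 'p"  (infixr \<open>\<rhd>\<^sub>o\<index>\<close> 73)
  act_arr :: "'m \<Rightarrow> 'q \<Rightarrow> 'q"  (infixr \<open>\<rhd>\<^sub>m\<index>\<close> 73)
  massociator :: "'o \<Rightarrow> 'o \<Rightarrow> 'p \<Rightarrow> 'q"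
  munitor :: "'p \<Rightarrow> 'q"

record ('o, 'm, 'p, 'q, 'k) braided_modcat = "('o, 'm, 'p, 'q, 'k) modcat" +
  mbraiding :: "'o \<Rightarrow> 'p \<Rightarrow> 'q"

locale finite_module_category =
  C?: linear_monoidal_category C + M: finite_abelian_category M
  for C :: "('o, 'm, 'k :: field, 'z) moncat_scheme" (structure)
    and M :: "('o, 'm, 'p, 'q, 'k, 'y) modcat_scheme" (structure) +
  assumes act_obj: "\<lbrakk>X \<in> obj C; A \<in> obj M\<rbrakk> \<Longrightarrow> X \<rhd>\<^sub>o\<^bsub>M\<^esub> A \<in> obj M"
    and act_arr:
      "\<lbrakk>f \<in> Hom C X X'; g \<in> Hom M A A'\<rbrakk> \<Longrightarrow> f \<rhd>\<^sub>m\<^bsub>M\<^esub> g \<in> Hom M (X \<rhd>\<^sub>o\<^bsub>M\<^esub> A) (X' \<rhd>\<^sub>o\<^bsub>M\<^esub> A')"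
    and act_ident:
      "\<lbrakk>X \<in> obj C; A \<in> obj M\<rbrakk> \<Longrightarrow> ident C X \<rhd>\<^sub>m\<^bsub>M\<^esub> ident M A = ident M (X \<rhd>\<^sub>o\<^bsub>M\<^esub> A)"
    and act_cmp:
      "\<lbrakk>f \<in> Hom C X X'; f' \<in> Hom C X' X''; g \<in> Hom M A A'; g' \<in> Hom M A' A''\<rbrakk>
        \<Longrightarrow> (f' \<cdot>\<^bsub>C\<^esub> f) \<rhd>\<^sub>m\<^bsub>M\<^esub> (g' \<cdot>\<^bsub>M\<^esub> g) = (f' \<rhd>\<^sub>m\<^bsub>M\<^esub> g') \<cdot>\<^bsub>M\<^esub> (f \<rhd>\<^sub>m\<^bsub>M\<^esub> g)"
    and act_add_left:
      "\<lbrakk>f \<in> Hom C X X'; f' \<in> Hom C X X'; g \<in> Hom M A A'\<rbrakk>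
        \<Longrightarrow> add_arr C f f' \<rhd>\<^sub>m\<^bsub>M\<^esub> g = add_arr M (f \<rhd>\<^sub>m\<^bsub>M\<^esub> g) (f' \<rhd>\<^sub>m\<^bsub>M\<^esub> g)"
    and act_add_right:
      "\<lbrakk>f \<in> Hom C X X'; g \<in> Hom M A A'; g' \<in> Hom M A A'\<rbrakk>
        \<Longrightarrow> f \<rhd>\<^sub>m\<^bsub>M\<^esub> add_arr M g g' = add_arr M (f \<rhd>\<^sub>m\<^bsub>M\<^esub> g) (f \<rhd>\<^sub>m\<^bsub>M\<^esub> g')"
    and act_scale_left:
      "\<lbrakk>f \<in> Hom C X X'; g \<in> Hom M A A'\<rbrakk>
        \<Longrightarrow> scale_arr C a f \<rhd>\<^sub>m\<^bsub>M\<^esub> g = scale_arr M a (f \<rhd>\<^sub>m\<^bsub>M\<^esub> g)"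
    and act_scale_right:
      "\<lbrakk>f \<in> Hom C X X'; g \<in> Hom M A A'\<rbrakk>
        \<Longrightarrow> f \<rhd>\<^sub>m\<^bsub>M\<^esub> scale_arr M a g = scale_arr M a (f \<rhd>\<^sub>m\<^bsub>M\<^esub> g)"
    and massociator_Iso:
      "\<lbrakk>X \<in> obj C; Y \<in> obj C; A \<in> obj M\<rbrakk>
        \<Longrightarrow> massociator M X Y A \<in> Iso M ((X \<otimes>\<^sub>o\<^bsub>C\<^esub> Y) \<rhd>\<^sub>o\<^bsub>M\<^esub> A) (X \<rhd>\<^sub>o\<^bsub>M\<^esub> (Y \<rhd>\<^sub>o\<^bsub>M\<^esub> A))"
    and massociator_natural:
      "\<lbrakk>f \<in> Hom C X X'; h \<in> Hom C Y Y'; g \<in> Hom M A A'\<rbrakk>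
        \<Longrightarrow> massociator M X' Y' A' \<cdot>\<^bsub>M\<^esub> ((f \<otimes>\<^sub>m\<^bsub>C\<^esub> h) \<rhd>\<^sub>m\<^bsub>M\<^esub> g) =
            (f \<rhd>\<^sub>m\<^bsub>M\<^esub> (h \<rhd>\<^sub>m\<^bsub>M\<^esub> g)) \<cdot>\<^bsub>M\<^esub> massociator M X Y A"
    and munitor_Iso: "A \<in> obj M \<Longrightarrow> munitor M A \<in> Iso M (\<I>\<^bsub>C\<^esub> \<rhd>\<^sub>o\<^bsub>M\<^esub> A) A"
    and munitor_natural:
      "g \<in> Hom M A A' \<Longrightarrow> munitor M A' \<cdot>\<^bsub>M\<^esub> (ident C \<I>\<^bsub>C\<^esub> \<rhd>\<^sub>m\<^bsub>M\<^esub> g) = g \<cdot>\<^bsub>M\<^esub> munitor M A"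
    and module_pentagon:
      "\<lbrakk>X \<in> obj C; Y \<in> obj C; Z \<in> obj C; A \<in> obj M\<rbrakk>
        \<Longrightarrow> massociator M X Y (Z \<rhd>\<^sub>o\<^bsub>M\<^esub> A) \<cdot>\<^bsub>M\<^esub> massociator M (X \<otimes>\<^sub>o\<^bsub>C\<^esub> Y) Z A =
            (ident C X \<rhd>\<^sub>m\<^bsub>M\<^esub> massociator M Y Z A) \<cdot>\<^bsub>M\<^esub> massociator M X (Y \<otimes>\<^sub>o\<^bsub>C\<^esub> Z) A \<cdot>\<^bsub>M\<^esub>
            (associator C X Y Z \<rhd>\<^sub>m\<^bsub>M\<^esub> ident M A)"
    and module_triangle:
      "\<lbrakk>X \<in> obj C; A \<in> obj M\<rbrakk>
        \<Longrightarrow> (ident C X \<rhd>\<^sub>m\<^bsub>M\<^esub> munitor M A) \<cdot>\<^bsub>M\<^esub> massociator M X \<I>\<^bsub>C\<^esub> A =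
            runitor C X \<rhd>\<^sub>m\<^bsub>M\<^esub> ident M A"
    and act_exact:
      "A \<in> obj M \<Longrightarrow>
        exact_functor C M \<lparr>on_obj = (\<lambda>X. X \<rhd>\<^sub>o\<^bsub>M\<^esub> A), on_arr = (\<lambda>f. f \<rhd>\<^sub>m\<^bsub>M\<^esub> ident M A)\<rparr>"

locale braided_finite_module_category = finite_module_category C M
  for C :: "('o, 'm, 'k :: field, 'z) braided_moncat_scheme" (structure)
    and M :: "('o, 'm, 'p, 'q, 'k, 'y) braided_modcat_scheme" (structure) +
  assumes mbraiding_Iso:
      "\<lbrakk>X \<in> obj C; A \<in> obj M\<rbrakk> \<Longrightarrow> mbraiding M X A \<in> Iso M (X \<rhd>\<^sub>o\<^bsub>M\<^esub> A) (X \<rhd>\<^sub>o\<^bsub>M\<^esub> A)"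
    and mbraiding_natural:
      "\<lbrakk>f \<in> Hom C X X'; g \<in> Hom M A A'\<rbrakk>
        \<Longrightarrow> mbraiding M X' A' \<cdot>\<^bsub>M\<^esub> (f \<rhd>\<^sub>m\<^bsub>M\<^esub> g) = (f \<rhd>\<^sub>m\<^bsub>M\<^esub> g) \<cdot>\<^bsub>M\<^esub> mbraiding M X A"
    and mbraiding_tens:
      "\<lbrakk>X \<in> obj C; Y \<in> obj C; A \<in> obj M\<rbrakk>
        \<Longrightarrow> mbraiding M (X \<otimes>\<^sub>o\<^bsub>C\<^esub> Y) A =
            inv_arr M (massociator M X Y A) \<cdot>\<^bsub>M\<^esub> (ident C X \<rhd>\<^sub>m\<^bsub>M\<^esub> mbraiding M Y A) \<cdot>\<^bsub>M\<^esub>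
            massociator M X Y A \<cdot>\<^bsub>M\<^esub> (braiding C Y X \<rhd>\<^sub>m\<^bsub>M\<^esub> ident M A) \<cdot>\<^bsub>M\<^esub>
            inv_arr M (massociator M Y X A) \<cdot>\<^bsub>M\<^esub> (ident C Y \<rhd>\<^sub>m\<^bsub>M\<^esub> mbraiding M X A) \<cdot>\<^bsub>M\<^esub>
            massociator M Y X A \<cdot>\<^bsub>M\<^esub> (inv_arr C (braiding C Y X) \<rhd>\<^sub>m\<^bsub>M\<^esub> ident M A)"
    and mbraiding_act:
      "\<lbrakk>X \<in> obj C; Y \<in> obj C; A \<in> obj M\<rbrakk>
        \<Longrightarrow> mbraiding M X (Y \<rhd>\<^sub>o\<^bsub>M\<^esub> A) =
            massociator M X Y A \<cdot>\<^bsub>M\<^esub> (braiding C Y X \<rhd>\<^sub>m\<^bsub>M\<^esub> ident M A) \<cdot>\<^bsub>M\<^esub>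
            inv_arr M (massociator M Y X A) \<cdot>\<^bsub>M\<^esub> (ident C Y \<rhd>\<^sub>m\<^bsub>M\<^esub> mbraiding M X A) \<cdot>\<^bsub>M\<^esub>
            massociator M Y X A \<cdot>\<^bsub>M\<^esub> (braiding C X Y \<rhd>\<^sub>m\<^bsub>M\<^esub> ident M A) \<cdot>\<^bsub>M\<^esub>
            inv_arr M (massociator M X Y A)"

definition nonzero_category :: "('o, 'm, 'k, 'z) lcat_scheme \<Rightarrow> bool" where
  "nonzero_category M \<longleftrightarrow> (\<exists>A \<in> obj M. \<not> zero_object M A)"

definition exact_module_category ::
  "('o, 'm, 'k, 'z) lcat_scheme \<Rightarrow> ('o, 'm, 'p, 'q, 'k, 'y) modcat_scheme \<Rightarrow> bool" where
  "exact_module_category C M \<longleftrightarrow>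
     (\<forall>P A. projective C P \<and> A \<in> obj M \<longrightarrow> projective M (P \<rhd>\<^sub>o\<^bsub>M\<^esub> A))"

text \<open>
  A module functor is a linear functor with a natural isomorphism
  \<open>s X A : F (X \<rhd> A) \<rightarrow> X \<rhd> F A\<close> compatible with the module associators and unitors.
\<close>

definition module_functor ::
  "('o, 'm, 'k, 'z) moncat_scheme \<Rightarrow> ('o, 'm, 'p, 'q, 'k, 'y) modcat_scheme \<Rightarrow>
   ('o, 'm, 'r, 's, 'k, 'x) modcat_scheme \<Rightarrow> ('p, 'q, 'r, 's) ftor \<Rightarrow> ('o \<Rightarrow> 'p \<Rightarrow> 's) \<Rightarrow> bool" where
  "module_functor C M N F s \<longleftrightarrow>
     linear_functor M N F \<and>
     (\<forall>X \<in> obj C. \<forall>A \<in> obj M.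
        s X A \<in> Iso N (on_obj F (X \<rhd>\<^sub>o\<^bsub>M\<^esub> A)) (X \<rhd>\<^sub>o\<^bsub>N\<^esub> on_obj F A)) \<and>
     (\<forall>f \<in> arr C. \<forall>g \<in> arr M.
        s (tgt C f) (tgt M g) \<cdot>\<^bsub>N\<^esub> on_arr F (f \<rhd>\<^sub>m\<^bsub>M\<^esub> g) =
        (f \<rhd>\<^sub>m\<^bsub>N\<^esub> on_arr F g) \<cdot>\<^bsub>N\<^esub> s (src C f) (src M g)) \<and>
     (\<forall>X \<in> obj C. \<forall>Y \<in> obj C. \<forall>A \<in> obj M.
        (ident C X \<rhd>\<^sub>m\<^bsub>N\<^esub> s Y A) \<cdot>\<^bsub>N\<^esub> s X (Y \<rhd>\<^sub>o\<^bsub>M\<^esub> A) \<cdot>\<^bsub>N\<^esub> on_arr F (massociator M X Y A) =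
        massociator N X Y (on_obj F A) \<cdot>\<^bsub>N\<^esub> s (X \<otimes>\<^sub>o\<^bsub>C\<^esub> Y) A) \<and>
     (\<forall>A \<in> obj M. munitor N (on_obj F A) \<cdot>\<^bsub>N\<^esub> s \<I>\<^bsub>C\<^esub> A = on_arr F (munitor M A))"

definition module_equivalent ::
  "('o, 'm, 'k, 'z) moncat_scheme \<Rightarrow> ('o, 'm, 'p, 'q, 'k, 'y) modcat_scheme \<Rightarrow>
   ('o, 'm, 'r, 's, 'k, 'x) modcat_scheme \<Rightarrow> bool" where
  "module_equivalent C M N \<longleftrightarrow> (\<exists>F s. module_functor C M N F s \<and> equivalence M N F)"

definition direct_sum ::
  "('o, 'm, 'p, 'q, 'k, 'y) modcat_scheme \<Rightarrow> ('o, 'm, 'r, 's, 'k, 'x) modcat_scheme \<Rightarrow>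
   ('o, 'm, 'p \<times> 'r, 'q \<times> 's, 'k) modcat" where
  "direct_sum M N =
     \<lparr>obj = obj M \<times> obj N,
      arr = arr M \<times> arr N,
      src = (\<lambda>(f, g). (src M f, src N g)),
      tgt = (\<lambda>(f, g). (tgt M f, tgt N g)),
      ident = (\<lambda>(A, B). (ident M A, ident N B)),
      cmp = (\<lambda>(f', g') (f, g). (f' \<cdot>\<^bsub>M\<^esub> f, g' \<cdot>\<^bsub>N\<^esub> g)),
      zero_arr = (\<lambda>(A, B) (A', B'). (zero_arr M A A', zero_arr N B B')),
      add_arr = (\<lambda>(f, g) (f', g'). (add_arr M f f', add_arr N g g')),
      scale_arr = (\<lambda>a (f, g). (scale_arr M a f, scale_arr N a g)),
      act_obj = (\<lambda>X (A, B). (X \<rhd>\<^sub>o\<^bsub>M\<^esub> A, X \<rhd>\<^sub>o\<^bsub>N\<^esub> B)),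
      act_arr = (\<lambda>h (f, g). (h \<rhd>\<^sub>m\<^bsub>M\<^esub> f, h \<rhd>\<^sub>m\<^bsub>N\<^esub> g)),
      massociator = (\<lambda>X Y (A, B). (massociator M X Y A, massociator N X Y B)),
      munitor = (\<lambda>(A, B). (munitor M A, munitor N B))\<rparr>"

text \<open>
  The summands may be taken over the types of \<open>M\<close>: if \<open>M\<close> is equivalent to a direct sum, then each
  summand is equivalent to a full module subcategory of \<open>M\<close>.
\<close>

definition indecomposable_module_category ::
  "('o, 'm, 'k :: field, 'z) moncat_scheme \<Rightarrow> ('o, 'm, 'p, 'q, 'k, 'y) modcat_scheme \<Rightarrow> bool" where
  "indecomposable_module_category C M \<longleftrightarrow>
     \<not> (\<exists>(M\<^sub>1 :: ('o, 'm, 'p, 'q, 'k) modcat) (M\<^sub>2 :: ('o, 'm, 'p, 'q, 'k) modcat).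
          finite_module_category C M\<^sub>1 \<and> nonzero_category M\<^sub>1 \<and>
          finite_module_category C M\<^sub>2 \<and> nonzero_category M\<^sub>2 \<and>
          module_equivalent C M (direct_sum M\<^sub>1 M\<^sub>2))"

section \<open>Ends\<close>

text \<open>
  For a functor \<open>F\<close> on the product of the opposite category of \<open>D\<close> with \<open>D\<close>, the argument \<open>F x y\<close>
  is the value on objects, \<open>R x f = F(x, f)\<close> the covariant action \<open>F x x \<rightarrow> F x y\<close> and
  \<open>L f y = F(f, y)\<close> the contravariant action \<open>F y y \<rightarrow> F x y\<close> of an arrow \<open>f : x \<rightarrow> y\<close>.
\<close>

definition is_wedge ::
  "('o, 'm, 'k, 'z) lcat_scheme \<Rightarrow> ('p, 'q, 'l, 'y) lcat_scheme \<Rightarrow>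
   ('p \<Rightarrow> 'p \<Rightarrow> 'o) \<Rightarrow> ('q \<Rightarrow> 'p \<Rightarrow> 'm) \<Rightarrow> ('p \<Rightarrow> 'q \<Rightarrow> 'm) \<Rightarrow> 'o \<Rightarrow> ('p \<Rightarrow> 'm) \<Rightarrow> bool" where
  "is_wedge C D F L R T \<tau> \<longleftrightarrow>
     T \<in> obj C \<and> (\<forall>x \<in> obj D. \<tau> x \<in> Hom C T (F x x)) \<and>
     (\<forall>f \<in> arr D. R (src D f) f \<cdot>\<^bsub>C\<^esub> \<tau> (src D f) = L f (tgt D f) \<cdot>\<^bsub>C\<^esub> \<tau> (tgt D f))"

definition is_end ::
  "('o, 'm, 'k, 'z) lcat_scheme \<Rightarrow> ('p, 'q, 'l, 'y) lcat_scheme \<Rightarrow>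
   ('p \<Rightarrow> 'p \<Rightarrow> 'o) \<Rightarrow> ('q \<Rightarrow> 'p \<Rightarrow> 'm) \<Rightarrow> ('p \<Rightarrow> 'q \<Rightarrow> 'm) \<Rightarrow> 'o \<Rightarrow> ('p \<Rightarrow> 'm) \<Rightarrow> bool" where
  "is_end C D F L R E \<pi> \<longleftrightarrow>
     is_wedge C D F L R E \<pi> \<and>
     (\<forall>T \<tau>. is_wedge C D F L R T \<tau> \<longrightarrow>
        (\<exists>!u. u \<in> Hom C T E \<and> (\<forall>x \<in> obj D. \<pi> x \<cdot>\<^bsub>C\<^esub> u = \<tau> x)))"

section \<open>The universal copairing\<close>

locale left_duals =
  fixes C :: "('o, 'm, 'k :: field, 'z) moncat_scheme" (structure)
    and ldual :: "'o \<Rightarrow> 'o" and lev lcoev :: "'o \<Rightarrow> 'm"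
  assumes left_dual: "X \<in> obj C \<Longrightarrow> is_left_dual C X (ldual X) (lev X) (lcoev X)"
begin

definition ldual_arr :: "'m \<Rightarrow> 'm" where
  "ldual_arr f =
     (let X = src C f; Y = tgt C f in
      lunitor C (ldual X) \<cdot> (lev Y \<otimes>\<^sub>m ident C (ldual X)) \<cdot>
      inv_arr C (associator C (ldual Y) Y (ldual X)) \<cdot>
      (ident C (ldual Y) \<otimes>\<^sub>m (f \<otimes>\<^sub>m ident C (ldual X))) \<cdot>
      (ident C (ldual Y) \<otimes>\<^sub>m lcoev X) \<cdot> inv_arr C (runitor C (ldual Y)))"

definition is_end_C :: "'o \<Rightarrow> ('o \<Rightarrow> 'm) \<Rightarrow> bool" where
  "is_end_C E \<pi> \<longleftrightarrow>
     is_end C C (\<lambda>X Y. Y \<otimes>\<^sub>o ldual X) (\<lambda>f Y. ident C Y \<otimes>\<^sub>m ldual_arr f)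
       (\<lambda>X f. f \<otimes>\<^sub>m ident C (ldual X)) E \<pi>"

end

text \<open>
  The right adjoints of the functors \<open>- \<rhd> A\<close> are given by their counits \<open>iev A B : ihom A B \<rhd> A \<rightarrow> B\<close>.
\<close>

locale internal_homs =
  fixes C :: "('o, 'm, 'k :: field, 'z) moncat_scheme" (structure)
    and M :: "('o, 'm, 'p, 'q, 'k, 'y) modcat_scheme" (structure)
    and ihom :: "'p \<Rightarrow> 'p \<Rightarrow> 'o" and iev :: "'p \<Rightarrow> 'p \<Rightarrow> 'q"
  assumes ihom_obj: "\<lbrakk>A \<in> obj M; B \<in> obj M\<rbrakk> \<Longrightarrow> ihom A B \<in> obj C"
    and iev_Hom: "\<lbrakk>A \<in> obj M; B \<in> obj M\<rbrakk> \<Longrightarrow> iev A B \<in> Hom M (ihom A B \<rhd>\<^sub>o\<^bsub>M\<^esub> A) B"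
    and iev_universal:
      "\<lbrakk>A \<in> obj M; B \<in> obj M; X \<in> obj C; g \<in> Hom M (X \<rhd>\<^sub>o\<^bsub>M\<^esub> A) B\<rbrakk>
        \<Longrightarrow> \<exists>!f. f \<in> Hom C X (ihom A B) \<and> iev A B \<cdot>\<^bsub>M\<^esub> (f \<rhd>\<^sub>m\<^bsub>M\<^esub> ident M A) = g"
begin

definition adjunct :: "'o \<Rightarrow> 'p \<Rightarrow> 'p \<Rightarrow> 'q \<Rightarrow> 'm" where
  "adjunct X A B g = (THE f. f \<in> Hom C X (ihom A B) \<and> iev A B \<cdot>\<^bsub>M\<^esub> (f \<rhd>\<^sub>m\<^bsub>M\<^esub> ident M A) = g)"

definition icoev :: "'p \<Rightarrow> 'm" where
  "icoev A = adjunct \<I>\<^bsub>C\<^esub> A A (munitor M A)"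

definition ihom_right :: "'p \<Rightarrow> 'q \<Rightarrow> 'm" where
  "ihom_right A g = adjunct (ihom A (src M g)) A (tgt M g) (g \<cdot>\<^bsub>M\<^esub> iev A (src M g))"

definition ihom_left :: "'q \<Rightarrow> 'p \<Rightarrow> 'm" where
  "ihom_left f B =
     adjunct (ihom (tgt M f) B) (src M f) B
       (iev (tgt M f) B \<cdot>\<^bsub>M\<^esub> (ident C (ihom (tgt M f) B) \<rhd>\<^sub>m\<^bsub>M\<^esub> f))"

text \<open>The canonical isomorphism \<open>X \<otimes> ihom A B \<rightarrow> ihom A (X \<rhd> B)\<close>.\<close>

definition ihom_act :: "'o \<Rightarrow> 'p \<Rightarrow> 'p \<Rightarrow> 'm" where
  "ihom_act X A B =
     adjunct (X \<otimes>\<^sub>o\<^bsub>C\<^esub> ihom A B) A (X \<rhd>\<^sub>o\<^bsub>M\<^esub> B)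
       ((ident C X \<rhd>\<^sub>m\<^bsub>M\<^esub> iev A B) \<cdot>\<^bsub>M\<^esub> massociator M X (ihom A B) A)"

definition is_end_M :: "'o \<Rightarrow> ('p \<Rightarrow> 'm) \<Rightarrow> bool" where
  "is_end_M E \<pi> \<longleftrightarrow> is_end C M ihom ihom_left ihom_right E \<pi>"

end

locale copairing_data =
  left_duals C ldual lev lcoev + internal_homs C M ihom iev
  for C :: "('o, 'm, 'k :: field, 'z) moncat_scheme" (structure)
    and M :: "('o, 'm, 'p, 'q, 'k, 'y) braided_modcat_scheme" (structure)
    and ldual lev lcoev ihom iev +
  fixes E\<^sub>C :: 'o and \<pi>\<^sub>C :: "'o \<Rightarrow> 'm" and E\<^sub>M :: 'o and \<pi>\<^sub>M :: "'p \<Rightarrow> 'm"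
  assumes end_C: "is_end_C E\<^sub>C \<pi>\<^sub>C"
    and end_M: "is_end_M E\<^sub>M \<pi>\<^sub>M"
begin

definition copairing_component :: "'o \<Rightarrow> 'p \<Rightarrow> 'm" where
  "copairing_component X A =
     inv_arr C (associator C X (ldual X) (ihom A A)) \<cdot>
     (ident C X \<otimes>\<^sub>m inv_arr C (ihom_act (ldual X) A A)) \<cdot>
     (ident C X \<otimes>\<^sub>m ihom_right A (mbraiding M (ldual X) A)) \<cdot>
     (ident C X \<otimes>\<^sub>m ihom_act (ldual X) A A) \<cdot>
     associator C X (ldual X) (ihom A A) \<cdot>
     (lcoev X \<otimes>\<^sub>m icoev A) \<cdot> inv_arr C (lunitor C \<I>)"

definition universal_copairing :: "'m \<Rightarrow> bool" where
  "universal_copairing \<omega> \<longleftrightarrow>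
     \<omega> \<in> Hom C \<I> (E\<^sub>C \<otimes>\<^sub>o E\<^sub>M) \<and>
     (\<forall>X \<in> obj C. \<forall>A \<in> obj M. (\<pi>\<^sub>C X \<otimes>\<^sub>m \<pi>\<^sub>M A) \<cdot> \<omega> = copairing_component X A)"

definition Omega :: "'m \<Rightarrow> 'm \<Rightarrow> 'm" where
  "Omega \<omega> f = lunitor C E\<^sub>M \<cdot> (f \<otimes>\<^sub>m ident C E\<^sub>M) \<cdot> \<omega>"

end

text \<open>
  The duals, internal Homs, ends and the copairing are determined up to unique isomorphism by their
  universal properties, and bijectivity does not depend on how they are chosen.
\<close>

definition weakly_factorizable ::
  "('o, 'm, 'k :: field, 'z) moncat_scheme \<Rightarrow> ('o, 'm, 'p, 'q, 'k, 'y) braided_modcat_scheme \<Rightarrow> bool"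
  where
  "weakly_factorizable C M \<longleftrightarrow>
     (\<exists>ldual lev lcoev ihom iev E\<^sub>C \<pi>\<^sub>C E\<^sub>M \<pi>\<^sub>M \<omega>.
        copairing_data C M ldual lev lcoev ihom iev E\<^sub>C \<pi>\<^sub>C E\<^sub>M \<pi>\<^sub>M \<and>
        copairing_data.universal_copairing C M ldual lcoev ihom iev E\<^sub>C \<pi>\<^sub>C E\<^sub>M \<pi>\<^sub>M \<omega> \<and>
        bij_betw (copairing_data.Omega C E\<^sub>M \<omega>) (Hom C E\<^sub>C \<I>\<^bsub>C\<^esub>) (Hom C \<I>\<^bsub>C\<^esub> E\<^sub>M))"

section \<open>The symmetric center\<close>

definition symmetric_center ::
  "('o, 'm, 'k, 'z) lcat_scheme \<Rightarrow> ('o, 'm, 'p, 'q, 'k, 'y) braided_modcat_scheme \<Rightarrow>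
   ('o, 'm, 'k, 'z) lcat_scheme" where
  "symmetric_center C M =
     full_subcategory C {X \<in> obj C. \<forall>A \<in> obj M. mbraiding M X A = ident M (X \<rhd>\<^sub>o\<^bsub>M\<^esub> A)}"

definition trivial_symmetric_center ::
  "('o, 'm, 'k :: field, 'z) lcat_scheme \<Rightarrow> ('o, 'm, 'p, 'q, 'k, 'y) braided_modcat_scheme \<Rightarrow> bool" where
  "trivial_symmetric_center C M \<longleftrightarrow>
     (\<exists>F. equivalence (symmetric_center C M) (FdVec :: (_, _, 'k) lcat) F)"

end

theory Submission
  imports Defs
begin

text \<open>
  Let \<open>\<epsilon> : E\<^sub>C \<rightarrow> \<I>\<close> be \<open>\<pi>\<^sub>C \<I>\<close> followed by the inverse of the coevaluation of \<open>\<I>\<close>. If the module braiding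
  of \<open>D\<^sup>*\<close> is trivial, then so is the copairing at \<open>D\<close>, and the copairing does not distinguish \<open>\<pi>\<^sub>C D\<close>
  from \<open>coev\<^sub>D \<epsilon>\<close>; by injectivity of \<open>\<Omega>\<close> these agree after composition with any \<open>D \<otimes> D\<^sup>* \<rightarrow> \<I>\<close>. To
  exploit this, choose covers \<open>Q \<rightarrow> X\<close> and \<open>Q' \<rightarrow> X\<^sup>*\<close> of a simple object and of its dual by
  indecomposable projectives. A linear functional on \<open>Hom(Q' \<otimes> Q, \<I>)\<close> with value 1 at the evaluation
  of \<open>X\<close> makes \<open>Hom(Q, Z)\<close> and \<open>Hom(Q', Z\<^sup>*)\<close> dual to each other, and the canonical elements of these
  dualities form a wedge \<open>Q \<otimes> Q' \<rightarrow> Z \<otimes> Z\<^sup>*\<close>, that is, a test morphism into \<open>E\<^sub>C\<close>. For \<open>X = D\<close> simple it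
  shows with Schur's lemma that \<open>D\<close> is isomorphic to \<open>\<I>\<close>, and for \<open>X = \<I>\<close> that an extension \<open>D\<close> of \<open>\<I>\<close>
  by a multiple of \<open>\<I>\<close> splits. By induction on the length, every \<open>D\<close> as above is a multiple of \<open>\<I>\<close>.
  The objects of the symmetric center are the duals of such \<open>D\<close>, so \<open>Hom(\<I>, -)\<close> identifies it with
  the category of finite-dimensional vector spaces.
\<close>

section \<open>Finite-dimensional vector spaces\<close>

text \<open>\<open>\<Omega>\<close> separates only morphisms from \<open>E\<^sub>C\<close> to
  \<open>\<I>\<close>, whereas the two morphisms to be compared at \<open>D\<close> end in
  \<open>D \<otimes> D\<^sup>*\<close>; this mismatch shapes both cases. For simple \<open>D\<close>
  a single functional, the braided evaluation, is enough, because it does not vanish on the wedge.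
  For an extension, dinaturality along both arrows of the exact sequence pushes the difference of
  the two morphisms down to \<open>\<I> \<otimes> \<I>\<^sup>*\<close>, a copy of
  \<open>\<I>\<close>, so that there they really coincide. The extension case has content: in
  positive characteristic the unit of a finite tensor category may have nonsplit self-extensions.
  Since \<open>E\<^sub>C\<close> is known only through its universal property, an equation between
  morphisms out of it can be exploited only by writing down a wedge. The wedge built from covers is
  chosen because it localizes at one simple object: at any simple object not isomorphic to
  \<open>X\<close> it vanishes, and at \<open>X\<close> itself it is a nonzero multiple of the
  tensor product of the two covers.\<close>

lemma homogeneous_system_solution:
  fixes A :: "nat \<Rightarrow> 'j \<Rightarrow> 'k :: field"
  assumes "finite J" "m < card J"
  shows "\<exists>x. (\<exists>j\<in>J. x j \<noteq> 0) \<and> (\<forall>i<m. (\<Sum>j\<in>J. A i j * x j) = 0)"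
  using assms
proof (induction m arbitrary: J A)
  case 0
  then obtain j where "j \<in> J" by fastforce
  then show ?case by (intro exI[of _ "\<lambda>_. 1"]) auto
next
  case (Suc m)
  show ?case
  proof (cases "\<exists>p\<in>J. A m p \<noteq> 0")
    case False
    then show ?thesis using Suc.IH[of J A] Suc.prems by (auto simp: less_Suc_eq)
  next
    case True
    then obtain p where p: "p \<in> J" "A m p \<noteq> 0" by auto
    define J' where "J' = J - {p}"
    have J': "finite J'" "m < card J'" "p \<notin> J'" "J = insert p J'"
      using Suc.prems p by (auto simp: J'_def)
    \<comment> \<open>Adding \<open>- A i p / A m p\<close> times equation \<open>m\<close> to
      equation \<open>i\<close> removes the unknown \<open>p\<close>; the induction hypothesis
      solves the resulting system in the unknowns \<open>J'\<close>.\<close>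
    obtain x where x: "\<exists>j\<in>J'. x j \<noteq> 0"
      "\<forall>i<m. (\<Sum>j\<in>J'. (A i j - A i p * A m j / A m p) * x j) = 0"
      using Suc.IH[OF J'(1,2), of "\<lambda>i j. A i j - A i p * A m j / A m p"] by blast
    define s where "s = (\<Sum>j\<in>J'. A m j * x j)"
    \<comment> \<open>The value at \<open>p\<close> is forced by equation \<open>m\<close>; the
      elimination then gives the remaining equations.\<close>
    define y where "y = x(p := - s / A m p)"
    have eq: "(\<Sum>j\<in>J. A i j * y j) = A i p * (- s / A m p) + (\<Sum>j\<in>J'. A i j * x j)" for i
      using J' by (auto simp: y_def intro!: sum.cong)
    have "(\<Sum>j\<in>J. A i j * y j) = 0" if "i < Suc m" for i
    proof (cases "i = m")
      case True
      then show ?thesis using p by (simp add: eq s_def)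
    next
      case False
      then have "(\<Sum>j\<in>J'. (A i j - A i p * A m j / A m p) * x j) = 0" using x that by auto
      then have "(\<Sum>j\<in>J'. A i j * x j) = A i p / A m p * s"
        by (simp add: s_def sum_distrib_left left_diff_distrib sum_subtractf algebra_simps)
      then show ?thesis by (simp add: eq)
    qed
    moreover have "\<exists>j\<in>J. y j \<noteq> 0" using x(1) J' by (auto simp: y_def)
    ultimately show ?thesis by blast
  qed
qed

text \<open>Recursion on the length makes the summation laws plain inductions, in place of
  \<open>finsum\<close> with its set-indexed side conditions. The indices are
  \<open>0, ..., n - 1\<close>, so bases are families rather than sets.\<close>

primrec vsum :: "('k, 'v, 'z) module_scheme \<Rightarrow> (nat \<Rightarrow> 'v) \<Rightarrow> nat \<Rightarrow> 'v" where
  "vsum V f 0 = \<zero>\<^bsub>V\<^esub>"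
| "vsum V f (Suc n) = vsum V f n \<oplus>\<^bsub>V\<^esub> f n"

locale vec_space =
  fixes V :: "('k :: field, 'v) module" (structure)
  assumes module_V: "Module.module (scalar_ring :: 'k ring) V"

sublocale vec_space \<subseteq> V?: module "scalar_ring :: 'k ring" V
  by (rule module_V)

lemma scalar_ring_simps [simp]:
  "carrier (scalar_ring :: 'k :: field ring) = UNIV"
  "\<one>\<^bsub>scalar_ring :: 'k ring\<^esub> = 1" "\<zero>\<^bsub>scalar_ring :: 'k ring\<^esub> = 0"
  "a \<otimes>\<^bsub>scalar_ring :: 'k ring\<^esub> b = a * b" "a \<oplus>\<^bsub>scalar_ring :: 'k ring\<^esub> b = a + b"
  by (simp_all add: scalar_ring_def)

text \<open>Values lie in the type \<open>'k\<close> itself, so they can serve as coefficients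
  without regarding the field as a one-dimensional module.\<close>

definition lin_fun :: "('k :: field, 'v) module \<Rightarrow> ('v \<Rightarrow> 'k) \<Rightarrow> bool" where
  "lin_fun V t \<longleftrightarrow>
     (\<forall>x\<in>carrier V. \<forall>y\<in>carrier V. t (x \<oplus>\<^bsub>V\<^esub> y) = t x + t y) \<and>
     (\<forall>a. \<forall>x\<in>carrier V. t (a \<odot>\<^bsub>V\<^esub> x) = a * t x)"

text \<open>A condition on families, not on sets: repeating a vector makes the family
  dependent.\<close>

definition indep :: "('k :: field, 'v) module \<Rightarrow> (nat \<Rightarrow> 'v) \<Rightarrow> nat \<Rightarrow> bool" where
  "indep V b n \<longleftrightarrow> (\<forall>i<n. b i \<in> carrier V) \<and>
     (\<forall>x. vsum V (\<lambda>i. x i \<odot>\<^bsub>V\<^esub> b i) n = \<zero>\<^bsub>V\<^esub> \<longrightarrow> (\<forall>i<n. x i = 0))"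

lemma indepD:
  "\<lbrakk>indep V b n; vsum V (\<lambda>i. x i \<odot>\<^bsub>V\<^esub> b i) n = \<zero>\<^bsub>V\<^esub>; i < n\<rbrakk> \<Longrightarrow> x i = 0"
  unfolding indep_def by blast

text \<open>\<open>GREATEST\<close> is informative only if the lengths of independent families are
  bounded; in \<open>fd_space\<close> the bound comes from \<open>indep_bound\<close> applied to a
  finite spanning family.\<close>

definition vdim :: "('k :: field, 'v) module \<Rightarrow> nat" where
  "vdim V = (GREATEST n. \<exists>b. indep V b n)"

section \<open>Finite sums and linear independence\<close>

context vec_space
begin

lemma smult_in [simp]: "v \<in> carrier V \<Longrightarrow> a \<odot> v \<in> carrier V"
  using smult_closed[of a v] by simp

lemma smult_add_scalar: "v \<in> carrier V \<Longrightarrow> (a + b) \<odot> v = a \<odot> v \<oplus> b \<odot> v"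
  using smult_l_distr[of a b v] by simp

lemma smult_add_vec: "\<lbrakk>v \<in> carrier V; w \<in> carrier V\<rbrakk> \<Longrightarrow> a \<odot> (v \<oplus> w) = a \<odot> v \<oplus> a \<odot> w"
  using smult_r_distr[of a v w] by simp

lemma smult_smult: "v \<in> carrier V \<Longrightarrow> a \<odot> (b \<odot> v) = (a * b) \<odot> v"
  using smult_assoc1[of a b v] by simp

lemma smult_1 [simp]: "v \<in> carrier V \<Longrightarrow> 1 \<odot> v = v"
  using smult_one[of v] by simp

lemma smult_0 [simp]: "v \<in> carrier V \<Longrightarrow> 0 \<odot> v = \<zero>"
  using smult_l_null[of v] by simp

lemma smult_zero [simp]: "a \<odot> \<zero> = \<zero>"
  using smult_r_null[of a] by simp

lemma add_neg: "v \<in> carrier V \<Longrightarrow> v \<oplus> (- 1) \<odot> v = \<zero>"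
  using smult_add_scalar[of v 1 "- 1"] by simp

lemma add_neg_eq_zero_iff:
  assumes "v \<in> carrier V" "w \<in> carrier V"
  shows "v \<oplus> (- 1) \<odot> w = \<zero> \<longleftrightarrow> v = w"
  using assms add_neg[of w] by (metis V.M.add.inv_equality V.M.a_comm V.M.minus_equality
      V.M.minus_minus smult_in)

lemma vsum_closed [simp]: "(\<And>i. i < n \<Longrightarrow> f i \<in> carrier V) \<Longrightarrow> vsum V f n \<in> carrier V"
  by (induction n) auto

lemma vsum_cong: "(\<And>i. i < n \<Longrightarrow> f i = g i) \<Longrightarrow> vsum V f n = vsum V g n"
  by (induction n) auto

lemma vsum_zero: "(\<And>i. i < n \<Longrightarrow> f i = \<zero>) \<Longrightarrow> vsum V f n = \<zero>"
  by (induction n) auto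

lemma vsum_add:
  "\<lbrakk>\<And>i. i < n \<Longrightarrow> f i \<in> carrier V; \<And>i. i < n \<Longrightarrow> g i \<in> carrier V\<rbrakk>
    \<Longrightarrow> vsum V (\<lambda>i. f i \<oplus> g i) n = vsum V f n \<oplus> vsum V g n"
  by (induction n) (auto simp: V.M.a_ac)

lemma vsum_smult:
  "(\<And>i. i < n \<Longrightarrow> f i \<in> carrier V) \<Longrightarrow> a \<odot> vsum V f n = vsum V (\<lambda>i. a \<odot> f i) n"
  by (induction n) (auto simp: smult_add_vec)

lemma vsum_single:
  assumes "j < n" "f j \<in> carrier V" "\<And>i. i < n \<Longrightarrow> i \<noteq> j \<Longrightarrow> f i = \<zero>"
  shows "vsum V f n = f j"
  using assms
proof (induction n)
  case (Suc n)
  show ?case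
  proof (cases "j = n")
    case True
    then have "vsum V f n = \<zero>" using Suc.prems by (intro vsum_zero) auto
    then show ?thesis using True Suc.prems by simp
  qed (use Suc in auto)
qed auto

lemma vsum_delta:
  assumes "j < n" "\<And>i. i < n \<Longrightarrow> b i \<in> carrier V"
  shows "vsum V (\<lambda>i. (if i = j then 1 else 0) \<odot> b i) n = b j"
  using vsum_single[of j n "\<lambda>i. (if i = j then 1 else 0) \<odot> b i"] assms by auto

text \<open>Turns a relation among vectors that are expressed through the \<open>s i\<close> into a
  linear system for the coefficients; this is how \<open>homogeneous_system_solution\<close>
  enters.\<close>

lemma vsum_swap:
  assumes "\<And>i. i < m \<Longrightarrow> s i \<in> carrier V"
  shows "vsum V (\<lambda>j. x j \<odot> vsum V (\<lambda>i. a i j \<odot> s i) m) n =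
    vsum V (\<lambda>i. (\<Sum>j<n. a i j * x j) \<odot> s i) m"
proof (induction n)
  case 0
  then show ?case using assms by (auto intro!: vsum_zero[symmetric])
next
  case (Suc n)
  have "x n \<odot> vsum V (\<lambda>i. a i n \<odot> s i) m = vsum V (\<lambda>i. (a i n * x n) \<odot> s i) m"
    using assms by (subst vsum_smult) (auto intro!: vsum_cong simp: smult_smult mult.commute)
  then show ?case using Suc assms
    by (auto simp: vsum_add[symmetric] smult_add_scalar intro!: vsum_cong)
qed

lemma lin_fun_vsum:
  assumes "lin_fun V t" "\<And>i. i < n \<Longrightarrow> f i \<in> carrier V"
  shows "t (vsum V f n) = (\<Sum>i<n. t (f i))"
proof -
  have "t \<zero> = 0" using assms(1) smult_0[of \<zero>] unfolding lin_fun_def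
    by (metis V.M.zero_closed mult_zero_left)
  with assms show ?thesis by (induction n) (auto simp: lin_fun_def)
qed

lemma linear_map_vsum:
  assumes "linear_map V W T" "\<And>i. i < n \<Longrightarrow> f i \<in> carrier V" "vec_space W"
  shows "T (vsum V f n) = vsum W (\<lambda>i. T (f i)) n"
proof -
  interpret W: vec_space W by fact
  have "T (0 \<odot>\<^bsub>V\<^esub> \<zero>\<^bsub>V\<^esub>) = 0 \<odot>\<^bsub>W\<^esub> T \<zero>\<^bsub>V\<^esub>"
    using assms(1) V.M.zero_closed unfolding linear_map_def by blast
  moreover have "T \<zero>\<^bsub>V\<^esub> \<in> carrier W" using assms(1) by (auto simp: linear_map_def)
  ultimately have "T \<zero>\<^bsub>V\<^esub> = \<zero>\<^bsub>W\<^esub>" by simp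
  with assms(1,2) show ?thesis by (induction n) (auto simp: linear_map_def)
qed

lemma finsum_eq_vsum:
  "(\<And>i. i < n \<Longrightarrow> f i \<in> carrier V) \<Longrightarrow> finsum V f {..<n} = vsum V f n"
proof (induction n)
  case (Suc n)
  then have "finsum V f (insert n {..<n}) = f n \<oplus> finsum V f {..<n}"
    by (intro V.M.finsum_insert) auto
  then show ?case using Suc by (simp add: lessThan_Suc V.M.a_comm)
qed simp

text \<open>Otherwise the coordinates of the \<open>n\<close> vectors with respect to the
  \<open>m\<close> spanning ones form a homogeneous system with more unknowns than equations, and a
  nonzero solution is a nontrivial relation among the \<open>b j\<close>.\<close>

lemma indep_bound:
  assumes span: "\<And>v. v \<in> carrier V \<Longrightarrow> \<exists>a. v = vsum V (\<lambda>i. a i \<odot> s i) m"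
    and s: "\<And>i. i < m \<Longrightarrow> s i \<in> carrier V" and b: "indep V b n"
  shows "n \<le> m"
proof (rule ccontr)
  assume "\<not> n \<le> m"
  have "\<forall>j. \<exists>a. j < n \<longrightarrow> b j = vsum V (\<lambda>i. a i \<odot> s i) m"
    using span b by (auto simp: indep_def)
  then obtain a where a: "\<And>j. j < n \<Longrightarrow> b j = vsum V (\<lambda>i. a j i \<odot> s i) m" by metis
  obtain x where x: "\<exists>j\<in>{..<n}. x j \<noteq> 0" "\<forall>i<m. (\<Sum>j<n. a j i * x j) = 0"
    using homogeneous_system_solution[of "{..<n}" m "\<lambda>i j. a j i"] \<open>\<not> n \<le> m\<close> by auto
  have "vsum V (\<lambda>j. x j \<odot> b j) n = vsum V (\<lambda>j. x j \<odot> vsum V (\<lambda>i. a j i \<odot> s i) m) n"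
    using a by (intro vsum_cong) auto
  also have "\<dots> = vsum V (\<lambda>i. (\<Sum>j<n. a j i * x j) \<odot> s i) m"
    by (rule vsum_swap) (use s in auto)
  also have "\<dots> = \<zero>" using x(2) s by (intro vsum_zero) auto
  finally show False using b x(1) by (auto simp: indep_def)
qed

lemma indep_extend:
  assumes b: "indep V b n" and v: "v \<in> carrier V" and not: "\<And>a. v \<noteq> vsum V (\<lambda>i. a i \<odot> b i) n"
  shows "indep V (b(n := v)) (Suc n)"
proof -
  let ?b = "b(n := v)"
  have bV: "\<And>i. i < n \<Longrightarrow> b i \<in> carrier V" using b by (auto simp: indep_def)
  have "\<forall>i<Suc n. x i = 0" if eq: "vsum V (\<lambda>i. x i \<odot> ?b i) (Suc n) = \<zero>" for x
  proof -
    have s: "vsum V (\<lambda>i. x i \<odot> ?b i) n = vsum V (\<lambda>i. x i \<odot> b i) n"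
      by (intro vsum_cong) auto
    \<comment> \<open>A nonzero coefficient of \<open>v\<close> could be divided out, which would
      express \<open>v\<close> through the old family.\<close>
    have xn: "x n = 0"
    proof (rule ccontr)
      assume "x n \<noteq> 0"
      let ?s = "vsum V (\<lambda>i. x i \<odot> b i) n"
      have "?s \<oplus> x n \<odot> v = \<zero>" using eq s by simp
      then have "(- 1 / x n) \<odot> (?s \<oplus> x n \<odot> v) = \<zero>" by simp
      then have "(- 1 / x n) \<odot> ?s \<oplus> (- 1) \<odot> v = \<zero>"
        using v bV \<open>x n \<noteq> 0\<close> by (simp add: smult_add_vec smult_smult)
      then have "v = (- 1 / x n) \<odot> ?s" using v bV add_neg_eq_zero_iff by simp
      also have "\<dots> = vsum V (\<lambda>i. (- 1 / x n * x i) \<odot> b i) n"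
        using bV by (subst vsum_smult) (auto intro!: vsum_cong simp: smult_smult)
      finally show False by (rule notE[OF not])
    qed
    then have "vsum V (\<lambda>i. x i \<odot> b i) n = \<zero>" using eq s v bV by simp
    then show ?thesis using b xn by (auto simp: indep_def less_Suc_eq)
  qed
  then show ?thesis using b v by (auto simp: indep_def less_Suc_eq)
qed

end

section \<open>Bases, coordinate functionals and dual bases\<close>

locale fd_space = vec_space +
  assumes fd: "fin_dim V"
begin

lemma spanning_family:
  obtains n s where "\<And>i. i < n \<Longrightarrow> s i \<in> carrier V"
    "\<And>v. v \<in> carrier V \<Longrightarrow> \<exists>a. v = vsum V (\<lambda>i. a i \<odot> s i) n"
proof -
  obtain B where B: "finite B" "B \<subseteq> carrier V"
    "\<And>v. v \<in> carrier V \<Longrightarrow> \<exists>a. v = finsum V (\<lambda>b. a b \<odot> b) B"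
    using fd unfolding fin_dim_def by blast
  obtain h where h: "bij_betw h {..<card B} B"
    using B(1) by (metis ex_bij_betw_nat_finite atLeast0LessThan)
  have hB: "h i \<in> carrier V" if "i < card B" for i
    using h B(2) that by (auto simp: bij_betw_def)
  have "\<exists>a. v = vsum V (\<lambda>i. a i \<odot> h i) (card B)" if "v \<in> carrier V" for v
  proof -
    obtain a where "v = finsum V (\<lambda>b. a b \<odot> b) B" using B(3) \<open>v \<in> carrier V\<close> by blast
    also have "\<dots> = finsum V (\<lambda>b. a b \<odot> b) (h ` {..<card B})"
      using h by (simp add: bij_betw_def)
    also have "\<dots> = finsum V (\<lambda>i. a (h i) \<odot> h i) {..<card B}"
      by (rule V.M.finsum_reindex) (use h B(2) in \<open>auto simp: bij_betw_def\<close>)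
    also have "\<dots> = vsum V (\<lambda>i. a (h i) \<odot> h i) (card B)"
      using hB by (intro finsum_eq_vsum) auto
    finally show ?thesis by auto
  qed
  with hB show ?thesis using that by blast
qed

lemma indep_le_vdim: "indep V b n \<Longrightarrow> n \<le> vdim V"
  and ex_indep_vdim: "\<exists>b. indep V b (vdim V)"
proof -
  obtain m s where s: "\<And>i. i < m \<Longrightarrow> s i \<in> carrier V"
    "\<And>v. v \<in> carrier V \<Longrightarrow> \<exists>a. v = vsum V (\<lambda>i. a i \<odot> s i) m"
    by (rule spanning_family) (rule that)
  have bd: "\<forall>n. (\<exists>b. indep V b n) \<longrightarrow> n \<le> m" using indep_bound[OF s(2,1)] by blast
  have 0: "\<exists>b. indep V b 0" by (simp add: indep_def)
  show "indep V b n \<Longrightarrow> n \<le> vdim V"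
    unfolding vdim_def using Greatest_le_nat[of "\<lambda>n. \<exists>b. indep V b n" n m] bd by blast
  show "\<exists>b. indep V b (vdim V)"
    unfolding vdim_def by (rule GreatestI_nat[of "\<lambda>n. \<exists>b. indep V b n", OF 0]) (use bd in blast)
qed

lemma indep_vdim_spans:
  assumes "indep V b (vdim V)" "v \<in> carrier V"
  shows "\<exists>a. v = vsum V (\<lambda>i. a i \<odot> b i) (vdim V)"
  using indep_extend[OF assms] indep_le_vdim[of "b(vdim V := v)" "Suc (vdim V)"] by force

text \<open>Coordinates are chosen for each vector separately. Independence makes them unique
  (\<open>uniq\<close>), and linearity of \<open>c i\<close> is uniqueness applied to two expansions
  of the same vector.\<close>

lemma coordinates:
  obtains b c where "\<And>i. i < vdim V \<Longrightarrow> b i \<in> carrier V" "\<And>i. i < vdim V \<Longrightarrow> lin_fun V (c i)"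
    "\<And>i j. \<lbrakk>i < vdim V; j < vdim V\<rbrakk> \<Longrightarrow> c i (b j) = (if i = j then 1 else 0)"
    "\<And>v. v \<in> carrier V \<Longrightarrow> v = vsum V (\<lambda>i. c i v \<odot> b i) (vdim V)"
proof -
  let ?n = "vdim V"
  obtain b where b: "indep V b ?n" using ex_indep_vdim by blast
  have bV: "b i \<in> carrier V" if "i < ?n" for i using b that by (auto simp: indep_def)
  define c where "c i v = (SOME a. v = vsum V (\<lambda>i. a i \<odot> b i) ?n) i" for i v
  have c: "v = vsum V (\<lambda>i. c i v \<odot> b i) ?n" if "v \<in> carrier V" for v
    unfolding c_def using someI_ex[OF indep_vdim_spans[OF b that]] .
  have uniq: "x i = y i"
    if "vsum V (\<lambda>i. x i \<odot> b i) ?n = vsum V (\<lambda>i. y i \<odot> b i) ?n" "i < ?n" for x y i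
  proof -
    have "vsum V (\<lambda>i. (x i + - 1 * y i) \<odot> b i) ?n =
        vsum V (\<lambda>i. x i \<odot> b i \<oplus> (- 1) \<odot> (y i \<odot> b i)) ?n"
      using bV by (intro vsum_cong) (auto simp: smult_smult smult_add_scalar[symmetric])
    also have "\<dots> = vsum V (\<lambda>i. x i \<odot> b i) ?n \<oplus> (- 1) \<odot> vsum V (\<lambda>i. y i \<odot> b i) ?n"
      using bV by (simp add: vsum_add vsum_smult)
    also have "\<dots> = \<zero>" using that(1) bV by (subst add_neg_eq_zero_iff) auto
    finally have "x i + - 1 * y i = 0" by (rule indepD[OF b _ that(2)])
    then show ?thesis by simp
  qed
  have "c i (v \<oplus> w) = c i v + c i w" if "i < ?n" "v \<in> carrier V" "w \<in> carrier V" for i v w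
  proof (rule uniq[OF _ that(1)])
    have "v \<oplus> w = vsum V (\<lambda>i. c i v \<odot> b i) ?n \<oplus> vsum V (\<lambda>i. c i w \<odot> b i) ?n"
      using c that by auto
    also have "\<dots> = vsum V (\<lambda>i. (c i v + c i w) \<odot> b i) ?n"
      using bV by (subst vsum_add[symmetric]) (auto intro!: vsum_cong simp: smult_add_scalar)
    finally have e: "v \<oplus> w = vsum V (\<lambda>i. (c i v + c i w) \<odot> b i) ?n" .
    show "vsum V (\<lambda>i. c i (v \<oplus> w) \<odot> b i) ?n = vsum V (\<lambda>i. (c i v + c i w) \<odot> b i) ?n"
      by (rule trans[OF c[symmetric] e]) (use that in auto)
  qed
  moreover have "c i (a \<odot> v) = a * c i v" if "i < ?n" "v \<in> carrier V" for a i v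
  proof (rule uniq[OF _ that(1)])
    have "a \<odot> v = a \<odot> vsum V (\<lambda>i. c i v \<odot> b i) ?n" using c that by auto
    also have "\<dots> = vsum V (\<lambda>i. (a * c i v) \<odot> b i) ?n"
      using bV by (subst vsum_smult) (auto intro!: vsum_cong simp: smult_smult)
    finally have e: "a \<odot> v = vsum V (\<lambda>i. (a * c i v) \<odot> b i) ?n" .
    show "vsum V (\<lambda>i. c i (a \<odot> v) \<odot> b i) ?n = vsum V (\<lambda>i. (a * c i v) \<odot> b i) ?n"
      by (rule trans[OF c[symmetric] e]) (use that in auto)
  qed
  moreover have "c i (b j) = (if i = j then 1 else 0)" if "i < ?n" "j < ?n" for i j
  proof (rule uniq[OF _ that(1)])
    show "vsum V (\<lambda>i. c i (b j) \<odot> b i) ?n = vsum V (\<lambda>i. (if i = j then 1 else 0) \<odot> b i) ?n"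
      using vsum_delta[of j ?n b] c[of "b j"] bV that by simp
  qed
  ultimately show ?thesis using that[of b c] bV c by (auto simp: lin_fun_def)
qed

text \<open>A coordinate functional that does not vanish at \<open>v\<close>, rescaled. It supplies
  the functional \<open>t\<close> of the character wedge.\<close>

lemma ex_lin_fun_nonzero:
  assumes "v \<in> carrier V" "v \<noteq> \<zero>"
  obtains t where "lin_fun V t" "t v = 1"
proof -
  obtain b c where bc: "\<And>i. i < vdim V \<Longrightarrow> b i \<in> carrier V" "\<And>i. i < vdim V \<Longrightarrow> lin_fun V (c i)"
    "v = vsum V (\<lambda>i. c i v \<odot> b i) (vdim V)"
    using coordinates assms(1) by metis
  obtain i where i: "i < vdim V" "c i v \<noteq> 0"
  proof (rule ccontr)
    assume "\<not> thesis"
    then have "\<And>i. i < vdim V \<Longrightarrow> c i v = 0" using that by blast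
    then have "vsum V (\<lambda>i. c i v \<odot> b i) (vdim V) = \<zero>" using bc(1) by (intro vsum_zero) auto
    then show False using bc(3) assms(2) by simp
  qed
  have "lin_fun V (\<lambda>w. c i w / c i v)"
    using bc(2)[OF i(1)] by (auto simp: lin_fun_def add_divide_distrib)
  then show ?thesis using that i(2) by simp
qed

end

lemma linear_map_indep:
  assumes "vec_space V" "vec_space W" "linear_map V W T"
    and inj: "\<And>v. \<lbrakk>v \<in> carrier V; T v = \<zero>\<^bsub>W\<^esub>\<rbrakk> \<Longrightarrow> v = \<zero>\<^bsub>V\<^esub>" and b: "indep V b n"
  shows "indep W (T \<circ> b) n"
proof -
  interpret V: vec_space V by fact
  interpret W: vec_space W by fact
  have bV: "b i \<in> carrier V" if "i < n" for i using b that by (auto simp: indep_def)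
  have "vsum W (\<lambda>i. x i \<odot>\<^bsub>W\<^esub> T (b i)) n = T (vsum V (\<lambda>i. x i \<odot>\<^bsub>V\<^esub> b i) n)" for x
    using assms(3) bV
    by (subst V.linear_map_vsum[OF assms(3) _ assms(2)])
      (auto intro!: W.vsum_cong simp: linear_map_def)
  then show ?thesis using b bV assms(3) inj V.vsum_closed[of n]
    by (auto simp: indep_def linear_map_def)
qed

lemma linear_map_inj_vdim_le:
  assumes "fd_space V" "fd_space W" "linear_map V W T"
    and inj: "\<And>v. \<lbrakk>v \<in> carrier V; T v = \<zero>\<^bsub>W\<^esub>\<rbrakk> \<Longrightarrow> v = \<zero>\<^bsub>V\<^esub>"
  shows "vdim V \<le> vdim W"
proof -
  interpret V: fd_space V by fact
  interpret W: fd_space W by fact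
  obtain b where "indep V b (vdim V)" using V.ex_indep_vdim by blast
  then have "indep W (T \<circ> b) (vdim V)"
    by (intro linear_map_indep[of V]) (use assms V.vec_space_axioms W.vec_space_axioms in auto)
  then show ?thesis by (rule W.indep_le_vdim)
qed

text \<open>The image of a basis is independent and of maximal length, hence spans. Applied with
  pre- and postcomposition as \<open>T\<close>, this produces arrows from a comparison of
  dimensions.\<close>

lemma linear_map_inj_surj:
  assumes "fd_space V" "fd_space W" "linear_map V W T"
    and inj: "\<And>v. \<lbrakk>v \<in> carrier V; T v = \<zero>\<^bsub>W\<^esub>\<rbrakk> \<Longrightarrow> v = \<zero>\<^bsub>V\<^esub>"
    and le: "vdim W \<le> vdim V" and w: "w \<in> carrier W"
  obtains v where "v \<in> carrier V" "T v = w"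
proof -
  interpret V: fd_space V by fact
  interpret W: fd_space W by fact
  have eq: "vdim V = vdim W" using linear_map_inj_vdim_le[OF assms(1-4)] le by simp
  obtain b where b: "indep V b (vdim V)" using V.ex_indep_vdim by blast
  then have "indep W (T \<circ> b) (vdim W)" unfolding eq[symmetric]
    by (intro linear_map_indep[of V]) (use assms V.vec_space_axioms W.vec_space_axioms in auto)
  from W.indep_vdim_spans[OF this w] obtain a
    where a: "w = vsum W (\<lambda>i. a i \<odot>\<^bsub>W\<^esub> T (b i)) (vdim V)" by (auto simp: eq)
  have bV: "b i \<in> carrier V" if "i < vdim V" for i using b that by (auto simp: indep_def)
  have "T (vsum V (\<lambda>i. a i \<odot>\<^bsub>V\<^esub> b i) (vdim V)) = w"
    unfolding a using assms(3) bV
    by (subst V.linear_map_vsum[OF assms(3) _ W.vec_space_axioms])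
      (auto intro!: W.vsum_cong simp: linear_map_def)
  then show ?thesis by (rule that[rotated]) (use bV in simp)
qed

text \<open>A biorthogonal pair of families of maximal length is already a pair of dual bases:
  removing the components along it leaves vectors that pair to zero with everything, and these
  vanish by nondegeneracy.\<close>

lemma perfect_pairing_dual_bases:
  fixes B :: "'v \<Rightarrow> 'w \<Rightarrow> 'k :: field"
  assumes V: "fd_space V" and W: "fd_space W"
    and B1: "\<And>w. w \<in> carrier W \<Longrightarrow> lin_fun V (\<lambda>v. B v w)"
    and B2: "\<And>v. v \<in> carrier V \<Longrightarrow> lin_fun W (B v)"
    and nd1: "\<And>v. \<lbrakk>v \<in> carrier V; v \<noteq> \<zero>\<^bsub>V\<^esub>\<rbrakk> \<Longrightarrow> \<exists>w\<in>carrier W. B v w \<noteq> 0"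
    and nd2: "\<And>w. \<lbrakk>w \<in> carrier W; w \<noteq> \<zero>\<^bsub>W\<^esub>\<rbrakk> \<Longrightarrow> \<exists>v\<in>carrier V. B v w \<noteq> 0"
  obtains n v w where "\<And>i. i < n \<Longrightarrow> v i \<in> carrier V" "\<And>i. i < n \<Longrightarrow> w i \<in> carrier W"
    "\<And>x. x \<in> carrier V \<Longrightarrow> x = vsum V (\<lambda>i. B x (w i) \<odot>\<^bsub>V\<^esub> v i) n"
    "\<And>y. y \<in> carrier W \<Longrightarrow> y = vsum W (\<lambda>i. B (v i) y \<odot>\<^bsub>W\<^esub> w i) n"
proof -
  interpret V: fd_space V by fact
  interpret W: fd_space W by fact
  have add1: "B (x \<oplus>\<^bsub>V\<^esub> x') y = B x y + B x' y"
    if "x \<in> carrier V" "x' \<in> carrier V" "y \<in> carrier W" for x x' y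
    using B1[OF that(3)] that by (auto simp: lin_fun_def)
  have smult1: "B (a \<odot>\<^bsub>V\<^esub> x) y = a * B x y" if "x \<in> carrier V" "y \<in> carrier W" for x y a
    using B1[OF that(2)] that by (auto simp: lin_fun_def)
  have add2: "B x (y \<oplus>\<^bsub>W\<^esub> y') = B x y + B x y'"
    if "x \<in> carrier V" "y \<in> carrier W" "y' \<in> carrier W" for x y y'
    using B2[OF that(1)] that by (auto simp: lin_fun_def)
  have smult2: "B x (a \<odot>\<^bsub>W\<^esub> y) = a * B x y" if "x \<in> carrier V" "y \<in> carrier W" for x y a
    using B2[OF that(1)] that by (auto simp: lin_fun_def)
  define dual where "dual v w n \<longleftrightarrow> (\<forall>i<n. v i \<in> carrier V \<and> w i \<in> carrier W) \<and>
    (\<forall>i<n. \<forall>j<n. B (v i) (w j) = (if i = j then 1 else 0))" for v w and n :: nat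
  \<comment> \<open>The vectors of a biorthogonal family are independent, so the lengths are bounded
    and a maximal one exists.\<close>
  have bd: "n \<le> vdim V" if d: "dual v w n" for v w n
  proof (rule V.indep_le_vdim)
    have vw: "v i \<in> carrier V" "w i \<in> carrier W" if "i < n" for i using d that by (auto simp: dual_def)
    have "x j = 0" if "vsum V (\<lambda>i. x i \<odot>\<^bsub>V\<^esub> v i) n = \<zero>\<^bsub>V\<^esub>" "j < n" for x j
    proof -
      have "B (vsum V (\<lambda>i. x i \<odot>\<^bsub>V\<^esub> v i) n) (w j) = (\<Sum>i<n. x i * (if i = j then 1 else 0))"
        using V.lin_fun_vsum[OF B1[OF vw(2)[OF that(2)]], of n "\<lambda>i. x i \<odot>\<^bsub>V\<^esub> v i"] vw d that(2)
        by (auto simp: dual_def smult1 intro!: sum.cong)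
      moreover have "B \<zero>\<^bsub>V\<^esub> (w j) = 0"
        using V.lin_fun_vsum[OF B1[OF vw(2)[OF that(2)]], of 0] by simp
      ultimately show ?thesis using that by (simp add: if_distrib cong: if_cong)
    qed
    then show "indep V v n" using vw by (auto simp: indep_def)
  qed
  define n where "n = (GREATEST n. \<exists>v w. dual v w n)"
  have "\<exists>v w. dual v w 0" by (simp add: dual_def)
  then have "\<exists>v w. dual v w n"
    unfolding n_def by (rule GreatestI_nat[where b = "vdim V"]) (use bd in blast)
  then obtain v w where vw: "dual v w n" by blast
  have max: "\<not> dual v' w' (Suc n)" for v' w'
    using Greatest_le_nat[of "\<lambda>n. \<exists>v w. dual v w n" "Suc n" "vdim V"] bd
    unfolding n_def[symmetric] by (metis Suc_n_not_le_n)
  have vV: "v i \<in> carrier V" and wW: "w i \<in> carrier W" if "i < n" for i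
    using vw that by (auto simp: dual_def)
  have Bvw: "B (v i) (w j) = (if i = j then 1 else 0)" if "i < n" "j < n" for i j
    using vw that by (auto simp: dual_def)
  \<comment> \<open>Projections onto the vectors orthogonal to all \<open>w j\<close>, respectively
    to all \<open>v j\<close>.\<close>
  define p where "p x = x \<oplus>\<^bsub>V\<^esub> (- 1) \<odot>\<^bsub>V\<^esub> vsum V (\<lambda>i. B x (w i) \<odot>\<^bsub>V\<^esub> v i) n" for x
  define q where "q y = y \<oplus>\<^bsub>W\<^esub> (- 1) \<odot>\<^bsub>W\<^esub> vsum W (\<lambda>i. B (v i) y \<odot>\<^bsub>W\<^esub> w i) n" for y
  have pV: "p x \<in> carrier V" if "x \<in> carrier V" for x using that vV by (simp add: p_def)
  have qW: "q y \<in> carrier W" if "y \<in> carrier W" for y using that wW by (simp add: q_def)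
  have Bp: "B (p x) y = B x y - (\<Sum>i<n. B x (w i) * B (v i) y)"
    if "x \<in> carrier V" "y \<in> carrier W" for x y
  proof -
    have "B (vsum V (\<lambda>i. B x (w i) \<odot>\<^bsub>V\<^esub> v i) n) y = (\<Sum>i<n. B x (w i) * B (v i) y)"
      using V.lin_fun_vsum[OF B1[OF that(2)], of n "\<lambda>i. B x (w i) \<odot>\<^bsub>V\<^esub> v i"] that vV
      by (auto simp: smult1 intro!: sum.cong)
    then show ?thesis using that vV by (simp add: p_def add1 smult1)
  qed
  have Bq: "B x (q y) = B x y - (\<Sum>i<n. B (v i) y * B x (w i))"
    if "x \<in> carrier V" "y \<in> carrier W" for x y
  proof -
    have "B x (vsum W (\<lambda>i. B (v i) y \<odot>\<^bsub>W\<^esub> w i) n) = (\<Sum>i<n. B (v i) y * B x (w i))"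
      using W.lin_fun_vsum[OF B2[OF that(1)], of n "\<lambda>i. B (v i) y \<odot>\<^bsub>W\<^esub> w i"] that wW
      by (auto simp: smult2 intro!: sum.cong)
    then show ?thesis using that wW by (simp add: q_def add2 smult2)
  qed
  have pw: "B (p x) (w j) = 0" if "x \<in> carrier V" "j < n" for x j
  proof -
    have "(\<Sum>i<n. B x (w i) * B (v i) (w j)) = (\<Sum>i<n. if i = j then B x (w i) else 0)"
      using Bvw that(2) by (intro sum.cong) auto
    then show ?thesis using Bp[OF that(1) wW[OF that(2)]] that(2) by simp
  qed
  have vq: "B (v j) (q y) = 0" if "y \<in> carrier W" "j < n" for y j
  proof -
    have "(\<Sum>i<n. B (v i) y * B (v j) (w i)) = (\<Sum>i<n. if i = j then B (v i) y else 0)"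
      using Bvw that(2) by (intro sum.cong) auto
    then show ?thesis using Bq[OF vV[OF that(2)] that(1)] that(2) by simp
  qed
  \<comment> \<open>If two residual vectors paired to a nonzero scalar, \<open>p x\<close> and a
    rescaled \<open>q y\<close> would lengthen the biorthogonal pair.\<close>
  have pq: "B (p x) (q y) = 0" if "x \<in> carrier V" "y \<in> carrier W" for x y
  proof (rule ccontr)
    let ?c = "1 / B (p x) (q y)"
    assume "B (p x) (q y) \<noteq> 0"
    then have "B (p x) (?c \<odot>\<^bsub>W\<^esub> q y) = 1" using pV qW that by (simp add: smult2)
    moreover have "B (v j) (?c \<odot>\<^bsub>W\<^esub> q y) = 0" if "j < n" for j
      using vq[OF \<open>y \<in> carrier W\<close> that] qW \<open>y \<in> carrier W\<close> vV[OF that]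
      by (simp add: smult2)
    ultimately have "dual (v(n := p x)) (w(n := ?c \<odot>\<^bsub>W\<^esub> q y)) (Suc n)"
      using pw that pV qW vV wW Bvw by (auto simp: dual_def less_Suc_eq)
    then show False using max by blast
  qed
  have "p x = \<zero>\<^bsub>V\<^esub>" if "x \<in> carrier V" for x
  proof -
    \<comment> \<open>\<open>y\<close> differs from \<open>q y\<close> by a combination of the
      \<open>w j\<close>, and these are orthogonal to \<open>p x\<close>.\<close>
    have "B (p x) y = 0" if "y \<in> carrier W" for y
      using pq[OF \<open>x \<in> carrier V\<close> that] Bq[OF pV[OF \<open>x \<in> carrier V\<close>] that] pw \<open>x \<in> carrier V\<close> by simp
    then show ?thesis using nd1 pV that by blast
  qed
  moreover have "q y = \<zero>\<^bsub>W\<^esub>" if "y \<in> carrier W" for y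
  proof -
    have "B x (q y) = 0" if "x \<in> carrier V" for x
      using pq[OF that \<open>y \<in> carrier W\<close>] Bp[OF that qW[OF \<open>y \<in> carrier W\<close>]] vq \<open>y \<in> carrier W\<close> by simp
    then show ?thesis using nd2 qW that by blast
  qed
  ultimately show ?thesis using that[of n v w] vV wW
    by (simp add: p_def q_def V.add_neg_eq_zero_iff W.add_neg_eq_zero_iff)
qed

section \<open>Linear and abelian categories\<close>

lemma Hom_iff: "f \<in> Hom C A B \<longleftrightarrow> f \<in> arr C \<and> src C f = A \<and> tgt C f = B"
  by (auto simp: Hom_def)

lemma hom_space_simps [simp]:
  "carrier (hom_space C A B) = Hom C A B"
  "\<zero>\<^bsub>hom_space C A B\<^esub> = zero_arr C A B"
  "f \<oplus>\<^bsub>hom_space C A B\<^esub> g = add_arr C f g"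
  "a \<odot>\<^bsub>hom_space C A B\<^esub> f = scale_arr C a f"
  by (simp_all add: hom_space_def)

text \<open>Negation is not a field of the category record, so the difference is formed with the
  scalar \<open>- 1\<close>.\<close>

definition sub_arr :: "('o, 'm, 'k :: field, 'z) lcat_scheme \<Rightarrow> 'm \<Rightarrow> 'm \<Rightarrow> 'm" where
  "sub_arr C f g = add_arr C f (scale_arr C (- 1) g)"

section \<open>Calculus of arrows, kernels and cokernels\<close>

context linear_category
begin

lemma vec_space_Hom: "\<lbrakk>A \<in> obj C; B \<in> obj C\<rbrakk> \<Longrightarrow> vec_space (hom_space C A B)"
  by (rule vec_space.intro[OF hom_space_module])

declare src_obj [simp] tgt_obj [simp]

lemma ident_typing [simp]:
  assumes "A \<in> obj C"
  shows "ident C A \<in> arr C" "src C (ident C A) = A" "tgt C (ident C A) = A"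
  using ident_Hom[OF assms] by (auto simp: Hom_iff)

lemma cmp_typing [simp]:
  assumes "f \<in> arr C" "g \<in> arr C" "tgt C f = src C g"
  shows "g \<cdot> f \<in> arr C" "src C (g \<cdot> f) = src C f" "tgt C (g \<cdot> f) = tgt C g"
  using cmp_Hom[of f "src C f" "tgt C f" g "tgt C g"] assms by (auto simp: Hom_iff)

lemma cmp_ident [simp]:
  "\<lbrakk>f \<in> arr C; src C f = A\<rbrakk> \<Longrightarrow> f \<cdot> ident C A = f"
  "\<lbrakk>f \<in> arr C; tgt C f = A\<rbrakk> \<Longrightarrow> ident C A \<cdot> f = f"
  using cmp_ident_right[of f] cmp_ident_left[of f] by (auto simp: Hom_iff)

lemma cmp_assoc_arr [simp]:
  "\<lbrakk>f \<in> arr C; g \<in> arr C; h \<in> arr C; tgt C f = src C g; tgt C g = src C h\<rbrakk>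
    \<Longrightarrow> (h \<cdot> g) \<cdot> f = h \<cdot> (g \<cdot> f)"
  using cmp_assoc[of f "src C f" "tgt C f" g "tgt C g" h "tgt C h"] by (auto simp: Hom_iff)

text \<open>Composites are kept nested to the right, so the left-hand side of
  \<open>p \<cdot> q = r\<close> usually occurs as \<open>p \<cdot> (q \<cdot> x)\<close>; this form
  matches it.\<close>

lemma cmp_reduce:
  assumes "p \<cdot> q = r" "p \<in> arr C" "q \<in> arr C" "tgt C q = src C p" "x \<in> arr C" "tgt C x = src C q"
  shows "p \<cdot> (q \<cdot> x) = r \<cdot> x"
  using assms by (metis cmp_assoc_arr)

lemma zero_typing [simp]:
  assumes "A \<in> obj C" "B \<in> obj C"
  shows "zero_arr C A B \<in> arr C" "src C (zero_arr C A B) = A" "tgt C (zero_arr C A B) = B"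
proof -
  interpret H: vec_space "hom_space C A B" using vec_space_Hom assms by simp
  show "zero_arr C A B \<in> arr C" "src C (zero_arr C A B) = A" "tgt C (zero_arr C A B) = B"
    using H.V.M.zero_closed by (auto simp: Hom_iff)
qed

lemma add_typing [simp]:
  assumes "f \<in> arr C" "g \<in> arr C" "src C f = src C g" "tgt C f = tgt C g"
  shows "add_arr C f g \<in> arr C" "src C (add_arr C f g) = src C g" "tgt C (add_arr C f g) = tgt C g"
proof -
  interpret H: vec_space "hom_space C (src C g) (tgt C g)" using vec_space_Hom assms by simp
  show "add_arr C f g \<in> arr C" "src C (add_arr C f g) = src C g" "tgt C (add_arr C f g) = tgt C g"
    using H.V.M.a_closed[of f g] assms by (auto simp: Hom_iff)
qed

lemma scale_typing [simp]:
  assumes "f \<in> arr C"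
  shows "scale_arr C a f \<in> arr C" "src C (scale_arr C a f) = src C f" "tgt C (scale_arr C a f) =
        tgt C f"
proof -
  interpret H: vec_space "hom_space C (src C f) (tgt C f)" using vec_space_Hom assms by simp
  show "scale_arr C a f \<in> arr C" "src C (scale_arr C a f) = src C f"
    "tgt C (scale_arr C a f) = tgt C f"
    using H.smult_in[of f a] assms by (auto simp: Hom_iff)
qed

lemma sub_typing [simp]:
  assumes "f \<in> arr C" "g \<in> arr C" "src C f = src C g" "tgt C f = tgt C g"
  shows "sub_arr C f g \<in> arr C" "src C (sub_arr C f g) = src C g" "tgt C (sub_arr C f g) = tgt C g"
  using assms by (auto simp: sub_arr_def)

lemma scale_0 [simp]: "f \<in> arr C \<Longrightarrow> scale_arr C 0 f = zero_arr C (src C f) (tgt C f)"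
  using vec_space.smult_0[OF vec_space_Hom[of "src C f" "tgt C f"], of f] by (simp add: Hom_iff)

lemma scale_1 [simp]: "f \<in> arr C \<Longrightarrow> scale_arr C 1 f = f"
  using vec_space.smult_1[OF vec_space_Hom[of "src C f" "tgt C f"], of f] by (simp add: Hom_iff)

lemma scale_scale: "f \<in> arr C \<Longrightarrow> scale_arr C a (scale_arr C b f) = scale_arr C (a * b) f"
  using vec_space.smult_smult[OF vec_space_Hom[of "src C f" "tgt C f"], of f] by (simp add: Hom_iff)

lemma scale_zero [simp]:
  "\<lbrakk>A \<in> obj C; B \<in> obj C\<rbrakk> \<Longrightarrow> scale_arr C a (zero_arr C A B) = zero_arr C A B"
  using vec_space.smult_zero[OF vec_space_Hom[of A B]] by simp

lemma sub_eq_zero_iff: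
  assumes "f \<in> arr C" "g \<in> arr C" "src C f = src C g" "tgt C f = tgt C g"
  shows "sub_arr C f g = zero_arr C (src C g) (tgt C g) \<longleftrightarrow> f = g"
  using vec_space.add_neg_eq_zero_iff[OF vec_space_Hom[of "src C g" "tgt C g"], of f g] assms
  by (simp add: Hom_iff sub_arr_def)

lemma add_zero [simp]:
  "\<lbrakk>f \<in> arr C; src C f = A; tgt C f = B\<rbrakk> \<Longrightarrow> add_arr C f (zero_arr C A B) = f"
  "\<lbrakk>f \<in> arr C; src C f = A; tgt C f = B\<rbrakk> \<Longrightarrow> add_arr C (zero_arr C A B) f = f"
  using abelian_monoid.r_zero[of "hom_space C A B" f] abelian_monoid.l_zero[of "hom_space C A B" f]
    vec_space.module_V[OF vec_space_Hom[of A B]]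
  by (auto simp: Hom_iff Module.module_def abelian_group_def)

lemma cmp_add_arr_left:
  "\<lbrakk>f \<in> arr C; g \<in> arr C; h \<in> arr C; tgt C f = src C g; src C h = src C g; tgt C h = tgt C g\<rbrakk>
    \<Longrightarrow> add_arr C g h \<cdot> f = add_arr C (g \<cdot> f) (h \<cdot> f)"
  using cmp_add_left[of f "src C f" "tgt C f" g "tgt C g" h] by (simp add: Hom_iff)

lemma cmp_add_arr_right:
  "\<lbrakk>f \<in> arr C; g \<in> arr C; h \<in> arr C; tgt C f = src C h; src C f = src C g; tgt C f = tgt C g\<rbrakk>
    \<Longrightarrow> h \<cdot> add_arr C f g = add_arr C (h \<cdot> f) (h \<cdot> g)"
  using cmp_add_right[of f "src C f" "tgt C f" g h "tgt C h"] by (simp add: Hom_iff)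

lemma cmp_scale [simp]:
  "\<lbrakk>f \<in> arr C; g \<in> arr C; tgt C f = src C g\<rbrakk> \<Longrightarrow> scale_arr C a g \<cdot> f = scale_arr C a (g \<cdot> f)"
  "\<lbrakk>f \<in> arr C; g \<in> arr C; tgt C f = src C g\<rbrakk> \<Longrightarrow> g \<cdot> scale_arr C a f = scale_arr C a (g \<cdot> f)"
  using cmp_scale_left[of f "src C f" "tgt C f" g "tgt C g" a]
    cmp_scale_right[of f "src C f" "tgt C f" g "tgt C g" a] by (simp_all add: Hom_iff)

lemma cmp_zero [simp]:
  "\<lbrakk>f \<in> arr C; A \<in> obj C; src C f = B\<rbrakk> \<Longrightarrow> f \<cdot> zero_arr C A B = zero_arr C A (tgt C f)"
  "\<lbrakk>f \<in> arr C; D \<in> obj C; tgt C f = B\<rbrakk> \<Longrightarrow> zero_arr C B D \<cdot> f = zero_arr C (src C f) D"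
  using cmp_scale(2)[of "zero_arr C A B" f 0] cmp_scale(1)[of f "zero_arr C B D" 0]
  by auto

lemma cmp_sub_left:
  "\<lbrakk>f \<in> arr C; g \<in> arr C; h \<in> arr C; tgt C f = src C g; src C h = src C g; tgt C h = tgt C g\<rbrakk>
    \<Longrightarrow> sub_arr C g h \<cdot> f = sub_arr C (g \<cdot> f) (h \<cdot> f)"
  by (simp add: sub_arr_def cmp_add_arr_left)

lemma cmp_sub_right:
  "\<lbrakk>f \<in> arr C; g \<in> arr C; h \<in> arr C; tgt C f = src C h; src C f = src C g; tgt C f = tgt C g\<rbrakk>
    \<Longrightarrow> h \<cdot> sub_arr C f g = sub_arr C (h \<cdot> f) (h \<cdot> g)"
  by (simp add: sub_arr_def cmp_add_arr_right)

lemma linear_map_cmp_left: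
  "\<lbrakk>h \<in> arr C; src C h = B; tgt C h = D\<rbrakk>
    \<Longrightarrow> linear_map (hom_space C A B) (hom_space C A D) (\<lambda>f. h \<cdot> f)"
  by (auto simp: linear_map_def Hom_iff cmp_add_arr_right)

lemma linear_map_cmp_right:
  "\<lbrakk>h \<in> arr C; src C h = A; tgt C h = B\<rbrakk>
    \<Longrightarrow> linear_map (hom_space C B D) (hom_space C A D) (\<lambda>f. f \<cdot> h)"
  by (auto simp: linear_map_def Hom_iff cmp_add_arr_left)

lemma is_inverse_unique: "\<lbrakk>is_inverse C f g; is_inverse C f h\<rbrakk> \<Longrightarrow> g = h"
  unfolding is_inverse_def by (metis (no_types, lifting) Hom_iff cmp_assoc_arr cmp_ident)

lemma inv_arrI: "is_inverse C f g \<Longrightarrow> inv_arr C f = g"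
  unfolding inv_arr_def using is_inverse_unique by (intro the_equality) blast+

lemma is_isoD [simp]:
  assumes "is_iso C f"
  shows "f \<in> arr C" "inv_arr C f \<in> arr C" "src C (inv_arr C f) = tgt C f"
    "tgt C (inv_arr C f) = src C f"
    "inv_arr C f \<cdot> f = ident C (src C f)" "f \<cdot> inv_arr C f = ident C (tgt C f)"
proof -
  obtain g where g: "is_inverse C f g" using assms by (auto simp: is_iso_def)
  show "f \<in> arr C" "inv_arr C f \<in> arr C" "src C (inv_arr C f) = tgt C f"
    "tgt C (inv_arr C f) = src C f"
    "inv_arr C f \<cdot> f = ident C (src C f)" "f \<cdot> inv_arr C f = ident C (tgt C f)"
    using g unfolding inv_arrI[OF g] by (auto simp: is_inverse_def Hom_iff)
qed

lemma iso_cancel [simp]: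
  "\<lbrakk>is_iso C f; g \<in> arr C; tgt C g = src C f\<rbrakk> \<Longrightarrow> inv_arr C f \<cdot> (f \<cdot> g) = g"
  "\<lbrakk>is_iso C f; g \<in> arr C; tgt C g = tgt C f\<rbrakk> \<Longrightarrow> f \<cdot> (inv_arr C f \<cdot> g) = g"
  by (simp_all flip: cmp_assoc_arr)

lemma isoI:
  assumes "f \<in> arr C" "g \<in> arr C" "src C g = tgt C f" "tgt C g = src C f"
    "g \<cdot> f = ident C (src C f)" "f \<cdot> g = ident C (tgt C f)"
  shows "is_iso C f" "inv_arr C f = g"
proof -
  have "is_inverse C f g" using assms by (auto simp: is_inverse_def Hom_iff)
  then show "is_iso C f" "inv_arr C f = g" using inv_arrI by (auto simp: is_iso_def)
qed

lemma iso_ident [simp]: "A \<in> obj C \<Longrightarrow> is_iso C (ident C A)"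
  by (rule isoI(1)[of _ "ident C A"]) auto

lemma inv_ident [simp]: "A \<in> obj C \<Longrightarrow> inv_arr C (ident C A) = ident C A"
  by (rule isoI(2)) auto

lemma iso_inv [simp]: "is_iso C f \<Longrightarrow> is_iso C (inv_arr C f)" "is_iso C f \<Longrightarrow> inv_arr C (inv_arr C f) = f"
  using isoI[of "inv_arr C f" f] by auto

lemma iso_cmp [simp]:
  assumes "is_iso C f" "is_iso C g" "tgt C f = src C g"
  shows "is_iso C (g \<cdot> f)" "inv_arr C (g \<cdot> f) = inv_arr C f \<cdot> inv_arr C g"
  using isoI[of "g \<cdot> f" "inv_arr C f \<cdot> inv_arr C g"] assms by auto

lemma monoI:
  "\<lbrakk>f \<in> arr C; \<And>g h. \<lbrakk>g \<in> arr C; h \<in> arr C; src C g = src C h; tgt C g = src C f; tgt C h = src C f;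
      f \<cdot> g = f \<cdot> h\<rbrakk> \<Longrightarrow> g = h\<rbrakk> \<Longrightarrow> is_mono C f"
  by (auto simp: is_mono_def Hom_iff)

lemma monoD:
  "\<lbrakk>is_mono C f; f \<cdot> g = f \<cdot> h; g \<in> arr C; h \<in> arr C; src C g = src C h; tgt C g = src C f;
    tgt C h = src C f\<rbrakk> \<Longrightarrow> g = h"
  unfolding is_mono_def by (metis Hom_iff src_obj)

lemma epiI:
  "\<lbrakk>f \<in> arr C; \<And>g h. \<lbrakk>g \<in> arr C; h \<in> arr C; tgt C g = tgt C h; src C g = tgt C f; src C h = tgt C f;
      g \<cdot> f = h \<cdot> f\<rbrakk> \<Longrightarrow> g = h\<rbrakk> \<Longrightarrow> is_epi C f"
  by (auto simp: is_epi_def Hom_iff)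

lemma epiD:
  "\<lbrakk>is_epi C f; g \<cdot> f = h \<cdot> f; g \<in> arr C; h \<in> arr C; tgt C g = tgt C h; src C g = tgt C f;
    src C h = tgt C f\<rbrakk> \<Longrightarrow> g = h"
  unfolding is_epi_def by (metis Hom_iff tgt_obj)

lemma mono_arr [simp]: "is_mono C f \<Longrightarrow> f \<in> arr C" and epi_arr [simp]: "is_epi C f \<Longrightarrow> f \<in> arr C"
  by (auto simp: is_mono_def is_epi_def)

lemma iso_mono: "is_iso C f \<Longrightarrow> is_mono C f"
  by (rule monoI) (auto, metis iso_cancel(1))

lemma iso_epi: "is_iso C f \<Longrightarrow> is_epi C f"
proof (rule epiI)
  fix g h assume f: "is_iso C f" and gh: "g \<in> arr C" "h \<in> arr C" "src C g = tgt C f" "src C h = tgt C f"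
    and eq: "g \<cdot> f = h \<cdot> f"
  have "(g \<cdot> f) \<cdot> inv_arr C f = (h \<cdot> f) \<cdot> inv_arr C f" by (simp only: eq)
  then show "g = h" using f gh by simp
qed auto

lemma mono_cmp:
  assumes "is_mono C f" "is_mono C g" "tgt C f = src C g"
  shows "is_mono C (g \<cdot> f)"
proof (rule monoI)
  fix a b assume ab: "a \<in> arr C" "b \<in> arr C" "src C a = src C b" "tgt C a = src C (g \<cdot> f)"
    "tgt C b = src C (g \<cdot> f)" "(g \<cdot> f) \<cdot> a = (g \<cdot> f) \<cdot> b"
  then have "f \<cdot> a = f \<cdot> b" using assms by - (rule monoD[OF assms(2)], auto)
  then show "a = b" using ab assms by - (rule monoD[OF assms(1)], auto)
qed (use assms in auto)

lemma epi_cmp: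
  assumes "is_epi C f" "is_epi C g" "tgt C f = src C g"
  shows "is_epi C (g \<cdot> f)"
proof (rule epiI)
  fix a b assume ab: "a \<in> arr C" "b \<in> arr C" "tgt C a = tgt C b" "src C a = tgt C (g \<cdot> f)"
    "src C b = tgt C (g \<cdot> f)" "a \<cdot> (g \<cdot> f) = b \<cdot> (g \<cdot> f)"
  then have "a \<cdot> g = b \<cdot> g" using assms by - (rule epiD[OF assms(1)], auto)
  then show "a = b" using ab assms by - (rule epiD[OF assms(2)], auto)
qed (use assms in auto)

lemma epi_left:
  assumes "is_epi C (g \<cdot> f)" "f \<in> arr C" "g \<in> arr C" "tgt C f = src C g"
  shows "is_epi C g"
proof (rule epiI)
  fix a b assume ab: "a \<in> arr C" "b \<in> arr C" "tgt C a = tgt C b" "src C a = tgt C g" "src C b = tgt C g"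
    "a \<cdot> g = b \<cdot> g"
  then have "(a \<cdot> g) \<cdot> f = (b \<cdot> g) \<cdot> f" by simp
  then have "a \<cdot> (g \<cdot> f) = b \<cdot> (g \<cdot> f)" using ab(1-5) assms(2-4) by simp
  then show "a = b" using ab assms by - (rule epiD[OF assms(1)], auto)
qed (use assms in auto)

lemma epi_split_mono_iso:
  assumes "is_epi C f" "r \<in> arr C" "src C r = tgt C f" "tgt C r = src C f" "r \<cdot> f = ident C (src C f)"
  shows "is_iso C f"
proof (rule isoI(1)[of _ r])
  have "(f \<cdot> r) \<cdot> f = ident C (tgt C f) \<cdot> f" using assms by simp
  then show "f \<cdot> r = ident C (tgt C f)" using assms by - (rule epiD[OF assms(1)], auto)
qed (use assms in auto)

lemma mono_split_epi_iso:
  assumes "is_mono C f" "r \<in> arr C" "src C r = tgt C f" "tgt C r = src C f" "f \<cdot> r = ident C (tgt C f)"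
  shows "is_iso C f"
proof (rule isoI(1)[of _ r])
  have "f \<cdot> (r \<cdot> f) = f \<cdot> ident C (src C f)" using assms by (simp flip: cmp_assoc_arr)
  then show "r \<cdot> f = ident C (src C f)" using assms by - (rule monoD[OF assms(1)], auto)
qed (use assms in auto)

text \<open>Bilinearity of composition reduces cancellation of \<open>f\<close> to the difference
  \<open>sub_arr C g h\<close>.\<close>

lemma mono_iff_zero:
  "is_mono C f \<longleftrightarrow> f \<in> arr C \<and> (\<forall>g\<in>arr C. tgt C g = src C f \<and>
     f \<cdot> g = zero_arr C (src C g) (tgt C f) \<longrightarrow> g = zero_arr C (src C g) (src C f))"
proof (intro iffI conjI ballI impI)
  fix g assume f: "is_mono C f" and g: "g \<in> arr C"
    "tgt C g = src C f \<and> f \<cdot> g = zero_arr C (src C g) (tgt C f)"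
  then show "g = zero_arr C (src C g) (src C f)"
    using f by - (rule monoD[OF f], auto)
next
  assume *: "f \<in> arr C \<and> (\<forall>g\<in>arr C. tgt C g = src C f \<and>
     f \<cdot> g = zero_arr C (src C g) (tgt C f) \<longrightarrow> g = zero_arr C (src C g) (src C f))"
  show "is_mono C f"
  proof (rule monoI)
    fix g h assume gh: "g \<in> arr C" "h \<in> arr C" "src C g = src C h" "tgt C g = src C f"
      "tgt C h = src C f" "f \<cdot> g = f \<cdot> h"
    then have "f \<cdot> sub_arr C g h = zero_arr C (src C h) (tgt C f)"
      using * by (simp add: cmp_sub_right sub_eq_zero_iff[of "f \<cdot> h" "f \<cdot> h", simplified])
    then have "sub_arr C g h = zero_arr C (src C h) (tgt C h)"
      using bspec[OF conjunct2[OF *], of "sub_arr C g h"] gh(1-5) by simp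
    then show "g = h" using gh sub_eq_zero_iff[of g h] by simp
  qed (use * in auto)
qed (auto simp: mono_arr)

lemma epi_iff_zero:
  "is_epi C f \<longleftrightarrow> f \<in> arr C \<and> (\<forall>g\<in>arr C. src C g = tgt C f \<and>
     g \<cdot> f = zero_arr C (src C f) (tgt C g) \<longrightarrow> g = zero_arr C (tgt C f) (tgt C g))"
proof (intro iffI conjI ballI impI)
  fix g assume f: "is_epi C f" and g: "g \<in> arr C"
    "src C g = tgt C f \<and> g \<cdot> f = zero_arr C (src C f) (tgt C g)"
  then show "g = zero_arr C (tgt C f) (tgt C g)"
    using f by - (rule epiD[OF f], auto)
next
  assume *: "f \<in> arr C \<and> (\<forall>g\<in>arr C. src C g = tgt C f \<and>
     g \<cdot> f = zero_arr C (src C f) (tgt C g) \<longrightarrow> g = zero_arr C (tgt C f) (tgt C g))"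
  show "is_epi C f"
  proof (rule epiI)
    fix g h assume gh: "g \<in> arr C" "h \<in> arr C" "tgt C g = tgt C h" "src C g = tgt C f"
      "src C h = tgt C f" "g \<cdot> f = h \<cdot> f"
    then have "sub_arr C g h \<cdot> f = zero_arr C (src C f) (tgt C h)"
      using * by (simp add: cmp_sub_left sub_eq_zero_iff[of "h \<cdot> f" "h \<cdot> f", simplified])
    then have "sub_arr C g h = zero_arr C (src C h) (tgt C h)"
      using bspec[OF conjunct2[OF *], of "sub_arr C g h"] gh(1-5) by simp
    then show "g = h" using gh sub_eq_zero_iff[of g h] by simp
  qed (use * in auto)
qed auto

lemma kernel_mono: "is_kernel C f k \<Longrightarrow> is_mono C k"
proof (rule monoI)
  fix g h assume k: "is_kernel C f k" and gh: "g \<in> arr C" "h \<in> arr C" "src C g = src C h"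
    "tgt C g = src C k" "tgt C h = src C k" "k \<cdot> g = k \<cdot> h"
  have *: "f \<cdot> (k \<cdot> g) = zero_arr C (src C g) (tgt C f)"
    using k gh by (simp add: is_kernel_def flip: cmp_assoc_arr)
  have "\<forall>h\<in>arr C. tgt C h = src C f \<and> f \<cdot> h = zero_arr C (src C h) (tgt C f) \<longrightarrow>
      (\<exists>!u. u \<in> Hom C (src C h) (src C k) \<and> k \<cdot> u = h)"
    using k unfolding is_kernel_def by blast
  from bspec[OF this, of "k \<cdot> g"]
  have "\<exists>!u. u \<in> Hom C (src C (k \<cdot> g)) (src C k) \<and> k \<cdot> u = k \<cdot> g"
    using * k gh(1-5) by (simp add: is_kernel_def)
  then show "g = h" using gh k by (auto simp: Hom_iff is_kernel_def)
qed (auto simp: is_kernel_def)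

lemma cokernel_epi: "is_cokernel C f k \<Longrightarrow> is_epi C k"
proof (rule epiI)
  fix g h assume k: "is_cokernel C f k" and gh: "g \<in> arr C" "h \<in> arr C" "tgt C g = tgt C h"
    "src C g = tgt C k" "src C h = tgt C k" "g \<cdot> k = h \<cdot> k"
  have *: "(g \<cdot> k) \<cdot> f = zero_arr C (src C f) (tgt C g)"
    using k gh by (simp add: is_cokernel_def)
  have "\<forall>h\<in>arr C. src C h = tgt C f \<and> h \<cdot> f = zero_arr C (src C f) (tgt C h) \<longrightarrow>
      (\<exists>!u. u \<in> Hom C (tgt C k) (tgt C h) \<and> u \<cdot> k = h)"
    using k unfolding is_cokernel_def by blast
  from bspec[OF this, of "g \<cdot> k"]
  have "\<exists>!u. u \<in> Hom C (tgt C k) (tgt C (g \<cdot> k)) \<and> u \<cdot> k = g \<cdot> k"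
    using * k gh(1-5) by (simp add: is_cokernel_def)
  then show "g = h" using gh k by (auto simp: Hom_iff is_cokernel_def)
qed (auto simp: is_cokernel_def)

lemma kernelD:
  assumes "is_kernel C f k"
  shows "f \<in> arr C" "is_mono C k" "tgt C k = src C f" "f \<cdot> k = zero_arr C (src C k) (tgt C f)"
  using kernel_mono[OF assms] assms by (auto simp: is_kernel_def)

lemma cokernelD:
  assumes "is_cokernel C f q"
  shows "f \<in> arr C" "is_epi C q" "src C q = tgt C f" "q \<cdot> f = zero_arr C (src C f) (tgt C q)"
  using cokernel_epi[OF assms] assms by (auto simp: is_cokernel_def)

lemma kernel_factor:
  assumes "is_kernel C f k" "h \<in> arr C" "tgt C h = src C f" "f \<cdot> h = zero_arr C (src C h) (tgt C f)"
  obtains u where "u \<in> arr C" "src C u = src C h" "tgt C u = src C k" "k \<cdot> u = h"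
proof -
  have "\<exists>!u. u \<in> Hom C (src C h) (src C k) \<and> k \<cdot> u = h"
    using assms unfolding is_kernel_def by blast
  then show ?thesis using that by (auto simp: Hom_iff)
qed

lemma cokernel_factor:
  assumes "is_cokernel C f q" "h \<in> arr C" "src C h = tgt C f" "h \<cdot> f = zero_arr C (src C f) (tgt C h)"
  obtains u where "u \<in> arr C" "src C u = tgt C q" "tgt C u = tgt C h" "u \<cdot> q = h"
proof -
  have "\<exists>!u. u \<in> Hom C (tgt C q) (tgt C h) \<and> u \<cdot> q = h"
    using assms unfolding is_cokernel_def by blast
  then show ?thesis using that by (auto simp: Hom_iff)
qed

text \<open>For a mono the factorization is automatically unique, so only its existence remains to
  be checked.\<close>

lemma kernelI:
  assumes "is_mono C k" "f \<in> arr C" "tgt C k = src C f" "f \<cdot> k = zero_arr C (src C k) (tgt C f)"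
    and fac: "\<And>h. \<lbrakk>h \<in> arr C; tgt C h = src C f; f \<cdot> h = zero_arr C (src C h) (tgt C f)\<rbrakk>
      \<Longrightarrow> \<exists>u\<in>arr C. tgt C u = src C k \<and> k \<cdot> u = h"
  shows "is_kernel C f k"
  unfolding is_kernel_def
proof (intro conjI ballI impI)
  fix h assume h: "h \<in> arr C" "tgt C h = src C f \<and> f \<cdot> h = zero_arr C (src C h) (tgt C f)"
  then obtain u where u: "u \<in> arr C" "tgt C u = src C k" "k \<cdot> u = h" using fac by blast
  then have "src C u = src C h" using assms(1) by auto
  with u show "\<exists>!u. u \<in> Hom C (src C h) (src C k) \<and> k \<cdot> u = h"
    by (intro ex1I[of _ u]) (auto simp: Hom_iff intro: monoD[OF assms(1)])
qed (use assms in auto)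

lemma cokernelI:
  assumes "is_epi C q" "f \<in> arr C" "src C q = tgt C f" "q \<cdot> f = zero_arr C (src C f) (tgt C q)"
    and fac: "\<And>h. \<lbrakk>h \<in> arr C; src C h = tgt C f; h \<cdot> f = zero_arr C (src C f) (tgt C h)\<rbrakk>
      \<Longrightarrow> \<exists>u\<in>arr C. src C u = tgt C q \<and> u \<cdot> q = h"
  shows "is_cokernel C f q"
  unfolding is_cokernel_def
proof (intro conjI ballI impI)
  fix h assume h: "h \<in> arr C" "src C h = tgt C f \<and> h \<cdot> f = zero_arr C (src C f) (tgt C h)"
  then obtain u where u: "u \<in> arr C" "src C u = tgt C q" "u \<cdot> q = h" using fac by blast
  then have "tgt C u = tgt C h" using assms(1) by auto
  with u show "\<exists>!u. u \<in> Hom C (tgt C q) (tgt C h) \<and> u \<cdot> q = h"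
    by (intro ex1I[of _ u]) (auto simp: Hom_iff intro: epiD[OF assms(1)])
qed (use assms in auto)

lemma zero_object_iff:
  assumes "A \<in> obj C"
  shows "zero_object C A \<longleftrightarrow> ident C A = zero_arr C A A"
proof
  assume "zero_object C A"
  then have "\<exists>!f. f \<in> Hom C A A" using assms by (auto simp: zero_object_def)
  moreover have "ident C A \<in> Hom C A A" "zero_arr C A A \<in> Hom C A A"
    using assms by (auto simp: Hom_iff)
  ultimately show "ident C A = zero_arr C A A" by blast
next
  assume *: "ident C A = zero_arr C A A"
  have "f = zero_arr C A B" if "f \<in> Hom C A B" for f B
    using that assms cmp_ident(1)[of f A] unfolding * by (auto simp: Hom_iff)
  moreover have "f = zero_arr C B A" if "f \<in> Hom C B A" for f B
    using that assms cmp_ident(2)[of f A] unfolding * by (auto simp: Hom_iff)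
  ultimately show "zero_object C A" unfolding zero_object_def using assms
    by (metis Hom_iff zero_typing)
qed

lemma zero_object_zero_arr:
  "\<lbrakk>zero_object C (src C f); f \<in> arr C\<rbrakk> \<Longrightarrow> f = zero_arr C (src C f) (tgt C f)"
  "\<lbrakk>zero_object C (tgt C f); f \<in> arr C\<rbrakk> \<Longrightarrow> f = zero_arr C (src C f) (tgt C f)"
  unfolding zero_object_def by (metis Hom_iff src_obj tgt_obj zero_typing)+

lemma iso_nonzero: 
  assumes "is_iso C f" "\<not> zero_object C (src C f)" shows "f \<noteq> zero_arr C (src C f) (tgt C f)"
proof
  assume f: "f = zero_arr C (src C f) (tgt C f)"
  have "inv_arr C f \<cdot> f = inv_arr C f \<cdot> zero_arr C (src C f) (tgt C f)"
    by (rule arg_cong[OF f])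
  then show False using assms zero_object_iff[of "src C f"] by simp
qed

end

section \<open>Images, short exact sequences and simple objects\<close>

context abelian_category
begin

text \<open>A mono is the kernel of some \<open>g\<close>; if it is epi as well, then
  \<open>g = 0\<close>, so the identity factors through it.\<close>

lemma mono_epi_iso:
  assumes "is_mono C f" "is_epi C f" shows "is_iso C f"
proof -
  obtain g where g: "is_kernel C g f" using mono_normal[OF assms(1)] by blast
  then have gf: "g \<in> arr C" "src C g = tgt C f" "g \<cdot> f = zero_arr C (src C f) (tgt C g)"
    by (auto simp: is_kernel_def)
  then have "g = zero_arr C (tgt C f) (tgt C g)" using assms(2) epi_iff_zero by blast
  then have "g \<cdot> ident C (tgt C f) = zero_arr C (tgt C f) (tgt C g)" using gf by simp
  with gf assms obtain r where "r \<in> arr C" "src C r = tgt C f" "tgt C r = src C f"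
    "f \<cdot> r = ident C (tgt C f)"
    using kernel_factor[OF g, of "ident C (tgt C f)"] by auto
  then show ?thesis using mono_split_epi_iso[OF assms(1)] by blast
qed

text \<open>The mono part is the kernel of the cokernel of \<open>f\<close>; the content is that the
  remaining factor \<open>p\<close> is epi.\<close>

lemma epi_mono_factorization:
  assumes f: "f \<in> arr C"
  obtains p m where "is_epi C p" "is_mono C m" "src C p = src C f" "tgt C m = tgt C f"
    "tgt C p = src C m" "m \<cdot> p = f"
proof -
  obtain q where q: "is_cokernel C f q" using ex_cokernel[OF f] by blast
  then have q': "q \<in> arr C" "src C q = tgt C f" "q \<cdot> f = zero_arr C (src C f) (tgt C q)"
    by (auto simp: is_cokernel_def)
  obtain m where m: "is_kernel C q m" using ex_kernel q' by blast
  then have m': "is_mono C m" "tgt C m = tgt C f" "q \<cdot> m = zero_arr C (src C m) (tgt C q)"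
    using kernelD[OF m] q' by auto
  obtain p where p: "p \<in> arr C" "src C p = src C f" "tgt C p = src C m" "m \<cdot> p = f"
    using kernel_factor[OF m f] q' by auto
  have "is_epi C p"
    unfolding epi_iff_zero
  proof (intro conjI ballI impI)
    fix c assume c: "c \<in> arr C" and c': "src C c = tgt C p \<and> c \<cdot> p = zero_arr C (src C p) (tgt C c)"
    \<comment> \<open>To get \<open>c = 0\<close>, the kernel \<open>e\<close> of \<open>c\<close>
      is shown to have a right inverse. Since \<open>p\<close> factors through \<open>e\<close>, the
      arrow \<open>f\<close> factors through the subobject \<open>m \<cdot> e\<close>, which is
      itself the kernel of some \<open>g\<close>.\<close>
    obtain e where e: "is_kernel C c e" using ex_kernel c by blast
    note e' = kernelD(2-)[OF e]
    obtain p' where p': "p' \<in> arr C" "src C p' = src C p" "tgt C p' = src C e" "e \<cdot> p' = p"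
      using kernel_factor[OF e p(1)] c' by auto
    have "is_mono C (m \<cdot> e)" using m' e' c' p by (intro mono_cmp) auto
    then obtain g where g: "is_kernel C g (m \<cdot> e)" using mono_normal by blast
    then have g': "g \<in> arr C" "src C g = tgt C f" "g \<cdot> (m \<cdot> e) = zero_arr C (src C e) (tgt C g)"
      using m' e' c' p by (auto simp: is_kernel_def)
    have "(g \<cdot> (m \<cdot> e)) \<cdot> p' = g \<cdot> f" using g'(1,2) m'(1,2) e'(1,2) p' c' p by simp
    moreover have "(g \<cdot> (m \<cdot> e)) \<cdot> p' = zero_arr C (src C f) (tgt C g)"
      using g' p'(1-3) p(1-3) e'(1,2) by simp
    ultimately have "g \<cdot> f = zero_arr C (src C f) (tgt C g)" by simp
    \<comment> \<open>\<open>g\<close> kills \<open>f\<close>, so it factors through the cokernel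
      \<open>q\<close> of \<open>f\<close> and kills \<open>m\<close> too; hence \<open>m\<close>
      factors through \<open>m \<cdot> e\<close>.\<close>
    then obtain x where x: "x \<in> arr C" "src C x = tgt C q" "tgt C x = tgt C g" "x \<cdot> q = g"
      using cokernel_factor[OF q, of g] g' by auto
    have "g \<cdot> m = x \<cdot> (q \<cdot> m)" using x q' m' by auto
    then have "g \<cdot> m = zero_arr C (src C m) (tgt C g)" using x m' by simp
    then obtain y where y: "y \<in> arr C" "src C y = src C m" "tgt C y = src C e" "(m \<cdot> e) \<cdot> y = m"
      using kernel_factor[OF g, of m] g' m' e' c' p by auto
    have "m \<cdot> (e \<cdot> y) = m \<cdot> ident C (src C m)" using y m' e' c' p by simp
    then have "e \<cdot> y = ident C (src C m)" using y e' c' p m' by - (rule monoD[OF m'(1)], auto)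
    then have "(c \<cdot> e) \<cdot> y = c" using c c' e'(1,2) y(1-3) p(1-3) by simp
    moreover have "(c \<cdot> e) \<cdot> y = zero_arr C (tgt C p) (tgt C c)"
      using c e' y(1-3) p(1-3) by simp
    ultimately show "c = zero_arr C (tgt C p) (tgt C c)" by (rule trans[OF sym])
  qed (use p in auto)
  then show ?thesis using that p m' by blast
qed

text \<open>The mono is the kernel of some \<open>g\<close>, and \<open>g\<close> factors through
  the cokernel \<open>q\<close>; whatever \<open>q\<close> kills is therefore killed by
  \<open>g\<close>.\<close>

lemma mono_kernel_of_cokernel:
  assumes m: "is_mono C m" and q: "is_cokernel C m q"
  shows "is_kernel C q m"
proof -
  obtain g where g: "is_kernel C g m" using mono_normal m by blast
  have gm: "g \<in> arr C" "tgt C m = src C g" "g \<cdot> m = zero_arr C (src C m) (tgt C g)"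
    using g by (auto simp: is_kernel_def)
  have qm: "q \<in> arr C" "src C q = tgt C m" "q \<cdot> m = zero_arr C (src C m) (tgt C q)"
    using q by (auto simp: is_cokernel_def)
  obtain u where u: "u \<in> arr C" "src C u = tgt C q" "tgt C u = tgt C g" "u \<cdot> q = g"
    using cokernel_factor[OF q, of g] gm by auto
  show ?thesis
  proof (rule kernelI[OF m])
    fix h assume h: "h \<in> arr C" "tgt C h = src C q" "q \<cdot> h = zero_arr C (src C h) (tgt C q)"
    have "g \<cdot> h = u \<cdot> (q \<cdot> h)" using u h qm by auto
    then have "g \<cdot> h = zero_arr C (src C h) (tgt C g)" using u h by simp
    then show "\<exists>u\<in>arr C. tgt C u = src C m \<and> m \<cdot> u = h"
      using kernel_factor[OF g, of h] h qm gm by metis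
  qed (use qm in auto)
qed

lemma epi_cokernel_of_kernel:
  assumes m: "is_epi C m" and q: "is_kernel C m q"
  shows "is_cokernel C q m"
proof -
  obtain g where g: "is_cokernel C g m" using epi_conormal m by blast
  have gm: "g \<in> arr C" "src C m = tgt C g" "m \<cdot> g = zero_arr C (src C g) (tgt C m)"
    using g by (auto simp: is_cokernel_def)
  have qm: "q \<in> arr C" "tgt C q = src C m" "m \<cdot> q = zero_arr C (src C q) (tgt C m)"
    using q by (auto simp: is_kernel_def)
  obtain u where u: "u \<in> arr C" "tgt C u = src C q" "src C u = src C g" "q \<cdot> u = g"
    using kernel_factor[OF q, of g] gm by auto
  show ?thesis
  proof (rule cokernelI[OF m])
    fix h assume h: "h \<in> arr C" "src C h = tgt C q" "h \<cdot> q = zero_arr C (src C q) (tgt C h)"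
    have "h \<cdot> g = (h \<cdot> q) \<cdot> u" using u h(1,2) qm by auto
    then have "h \<cdot> g = zero_arr C (src C g) (tgt C h)" using u h by simp
    then show "\<exists>u\<in>arr C. src C u = tgt C m \<and> u \<cdot> m = h"
      using cokernel_factor[OF g, of h] h qm gm by metis
  qed (use qm in auto)
qed

lemma mono_short_exact:
  assumes "is_mono C m" obtains q where "short_exact C m q"
  using ex_cokernel[of m] mono_kernel_of_cokernel[OF assms] assms by (auto simp: short_exact_def)

lemma epi_short_exact:
  assumes "is_epi C q" obtains k where "short_exact C k q"
  using ex_kernel[of q] epi_cokernel_of_kernel[OF assms] assms by (auto simp: short_exact_def)

lemma simple_objectD:
  assumes "simple_object C S"
  shows "S \<in> obj C" "\<not> zero_object C S"
    "\<And>f. \<lbrakk>is_mono C f; tgt C f = S; \<not> is_iso C f\<rbrakk> \<Longrightarrow> zero_object C (src C f)"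
  using assms by (auto simp: simple_object_def)

text \<open>The image is a nonzero subobject of a simple object, hence all of it.\<close>

lemma nonzero_into_simple_epi:
  assumes S: "simple_object C (tgt C f)" and f: "f \<in> arr C" "f \<noteq> zero_arr C (src C f) (tgt C f)"
  shows "is_epi C f"
proof -
  obtain p m where pm: "is_epi C p" "is_mono C m" "src C p = src C f" "tgt C m = tgt C f"
    "tgt C p = src C m" "m \<cdot> p = f"
    using epi_mono_factorization[OF f(1)] by blast
  have "\<not> zero_object C (src C m)"
  proof
    assume "zero_object C (src C m)"
    then have "m = zero_arr C (src C m) (tgt C m)" using pm by (intro zero_object_zero_arr(1)) auto
    from arg_cong[OF this, of "\<lambda>x. x \<cdot> p"] show False using pm f by simp
  qed
  then have "is_iso C m" using simple_objectD(3)[OF S pm(2,4)] by blast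
  then have "is_epi C (m \<cdot> p)" using pm iso_epi by (intro epi_cmp) auto
  then show ?thesis using pm by simp
qed

lemma nonzero_from_simple_mono:
  assumes S: "simple_object C (src C f)" and f: "f \<in> arr C" "f \<noteq> zero_arr C (src C f) (tgt C f)"
  shows "is_mono C f"
proof -
  obtain k where k: "is_kernel C f k" using ex_kernel f by blast
  note k' = kernelD(2-)[OF k]
  have "\<not> is_iso C k"
  proof
    assume i: "is_iso C k"
    then have "(f \<cdot> k) \<cdot> inv_arr C k = f" using f k'(1,2) by simp
    moreover have "(f \<cdot> k) \<cdot> inv_arr C k = zero_arr C (src C f) (tgt C f)" using f k' i by simp
    ultimately have "f = zero_arr C (src C f) (tgt C f)" by (rule trans[OF sym])
    then show False using f(2) by contradiction
  qed
  then have z: "zero_object C (src C k)" using simple_objectD(3)[OF S k'(1,2)] by blast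
  show ?thesis unfolding mono_iff_zero
  proof (intro conjI ballI impI)
    fix g assume g: "g \<in> arr C" "tgt C g = src C f \<and> f \<cdot> g = zero_arr C (src C g) (tgt C f)"
    obtain u where u: "u \<in> arr C" "src C u = src C g" "tgt C u = src C k" "k \<cdot> u = g"
      using kernel_factor[OF k, of g] g by auto
    have "k = zero_arr C (src C k) (tgt C k)" using zero_object_zero_arr(1)[OF z] k' mono_arr by blast
    then have "k \<cdot> u = zero_arr C (src C k) (tgt C k) \<cdot> u" by (rule arg_cong)
    also have "\<dots> = zero_arr C (src C g) (src C f)" using u(1-3) f(1) k'(1,2) by simp
    finally show "g = zero_arr C (src C g) (src C f)" unfolding u(4) .
  qed (use f in auto)
qed

lemma nonzero_between_simples_iso:
  "\<lbrakk>simple_object C (src C f); simple_object C (tgt C f); f \<in> arr C;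
    f \<noteq> zero_arr C (src C f) (tgt C f)\<rbrakk> \<Longrightarrow> is_iso C f"
  using nonzero_from_simple_mono nonzero_into_simple_epi mono_epi_iso by blast

end

section \<open>Rigid monoidal categories acting on linear categories\<close>

context linear_monoidal_category
begin

declare unit_obj [simp] tens_obj [simp] tens_ident [simp]

lemma tens_typing [simp]:
  assumes "f \<in> arr C" "g \<in> arr C"
  shows "f \<otimes>\<^sub>m g \<in> arr C" "src C (f \<otimes>\<^sub>m g) = src C f \<otimes>\<^sub>o src C g"
    "tgt C (f \<otimes>\<^sub>m g) = tgt C f \<otimes>\<^sub>o tgt C g"
  using tens_arr[of f "src C f" "tgt C f" g "src C g" "tgt C g"] assms by (auto simp: Hom_iff)

text \<open>Oriented so that composites of tensor products merge into one. Where factors have to be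
  regrouped instead, this rule or its counterpart for actions is removed from the simpset.\<close>

lemma interchange [simp]:
  assumes "f \<in> arr C" "f' \<in> arr C" "g \<in> arr C" "g' \<in> arr C" "tgt C f = src C f'" "tgt C g = src C g'"
  shows "(f' \<otimes>\<^sub>m g') \<cdot> (f \<otimes>\<^sub>m g) = (f' \<cdot> f) \<otimes>\<^sub>m (g' \<cdot> g)"
  using tens_cmp[of f "src C f" "tgt C f" f' "tgt C f'" g "src C g" "tgt C g" g' "tgt C g'"] assms
  by (auto simp: Hom_iff)

lemma interchange' [simp]:
  assumes "f \<in> arr C" "f' \<in> arr C" "g \<in> arr C" "g' \<in> arr C" "tgt C f = src C f'" "tgt C g = src C g'"
    "x \<in> arr C" "tgt C x = src C f \<otimes>\<^sub>o src C g"
  shows "(f' \<otimes>\<^sub>m g') \<cdot> ((f \<otimes>\<^sub>m g) \<cdot> x) = ((f' \<cdot> f) \<otimes>\<^sub>m (g' \<cdot> g)) \<cdot> x"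
  using assms by (simp flip: cmp_assoc_arr)

lemma tens_iso [simp]:
  assumes "is_iso C f" "is_iso C g"
  shows "is_iso C (f \<otimes>\<^sub>m g)" "inv_arr C (f \<otimes>\<^sub>m g) = inv_arr C f \<otimes>\<^sub>m inv_arr C g"
  using assms isoI[of "f \<otimes>\<^sub>m g" "inv_arr C f \<otimes>\<^sub>m inv_arr C g"] by auto

lemma assoc_iso [simp]:
  assumes "X \<in> obj C" "Y \<in> obj C" "Z \<in> obj C"
  shows "is_iso C (associator C X Y Z)" "associator C X Y Z \<in> arr C"
    "src C (associator C X Y Z) = (X \<otimes>\<^sub>o Y) \<otimes>\<^sub>o Z" "tgt C (associator C X Y Z) = X \<otimes>\<^sub>o (Y \<otimes>\<^sub>o Z)"
  using associator_Iso[OF assms] by (auto simp: Iso_def Hom_iff)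

lemma lunitor_iso [simp]:
  assumes "X \<in> obj C"
  shows "is_iso C (lunitor C X)" "lunitor C X \<in> arr C" "src C (lunitor C X) =
        \<I> \<otimes>\<^sub>o X" "tgt C (lunitor C X) = X"
  using lunitor_Iso[OF assms] by (auto simp: Iso_def Hom_iff)

lemma runitor_iso [simp]:
  assumes "X \<in> obj C"
  shows "is_iso C (runitor C X)" "runitor C X \<in> arr C" "src C (runitor C X) =
        X \<otimes>\<^sub>o \<I>" "tgt C (runitor C X) = X"
  using runitor_Iso[OF assms] by (auto simp: Iso_def Hom_iff)

lemma lunitor_nat: "f \<in> arr C \<Longrightarrow> lunitor C (tgt C f) \<cdot> (ident C \<I> \<otimes>\<^sub>m f) = f \<cdot> lunitor C (src C f)"
  using lunitor_natural[of f "src C f" "tgt C f"] by (simp add: Hom_iff)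

lemma runitor_nat: "f \<in> arr C \<Longrightarrow> runitor C (tgt C f) \<cdot> (f \<otimes>\<^sub>m ident C \<I>) = f \<cdot> runitor C (src C f)"
  using runitor_natural[of f "src C f" "tgt C f"] by (simp add: Hom_iff)

lemma assoc_nat:
  "\<lbrakk>f \<in> arr C; g \<in> arr C; h \<in> arr C\<rbrakk> \<Longrightarrow>
    associator C (tgt C f) (tgt C g) (tgt C h) \<cdot> ((f \<otimes>\<^sub>m g) \<otimes>\<^sub>m h) =
    (f \<otimes>\<^sub>m (g \<otimes>\<^sub>m h)) \<cdot> associator C (src C f) (src C g) (src C h)"
  using associator_natural[of f "src C f" "tgt C f" g "src C g" "tgt C g" h "src C h" "tgt C h"]
  by (simp add: Hom_iff)

lemma linear_map_tens_left:
  "\<lbrakk>h \<in> arr C; src C h = X; tgt C h = X'; A \<in> obj C; B \<in> obj C\<rbrakk>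
    \<Longrightarrow> linear_map (hom_space C A B) (hom_space C (X \<otimes>\<^sub>o A) (X' \<otimes>\<^sub>o B)) (\<lambda>f. h \<otimes>\<^sub>m f)"
  using tens_add_right[of h X X'] tens_scale_right[of h X X'] by (auto simp: linear_map_def Hom_iff)

lemma linear_map_tens_right:
  "\<lbrakk>h \<in> arr C; src C h = X; tgt C h = X'; A \<in> obj C; B \<in> obj C\<rbrakk>
    \<Longrightarrow> linear_map (hom_space C A B) (hom_space C (A \<otimes>\<^sub>o X) (B \<otimes>\<^sub>o X')) (\<lambda>f. f \<otimes>\<^sub>m h)"
  using tens_add_left[of _ _ _ _ h X X'] tens_scale_left[of _ _ _ h X X']
  by (auto simp: linear_map_def Hom_iff)

lemma tens_scale [simp]:
  "\<lbrakk>f \<in> arr C; g \<in> arr C\<rbrakk> \<Longrightarrow> scale_arr C a f \<otimes>\<^sub>m g = scale_arr C a (f \<otimes>\<^sub>m g)"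
  "\<lbrakk>f \<in> arr C; g \<in> arr C\<rbrakk> \<Longrightarrow> f \<otimes>\<^sub>m scale_arr C a g = scale_arr C a (f \<otimes>\<^sub>m g)"
  using tens_scale_left[of f "src C f" "tgt C f" g "src C g" "tgt C g"]
    tens_scale_right[of f "src C f" "tgt C f" g "src C g" "tgt C g"] by (auto simp: Hom_iff)

lemma tens_zero [simp]:
  "\<lbrakk>g \<in> arr C; A \<in> obj C; B \<in> obj C\<rbrakk>
    \<Longrightarrow> zero_arr C A B \<otimes>\<^sub>m g = zero_arr C (A \<otimes>\<^sub>o src C g) (B \<otimes>\<^sub>o tgt C g)"
  "\<lbrakk>g \<in> arr C; A \<in> obj C; B \<in> obj C\<rbrakk>
    \<Longrightarrow> g \<otimes>\<^sub>m zero_arr C A B = zero_arr C (src C g \<otimes>\<^sub>o A) (tgt C g \<otimes>\<^sub>o B)"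
  using tens_scale(1)[of "zero_arr C A B" g 0] tens_scale(2)[of g "zero_arr C A B" 0] by auto

lemma tens_sub_left:
  "\<lbrakk>f \<in> arr C; f' \<in> arr C; g \<in> arr C; src C f = src C f'; tgt C f = tgt C f'\<rbrakk>
    \<Longrightarrow> sub_arr C f f' \<otimes>\<^sub>m g = sub_arr C (f \<otimes>\<^sub>m g) (f' \<otimes>\<^sub>m g)"
  using tens_add_left[of f "src C f" "tgt C f" "scale_arr C (- 1) f'" g "src C g" "tgt C g"]
  by (simp add: sub_arr_def Hom_iff)

lemma is_left_dualD:
  assumes "is_left_dual C X D ev coev" "X \<in> obj C"
  shows "D \<in> obj C" "ev \<in> arr C" "src C ev = D \<otimes>\<^sub>o X" "tgt C ev = \<I>"
    "coev \<in> arr C" "src C coev = \<I>" "tgt C coev = X \<otimes>\<^sub>o D"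
  using assms by (auto simp: is_left_dual_def Hom_iff)

end

text \<open>Collects what the duality adjunction needs of an action, stated for arrows rather than
  Hom-sets. Both the module category and \<open>C\<close> acting on itself are instances, so each
  adjunction argument is made once.\<close>

locale lin_action =
  C?: linear_monoidal_category C + M: linear_category M
  for C :: "('o, 'm, 'k :: field, 'z) moncat_scheme" (structure)
    and M :: "('o, 'm, 'p, 'q, 'k, 'y) modcat_scheme" (structure) +
  assumes act_obj_closed [simp]: "\<lbrakk>X \<in> obj C; A \<in> obj M\<rbrakk> \<Longrightarrow> X \<rhd>\<^sub>o\<^bsub>M\<^esub> A \<in> obj M"
    and act_typing [simp]:
      "\<lbrakk>f \<in> arr C; g \<in> arr M\<rbrakk> \<Longrightarrow> f \<rhd>\<^sub>m\<^bsub>M\<^esub> g \<in> arr M"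
      "\<lbrakk>f \<in> arr C; g \<in> arr M\<rbrakk> \<Longrightarrow> src M (f \<rhd>\<^sub>m\<^bsub>M\<^esub> g) = src C f \<rhd>\<^sub>o\<^bsub>M\<^esub> src M g"
      "\<lbrakk>f \<in> arr C; g \<in> arr M\<rbrakk> \<Longrightarrow> tgt M (f \<rhd>\<^sub>m\<^bsub>M\<^esub> g) = tgt C f \<rhd>\<^sub>o\<^bsub>M\<^esub> tgt M g"
    and act_ident_ident [simp]:
      "\<lbrakk>X \<in> obj C; A \<in> obj M\<rbrakk> \<Longrightarrow> ident C X \<rhd>\<^sub>m\<^bsub>M\<^esub> ident M A = ident M (X \<rhd>\<^sub>o\<^bsub>M\<^esub> A)"
    and act_interchange [simp]:
      "\<lbrakk>f \<in> arr C; f' \<in> arr C; g \<in> arr M; g' \<in> arr M; tgt C f = src C f'; tgt M g = src M g'\<rbrakk>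
        \<Longrightarrow> (f' \<rhd>\<^sub>m\<^bsub>M\<^esub> g') \<cdot>\<^bsub>M\<^esub> (f \<rhd>\<^sub>m\<^bsub>M\<^esub> g) = (f' \<cdot>\<^bsub>C\<^esub> f) \<rhd>\<^sub>m\<^bsub>M\<^esub> (g' \<cdot>\<^bsub>M\<^esub> g)"
    and act_scale_right_arr [simp]:
      "\<lbrakk>f \<in> arr C; g \<in> arr M\<rbrakk> \<Longrightarrow> f \<rhd>\<^sub>m\<^bsub>M\<^esub> scale_arr M a g = scale_arr M a (f \<rhd>\<^sub>m\<^bsub>M\<^esub> g)"
    and massoc_iso [simp]:
      "\<lbrakk>X \<in> obj C; Y \<in> obj C; A \<in> obj M\<rbrakk> \<Longrightarrow> is_iso M (massociator M X Y A)"
      "\<lbrakk>X \<in> obj C; Y \<in> obj C; A \<in> obj M\<rbrakk>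
        \<Longrightarrow> src M (massociator M X Y A) = (X \<otimes>\<^sub>o\<^bsub>C\<^esub> Y) \<rhd>\<^sub>o\<^bsub>M\<^esub> A"
      "\<lbrakk>X \<in> obj C; Y \<in> obj C; A \<in> obj M\<rbrakk>
        \<Longrightarrow> tgt M (massociator M X Y A) = X \<rhd>\<^sub>o\<^bsub>M\<^esub> (Y \<rhd>\<^sub>o\<^bsub>M\<^esub> A)"
    and massoc_nat:
      "\<lbrakk>f \<in> arr C; h \<in> arr C; g \<in> arr M\<rbrakk>
        \<Longrightarrow> massociator M (tgt C f) (tgt C h) (tgt M g) \<cdot>\<^bsub>M\<^esub> ((f \<otimes>\<^sub>m\<^bsub>C\<^esub> h) \<rhd>\<^sub>m\<^bsub>M\<^esub> g) =
            (f \<rhd>\<^sub>m\<^bsub>M\<^esub> (h \<rhd>\<^sub>m\<^bsub>M\<^esub> g)) \<cdot>\<^bsub>M\<^esub> massociator M (src C f) (src C h) (src M g)"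
    and munit_iso [simp]:
      "A \<in> obj M \<Longrightarrow> is_iso M (munitor M A)"
      "A \<in> obj M \<Longrightarrow> src M (munitor M A) = \<I>\<^bsub>C\<^esub> \<rhd>\<^sub>o\<^bsub>M\<^esub> A"
      "A \<in> obj M \<Longrightarrow> tgt M (munitor M A) = A"
    and munit_nat:
      "g \<in> arr M
        \<Longrightarrow> munitor M (tgt M g) \<cdot>\<^bsub>M\<^esub> (ident C \<I>\<^bsub>C\<^esub> \<rhd>\<^sub>m\<^bsub>M\<^esub> g) = g \<cdot>\<^bsub>M\<^esub> munitor M (src M g)"
    and act_pentagon:
      "\<lbrakk>X \<in> obj C; Y \<in> obj C; Z \<in> obj C; A \<in> obj M\<rbrakk>
        \<Longrightarrow> massociator M X Y (Z \<rhd>\<^sub>o\<^bsub>M\<^esub> A) \<cdot>\<^bsub>M\<^esub> massociator M (X \<otimes>\<^sub>o\<^bsub>C\<^esub> Y) Z A =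
            (ident C X \<rhd>\<^sub>m\<^bsub>M\<^esub> massociator M Y Z A) \<cdot>\<^bsub>M\<^esub> massociator M X (Y \<otimes>\<^sub>o\<^bsub>C\<^esub> Z) A \<cdot>\<^bsub>M\<^esub>
            (associator C X Y Z \<rhd>\<^sub>m\<^bsub>M\<^esub> ident M A)"
    and act_triangle:
      "\<lbrakk>X \<in> obj C; A \<in> obj M\<rbrakk>
        \<Longrightarrow> (ident C X \<rhd>\<^sub>m\<^bsub>M\<^esub> munitor M A) \<cdot>\<^bsub>M\<^esub> massociator M X \<I>\<^bsub>C\<^esub> A =
            runitor C X \<rhd>\<^sub>m\<^bsub>M\<^esub> ident M A"
begin

lemma act_interchange' [simp]:
  assumes "f \<in> arr C" "f' \<in> arr C" "g \<in> arr M" "g' \<in> arr M" "tgt C f = src C f'" "tgt M g = src M g'"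
    "x \<in> arr M" "tgt M x = src C f \<rhd>\<^sub>o\<^bsub>M\<^esub> src M g"
  shows "(f' \<rhd>\<^sub>m\<^bsub>M\<^esub> g') \<cdot>\<^bsub>M\<^esub> ((f \<rhd>\<^sub>m\<^bsub>M\<^esub> g) \<cdot>\<^bsub>M\<^esub> x) = ((f' \<cdot>\<^bsub>C\<^esub> f) \<rhd>\<^sub>m\<^bsub>M\<^esub> (g' \<cdot>\<^bsub>M\<^esub> g)) \<cdot>\<^bsub>M\<^esub> x"
  using assms by (simp flip: M.cmp_assoc_arr)

lemma act_iso [simp]:
  assumes "is_iso C f" "is_iso M g"
  shows "is_iso M (f \<rhd>\<^sub>m\<^bsub>M\<^esub> g)" "inv_arr M (f \<rhd>\<^sub>m\<^bsub>M\<^esub> g) = inv_arr C f \<rhd>\<^sub>m\<^bsub>M\<^esub> inv_arr M g"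
  using assms M.isoI[of "f \<rhd>\<^sub>m\<^bsub>M\<^esub> g" "inv_arr C f \<rhd>\<^sub>m\<^bsub>M\<^esub> inv_arr M g"] by auto

lemma act_zero [simp]:
  "\<lbrakk>f \<in> arr C; A \<in> obj M; B \<in> obj M\<rbrakk>
    \<Longrightarrow> f \<rhd>\<^sub>m\<^bsub>M\<^esub> zero_arr M A B = zero_arr M (src C f \<rhd>\<^sub>o\<^bsub>M\<^esub> A) (tgt C f \<rhd>\<^sub>o\<^bsub>M\<^esub> B)"
  using act_scale_right_arr[of f "zero_arr M A B" 0] by auto

text \<open>Acting with the unit object is naturally isomorphic to the identity functor. Kelly's
  argument proves its equation after this functor has been applied.\<close>

lemma unit_act_faithful:
  assumes "f \<in> arr M" "g \<in> arr M" "src M f = src M g" "tgt M f = tgt M g"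
    "ident C \<I>\<^bsub>C\<^esub> \<rhd>\<^sub>m\<^bsub>M\<^esub> f = ident C \<I>\<^bsub>C\<^esub> \<rhd>\<^sub>m\<^bsub>M\<^esub> g"
  shows "f = g"
proof -
  have "f \<cdot>\<^bsub>M\<^esub> munitor M (src M g) = g \<cdot>\<^bsub>M\<^esub> munitor M (src M g)"
    using munit_nat[of f] munit_nat[of g] assms by simp
  then show ?thesis using assms by - (rule M.epiD[OF M.iso_epi[OF munit_iso(1)[of "src M g"]]], auto)
qed

text \<open>Kelly's argument: this coherence follows from the pentagon and triangle axioms.\<close>

lemma munit_massoc:
  assumes [simp]: "X \<in> obj C" "A \<in> obj M"
  shows "munitor M (X \<rhd>\<^sub>o\<^bsub>M\<^esub> A) \<cdot>\<^bsub>M\<^esub> massociator M \<I>\<^bsub>C\<^esub> X A = lunitor C X \<rhd>\<^sub>m\<^bsub>M\<^esub> ident M A"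
proof (rule unit_act_faithful)
  let ?i = "ident C \<I>\<^bsub>C\<^esub>" and ?m = "munitor M (X \<rhd>\<^sub>o\<^bsub>M\<^esub> A)"
  let ?b = "massociator M \<I>\<^bsub>C\<^esub> (\<I>\<^bsub>C\<^esub> \<otimes>\<^sub>o\<^bsub>C\<^esub> X) A" and ?c = "associator C \<I>\<^bsub>C\<^esub> \<I>\<^bsub>C\<^esub> X \<rhd>\<^sub>m\<^bsub>M\<^esub> ident M A"
  let ?a = "massociator M \<I>\<^bsub>C\<^esub> X A" and ?d = "massociator M (\<I>\<^bsub>C\<^esub> \<otimes>\<^sub>o\<^bsub>C\<^esub> \<I>\<^bsub>C\<^esub>) X A"
  \<comment> \<open>After precomposition with the invertible \<open>?b\<close> and
    \<open>?c\<close>, the pentagon for \<open>\<I>, \<I>, X, A\<close> and the two triangle axioms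
    turn one side into the other.\<close>
  have "(?i \<rhd>\<^sub>m\<^bsub>M\<^esub> (?m \<cdot>\<^bsub>M\<^esub> ?a)) \<cdot>\<^bsub>M\<^esub> (?b \<cdot>\<^bsub>M\<^esub> ?c) =
        (?i \<rhd>\<^sub>m\<^bsub>M\<^esub> ?m) \<cdot>\<^bsub>M\<^esub> ((?i \<rhd>\<^sub>m\<^bsub>M\<^esub> ?a) \<cdot>\<^bsub>M\<^esub> ?b \<cdot>\<^bsub>M\<^esub> ?c)"
    by simp
  also have "\<dots> = (?i \<rhd>\<^sub>m\<^bsub>M\<^esub> ?m) \<cdot>\<^bsub>M\<^esub> (massociator M \<I>\<^bsub>C\<^esub> \<I>\<^bsub>C\<^esub> (X \<rhd>\<^sub>o\<^bsub>M\<^esub> A) \<cdot>\<^bsub>M\<^esub> ?d)"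
    by (simp only: act_pentagon[of "\<I>\<^bsub>C\<^esub>" "\<I>\<^bsub>C\<^esub>" X A] unit_obj assms)
  also have "\<dots> = (runitor C \<I>\<^bsub>C\<^esub> \<rhd>\<^sub>m\<^bsub>M\<^esub> (ident C X \<rhd>\<^sub>m\<^bsub>M\<^esub> ident M A)) \<cdot>\<^bsub>M\<^esub> ?d"
    using act_triangle[of "\<I>\<^bsub>C\<^esub>" "X \<rhd>\<^sub>o\<^bsub>M\<^esub> A"] by (simp flip: M.cmp_assoc_arr)
  also have "\<dots> = ?a \<cdot>\<^bsub>M\<^esub> ((runitor C \<I>\<^bsub>C\<^esub> \<otimes>\<^sub>m\<^bsub>C\<^esub> ident C X) \<rhd>\<^sub>m\<^bsub>M\<^esub> ident M A)"
    using massoc_nat[of "runitor C \<I>\<^bsub>C\<^esub>" "ident C X" "ident M A"] by simp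
  also have "\<dots> = ?a \<cdot>\<^bsub>M\<^esub> (((ident C \<I>\<^bsub>C\<^esub> \<otimes>\<^sub>m\<^bsub>C\<^esub> lunitor C X) \<rhd>\<^sub>m\<^bsub>M\<^esub> ident M A) \<cdot>\<^bsub>M\<^esub> ?c)"
    using triangle[of "\<I>\<^bsub>C\<^esub>" X] by simp
  also have "\<dots> = (?a \<cdot>\<^bsub>M\<^esub> ((ident C \<I>\<^bsub>C\<^esub> \<otimes>\<^sub>m\<^bsub>C\<^esub> lunitor C X) \<rhd>\<^sub>m\<^bsub>M\<^esub> ident M A)) \<cdot>\<^bsub>M\<^esub> ?c"
    by (simp del: act_interchange)
  also have "\<dots> = (?i \<rhd>\<^sub>m\<^bsub>M\<^esub> (lunitor C X \<rhd>\<^sub>m\<^bsub>M\<^esub> ident M A)) \<cdot>\<^bsub>M\<^esub> (?b \<cdot>\<^bsub>M\<^esub> ?c)"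
    using massoc_nat[of ?i "lunitor C X" "ident M A"] by simp
  finally have e: "(?i \<rhd>\<^sub>m\<^bsub>M\<^esub> (?m \<cdot>\<^bsub>M\<^esub> ?a)) \<cdot>\<^bsub>M\<^esub> (?b \<cdot>\<^bsub>M\<^esub> ?c) =
        (?i \<rhd>\<^sub>m\<^bsub>M\<^esub> (lunitor C X \<rhd>\<^sub>m\<^bsub>M\<^esub> ident M A)) \<cdot>\<^bsub>M\<^esub> (?b \<cdot>\<^bsub>M\<^esub> ?c)" .
  have "is_iso M (?b \<cdot>\<^bsub>M\<^esub> ?c)" by simp
  from M.epiD[OF M.iso_epi[OF this] e]
  show "?i \<rhd>\<^sub>m\<^bsub>M\<^esub> (?m \<cdot>\<^bsub>M\<^esub> ?a) = ?i \<rhd>\<^sub>m\<^bsub>M\<^esub> (lunitor C X \<rhd>\<^sub>m\<^bsub>M\<^esub> ident M A)" by simp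
qed simp_all

lemma massoc_inv_nat:
  assumes "f \<in> arr C" "h \<in> arr C" "g \<in> arr M"
  shows "inv_arr M (massociator M (tgt C f) (tgt C h) (tgt M g)) \<cdot>\<^bsub>M\<^esub> (f \<rhd>\<^sub>m\<^bsub>M\<^esub> (h \<rhd>\<^sub>m\<^bsub>M\<^esub> g)) =
    ((f \<otimes>\<^sub>m\<^bsub>C\<^esub> h) \<rhd>\<^sub>m\<^bsub>M\<^esub> g) \<cdot>\<^bsub>M\<^esub> inv_arr M (massociator M (src C f) (src C h) (src M g))"
proof -
  let ?a = "massociator M (tgt C f) (tgt C h) (tgt M g)"
      and ?b = "massociator M (src C f) (src C h) (src M g)"
  let ?l = "f \<rhd>\<^sub>m\<^bsub>M\<^esub> (h \<rhd>\<^sub>m\<^bsub>M\<^esub> g)" and ?r = "(f \<otimes>\<^sub>m\<^bsub>C\<^esub> h) \<rhd>\<^sub>m\<^bsub>M\<^esub> g"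
  have "inv_arr M ?a \<cdot>\<^bsub>M\<^esub> ?l = inv_arr M ?a \<cdot>\<^bsub>M\<^esub> (?l \<cdot>\<^bsub>M\<^esub> ?b) \<cdot>\<^bsub>M\<^esub> inv_arr M ?b" using assms by simp
  also have "\<dots> = inv_arr M ?a \<cdot>\<^bsub>M\<^esub> (?a \<cdot>\<^bsub>M\<^esub> ?r) \<cdot>\<^bsub>M\<^esub> inv_arr M ?b" using massoc_nat[OF assms] by simp
  also have "\<dots> = ?r \<cdot>\<^bsub>M\<^esub> inv_arr M ?b" using assms by simp
  finally show ?thesis .
qed

lemma munit_inv_nat:
  assumes "g \<in> arr M"
  shows "inv_arr M (munitor M (tgt M g)) \<cdot>\<^bsub>M\<^esub> g =
        (ident C \<I>\<^bsub>C\<^esub> \<rhd>\<^sub>m\<^bsub>M\<^esub> g) \<cdot>\<^bsub>M\<^esub> inv_arr M (munitor M (src M g))"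
proof -
  let ?a = "munitor M (tgt M g)" and ?b = "munitor M (src M g)" and ?l = "ident C \<I>\<^bsub>C\<^esub> \<rhd>\<^sub>m\<^bsub>M\<^esub> g"
  have "inv_arr M ?a \<cdot>\<^bsub>M\<^esub> g = inv_arr M ?a \<cdot>\<^bsub>M\<^esub> (g \<cdot>\<^bsub>M\<^esub> ?b) \<cdot>\<^bsub>M\<^esub> inv_arr M ?b" using assms by simp
  also have "\<dots> = inv_arr M ?a \<cdot>\<^bsub>M\<^esub> (?a \<cdot>\<^bsub>M\<^esub> ?l) \<cdot>\<^bsub>M\<^esub> inv_arr M ?b" using munit_nat[OF assms] by simp
  also have "\<dots> = ?l \<cdot>\<^bsub>M\<^esub> inv_arr M ?b" using assms by simp
  finally show ?thesis .
qed

text \<open>Unit of the adjunction in which acting with \<open>D\<close> is left adjoint to acting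
  with \<open>X\<close>; \<open>adj_counit\<close> is the counit.\<close>

definition adj_unit :: "'o \<Rightarrow> 'o \<Rightarrow> 'm \<Rightarrow> 'p \<Rightarrow> 'q" where
  "adj_unit X D coev A = massociator M X D A \<cdot>\<^bsub>M\<^esub> (coev \<rhd>\<^sub>m\<^bsub>M\<^esub> ident M A) \<cdot>\<^bsub>M\<^esub> inv_arr M (munitor M A)"

definition adj_counit :: "'o \<Rightarrow> 'o \<Rightarrow> 'm \<Rightarrow> 'p \<Rightarrow> 'q" where
  "adj_counit X D ev A = munitor M A \<cdot>\<^bsub>M\<^esub> (ev \<rhd>\<^sub>m\<^bsub>M\<^esub> ident M A) \<cdot>\<^bsub>M\<^esub> inv_arr M (massociator M D X A)"

section \<open>The adjunction of a dual pair and its exactness properties\<close>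

context
  fixes X D ev coev
  assumes dual: "is_left_dual C X D ev coev" and X [simp]: "X \<in> obj C"
begin

lemmas dual_typing [simp] = is_left_dualD[OF dual X]

lemma adj_unit_typing [simp]:
  assumes "A \<in> obj M"
  shows "adj_unit X D coev A \<in> arr M" "src M (adj_unit X D coev A) = A"
    "tgt M (adj_unit X D coev A) = X \<rhd>\<^sub>o\<^bsub>M\<^esub> (D \<rhd>\<^sub>o\<^bsub>M\<^esub> A)"
  using assms by (simp_all add: adj_unit_def)

lemma adj_counit_typing [simp]:
  assumes "A \<in> obj M"
  shows "adj_counit X D ev A \<in> arr M" "tgt M (adj_counit X D ev A) = A"
    "src M (adj_counit X D ev A) = D \<rhd>\<^sub>o\<^bsub>M\<^esub> (X \<rhd>\<^sub>o\<^bsub>M\<^esub> A)"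
  using assms by (simp_all add: adj_counit_def)

lemma adj_unit_nat:
  assumes g: "g \<in> arr M"
  shows "(ident C X \<rhd>\<^sub>m\<^bsub>M\<^esub> (ident C D \<rhd>\<^sub>m\<^bsub>M\<^esub> g)) \<cdot>\<^bsub>M\<^esub> adj_unit X D coev (src M g) =
    adj_unit X D coev (tgt M g) \<cdot>\<^bsub>M\<^esub> g"
proof -
  let ?i = "inv_arr M (munitor M (src M g))" and ?a = "massociator M X D (tgt M g)"
  have "(ident C X \<rhd>\<^sub>m\<^bsub>M\<^esub> (ident C D \<rhd>\<^sub>m\<^bsub>M\<^esub> g)) \<cdot>\<^bsub>M\<^esub> adj_unit X D coev (src M g) =
    ((ident C X \<rhd>\<^sub>m\<^bsub>M\<^esub> (ident C D \<rhd>\<^sub>m\<^bsub>M\<^esub> g)) \<cdot>\<^bsub>M\<^esub> massociator M X D (src M g)) \<cdot>\<^bsub>M\<^esub>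
      (coev \<rhd>\<^sub>m\<^bsub>M\<^esub> ident M (src M g)) \<cdot>\<^bsub>M\<^esub> ?i"
    using g by (simp add: adj_unit_def)
  also have "\<dots> = (?a \<cdot>\<^bsub>M\<^esub> (ident C (X \<otimes>\<^sub>o\<^bsub>C\<^esub> D) \<rhd>\<^sub>m\<^bsub>M\<^esub> g)) \<cdot>\<^bsub>M\<^esub>
      (coev \<rhd>\<^sub>m\<^bsub>M\<^esub> ident M (src M g)) \<cdot>\<^bsub>M\<^esub> ?i"
    using massoc_nat[of "ident C X" "ident C D" g] g by simp
  also have "\<dots> = ?a \<cdot>\<^bsub>M\<^esub> (coev \<rhd>\<^sub>m\<^bsub>M\<^esub> ident M (tgt M g)) \<cdot>\<^bsub>M\<^esub> ((ident C \<I>\<^bsub>C\<^esub> \<rhd>\<^sub>m\<^bsub>M\<^esub> g) \<cdot>\<^bsub>M\<^esub> ?i)"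
    using g by simp
  also have "\<dots> = adj_unit X D coev (tgt M g) \<cdot>\<^bsub>M\<^esub> g"
    unfolding munit_inv_nat[OF g, symmetric] using g by (simp add: adj_unit_def)
  finally show ?thesis .
qed

lemma adj_counit_nat:
  assumes g: "g \<in> arr M"
  shows "adj_counit X D ev (tgt M g) \<cdot>\<^bsub>M\<^esub> (ident C D \<rhd>\<^sub>m\<^bsub>M\<^esub> (ident C X \<rhd>\<^sub>m\<^bsub>M\<^esub> g)) =
    g \<cdot>\<^bsub>M\<^esub> adj_counit X D ev (src M g)"
proof -
  let ?i = "inv_arr M (massociator M D X (src M g))" and ?a = "munitor M (tgt M g)"
  have "adj_counit X D ev (tgt M g) \<cdot>\<^bsub>M\<^esub> (ident C D \<rhd>\<^sub>m\<^bsub>M\<^esub> (ident C X \<rhd>\<^sub>m\<^bsub>M\<^esub> g)) =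
    ?a \<cdot>\<^bsub>M\<^esub> (ev \<rhd>\<^sub>m\<^bsub>M\<^esub> ident M (tgt M g)) \<cdot>\<^bsub>M\<^esub>
      (inv_arr M (massociator M D X (tgt M g)) \<cdot>\<^bsub>M\<^esub> (ident C D \<rhd>\<^sub>m\<^bsub>M\<^esub> (ident C X \<rhd>\<^sub>m\<^bsub>M\<^esub> g)))"
    using g by (simp add: adj_counit_def)
  also have "\<dots> = ?a \<cdot>\<^bsub>M\<^esub> (ev \<rhd>\<^sub>m\<^bsub>M\<^esub> ident M (tgt M g)) \<cdot>\<^bsub>M\<^esub> ((ident C (D \<otimes>\<^sub>o\<^bsub>C\<^esub> X) \<rhd>\<^sub>m\<^bsub>M\<^esub> g) \<cdot>\<^bsub>M\<^esub> ?i)"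
    using massoc_inv_nat[of "ident C D" "ident C X" g] g by simp
  also have "\<dots> = (?a \<cdot>\<^bsub>M\<^esub> (ident C \<I>\<^bsub>C\<^esub> \<rhd>\<^sub>m\<^bsub>M\<^esub> g)) \<cdot>\<^bsub>M\<^esub> (ev \<rhd>\<^sub>m\<^bsub>M\<^esub> ident M (src M g)) \<cdot>\<^bsub>M\<^esub> ?i"
    using g by simp
  also have "\<dots> = g \<cdot>\<^bsub>M\<^esub> adj_counit X D ev (src M g)"
    unfolding munit_nat[OF g] using g by (simp add: adj_counit_def)
  finally show ?thesis .
qed

text \<open>This is the zigzag identity of the dual pair, transported to the action: the pentagon
  carries \<open>ev\<close> and \<open>coev\<close> past the associators, and
  \<open>munit_massoc\<close> with the triangle axiom removes the unit constraints.\<close>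

lemma adj_triangle_left:
  assumes [simp]: "A \<in> obj M"
  shows "(ident C X \<rhd>\<^sub>m\<^bsub>M\<^esub> adj_counit X D ev A) \<cdot>\<^bsub>M\<^esub> adj_unit X D coev (X \<rhd>\<^sub>o\<^bsub>M\<^esub> A) =
        ident M (X \<rhd>\<^sub>o\<^bsub>M\<^esub> A)"
proof -
  let ?x = "ident C X" and ?A = "ident M A" and ?XA = "X \<rhd>\<^sub>o\<^bsub>M\<^esub> A"
  let ?a = "massociator M X D ?XA" and ?b = "massociator M (X \<otimes>\<^sub>o\<^bsub>C\<^esub> D) X A"
  let ?c = "massociator M X (D \<otimes>\<^sub>o\<^bsub>C\<^esub> X) A" and ?d = "massociator M D X A" and ?s = "associator C X D X"
  let ?m = "inv_arr M (munitor M ?XA)" and ?e = "massociator M \<I>\<^bsub>C\<^esub> X A"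
      and ?f = "massociator M X \<I>\<^bsub>C\<^esub> A"
  have pent: "(?x \<rhd>\<^sub>m\<^bsub>M\<^esub> inv_arr M ?d) \<cdot>\<^bsub>M\<^esub> ?a = ?c \<cdot>\<^bsub>M\<^esub> (?s \<rhd>\<^sub>m\<^bsub>M\<^esub> ?A) \<cdot>\<^bsub>M\<^esub> inv_arr M ?b"
  proof -
    have "(?x \<rhd>\<^sub>m\<^bsub>M\<^esub> inv_arr M ?d) \<cdot>\<^bsub>M\<^esub> ?a = (?x \<rhd>\<^sub>m\<^bsub>M\<^esub> inv_arr M ?d) \<cdot>\<^bsub>M\<^esub> (?a \<cdot>\<^bsub>M\<^esub> ?b) \<cdot>\<^bsub>M\<^esub>
          inv_arr M ?b" by simp
    also have "\<dots> = (?x \<rhd>\<^sub>m\<^bsub>M\<^esub> inv_arr M ?d) \<cdot>\<^bsub>M\<^esub> ((?x \<rhd>\<^sub>m\<^bsub>M\<^esub> ?d) \<cdot>\<^bsub>M\<^esub> ?c \<cdot>\<^bsub>M\<^esub> (?s \<rhd>\<^sub>m\<^bsub>M\<^esub> ?A)) \<cdot>\<^bsub>M\<^esub>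
          inv_arr M ?b"
      using act_pentagon[of X D X A] by simp
    also have "\<dots> = ?c \<cdot>\<^bsub>M\<^esub> (?s \<rhd>\<^sub>m\<^bsub>M\<^esub> ?A) \<cdot>\<^bsub>M\<^esub> inv_arr M ?b" by simp
    finally show ?thesis .
  qed
  have kelly: "inv_arr M ?e \<cdot>\<^bsub>M\<^esub> ?m = inv_arr C (lunitor C X) \<rhd>\<^sub>m\<^bsub>M\<^esub> ?A"
  proof -
    have "inv_arr M ?e \<cdot>\<^bsub>M\<^esub> ?m = inv_arr M (munitor M ?XA \<cdot>\<^bsub>M\<^esub> ?e)" by simp
    also have "\<dots> = inv_arr M (lunitor C X \<rhd>\<^sub>m\<^bsub>M\<^esub> ?A)" by (simp only: munit_massoc X assms)
    finally show ?thesis by simp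
  qed
  have "(?x \<rhd>\<^sub>m\<^bsub>M\<^esub> adj_counit X D ev A) \<cdot>\<^bsub>M\<^esub> adj_unit X D coev ?XA =
    (?x \<rhd>\<^sub>m\<^bsub>M\<^esub> munitor M A) \<cdot>\<^bsub>M\<^esub> (?x \<rhd>\<^sub>m\<^bsub>M\<^esub> (ev \<rhd>\<^sub>m\<^bsub>M\<^esub> ?A)) \<cdot>\<^bsub>M\<^esub> ((?x \<rhd>\<^sub>m\<^bsub>M\<^esub> inv_arr M ?d) \<cdot>\<^bsub>M\<^esub> ?a) \<cdot>\<^bsub>M\<^esub>
      (coev \<rhd>\<^sub>m\<^bsub>M\<^esub> ident M ?XA) \<cdot>\<^bsub>M\<^esub> ?m"
    by (simp add: adj_unit_def adj_counit_def)
  also have "\<dots> = (?x \<rhd>\<^sub>m\<^bsub>M\<^esub> munitor M A) \<cdot>\<^bsub>M\<^esub> ((?x \<rhd>\<^sub>m\<^bsub>M\<^esub> (ev \<rhd>\<^sub>m\<^bsub>M\<^esub> ?A)) \<cdot>\<^bsub>M\<^esub> ?c) \<cdot>\<^bsub>M\<^esub>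
        (?s \<rhd>\<^sub>m\<^bsub>M\<^esub> ?A) \<cdot>\<^bsub>M\<^esub>
      (inv_arr M ?b \<cdot>\<^bsub>M\<^esub> (coev \<rhd>\<^sub>m\<^bsub>M\<^esub> ident M ?XA)) \<cdot>\<^bsub>M\<^esub> ?m"
    unfolding pent by (simp del: act_interchange act_interchange')
  also have "\<dots> = (?x \<rhd>\<^sub>m\<^bsub>M\<^esub> munitor M A) \<cdot>\<^bsub>M\<^esub> (?f \<cdot>\<^bsub>M\<^esub> ((?x \<otimes>\<^sub>m\<^bsub>C\<^esub> ev) \<rhd>\<^sub>m\<^bsub>M\<^esub> ?A)) \<cdot>\<^bsub>M\<^esub>
        (?s \<rhd>\<^sub>m\<^bsub>M\<^esub> ?A) \<cdot>\<^bsub>M\<^esub>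
      (((coev \<otimes>\<^sub>m\<^bsub>C\<^esub> ?x) \<rhd>\<^sub>m\<^bsub>M\<^esub> ?A) \<cdot>\<^bsub>M\<^esub> inv_arr M ?e) \<cdot>\<^bsub>M\<^esub> ?m"
    using massoc_nat[of ?x ev ?A] massoc_inv_nat[of coev ?x ?A] by simp
  also have "\<dots> = ((?x \<rhd>\<^sub>m\<^bsub>M\<^esub> munitor M A) \<cdot>\<^bsub>M\<^esub> ?f) \<cdot>\<^bsub>M\<^esub> ((?x \<otimes>\<^sub>m\<^bsub>C\<^esub> ev) \<rhd>\<^sub>m\<^bsub>M\<^esub> ?A) \<cdot>\<^bsub>M\<^esub>
        (?s \<rhd>\<^sub>m\<^bsub>M\<^esub> ?A) \<cdot>\<^bsub>M\<^esub>
      ((coev \<otimes>\<^sub>m\<^bsub>C\<^esub> ?x) \<rhd>\<^sub>m\<^bsub>M\<^esub> ?A) \<cdot>\<^bsub>M\<^esub> (inv_arr M ?e \<cdot>\<^bsub>M\<^esub> ?m)"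
    by (simp del: act_interchange act_interchange')
  also have "\<dots> = (runitor C X \<rhd>\<^sub>m\<^bsub>M\<^esub> ?A) \<cdot>\<^bsub>M\<^esub> ((?x \<otimes>\<^sub>m\<^bsub>C\<^esub> ev) \<rhd>\<^sub>m\<^bsub>M\<^esub> ?A) \<cdot>\<^bsub>M\<^esub> (?s \<rhd>\<^sub>m\<^bsub>M\<^esub> ?A) \<cdot>\<^bsub>M\<^esub>
      ((coev \<otimes>\<^sub>m\<^bsub>C\<^esub> ?x) \<rhd>\<^sub>m\<^bsub>M\<^esub> ?A) \<cdot>\<^bsub>M\<^esub> (inv_arr C (lunitor C X) \<rhd>\<^sub>m\<^bsub>M\<^esub> ?A)"
    unfolding kelly by (simp only: act_triangle X assms)
  also have "\<dots> = (runitor C X \<cdot>\<^bsub>C\<^esub> (?x \<otimes>\<^sub>m\<^bsub>C\<^esub> ev) \<cdot>\<^bsub>C\<^esub> ?s \<cdot>\<^bsub>C\<^esub> (coev \<otimes>\<^sub>m\<^bsub>C\<^esub> ?x) \<cdot>\<^bsub>C\<^esub> inv_arr C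
        (lunitor C X)) \<rhd>\<^sub>m\<^bsub>M\<^esub> ?A"
    by simp
  also have "\<dots> = ident M ?XA" using dual by (simp add: is_left_dual_def)
  finally show ?thesis .
qed

lemma adj_triangle_right:
  assumes [simp]: "A \<in> obj M"
  shows "adj_counit X D ev (D \<rhd>\<^sub>o\<^bsub>M\<^esub> A) \<cdot>\<^bsub>M\<^esub> (ident C D \<rhd>\<^sub>m\<^bsub>M\<^esub> adj_unit X D coev A) =
        ident M (D \<rhd>\<^sub>o\<^bsub>M\<^esub> A)"
proof -
  let ?x = "ident C D" and ?A = "ident M A" and ?DA = "D \<rhd>\<^sub>o\<^bsub>M\<^esub> A"
  let ?a = "massociator M D X ?DA" and ?b = "massociator M (D \<otimes>\<^sub>o\<^bsub>C\<^esub> X) D A"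
  let ?c = "massociator M D (X \<otimes>\<^sub>o\<^bsub>C\<^esub> D) A" and ?d = "massociator M X D A" and ?s = "associator C D X D"
  let ?m = "munitor M ?DA" and ?e = "massociator M \<I>\<^bsub>C\<^esub> D A" and ?f = "massociator M D \<I>\<^bsub>C\<^esub> A"
  have pent: "inv_arr M ?a \<cdot>\<^bsub>M\<^esub> (?x \<rhd>\<^sub>m\<^bsub>M\<^esub> ?d) \<cdot>\<^bsub>M\<^esub> ?c = ?b \<cdot>\<^bsub>M\<^esub> (inv_arr C ?s \<rhd>\<^sub>m\<^bsub>M\<^esub> ?A)"
  proof -
    have "inv_arr M ?a \<cdot>\<^bsub>M\<^esub> (?x \<rhd>\<^sub>m\<^bsub>M\<^esub> ?d) \<cdot>\<^bsub>M\<^esub> ?c =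
      inv_arr M ?a \<cdot>\<^bsub>M\<^esub> ((?x \<rhd>\<^sub>m\<^bsub>M\<^esub> ?d) \<cdot>\<^bsub>M\<^esub> ?c \<cdot>\<^bsub>M\<^esub> (?s \<rhd>\<^sub>m\<^bsub>M\<^esub> ?A)) \<cdot>\<^bsub>M\<^esub> (inv_arr C ?s \<rhd>\<^sub>m\<^bsub>M\<^esub> ?A)"
          by simp
    also have "\<dots> = inv_arr M ?a \<cdot>\<^bsub>M\<^esub> (?a \<cdot>\<^bsub>M\<^esub> ?b) \<cdot>\<^bsub>M\<^esub> (inv_arr C ?s \<rhd>\<^sub>m\<^bsub>M\<^esub> ?A)"
      by (simp only: act_pentagon[of D X D A] dual_typing X assms)
    also have "\<dots> = ?b \<cdot>\<^bsub>M\<^esub> (inv_arr C ?s \<rhd>\<^sub>m\<^bsub>M\<^esub> ?A)" by simp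
    finally show ?thesis .
  qed
  have tri: "?x \<rhd>\<^sub>m\<^bsub>M\<^esub> inv_arr M (munitor M A) = ?f \<cdot>\<^bsub>M\<^esub> (inv_arr C (runitor C D) \<rhd>\<^sub>m\<^bsub>M\<^esub> ?A)"
  proof -
    have "?f \<cdot>\<^bsub>M\<^esub> (inv_arr C (runitor C D) \<rhd>\<^sub>m\<^bsub>M\<^esub> ?A) = ?f \<cdot>\<^bsub>M\<^esub> inv_arr M (runitor C D \<rhd>\<^sub>m\<^bsub>M\<^esub> ?A)"
        by simp
    also have "\<dots> = ?f \<cdot>\<^bsub>M\<^esub> inv_arr M ((?x \<rhd>\<^sub>m\<^bsub>M\<^esub> munitor M A) \<cdot>\<^bsub>M\<^esub> ?f)"
      by (simp only: act_triangle dual_typing assms)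
    also have "\<dots> = ?x \<rhd>\<^sub>m\<^bsub>M\<^esub> inv_arr M (munitor M A)" by simp
    finally show ?thesis by simp
  qed
  have "adj_counit X D ev ?DA \<cdot>\<^bsub>M\<^esub> (?x \<rhd>\<^sub>m\<^bsub>M\<^esub> adj_unit X D coev A) =
    ?m \<cdot>\<^bsub>M\<^esub> (ev \<rhd>\<^sub>m\<^bsub>M\<^esub> ident M ?DA) \<cdot>\<^bsub>M\<^esub> inv_arr M ?a \<cdot>\<^bsub>M\<^esub> (?x \<rhd>\<^sub>m\<^bsub>M\<^esub> ?d) \<cdot>\<^bsub>M\<^esub>
          (?x \<rhd>\<^sub>m\<^bsub>M\<^esub> (coev \<rhd>\<^sub>m\<^bsub>M\<^esub> ?A)) \<cdot>\<^bsub>M\<^esub>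
      (?x \<rhd>\<^sub>m\<^bsub>M\<^esub> inv_arr M (munitor M A))"
    by (simp add: adj_unit_def adj_counit_def)
  also have "\<dots> = ?m \<cdot>\<^bsub>M\<^esub> (ev \<rhd>\<^sub>m\<^bsub>M\<^esub> ident M ?DA) \<cdot>\<^bsub>M\<^esub> inv_arr M ?a \<cdot>\<^bsub>M\<^esub> (?x \<rhd>\<^sub>m\<^bsub>M\<^esub> ?d) \<cdot>\<^bsub>M\<^esub>
        ((?x \<rhd>\<^sub>m\<^bsub>M\<^esub> (coev \<rhd>\<^sub>m\<^bsub>M\<^esub> ?A)) \<cdot>\<^bsub>M\<^esub> ?f) \<cdot>\<^bsub>M\<^esub>
      (inv_arr C (runitor C D) \<rhd>\<^sub>m\<^bsub>M\<^esub> ?A)"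
    unfolding tri by (simp del: act_interchange act_interchange')
  also have "\<dots> = ?m \<cdot>\<^bsub>M\<^esub> (ev \<rhd>\<^sub>m\<^bsub>M\<^esub> ident M ?DA) \<cdot>\<^bsub>M\<^esub> inv_arr M ?a \<cdot>\<^bsub>M\<^esub> (?x \<rhd>\<^sub>m\<^bsub>M\<^esub> ?d) \<cdot>\<^bsub>M\<^esub>
        (?c \<cdot>\<^bsub>M\<^esub> ((?x \<otimes>\<^sub>m\<^bsub>C\<^esub> coev) \<rhd>\<^sub>m\<^bsub>M\<^esub> ?A)) \<cdot>\<^bsub>M\<^esub>
      (inv_arr C (runitor C D) \<rhd>\<^sub>m\<^bsub>M\<^esub> ?A)"
    using massoc_nat[of ?x coev ?A] by simp
  also have "\<dots> = ?m \<cdot>\<^bsub>M\<^esub> (ev \<rhd>\<^sub>m\<^bsub>M\<^esub> ident M ?DA) \<cdot>\<^bsub>M\<^esub> (inv_arr M ?a \<cdot>\<^bsub>M\<^esub> (?x \<rhd>\<^sub>m\<^bsub>M\<^esub> ?d) \<cdot>\<^bsub>M\<^esub> ?c) \<cdot>\<^bsub>M\<^esub>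
        ((?x \<otimes>\<^sub>m\<^bsub>C\<^esub> coev) \<rhd>\<^sub>m\<^bsub>M\<^esub> ?A) \<cdot>\<^bsub>M\<^esub>
      (inv_arr C (runitor C D) \<rhd>\<^sub>m\<^bsub>M\<^esub> ?A)"
    by (simp del: act_interchange act_interchange')
  also have "\<dots> = ?m \<cdot>\<^bsub>M\<^esub> ((ev \<rhd>\<^sub>m\<^bsub>M\<^esub> ident M ?DA) \<cdot>\<^bsub>M\<^esub> ?b) \<cdot>\<^bsub>M\<^esub> (inv_arr C ?s \<rhd>\<^sub>m\<^bsub>M\<^esub> ?A) \<cdot>\<^bsub>M\<^esub>
        ((?x \<otimes>\<^sub>m\<^bsub>C\<^esub> coev) \<rhd>\<^sub>m\<^bsub>M\<^esub> ?A) \<cdot>\<^bsub>M\<^esub>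
      (inv_arr C (runitor C D) \<rhd>\<^sub>m\<^bsub>M\<^esub> ?A)"
    unfolding pent by (simp del: act_interchange act_interchange')
  also have "\<dots> = ?m \<cdot>\<^bsub>M\<^esub> (?e \<cdot>\<^bsub>M\<^esub> ((ev \<otimes>\<^sub>m\<^bsub>C\<^esub> ?x) \<rhd>\<^sub>m\<^bsub>M\<^esub> ?A)) \<cdot>\<^bsub>M\<^esub> (inv_arr C ?s \<rhd>\<^sub>m\<^bsub>M\<^esub> ?A) \<cdot>\<^bsub>M\<^esub>
        ((?x \<otimes>\<^sub>m\<^bsub>C\<^esub> coev) \<rhd>\<^sub>m\<^bsub>M\<^esub> ?A) \<cdot>\<^bsub>M\<^esub>
      (inv_arr C (runitor C D) \<rhd>\<^sub>m\<^bsub>M\<^esub> ?A)"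
    using massoc_nat[of ev ?x ?A] by simp
  also have "\<dots> = (?m \<cdot>\<^bsub>M\<^esub> ?e) \<cdot>\<^bsub>M\<^esub> ((ev \<otimes>\<^sub>m\<^bsub>C\<^esub> ?x) \<rhd>\<^sub>m\<^bsub>M\<^esub> ?A) \<cdot>\<^bsub>M\<^esub> (inv_arr C ?s \<rhd>\<^sub>m\<^bsub>M\<^esub> ?A) \<cdot>\<^bsub>M\<^esub>
        ((?x \<otimes>\<^sub>m\<^bsub>C\<^esub> coev) \<rhd>\<^sub>m\<^bsub>M\<^esub> ?A) \<cdot>\<^bsub>M\<^esub>
      (inv_arr C (runitor C D) \<rhd>\<^sub>m\<^bsub>M\<^esub> ?A)"
    by (simp del: act_interchange act_interchange')
  also have "\<dots> = (lunitor C D \<cdot>\<^bsub>C\<^esub> (ev \<otimes>\<^sub>m\<^bsub>C\<^esub> ?x) \<cdot>\<^bsub>C\<^esub> inv_arr C ?s \<cdot>\<^bsub>C\<^esub> (?x \<otimes>\<^sub>m\<^bsub>C\<^esub> coev) \<cdot>\<^bsub>C\<^esub> inv_arr C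
        (runitor C D)) \<rhd>\<^sub>m\<^bsub>M\<^esub> ?A"
    by (simp add: munit_massoc)
  also have "\<dots> = ident M ?DA" using dual by (simp add: is_left_dual_def)
  finally show ?thesis .
qed

text \<open>The counit recovers \<open>h\<close> from its transpose, by naturality and the second
  triangle identity.\<close>

lemma adj_inj:
  assumes "h \<in> arr M" "h' \<in> arr M" "src M h = D \<rhd>\<^sub>o\<^bsub>M\<^esub> A" "src M h' = D \<rhd>\<^sub>o\<^bsub>M\<^esub> A" "tgt M h = tgt M h'"
    and [simp]: "A \<in> obj M"
    and eq: "(ident C X \<rhd>\<^sub>m\<^bsub>M\<^esub> h) \<cdot>\<^bsub>M\<^esub> adj_unit X D coev A =
          (ident C X \<rhd>\<^sub>m\<^bsub>M\<^esub> h') \<cdot>\<^bsub>M\<^esub> adj_unit X D coev A"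
  shows "h = h'"
proof -
  have rec: "adj_counit X D ev (tgt M h) \<cdot>\<^bsub>M\<^esub> (ident C D \<rhd>\<^sub>m\<^bsub>M\<^esub> ((ident C X \<rhd>\<^sub>m\<^bsub>M\<^esub> h) \<cdot>\<^bsub>M\<^esub>
        adj_unit X D coev A)) = h"
    if h: "h \<in> arr M" "src M h = D \<rhd>\<^sub>o\<^bsub>M\<^esub> A" for h
  proof -
    have "adj_counit X D ev (tgt M h) \<cdot>\<^bsub>M\<^esub> (ident C D \<rhd>\<^sub>m\<^bsub>M\<^esub> ((ident C X \<rhd>\<^sub>m\<^bsub>M\<^esub> h) \<cdot>\<^bsub>M\<^esub>
          adj_unit X D coev A)) =
      (adj_counit X D ev (tgt M h) \<cdot>\<^bsub>M\<^esub> (ident C D \<rhd>\<^sub>m\<^bsub>M\<^esub> (ident C X \<rhd>\<^sub>m\<^bsub>M\<^esub> h))) \<cdot>\<^bsub>M\<^esub>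
            (ident C D \<rhd>\<^sub>m\<^bsub>M\<^esub> adj_unit X D coev A)"
      using h by simp
    also have "\<dots> = (h \<cdot>\<^bsub>M\<^esub> adj_counit X D ev (D \<rhd>\<^sub>o\<^bsub>M\<^esub> A)) \<cdot>\<^bsub>M\<^esub> (ident C D \<rhd>\<^sub>m\<^bsub>M\<^esub> adj_unit X D coev A)"
      using adj_counit_nat[OF h(1)] h by simp
    also have "\<dots> = h" using h by (simp add: adj_triangle_right)
    finally show ?thesis .
  qed
  show ?thesis using rec[OF assms(1,3), unfolded eq \<open>tgt M h = tgt M h'\<close>] rec[OF assms(2,4)]
    by (rule trans[OF sym])
qed

lemma adj_surj:
  assumes "g \<in> arr M" "tgt M g = X \<rhd>\<^sub>o\<^bsub>M\<^esub> B" and [simp]: "B \<in> obj M"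
  obtains h where "h \<in> arr M" "src M h = D \<rhd>\<^sub>o\<^bsub>M\<^esub> src M g" "tgt M h = B"
    "(ident C X \<rhd>\<^sub>m\<^bsub>M\<^esub> h) \<cdot>\<^bsub>M\<^esub> adj_unit X D coev (src M g) = g"
proof -
  let ?h = "adj_counit X D ev B \<cdot>\<^bsub>M\<^esub> (ident C D \<rhd>\<^sub>m\<^bsub>M\<^esub> g)"
  have "(ident C X \<rhd>\<^sub>m\<^bsub>M\<^esub> ?h) \<cdot>\<^bsub>M\<^esub> adj_unit X D coev (src M g) =
    (ident C X \<rhd>\<^sub>m\<^bsub>M\<^esub> adj_counit X D ev B) \<cdot>\<^bsub>M\<^esub> ((ident C X \<rhd>\<^sub>m\<^bsub>M\<^esub> (ident C D \<rhd>\<^sub>m\<^bsub>M\<^esub> g)) \<cdot>\<^bsub>M\<^esub>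
          adj_unit X D coev (src M g))"
    using assms by simp
  also have "\<dots> = (ident C X \<rhd>\<^sub>m\<^bsub>M\<^esub> adj_counit X D ev B) \<cdot>\<^bsub>M\<^esub> (adj_unit X D coev (tgt M g) \<cdot>\<^bsub>M\<^esub> g)"
    using adj_unit_nat[OF assms(1)] by simp
  also have "\<dots> = ((ident C X \<rhd>\<^sub>m\<^bsub>M\<^esub> adj_counit X D ev B) \<cdot>\<^bsub>M\<^esub> adj_unit X D coev (X \<rhd>\<^sub>o\<^bsub>M\<^esub> B)) \<cdot>\<^bsub>M\<^esub> g"
    using assms by simp
  also have "\<dots> = g" unfolding adj_triangle_left[OF assms(3)] using assms by simp
  finally show ?thesis using that[of ?h] assms by simp
qed

text \<open>Acting with \<open>X\<close> is a right adjoint, so it preserves monos and, in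
  \<open>act_kernel\<close>, kernels; acting with \<open>D\<close> is a left adjoint and preserves
  epis in \<open>act_epi\<close>.\<close>

lemma act_mono:
  assumes m: "is_mono M m"
  shows "is_mono M (ident C X \<rhd>\<^sub>m\<^bsub>M\<^esub> m)"
proof (rule M.monoI)
  have mm [simp]: "m \<in> arr M" using m by simp
  fix g h assume gh: "g \<in> arr M" "h \<in> arr M" "src M g = src M h" "tgt M g = src M (ident C X \<rhd>\<^sub>m\<^bsub>M\<^esub> m)"
    "tgt M h = src M (ident C X \<rhd>\<^sub>m\<^bsub>M\<^esub> m)" and eq: "(ident C X \<rhd>\<^sub>m\<^bsub>M\<^esub> m) \<cdot>\<^bsub>M\<^esub> g =
          (ident C X \<rhd>\<^sub>m\<^bsub>M\<^esub> m) \<cdot>\<^bsub>M\<^esub> h"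
  obtain g' where g': "g' \<in> arr M" "src M g' = D \<rhd>\<^sub>o\<^bsub>M\<^esub> src M g" "tgt M g' = src M m"
    "(ident C X \<rhd>\<^sub>m\<^bsub>M\<^esub> g') \<cdot>\<^bsub>M\<^esub> adj_unit X D coev (src M g) = g"
    using adj_surj[of g "src M m"] gh by auto
  obtain h' where h': "h' \<in> arr M" "src M h' = D \<rhd>\<^sub>o\<^bsub>M\<^esub> src M g" "tgt M h' = src M m"
    "(ident C X \<rhd>\<^sub>m\<^bsub>M\<^esub> h') \<cdot>\<^bsub>M\<^esub> adj_unit X D coev (src M g) = h"
    using adj_surj[of h "src M m"] gh by auto
  have "(ident C X \<rhd>\<^sub>m\<^bsub>M\<^esub> (m \<cdot>\<^bsub>M\<^esub> g')) \<cdot>\<^bsub>M\<^esub> adj_unit X D coev (src M g) = (ident C X \<rhd>\<^sub>m\<^bsub>M\<^esub> m) \<cdot>\<^bsub>M\<^esub> g"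
    (is "?l = _")
  proof -
    have "?l = (ident C X \<rhd>\<^sub>m\<^bsub>M\<^esub> m) \<cdot>\<^bsub>M\<^esub> ((ident C X \<rhd>\<^sub>m\<^bsub>M\<^esub> g') \<cdot>\<^bsub>M\<^esub> adj_unit X D coev (src M g))"
      using g'(1-3) gh(1) by simp
    then show ?thesis by (simp only: g'(4))
  qed
  moreover have "(ident C X \<rhd>\<^sub>m\<^bsub>M\<^esub> (m \<cdot>\<^bsub>M\<^esub> h')) \<cdot>\<^bsub>M\<^esub> adj_unit X D coev (src M g) =
        (ident C X \<rhd>\<^sub>m\<^bsub>M\<^esub> m) \<cdot>\<^bsub>M\<^esub> h"
    (is "?l = _")
  proof -
    have "?l = (ident C X \<rhd>\<^sub>m\<^bsub>M\<^esub> m) \<cdot>\<^bsub>M\<^esub> ((ident C X \<rhd>\<^sub>m\<^bsub>M\<^esub> h') \<cdot>\<^bsub>M\<^esub> adj_unit X D coev (src M g))"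
      using h'(1-3) gh(1) by simp
    then show ?thesis by (simp only: h'(4))
  qed
  ultimately have "m \<cdot>\<^bsub>M\<^esub> g' = m \<cdot>\<^bsub>M\<^esub> h'"
    using g'(1-3) h'(1-3) gh(1) eq[symmetric] by - (rule adj_inj[where A = "src M g"], simp_all)
  then have "g' = h'" using g'(1-3) h'(1-3) by - (rule M.monoD[OF m], auto)
  then show "g = h" using g'(4) h'(4) by metis
qed (simp add: M.mono_arr[OF m])

lemma act_epi:
  assumes e: "is_epi M e"
  shows "is_epi M (ident C D \<rhd>\<^sub>m\<^bsub>M\<^esub> e)"
proof (rule M.epiI)
  have ee [simp]: "e \<in> arr M" using e by simp
  fix g h assume gh: "g \<in> arr M" "h \<in> arr M" "tgt M g = tgt M h" "src M g = tgt M (ident C D \<rhd>\<^sub>m\<^bsub>M\<^esub> e)"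
    "src M h = tgt M (ident C D \<rhd>\<^sub>m\<^bsub>M\<^esub> e)" and eq: "g \<cdot>\<^bsub>M\<^esub> (ident C D \<rhd>\<^sub>m\<^bsub>M\<^esub> e) =
          h \<cdot>\<^bsub>M\<^esub> (ident C D \<rhd>\<^sub>m\<^bsub>M\<^esub> e)"
  have *: "((ident C X \<rhd>\<^sub>m\<^bsub>M\<^esub> k) \<cdot>\<^bsub>M\<^esub> adj_unit X D coev (tgt M e)) \<cdot>\<^bsub>M\<^esub> e =
      (ident C X \<rhd>\<^sub>m\<^bsub>M\<^esub> (k \<cdot>\<^bsub>M\<^esub> (ident C D \<rhd>\<^sub>m\<^bsub>M\<^esub> e))) \<cdot>\<^bsub>M\<^esub> adj_unit X D coev (src M e)"
    if "k \<in> arr M" "src M k = D \<rhd>\<^sub>o\<^bsub>M\<^esub> tgt M e" for k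
  proof -
    have "((ident C X \<rhd>\<^sub>m\<^bsub>M\<^esub> k) \<cdot>\<^bsub>M\<^esub> adj_unit X D coev (tgt M e)) \<cdot>\<^bsub>M\<^esub> e =
      (ident C X \<rhd>\<^sub>m\<^bsub>M\<^esub> k) \<cdot>\<^bsub>M\<^esub> (adj_unit X D coev (tgt M e) \<cdot>\<^bsub>M\<^esub> e)" using that by simp
    then show ?thesis unfolding adj_unit_nat[OF ee, symmetric] using that by simp
  qed
  have "((ident C X \<rhd>\<^sub>m\<^bsub>M\<^esub> g) \<cdot>\<^bsub>M\<^esub> adj_unit X D coev (tgt M e)) \<cdot>\<^bsub>M\<^esub> e =
    ((ident C X \<rhd>\<^sub>m\<^bsub>M\<^esub> h) \<cdot>\<^bsub>M\<^esub> adj_unit X D coev (tgt M e)) \<cdot>\<^bsub>M\<^esub> e"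
    using *[of g] *[of h] gh eq by simp
  then have "(ident C X \<rhd>\<^sub>m\<^bsub>M\<^esub> g) \<cdot>\<^bsub>M\<^esub> adj_unit X D coev (tgt M e) =
        (ident C X \<rhd>\<^sub>m\<^bsub>M\<^esub> h) \<cdot>\<^bsub>M\<^esub> adj_unit X D coev (tgt M e)"
    using gh by - (rule M.epiD[OF e], auto)
  then show "g = h" using gh by - (rule adj_inj[where A = "tgt M e"], auto)
qed (simp add: M.epi_arr[OF e])

lemma act_kernel:
  assumes k: "is_kernel M f k"
  shows "is_kernel M (ident C X \<rhd>\<^sub>m\<^bsub>M\<^esub> f) (ident C X \<rhd>\<^sub>m\<^bsub>M\<^esub> k)"
proof (rule M.kernelI)
  note kf = M.kernelD[OF k]
  have kk [simp]: "k \<in> arr M" using kf by simp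
  show "is_mono M (ident C X \<rhd>\<^sub>m\<^bsub>M\<^esub> k)" using act_mono kf by simp
  show "ident C X \<rhd>\<^sub>m\<^bsub>M\<^esub> f \<in> arr M" "tgt M (ident C X \<rhd>\<^sub>m\<^bsub>M\<^esub> k) = src M (ident C X \<rhd>\<^sub>m\<^bsub>M\<^esub> f)"
    "(ident C X \<rhd>\<^sub>m\<^bsub>M\<^esub> f) \<cdot>\<^bsub>M\<^esub> (ident C X \<rhd>\<^sub>m\<^bsub>M\<^esub> k) =
     zero_arr M (src M (ident C X \<rhd>\<^sub>m\<^bsub>M\<^esub> k)) (tgt M (ident C X \<rhd>\<^sub>m\<^bsub>M\<^esub> f))"
    using kf by simp_all
  fix h assume h: "h \<in> arr M" "tgt M h = src M (ident C X \<rhd>\<^sub>m\<^bsub>M\<^esub> f)"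
    "(ident C X \<rhd>\<^sub>m\<^bsub>M\<^esub> f) \<cdot>\<^bsub>M\<^esub> h = zero_arr M (src M h) (tgt M (ident C X \<rhd>\<^sub>m\<^bsub>M\<^esub> f))"
  let ?u = "adj_unit X D coev (src M h)"
  obtain h' where h': "h' \<in> arr M" "src M h' = D \<rhd>\<^sub>o\<^bsub>M\<^esub> src M h" "tgt M h' = src M f"
    "(ident C X \<rhd>\<^sub>m\<^bsub>M\<^esub> h') \<cdot>\<^bsub>M\<^esub> ?u = h"
    using adj_surj[of h "src M f"] h(1,2) kf by auto
  have "(ident C X \<rhd>\<^sub>m\<^bsub>M\<^esub> (f \<cdot>\<^bsub>M\<^esub> h')) \<cdot>\<^bsub>M\<^esub> ?u =
        (ident C X \<rhd>\<^sub>m\<^bsub>M\<^esub> f) \<cdot>\<^bsub>M\<^esub> ((ident C X \<rhd>\<^sub>m\<^bsub>M\<^esub> h') \<cdot>\<^bsub>M\<^esub> ?u)"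
    using h'(1-3) h(1) kf(1) by simp
  also have "\<dots> = (ident C X \<rhd>\<^sub>m\<^bsub>M\<^esub> zero_arr M (src M h') (tgt M f)) \<cdot>\<^bsub>M\<^esub> ?u"
    unfolding h'(4) h(3) using h'(1-3) h(1) kf(1) by simp
  finally have "f \<cdot>\<^bsub>M\<^esub> h' = zero_arr M (src M h') (tgt M f)"
    using h'(1-3) h(1) kf(1) by - (rule adj_inj[where A = "src M h"], auto)
  then obtain u where u: "u \<in> arr M" "src M u = src M h'" "tgt M u = src M k" "k \<cdot>\<^bsub>M\<^esub> u = h'"
    using M.kernel_factor[OF k h'(1,3)] by blast
  have "(ident C X \<rhd>\<^sub>m\<^bsub>M\<^esub> k) \<cdot>\<^bsub>M\<^esub> ((ident C X \<rhd>\<^sub>m\<^bsub>M\<^esub> u) \<cdot>\<^bsub>M\<^esub> ?u) = h"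
    using u h' h(1) by simp
  then show "\<exists>u\<in>arr M. tgt M u = src M (ident C X \<rhd>\<^sub>m\<^bsub>M\<^esub> k) \<and> (ident C X \<rhd>\<^sub>m\<^bsub>M\<^esub> k) \<cdot>\<^bsub>M\<^esub> u = h"
    using u h'(2) h(1) by (intro bexI[of _ "(ident C X \<rhd>\<^sub>m\<^bsub>M\<^esub> u) \<cdot>\<^bsub>M\<^esub> ?u"]) auto
qed

end

end

section \<open>The regular action and the reversed tensor product\<close>

definition regular :: "('o, 'm, 'k, 'z) moncat_scheme \<Rightarrow> ('o, 'm, 'o, 'm, 'k) modcat" where
  "regular C =
     \<lparr>obj = obj C, arr = arr C, src = src C, tgt = tgt C, ident = ident C, cmp = cmp C,
      zero_arr = zero_arr C, add_arr = add_arr C, scale_arr = scale_arr C,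
      act_obj = tens_obj C, act_arr = tens_arr C, massociator = associator C, munitor = lunitor C\<rparr>"

text \<open>Reversal turns a dual pair \<open>X, D\<close> into the dual pair \<open>D, X\<close>
  with the same \<open>ev\<close> and \<open>coev\<close> (\<open>dual_rev\<close>), so statements
  about tensoring on the left yield those about tensoring on the right.\<close>

definition rev_cat :: "('o, 'm, 'k, 'z) moncat_scheme \<Rightarrow> ('o, 'm, 'k, 'z) moncat_scheme" where
  "rev_cat C = C\<lparr>tens_obj := \<lambda>X Y. tens_obj C Y X, tens_arr := \<lambda>f g. tens_arr C g f,
     associator := \<lambda>X Y Z. inv_arr C (associator C Z Y X),
     lunitor := runitor C, runitor := lunitor C\<rparr>"

lemma regular_simps:
  "obj (regular C) = obj C" "arr (regular C) = arr C" "src (regular C) = src C"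
  "tgt (regular C) = tgt C" "ident (regular C) = ident C" "cmp (regular C) = cmp C"
  "zero_arr (regular C) = zero_arr C" "add_arr (regular C) = add_arr C"
  "scale_arr (regular C) = scale_arr C" "act_obj (regular C) = tens_obj C"
  "act_arr (regular C) = tens_arr C" "massociator (regular C) = associator C"
  "munitor (regular C) = lunitor C" "Hom (regular C) = Hom C"
  "is_iso (regular C) = is_iso C" "inv_arr (regular C) = inv_arr C"
  "is_mono (regular C) = is_mono C" "is_epi (regular C) = is_epi C"
  "is_kernel (regular C) = is_kernel C" "hom_space (regular C) = hom_space C"
  by (simp_all add: regular_def Hom_def[abs_def] is_iso_def[abs_def] is_inverse_def[abs_def]
      inv_arr_def[abs_def] is_mono_def[abs_def] is_epi_def[abs_def] is_kernel_def[abs_def]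
      hom_space_def[abs_def])

lemma rev_cat_simps:
  "obj (rev_cat C) = obj C" "arr (rev_cat C) = arr C" "src (rev_cat C) = src C"
  "tgt (rev_cat C) = tgt C" "ident (rev_cat C) = ident C" "cmp (rev_cat C) = cmp C"
  "zero_arr (rev_cat C) = zero_arr C" "add_arr (rev_cat C) = add_arr C"
  "scale_arr (rev_cat C) = scale_arr C" "tens_obj (rev_cat C) = (\<lambda>X Y. tens_obj C Y X)"
  "tens_arr (rev_cat C) = (\<lambda>f g. tens_arr C g f)"
  "associator (rev_cat C) = (\<lambda>X Y Z. inv_arr C (associator C Z Y X))"
  "lunitor (rev_cat C) = runitor C" "runitor (rev_cat C) = lunitor C"
  "unit_obj (rev_cat C) = unit_obj C" "Hom (rev_cat C) = Hom C"
  "is_iso (rev_cat C) = is_iso C" "inv_arr (rev_cat C) = inv_arr C"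
  "is_mono (rev_cat C) = is_mono C" "is_epi (rev_cat C) = is_epi C"
  "is_kernel (rev_cat C) = is_kernel C" "hom_space (rev_cat C) = hom_space C"
  "Iso (rev_cat C) = Iso C"
  by (simp_all add: rev_cat_def Hom_def[abs_def] is_iso_def[abs_def] is_inverse_def[abs_def]
      inv_arr_def[abs_def] is_mono_def[abs_def] is_epi_def[abs_def] is_kernel_def[abs_def]
      hom_space_def[abs_def] Iso_def[abs_def])

context linear_monoidal_category
begin

lemma lin_action_regular: "lin_action C (regular C)"
proof -
  have lin: "linear_category (regular C)"
    using linear_category_axioms unfolding linear_category_def regular_simps .
  show ?thesis
    by (rule lin_action.intro[OF linear_monoidal_category_axioms lin], unfold_locales)
      (auto simp: regular_simps lunitor_nat assoc_nat pentagon triangle)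
qed

lemma inv_square:
  assumes "a \<cdot> f = g \<cdot> b" "is_iso C a" "is_iso C b" "f \<in> arr C" "g \<in> arr C"
    "tgt C f = src C a" "src C f = src C b" "src C g = tgt C b" "tgt C g = tgt C a"
  shows "inv_arr C a \<cdot> g = f \<cdot> inv_arr C b"
proof -
  have "inv_arr C a \<cdot> g = inv_arr C a \<cdot> (g \<cdot> b) \<cdot> inv_arr C b" using assms(2-) by simp
  also have "\<dots> = inv_arr C a \<cdot> (a \<cdot> f) \<cdot> inv_arr C b" by (simp only: assms(1))
  also have "\<dots> = f \<cdot> inv_arr C b" using assms(2-) by simp
  finally show ?thesis .
qed

lemma linear_monoidal_rev: "linear_monoidal_category (rev_cat C)"
proof -
  have lin: "linear_category (rev_cat C)"
    using linear_category_axioms unfolding linear_category_def rev_cat_simps .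
  show ?thesis
  proof (rule linear_monoidal_category.intro[OF lin], unfold_locales, unfold rev_cat_simps)
    fix f X X' g Y Y' h Z Z'
    assume "f \<in> Hom C X X'" "g \<in> Hom C Y Y'" "h \<in> Hom C Z Z'"
    then show "inv_arr C (associator C Z' Y' X') \<cdot> h \<otimes>\<^sub>m g \<otimes>\<^sub>m f =
        ((h \<otimes>\<^sub>m g) \<otimes>\<^sub>m f) \<cdot> inv_arr C (associator C Z Y X)"
      using assoc_nat[of h g f] by (intro inv_square) (auto simp: Hom_iff)
  next
    fix W X Y Z assume [simp]: "W \<in> obj C" "X \<in> obj C" "Y \<in> obj C" "Z \<in> obj C"
    have "inv_arr C (associator C Z Y (X \<otimes>\<^sub>o W) \<cdot> associator C (Z \<otimes>\<^sub>o Y) X W) =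
      inv_arr C ((ident C Z \<otimes>\<^sub>m associator C Y X W) \<cdot> associator C Z (Y \<otimes>\<^sub>o X) W \<cdot>
            (associator C Z Y X \<otimes>\<^sub>m ident C W))"
      by (simp only: pentagon \<open>W \<in> obj C\<close> \<open>X \<in> obj C\<close> \<open>Y \<in> obj C\<close> \<open>Z \<in> obj C\<close>)
    then show "inv_arr C (associator C (Z \<otimes>\<^sub>o Y) X W) \<cdot> inv_arr C (associator C Z Y (X \<otimes>\<^sub>o W)) =
          (inv_arr C (associator C Z Y X) \<otimes>\<^sub>m ident C W) \<cdot>
          inv_arr C (associator C Z (Y \<otimes>\<^sub>o X) W) \<cdot> (ident C Z \<otimes>\<^sub>m inv_arr C (associator C Y X W))"
      by simp
  next
    fix X Y assume [simp]: "X \<in> obj C" "Y \<in> obj C"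
    show "(runitor C Y \<otimes>\<^sub>m ident C X) \<cdot> inv_arr C (associator C Y \<I> X) = ident C Y \<otimes>\<^sub>m lunitor C X"
      using triangle[of Y X, symmetric] by simp
  qed (use tens_arr tens_add_left tens_add_right tens_scale_left tens_scale_right runitor_Iso
      lunitor_Iso lunitor_natural runitor_natural in \<open>auto simp: Hom_iff Iso_def\<close>)
qed

lemma dual_rev:
  assumes "is_left_dual C X D ev coev" "X \<in> obj C"
  shows "is_left_dual (rev_cat C) D X ev coev"
  using assms is_left_dualD[OF assms] unfolding is_left_dual_def rev_cat_simps by simp

text \<open>Kelly's coherence for the regular action; \<open>runitor_tens\<close> is the same
  statement in the reversed category.\<close>

lemma lunitor_tens:
  "\<lbrakk>X \<in> obj C; Y \<in> obj C\<rbrakk> \<Longrightarrow> lunitor C (X \<otimes>\<^sub>o Y) \<cdot> associator C \<I> X Y = lunitor C X \<otimes>\<^sub>m ident C Y"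
  using lin_action.munit_massoc[OF lin_action_regular, of X Y] by (simp add: regular_simps)

lemma runitor_tens:
  assumes [simp]: "X \<in> obj C" "Y \<in> obj C"
  shows "(ident C X \<otimes>\<^sub>m runitor C Y) \<cdot> associator C X Y \<I> = runitor C (X \<otimes>\<^sub>o Y)"
  using linear_monoidal_category.lunitor_tens[OF linear_monoidal_rev, of Y X, symmetric]
  by (simp add: rev_cat_simps)

text \<open>Naturality of the left unitor at itself identifies
  \<open>lunitor C (\<I> \<otimes>\<^sub>o \<I>)\<close> with
  \<open>ident C \<I> \<otimes>\<^sub>m lunitor C \<I>\<close>. Coherence then equates both unitors
  of \<open>\<I>\<close> after tensoring with \<open>\<I>\<close>, and that operation is
  faithful.\<close>

lemma lunitor_unit_eq: "lunitor C \<I> = runitor C \<I>"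
proof -
  have "lunitor C \<I> \<cdot> lunitor C (\<I> \<otimes>\<^sub>o \<I>) = lunitor C \<I> \<cdot> (ident C \<I> \<otimes>\<^sub>m lunitor C \<I>)"
    using lunitor_nat[of "lunitor C \<I>"] by simp
  then have "lunitor C (\<I> \<otimes>\<^sub>o \<I>) = ident C \<I> \<otimes>\<^sub>m lunitor C \<I>"
    by - (rule monoD[OF iso_mono[of "lunitor C \<I>"]], auto)
  then have e: "lunitor C \<I> \<otimes>\<^sub>m ident C \<I> = runitor C \<I> \<otimes>\<^sub>m ident C \<I>"
    using lunitor_tens[of \<I> \<I>] triangle[of \<I> \<I>] by simp
  have "lunitor C \<I> \<cdot> runitor C (\<I> \<otimes>\<^sub>o \<I>) = runitor C \<I> \<cdot> runitor C (\<I> \<otimes>\<^sub>o \<I>)"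
    using runitor_nat[of "lunitor C \<I>"] runitor_nat[of "runitor C \<I>"] e by simp
  then show ?thesis by - (rule epiD[OF iso_epi[of "runitor C (\<I> \<otimes>\<^sub>o \<I>)"]], auto)
qed

section \<open>Transposition along a dual pair of objects\<close>

context
  fixes X D ev coev
  assumes dual: "is_left_dual C X D ev coev" and X [simp]: "X \<in> obj C"
begin

lemmas dual_typing [simp] = is_left_dualD[OF dual X]

lemma left_adj_inj:
  assumes "h \<in> arr C" "h' \<in> arr C" "src C h = D \<otimes>\<^sub>o A" "src C h' = D \<otimes>\<^sub>o A" "tgt C h =
        tgt C h'" "A \<in> obj C"
    "(ident C X \<otimes>\<^sub>m h) \<cdot> associator C X D A \<cdot> (coev \<otimes>\<^sub>m ident C A) \<cdot> inv_arr C (lunitor C A) =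
     (ident C X \<otimes>\<^sub>m h') \<cdot> associator C X D A \<cdot> (coev \<otimes>\<^sub>m ident C A) \<cdot> inv_arr C (lunitor C A)"
  shows "h = h'"
  using lin_action.adj_inj[OF lin_action_regular dual X, of h h' A] assms
  by (simp add: regular_simps lin_action.adj_unit_def[OF lin_action_regular])

lemma left_adj_surj:
  assumes "g \<in> arr C" "src C g = A" "tgt C g = X \<otimes>\<^sub>o B" "B \<in> obj C"
  obtains h where "h \<in> arr C" "src C h = D \<otimes>\<^sub>o A" "tgt C h = B"
    "(ident C X \<otimes>\<^sub>m h) \<cdot> associator C X D A \<cdot> (coev \<otimes>\<^sub>m ident C A) \<cdot> inv_arr C (lunitor C A) = g"
  using lin_action.adj_surj[OF lin_action_regular dual X, of g B] assms
  by (auto simp: regular_simps lin_action.adj_unit_def[OF lin_action_regular])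

text \<open>Transposition at the unit, cleared of unit constraints: arrows
  \<open>D \<rightarrow> W\<close> correspond to arrows
  \<open>\<I> \<rightarrow> X \<otimes> W\<close> by
  \<open>g \<mapsto> (id \<otimes> g) coev\<close>. This is the form behind \<open>dual_inj\<close>
  and \<open>dual_surj\<close>.\<close>

lemma left_adj_unit:
  assumes "g \<in> arr C" "src C g = D"
  shows "(ident C X \<otimes>\<^sub>m (g \<cdot> runitor C D)) \<cdot> associator C X D \<I> \<cdot> (coev \<otimes>\<^sub>m ident C \<I>) \<cdot>
        inv_arr C (lunitor C \<I>) =
    (ident C X \<otimes>\<^sub>m g) \<cdot> coev"
proof -
  have "(ident C X \<otimes>\<^sub>m (g \<cdot> runitor C D)) \<cdot> associator C X D \<I> \<cdot> (coev \<otimes>\<^sub>m ident C \<I>) \<cdot>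
        inv_arr C (lunitor C \<I>) =
    (ident C X \<otimes>\<^sub>m g) \<cdot> ((ident C X \<otimes>\<^sub>m runitor C D) \<cdot> associator C X D \<I>) \<cdot> (coev \<otimes>\<^sub>m ident C \<I>) \<cdot>
          inv_arr C (lunitor C \<I>)"
    using assms by simp
  also have "\<dots> = (ident C X \<otimes>\<^sub>m g) \<cdot> (runitor C (X \<otimes>\<^sub>o D) \<cdot> (coev \<otimes>\<^sub>m ident C \<I>)) \<cdot>
        inv_arr C (lunitor C \<I>)"
    unfolding runitor_tens[OF X dual_typing(1)] using assms by simp
  also have "\<dots> = (ident C X \<otimes>\<^sub>m g) \<cdot> (coev \<cdot> runitor C \<I>) \<cdot> inv_arr C (lunitor C \<I>)"
    using runitor_nat[of coev] by simp
  also have "\<dots> = (ident C X \<otimes>\<^sub>m g) \<cdot> coev" using assms by (simp add: lunitor_unit_eq)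
  finally show ?thesis .
qed

lemma dual_inj:
  assumes "g \<in> arr C" "g' \<in> arr C" "src C g = D" "src C g' = D" "tgt C g = tgt C g'"
    "(ident C X \<otimes>\<^sub>m g) \<cdot> coev = (ident C X \<otimes>\<^sub>m g') \<cdot> coev"
  shows "g = g'"
proof -
  have "g \<cdot> runitor C D = g' \<cdot> runitor C D"
    using assms left_adj_unit[OF assms(1,3)] left_adj_unit[OF assms(2,4)]
    by - (rule left_adj_inj[where A = \<I>], auto)
  then show ?thesis using assms by - (rule epiD[OF iso_epi[of "runitor C D"]], auto)
qed

lemma dual_surj:
  assumes "k \<in> arr C" "src C k = \<I>" "tgt C k = X \<otimes>\<^sub>o W" "W \<in> obj C"
  obtains g where "g \<in> arr C" "src C g = D" "tgt C g = W" "(ident C X \<otimes>\<^sub>m g) \<cdot> coev = k"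
proof -
  obtain h where h: "h \<in> arr C" "src C h = D \<otimes>\<^sub>o \<I>" "tgt C h = W"
    "(ident C X \<otimes>\<^sub>m h) \<cdot> associator C X D \<I> \<cdot> (coev \<otimes>\<^sub>m ident C \<I>) \<cdot> inv_arr C (lunitor C \<I>) = k"
    using left_adj_surj[OF assms] by blast
  show ?thesis
    using that[of "h \<cdot> inv_arr C (runitor C D)"] left_adj_unit[of "h \<cdot> inv_arr C (runitor C D)"] h
    by simp
qed

lemma tens_mono_right':
  "is_mono C m \<Longrightarrow> is_mono C (ident C X \<otimes>\<^sub>m m)"
  using lin_action.act_mono[OF lin_action_regular dual X, of m] by (simp add: regular_simps)

lemma tens_epi_right':
  "is_epi C e \<Longrightarrow> is_epi C (ident C D \<otimes>\<^sub>m e)"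
  using lin_action.act_epi[OF lin_action_regular dual X, of e] by (simp add: regular_simps)

lemma tens_kernel_right':
  "is_kernel C f k \<Longrightarrow> is_kernel C (ident C X \<otimes>\<^sub>m f) (ident C X \<otimes>\<^sub>m k)"
  using lin_action.act_kernel[OF lin_action_regular dual X, of f k] by (simp add: regular_simps)

end

lemma dual_inj_left:
  assumes d: "is_left_dual C X D ev coev" "X \<in> obj C"
    and "f \<in> arr C" "f' \<in> arr C" "src C f = X" "src C f' = X" "tgt C f = tgt C f'"
    "(f \<otimes>\<^sub>m ident C D) \<cdot> coev = (f' \<otimes>\<^sub>m ident C D) \<cdot> coev"
  shows "f = f'"
  using linear_monoidal_category.dual_inj[OF linear_monoidal_rev dual_rev[OF d], of f f']
    assms is_left_dualD[OF d] by (simp add: rev_cat_simps)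

lemma dual_surj_left:
  assumes d: "is_left_dual C X D ev coev" "X \<in> obj C"
    and "k \<in> arr C" "src C k = \<I>" "tgt C k = W \<otimes>\<^sub>o D" "W \<in> obj C"
  obtains f where "f \<in> arr C" "src C f = X" "tgt C f = W" "(f \<otimes>\<^sub>m ident C D) \<cdot> coev = k"
  using linear_monoidal_category.dual_surj[OF linear_monoidal_rev dual_rev[OF d], of k W]
    assms is_left_dualD[OF d] by (auto simp: rev_cat_simps)

end

section \<open>The duality functor\<close>

locale rigid_monoidal = linear_monoidal_category C + left_duals C ldual lev lcoev
  for C :: "('o, 'm, 'k :: field, 'z) moncat_scheme" (structure) and ldual lev lcoev
begin

lemma ldual_typing [simp]:
  assumes "X \<in> obj C"
  shows "ldual X \<in> obj C" "lev X \<in> arr C" "src C (lev X) = ldual X \<otimes>\<^sub>o X" "tgt C (lev X) = \<I>"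
    "lcoev X \<in> arr C" "src C (lcoev X) = \<I>" "tgt C (lcoev X) = X \<otimes>\<^sub>o ldual X"
  using is_left_dualD[OF left_dual[OF assms] assms] by auto

lemma zigzag_left:
  assumes "X \<in> obj C"
  shows "runitor C X \<cdot> (ident C X \<otimes>\<^sub>m lev X) \<cdot> associator C X (ldual X) X \<cdot>
       (lcoev X \<otimes>\<^sub>m ident C X) \<cdot> inv_arr C (lunitor C X) = ident C X"
  using left_dual[OF assms] by (simp add: is_left_dual_def)

lemma ldual_arr_typing [simp]:
  assumes "f \<in> arr C"
  shows "ldual_arr f \<in> arr C" "src C (ldual_arr f) = ldual (tgt C f)" "tgt C (ldual_arr f) =
        ldual (src C f)"
  using assms by (simp_all add: ldual_arr_def Let_def)

text \<open>The dual arrow is defined by a zigzag, but this dinaturality of \<open>lcoev\<close>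
  already determines it (\<open>ldual_arr_unique\<close>). Functoriality, faithfulness, fullness and
  additivity of duality are read off from it.\<close>

lemma ldual_arr_coev:
  assumes f: "f \<in> arr C"
  shows "(ident C (tgt C f) \<otimes>\<^sub>m ldual_arr f) \<cdot> lcoev (tgt C f) =
    (f \<otimes>\<^sub>m ident C (ldual (src C f))) \<cdot> lcoev (src C f)"
proof -
  interpret R: lin_action C "regular C" by (rule lin_action_regular)
  let ?X = "src C f" and ?Y = "tgt C f"
  let ?k = "(f \<otimes>\<^sub>m ident C (ldual ?X)) \<cdot> lcoev ?X"
  let ?c = "R.adj_counit ?Y (ldual ?Y) (lev ?Y) (ldual ?X)"
  have d: "is_left_dual C ?Y (ldual ?Y) (lev ?Y) (lcoev ?Y)" using left_dual f by simp
  have l: "ldual_arr f = ?c \<cdot> (ident C (ldual ?Y) \<otimes>\<^sub>m ?k) \<cdot> inv_arr C (runitor C (ldual ?Y))"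
    using f by (simp add: ldual_arr_def R.adj_counit_def regular_simps Let_def)
  have "(ident C ?Y \<otimes>\<^sub>m ldual_arr f) \<cdot> lcoev ?Y =
    (ident C ?Y \<otimes>\<^sub>m (ldual_arr f \<cdot> runitor C (ldual ?Y))) \<cdot> R.adj_unit ?Y (ldual ?Y) (lcoev ?Y) \<I>"
    using left_adj_unit[OF d, of "ldual_arr f"] f by (simp add: R.adj_unit_def regular_simps)
  also have "ldual_arr f \<cdot> runitor C (ldual ?Y) = ?c \<cdot> (ident C (ldual ?Y) \<otimes>\<^sub>m ?k)"
    unfolding l using f R.adj_counit_typing[OF d, of "ldual ?X"] by (simp add: regular_simps)
  also have "(ident C ?Y \<otimes>\<^sub>m (?c \<cdot> (ident C (ldual ?Y) \<otimes>\<^sub>m ?k))) \<cdot> R.adj_unit ?Y (ldual ?Y) (lcoev ?Y) \<I>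
        =
    (ident C ?Y \<otimes>\<^sub>m ?c) \<cdot> ((ident C ?Y \<otimes>\<^sub>m (ident C (ldual ?Y) \<otimes>\<^sub>m ?k)) \<cdot>
          R.adj_unit ?Y (ldual ?Y) (lcoev ?Y) \<I>)"
    using f R.adj_counit_typing[OF d, of "ldual ?X"] R.adj_unit_typing[OF d, of \<I>]
    by (simp add: regular_simps)
  also have "\<dots> = (ident C ?Y \<otimes>\<^sub>m ?c) \<cdot> (R.adj_unit ?Y (ldual ?Y) (lcoev ?Y) (?Y \<otimes>\<^sub>o ldual ?X) \<cdot> ?k)"
    using R.adj_unit_nat[OF d, of ?k] f by (simp add: regular_simps)
  also have "\<dots> = ((ident C ?Y \<otimes>\<^sub>m ?c) \<cdot> R.adj_unit ?Y (ldual ?Y) (lcoev ?Y) (?Y \<otimes>\<^sub>o ldual ?X)) \<cdot> ?k"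
    using f R.adj_counit_typing[OF d, of "ldual ?X"] R.adj_unit_typing[OF d, of "?Y \<otimes>\<^sub>o ldual ?X"]
    by (simp add: regular_simps)
  also have "\<dots> = ?k" using R.adj_triangle_left[OF d, of "ldual ?X"] f by (simp add: regular_simps)
  finally show ?thesis .
qed

lemma ldual_arr_unique:
  assumes "f \<in> arr C" "g \<in> arr C" "src C g = ldual (tgt C f)" "tgt C g = ldual (src C f)"
    "(ident C (tgt C f) \<otimes>\<^sub>m g) \<cdot> lcoev (tgt C f) = (f \<otimes>\<^sub>m ident C (ldual (src C f))) \<cdot> lcoev (src C f)"
  shows "g = ldual_arr f"
  using dual_inj[OF left_dual[of "tgt C f"], of g "ldual_arr f"] ldual_arr_coev[of f] assms by simp

lemma ldual_arr_cmp:
  assumes "f \<in> arr C" "g \<in> arr C" "tgt C f = src C g"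
  shows "ldual_arr (g \<cdot> f) = ldual_arr f \<cdot> ldual_arr g"
proof (rule ldual_arr_unique[symmetric])
  let ?X = "src C f" and ?Y = "tgt C f" and ?Z = "tgt C g"
  have "(ident C ?Z \<otimes>\<^sub>m (ldual_arr f \<cdot> ldual_arr g)) \<cdot> lcoev ?Z =
    (ident C ?Z \<otimes>\<^sub>m ldual_arr f) \<cdot> ((ident C ?Z \<otimes>\<^sub>m ldual_arr g) \<cdot> lcoev ?Z)" using assms by simp
  also have "\<dots> = (ident C ?Z \<otimes>\<^sub>m ldual_arr f) \<cdot> ((g \<otimes>\<^sub>m ident C (ldual ?Y)) \<cdot> lcoev ?Y)"
    using ldual_arr_coev[OF assms(2)] assms(3) by simp
  also have "\<dots> = (g \<otimes>\<^sub>m ident C (ldual ?X)) \<cdot> ((ident C ?Y \<otimes>\<^sub>m ldual_arr f) \<cdot> lcoev ?Y)"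
    using assms by simp
  also have "\<dots> = ((g \<cdot> f) \<otimes>\<^sub>m ident C (ldual ?X)) \<cdot> lcoev ?X"
    unfolding ldual_arr_coev[OF assms(1)] using assms by simp
  finally show "(ident C (tgt C (g \<cdot> f)) \<otimes>\<^sub>m (ldual_arr f \<cdot> ldual_arr g)) \<cdot> lcoev (tgt C (g \<cdot> f)) =
    ((g \<cdot> f) \<otimes>\<^sub>m ident C (ldual (src C (g \<cdot> f)))) \<cdot> lcoev (src C (g \<cdot> f))" using assms by simp
qed (use assms in auto)

lemma ldual_arr_ident [simp]: "X \<in> obj C \<Longrightarrow> ldual_arr (ident C X) = ident C (ldual X)"
  by (rule ldual_arr_unique[symmetric]) auto

lemma ldual_arr_faithful:
  assumes "f \<in> arr C" "g \<in> arr C" "src C f = src C g" "tgt C f = tgt C g" "ldual_arr f = ldual_arr g"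
  shows "f = g"
  using ldual_arr_coev[OF assms(1)] ldual_arr_coev[OF assms(2)] assms
  by - (rule dual_inj_left[OF left_dual[of "src C f"]], auto)

lemma ldual_arr_full:
  assumes "g \<in> arr C" "src C g = ldual Y" "tgt C g = ldual X" "X \<in> obj C" "Y \<in> obj C"
  obtains f where "f \<in> arr C" "src C f = X" "tgt C f = Y" "ldual_arr f = g"
proof -
  obtain f where "f \<in> arr C" "src C f = X" "tgt C f = Y"
    "(f \<otimes>\<^sub>m ident C (ldual X)) \<cdot> lcoev X = (ident C Y \<otimes>\<^sub>m g) \<cdot> lcoev Y"
    using dual_surj_left[OF left_dual[OF assms(4)] assms(4), of "(ident C Y \<otimes>\<^sub>m g) \<cdot> lcoev Y" Y] assms
    by auto
  then show ?thesis using that ldual_arr_unique[of f g] assms by simp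
qed

lemma ldual_arr_zero [simp]:
  assumes "A \<in> obj C" "B \<in> obj C"
  shows "ldual_arr (zero_arr C A B) = zero_arr C (ldual B) (ldual A)"
  by (rule ldual_arr_unique[symmetric]) (use assms in auto)

lemma ldual_iso:
  assumes "is_iso C f"
  shows "is_iso C (ldual_arr f)"
  using assms ldual_arr_cmp[of f "inv_arr C f"] ldual_arr_cmp[of "inv_arr C f" f]
  by (intro isoI(1)[of _ "ldual_arr (inv_arr C f)"]) auto

text \<open>Both sides have the same transpose under the adjunction for \<open>tgt C f\<close>,
  namely \<open>f\<close> followed by the inverse of the right unitor.\<close>

lemma lev_dinatural:
  assumes f: "f \<in> arr C"
  shows "lev (src C f) \<cdot> (ldual_arr f \<otimes>\<^sub>m ident C (src C f)) =
        lev (tgt C f) \<cdot> (ident C (ldual (tgt C f)) \<otimes>\<^sub>m f)"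
proof -
  let ?X = "src C f" and ?Y = "tgt C f"
  let ?a = "associator C ?Y (ldual ?Y) ?X" and ?l = "inv_arr C (lunitor C ?X)"
  have aX: "associator C ?X (ldual ?X) ?X \<in> arr C" using f by simp
  have zz: "(ident C X \<otimes>\<^sub>m lev X) \<cdot> associator C X (ldual X) X \<cdot> (lcoev X \<otimes>\<^sub>m ident C X) \<cdot>
        inv_arr C (lunitor C X) =
    inv_arr C (runitor C X)" if X: "X \<in> obj C" for X
  proof -
    let ?t = "(ident C X \<otimes>\<^sub>m lev X) \<cdot> associator C X (ldual X) X \<cdot> (lcoev X \<otimes>\<^sub>m ident C X) \<cdot>
          inv_arr C (lunitor C X)"
    have "inv_arr C (runitor C X) \<cdot> (runitor C X \<cdot> ?t) = inv_arr C (runitor C X) \<cdot> ident C X"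
      by (simp only: zigzag_left[OF X])
    then show ?thesis using X by simp
  qed
  have 1: "(ident C ?Y \<otimes>\<^sub>m (lev ?X \<cdot> (ldual_arr f \<otimes>\<^sub>m ident C ?X))) \<cdot> ?a \<cdot> (lcoev ?Y \<otimes>\<^sub>m ident C ?X) \<cdot>
        ?l =
    inv_arr C (runitor C ?Y) \<cdot> f"
  proof -
    have "(ident C ?Y \<otimes>\<^sub>m (lev ?X \<cdot> (ldual_arr f \<otimes>\<^sub>m ident C ?X))) \<cdot> ?a \<cdot> (lcoev ?Y \<otimes>\<^sub>m ident C ?X) \<cdot>
          ?l =
      (ident C ?Y \<otimes>\<^sub>m lev ?X) \<cdot> ((ident C ?Y \<otimes>\<^sub>m (ldual_arr f \<otimes>\<^sub>m ident C ?X)) \<cdot> ?a) \<cdot>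
            (lcoev ?Y \<otimes>\<^sub>m ident C ?X) \<cdot> ?l"
      using f by simp
    also have "\<dots> = (ident C ?Y \<otimes>\<^sub>m lev ?X) \<cdot> associator C ?Y (ldual ?X) ?X \<cdot>
      (((ident C ?Y \<otimes>\<^sub>m ldual_arr f) \<cdot> lcoev ?Y) \<otimes>\<^sub>m ident C ?X) \<cdot> ?l"
      using assoc_nat[of "ident C ?Y" "ldual_arr f" "ident C ?X", symmetric] f by simp
    also have "\<dots> = (ident C ?Y \<otimes>\<^sub>m lev ?X) \<cdot> (associator C ?Y (ldual ?X) ?X \<cdot>
      ((f \<otimes>\<^sub>m ident C (ldual ?X)) \<otimes>\<^sub>m ident C ?X)) \<cdot> (lcoev ?X \<otimes>\<^sub>m ident C ?X) \<cdot> ?l"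
      unfolding ldual_arr_coev[OF f] using f by simp
    also have "\<dots> = (f \<otimes>\<^sub>m ident C \<I>) \<cdot> (ident C ?X \<otimes>\<^sub>m lev ?X) \<cdot> associator C ?X (ldual ?X) ?X \<cdot>
          (lcoev ?X \<otimes>\<^sub>m ident C ?X) \<cdot> ?l"
      using assoc_nat[of f "ident C (ldual ?X)" "ident C ?X"] f by simp
    also have "\<dots> = (f \<otimes>\<^sub>m ident C \<I>) \<cdot> inv_arr C (runitor C ?X)" using zz[of ?X] f by simp
    also have "\<dots> = inv_arr C (runitor C ?Y) \<cdot> f"
      using inv_square[OF runitor_nat[OF f]] f by simp
    finally show ?thesis .
  qed
  have 2: "(ident C ?Y \<otimes>\<^sub>m (lev ?Y \<cdot> (ident C (ldual ?Y) \<otimes>\<^sub>m f))) \<cdot> ?a \<cdot> (lcoev ?Y \<otimes>\<^sub>m ident C ?X) \<cdot>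
        ?l =
    inv_arr C (runitor C ?Y) \<cdot> f"
  proof -
    have "(ident C ?Y \<otimes>\<^sub>m (lev ?Y \<cdot> (ident C (ldual ?Y) \<otimes>\<^sub>m f))) \<cdot> ?a \<cdot> (lcoev ?Y \<otimes>\<^sub>m ident C ?X) \<cdot> ?l =
      (ident C ?Y \<otimes>\<^sub>m lev ?Y) \<cdot> ((ident C ?Y \<otimes>\<^sub>m (ident C (ldual ?Y) \<otimes>\<^sub>m f)) \<cdot> ?a) \<cdot>
            (lcoev ?Y \<otimes>\<^sub>m ident C ?X) \<cdot> ?l"
      using f by simp
    also have "\<dots> = (ident C ?Y \<otimes>\<^sub>m lev ?Y) \<cdot> associator C ?Y (ldual ?Y) ?Y \<cdot> (lcoev ?Y \<otimes>\<^sub>m ident C ?Y) \<cdot>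
          (ident C \<I> \<otimes>\<^sub>m f) \<cdot> ?l"
      using assoc_nat[of "ident C ?Y" "ident C (ldual ?Y)" f, symmetric] f by simp
    also have "(ident C \<I> \<otimes>\<^sub>m f) \<cdot> ?l = inv_arr C (lunitor C ?Y) \<cdot> f"
      using inv_square[OF lunitor_nat[OF f]] f by simp
    also have "(ident C ?Y \<otimes>\<^sub>m lev ?Y) \<cdot> associator C ?Y (ldual ?Y) ?Y \<cdot> (lcoev ?Y \<otimes>\<^sub>m ident C ?Y) \<cdot>
          (inv_arr C (lunitor C ?Y) \<cdot> f) =
      ((ident C ?Y \<otimes>\<^sub>m lev ?Y) \<cdot> associator C ?Y (ldual ?Y) ?Y \<cdot> (lcoev ?Y \<otimes>\<^sub>m ident C ?Y) \<cdot>
            inv_arr C (lunitor C ?Y)) \<cdot> f"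
      using f by (simp del: interchange interchange')
    also have "\<dots> = inv_arr C (runitor C ?Y) \<cdot> f" by (simp only: zz f tgt_obj)
    finally show ?thesis .
  qed
  show ?thesis
    by (rule left_adj_inj[OF left_dual[of ?Y], where A = ?X]) (use f in \<open>simp_all add: 1 2\<close>)
qed

lemma ldual_arr_add:
  assumes "f \<in> arr C" "g \<in> arr C" "src C f = src C g" "tgt C f = tgt C g"
  shows "ldual_arr (add_arr C f g) = add_arr C (ldual_arr f) (ldual_arr g)"
proof (rule ldual_arr_unique[symmetric])
  let ?X = "src C g" and ?Y = "tgt C g"
  have "ident C ?Y \<otimes>\<^sub>m add_arr C (ldual_arr f) (ldual_arr g) =
    add_arr C (ident C ?Y \<otimes>\<^sub>m ldual_arr f) (ident C ?Y \<otimes>\<^sub>m ldual_arr g)"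
    using assms by (intro tens_add_right[of _ ?Y ?Y _ "ldual ?Y" "ldual ?X"]) (auto simp: Hom_iff)
  moreover have "add_arr C f g \<otimes>\<^sub>m ident C (ldual ?X) =
    add_arr C (f \<otimes>\<^sub>m ident C (ldual ?X)) (g \<otimes>\<^sub>m ident C (ldual ?X))"
    using assms by (intro tens_add_left[of _ ?X ?Y _ _ "ldual ?X" "ldual ?X"]) (auto simp: Hom_iff)
  ultimately show "(ident C (tgt C (add_arr C f g)) \<otimes>\<^sub>m add_arr C (ldual_arr f) (ldual_arr g)) \<cdot>
        lcoev (tgt C (add_arr C f g)) =
    (add_arr C f g \<otimes>\<^sub>m ident C (ldual (src C (add_arr C f g)))) \<cdot> lcoev (src C (add_arr C f g))"
    using assms ldual_arr_coev[OF assms(1)] ldual_arr_coev[OF assms(2)] by (simp add: cmp_add_arr_left)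
qed (use assms in auto)

text \<open>\<open>?k\<close> is inverted by the arrow \<open>g\<close> whose transpose is the
  inverse left unitor: \<open>g \<cdot> ?k\<close> is an identity by the choice of \<open>g\<close>,
  and \<open>?k \<cdot> g\<close> is one because its transpose is the coevaluation.\<close>

lemma lcoev_unit_iso: "is_iso C (lcoev \<I>)"
proof -
  let ?k = "lunitor C (ldual \<I>) \<cdot> lcoev \<I>"
  have eq: "lunitor C (tgt C g) \<cdot> ((ident C \<I> \<otimes>\<^sub>m g) \<cdot> lcoev \<I>) = g \<cdot> ?k"
    if "g \<in> arr C" "src C g = ldual \<I>" for g
    using lunitor_nat[OF that(1)] that by (simp flip: cmp_assoc_arr)
  obtain g where g: "g \<in> arr C" "src C g = ldual \<I>" "tgt C g = \<I>"
    "(ident C \<I> \<otimes>\<^sub>m g) \<cdot> lcoev \<I> = inv_arr C (lunitor C \<I>)"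
    using dual_surj[OF left_dual[OF unit_obj], of "inv_arr C (lunitor C \<I>)" \<I>] by auto
  have gk: "g \<cdot> ?k = ident C \<I>" using eq[OF g(1,2)] g by simp
  have "lunitor C (ldual \<I>) \<cdot> ((ident C \<I> \<otimes>\<^sub>m (?k \<cdot> g)) \<cdot> lcoev \<I>) = (?k \<cdot> g) \<cdot> ?k"
    using eq[of "?k \<cdot> g"] g(1-3) by simp
  also have "\<dots> = ?k \<cdot> (g \<cdot> ?k)" using g(1-3) by simp
  also have "\<dots> = lunitor C (ldual \<I>) \<cdot> ((ident C \<I> \<otimes>\<^sub>m ident C (ldual \<I>)) \<cdot> lcoev \<I>)"
    unfolding gk by simp
  finally have "(ident C \<I> \<otimes>\<^sub>m (?k \<cdot> g)) \<cdot> lcoev \<I> = (ident C \<I> \<otimes>\<^sub>m ident C (ldual \<I>)) \<cdot> lcoev \<I>"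
    using g(1-3) by - (rule monoD[OF iso_mono[of "lunitor C (ldual \<I>)"]], auto)
  then have "?k \<cdot> g = ident C (ldual \<I>)"
    using g(1-3) by - (rule dual_inj[OF left_dual[OF unit_obj]], auto)
  then have "is_iso C ?k" using gk g(1-3) by (intro isoI(1)[of _ g]) auto
  then have "is_iso C (inv_arr C (lunitor C (ldual \<I>)) \<cdot> ?k)" by - (rule iso_cmp, auto)
  then show ?thesis by simp
qed

end

section \<open>Projective covers and the character wedge\<close>

context linear_category
begin

lemma mono_zero:
  assumes "is_mono C m" "g \<in> arr C" "tgt C g = src C m" "m \<cdot> g = zero_arr C (src C g) (tgt C m)"
  shows "g = zero_arr C (src C g) (src C m)"
  using assms unfolding mono_iff_zero by blast

lemma epi_zero:
  assumes "is_epi C e" "g \<in> arr C" "src C g = tgt C e" "g \<cdot> e = zero_arr C (src C e) (tgt C g)"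
  shows "g = zero_arr C (tgt C e) (tgt C g)"
  using assms unfolding epi_iff_zero by blast

end

section \<open>Projective covers\<close>

context abelian_category
begin

lemma projective_lift:
  assumes "projective C P" "is_epi C e" "f \<in> arr C" "src C f = P" "tgt C f = tgt C e"
  obtains h where "h \<in> arr C" "src C h = P" "tgt C h = src C e" "e \<cdot> h = f"
proof -
  have "f \<in> Hom C P (tgt C e)" using assms by (simp add: Hom_iff)
  then have "\<exists>h\<in>Hom C P (src C e). e \<cdot> h = f" using assms(1,2) unfolding projective_def by blast
  then show ?thesis using that by (auto simp: Hom_iff)
qed

lemma projective_retract:
  assumes P: "projective C P" and ab: "a \<in> arr C" "b \<in> arr C" "src C a = P" "tgt C a = N"
    "src C b = N" "tgt C b = P" "a \<cdot> b = ident C N"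
  shows "projective C N"
  unfolding projective_def
proof (intro conjI allI impI)
  show "N \<in> obj C" using ab tgt_obj by blast
  fix g f assume gf: "is_epi C g \<and> f \<in> Hom C N (tgt C g)"
  then obtain h where h: "h \<in> arr C" "src C h = P" "tgt C h = src C g" "g \<cdot> h = f \<cdot> a"
    using projective_lift[OF P, of g "f \<cdot> a"] ab by (auto simp: Hom_iff)
  have "g \<cdot> (h \<cdot> b) = (g \<cdot> h) \<cdot> b" using gf h(1-3) ab by (simp add: Hom_iff)
  also have "\<dots> = f" unfolding h(4) using gf ab by (simp add: Hom_iff)
  finally show "\<exists>h\<in>Hom C N (src C g). g \<cdot> h = f"
    using h ab by (intro bexI[of _ "h \<cdot> b"]) (auto simp: Hom_iff)
qed

lemma nonzero_simple_quotient:
  assumes "has_finite_length C A" "A \<in> obj C" "\<not> zero_object C A"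
  obtains p where "is_epi C p" "src C p = A" "simple_object C (tgt C p)"
  using assms(1)
proof cases
  case (extend f g)
  then show ?thesis using that cokernelD[of f g] by (auto simp: short_exact_def)
qed (use assms in simp)

lemma epi_zero_object:
  assumes "is_epi C p" "p = zero_arr C (src C p) (tgt C p)"
  shows "zero_object C (tgt C p)"
proof -
  have "ident C (tgt C p) \<cdot> p = zero_arr C (tgt C p) (tgt C p) \<cdot> p"
    using arg_cong[OF assms(2), of "\<lambda>x. ident C (tgt C p) \<cdot> x"] assms(1) by simp
  then have "ident C (tgt C p) = zero_arr C (tgt C p) (tgt C p)"
    using assms(1) by - (rule epiD[OF assms(1)], auto)
  then show ?thesis using zero_object_iff assms(1) by simp
qed

lemma simple_object_iso:
  assumes S: "simple_object C S" and i: "is_iso C i" "src C i = S" "tgt C i = T"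
  shows "simple_object C T"
  unfolding simple_object_def
proof (intro conjI allI impI)
  show "T \<in> obj C" using i tgt_obj is_isoD(1) by blast
  have "ident C T \<noteq> zero_arr C T T"
  proof
    assume "ident C T = zero_arr C T T"
    then have "inv_arr C i \<cdot> (ident C T \<cdot> i) = inv_arr C i \<cdot> (zero_arr C T T \<cdot> i)"
      by (rule arg_cong)
    then show False using i simple_objectD(1,2)[OF S] zero_object_iff[of S] \<open>T \<in> obj C\<close> by simp
  qed
  then show "\<not> zero_object C T" using zero_object_iff \<open>T \<in> obj C\<close> by simp
  fix f assume f: "is_mono C f \<and> tgt C f = T"
  then have m: "is_mono C (inv_arr C i \<cdot> f)" using i iso_mono by (intro mono_cmp) auto
  have "is_iso C f" if "is_iso C (inv_arr C i \<cdot> f)"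
  proof -
    have "is_iso C (i \<cdot> (inv_arr C i \<cdot> f))" by (rule iso_cmp[OF that i(1)]) (use f i in simp)
    then show ?thesis using i f by simp
  qed
  then show "zero_object C (src C f) \<or> is_iso C f"
    using simple_objectD(3)[OF S m] f i by auto
qed

text \<open>A projective cover, phrased as an essential epi: an arrow into \<open>Q\<close> that
  becomes epi after \<open>q\<close> is epi already. No radical or maximal subobject has to be
  formed.\<close>

definition local_cover :: "'a \<Rightarrow> 'b \<Rightarrow> bool" where
  "local_cover Q q \<longleftrightarrow> projective C Q \<and> is_epi C q \<and> src C q = Q \<and>
     (\<forall>g. g \<in> arr C \<and> tgt C g = Q \<and> is_epi C (q \<cdot> g) \<longrightarrow> is_epi C g)"

lemma local_coverD:
  assumes "local_cover Q q"
  shows "projective C Q" "is_epi C q" "src C q = Q" "q \<in> arr C" "Q \<in> obj C"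
    "\<And>g. \<lbrakk>g \<in> arr C; tgt C g = Q; is_epi C (q \<cdot> g)\<rbrakk> \<Longrightarrow> is_epi C g"
  using assms epi_arr unfolding local_cover_def projective_def by blast+

text \<open>\<open>q\<close> kills the kernel \<open>k\<close> of \<open>p\<close>: otherwise
  \<open>q \<cdot> k\<close> is epi onto the simple target, so \<open>k\<close> is epi by the
  covering property, and \<open>p = 0\<close>. Thus every nonzero quotient of \<open>Q\<close> still
  maps onto the simple top.\<close>

lemma local_cover_quotient:
  assumes q: "local_cover Q q" "simple_object C (tgt C q)"
    and p: "is_epi C p" "src C p = Q" "\<not> zero_object C (tgt C p)"
  obtains u where "u \<in> arr C" "src C u = tgt C p" "tgt C u = tgt C q" "u \<cdot> p = q"
proof -
  note qD = local_coverD[OF q(1)]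
  obtain k where k: "is_kernel C p k" using ex_kernel p(1) epi_arr by blast
  note k' = kernelD[OF k]
  have "q \<cdot> k = zero_arr C (src C k) (tgt C q)"
  proof (rule ccontr)
    assume nz: "q \<cdot> k \<noteq> zero_arr C (src C k) (tgt C q)"
    then have "is_epi C (q \<cdot> k)"
      using nonzero_into_simple_epi[of "q \<cdot> k"] q(2) qD k' p by simp
    then have "is_epi C k" using qD(6)[of k] k' p by simp
    then have i: "is_iso C k" using mono_epi_iso k' by blast
    have "(p \<cdot> k) \<cdot> inv_arr C k = p" using k'(1-3) i p by simp
    moreover have "(p \<cdot> k) \<cdot> inv_arr C k = zero_arr C (src C p) (tgt C p)" using k' i p by simp
    ultimately have "p = zero_arr C (src C p) (tgt C p)" by (rule trans[OF sym])
    then show False using epi_zero_object p by blast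
  qed
  then show ?thesis
    using cokernel_factor[OF epi_cokernel_of_kernel[OF p(1) k], of q] that k' qD p by auto
qed

lemma zero_if_factor_zero:
  assumes "m \<in> arr C" "p \<in> arr C" "tgt C p = src C m" "zero_object C (src C m)"
  shows "m \<cdot> p = zero_arr C (src C p) (tgt C m)"
  using arg_cong[OF zero_object_zero_arr(1)[OF assms(4,1)], of "\<lambda>x. x \<cdot> p"] assms by simp

end

context finite_abelian_category
begin

lemma fd_Hom: "\<lbrakk>A \<in> obj C; B \<in> obj C\<rbrakk> \<Longrightarrow> fd_space (hom_space C A B)"
  by (intro fd_space.intro fd_space_axioms.intro vec_space_Hom Hom_fin_dim)

lemma mono_vdim_le:
  assumes m: "is_mono C m" and P: "P \<in> obj C"
  shows "vdim (hom_space C P (src C m)) \<le> vdim (hom_space C P (tgt C m))"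
proof -
  have ma: "m \<in> arr C" using m by simp
  have lin: "linear_map (hom_space C P (src C m)) (hom_space C P (tgt C m)) ((\<cdot>) m)"
    using linear_map_cmp_left[OF ma] by simp
  have "v = \<zero>\<^bsub>hom_space C P (src C m)\<^esub>"
    if "v \<in> carrier (hom_space C P (src C m))" "m \<cdot> v = \<zero>\<^bsub>hom_space C P (tgt C m)\<^esub>" for v
    using mono_zero[OF m, of v] that by (simp add: Hom_iff)
  from linear_map_inj_vdim_le[OF fd_Hom[OF P src_obj[OF ma]] fd_Hom[OF P tgt_obj[OF ma]] lin this]
  show ?thesis by blast
qed

text \<open>Postcomposition with a mono is injective on arrows out of \<open>P\<close>; if the
  dimension does not grow, it is also surjective.\<close>

lemma mono_vdim_surj:
  assumes "is_mono C m" "P \<in> obj C" "vdim (hom_space C P (tgt C m)) \<le> vdim (hom_space C P (src C m))"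
    "g \<in> arr C" "src C g = P" "tgt C g = tgt C m"
  obtains u where "u \<in> arr C" "src C u = P" "tgt C u = src C m" "m \<cdot> u = g"
proof (rule linear_map_inj_surj[OF fd_Hom fd_Hom, where T = "\<lambda>f. m \<cdot> f" and w = g])
  show "linear_map (hom_space C P (src C m)) (hom_space C P (tgt C m)) ((\<cdot>) m)"
    using linear_map_cmp_left assms by simp
  fix v assume "v \<in> carrier (hom_space C P (src C m))"
    "m \<cdot> v = \<zero>\<^bsub>hom_space C P (tgt C m)\<^esub>"
  then show "v = \<zero>\<^bsub>hom_space C P (src C m)\<^esub>"
    using mono_zero[OF assms(1), of v] by (simp add: Hom_iff)
next
  fix v assume "v \<in> carrier (hom_space C P (src C m))" "m \<cdot> v = g"
  then show thesis using that by (auto simp: Hom_iff)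
qed (use assms in \<open>auto simp: Hom_iff\<close>)

text \<open>Precomposition with \<open>e\<close> is an injective endomorphism of a
  finite-dimensional endomorphism algebra, so the identity has the form
  \<open>r \<cdot> e\<close>.\<close>

lemma epi_endo_iso:
  assumes e: "is_epi C e" "tgt C e = src C e"
  shows "is_iso C e"
proof -
  let ?A = "src C e"
  have A: "?A \<in> obj C" using e by simp
  obtain r where "r \<in> Hom C ?A ?A" "r \<cdot> e = ident C ?A"
  proof (rule linear_map_inj_surj[OF fd_Hom fd_Hom, where T = "\<lambda>f. f \<cdot> e" and w = "ident C ?A"])
    show "linear_map (hom_space C ?A ?A) (hom_space C ?A ?A) (\<lambda>f. f \<cdot> e)"
      using linear_map_cmp_right[of e ?A ?A ?A] e by simp
    fix v assume "v \<in> carrier (hom_space C ?A ?A)" "v \<cdot> e = \<zero>\<^bsub>hom_space C ?A ?A\<^esub>"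
    then show "v = \<zero>\<^bsub>hom_space C ?A ?A\<^esub>"
      using epi_zero[OF e(1), of v] e(2) by (simp add: Hom_iff)
  qed (use A in \<open>auto simp: Hom_iff\<close>)
  then show ?thesis using epi_split_mono_iso[OF e(1), of r] e by (auto simp: Hom_iff)
qed

text \<open>
  Among the subobjects \<open>N\<close> of a projective \<open>P\<close> that still cover the target, one minimising
  \<open>dim Hom(P, N)\<close> may be replaced by the image of a lift \<open>P \<rightarrow> N\<close>; this image is the cover.
\<close>

lemma ex_local_cover:
  assumes A: "A \<in> obj C"
  obtains Q q where "local_cover Q q" "tgt C q = A"
proof -
  obtain q where q: "is_epi C q" "tgt C q = A" "projective C (src C q)"
    using enough_projectives[OF A] by blast
  let ?P = "src C q"
  let ?S = "\<lambda>j. is_mono C j \<and> tgt C j = ?P \<and> is_epi C (q \<cdot> j)"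
  let ?d = "\<lambda>j. vdim (hom_space C ?P (src C j))"
  have P: "?P \<in> obj C" and qa: "q \<in> arr C" using q by auto
  have "?S (ident C ?P)" using q P iso_mono by simp
  then obtain j where j: "?S j" and min: "\<And>j'. ?S j' \<Longrightarrow> ?d j \<le> ?d j'"
    using ex_has_least_nat[of ?S "ident C ?P" ?d] by blast
  have ja: "j \<in> arr C" using j by simp
  \<comment> \<open>\<open>q\<close> is lifted through its own restriction to the minimal subobject
    \<open>src C j\<close>; the image of the lift is the candidate.\<close>
  obtain s where s: "s \<in> arr C" "src C s = ?P" "tgt C s = src C j" "(q \<cdot> j) \<cdot> s = q"
    using projective_lift[OF q(3), of "q \<cdot> j" q] j q ja by auto
  obtain p m where pm: "is_epi C p" "is_mono C m" "src C p = ?P" "tgt C m = src C j"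
    "tgt C p = src C m" "m \<cdot> p = s"
    using epi_mono_factorization[OF s(1)] s by metis
  have pa: "p \<in> arr C" and ma: "m \<in> arr C" using pm by auto
  define i where "i = j \<cdot> m"
  have i: "is_mono C i" "i \<in> arr C" "src C i = src C m" "tgt C i = ?P"
    using mono_cmp[OF pm(2), of j] j pm ja ma by (auto simp: i_def)
  have qip: "(q \<cdot> i) \<cdot> p = q"
  proof -
    have "(q \<cdot> i) \<cdot> p = (q \<cdot> j) \<cdot> (m \<cdot> p)" using j pm(3-5) ja ma pa qa by (simp add: i_def)
    then show ?thesis using s(4) pm(6) by simp
  qed
  have qi: "is_epi C (q \<cdot> i)"
  proof (rule epi_left[of _ p])
    show "is_epi C ((q \<cdot> i) \<cdot> p)" unfolding qip by (rule q(1))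
  qed (use i pm pa qa in auto)
  have di: "?d i \<le> ?d j" using mono_vdim_le[OF pm(2) P] i pm by simp
  have local: "is_epi C g" if g: "g \<in> arr C" "tgt C g = src C i" "is_epi C ((q \<cdot> i) \<cdot> g)" for g
  proof -
    obtain p' m' where pm': "is_epi C p'" "is_mono C m'" "src C p' = src C g" "tgt C m' = src C i"
      "tgt C p' = src C m'" "m' \<cdot> p' = g"
      using epi_mono_factorization[OF g(1)] g by metis
    have pa': "p' \<in> arr C" and ma': "m' \<in> arr C" using pm' by auto
    have im: "is_mono C (i \<cdot> m')" using mono_cmp[OF pm'(2) i(1)] pm' by simp
    have "is_epi C ((q \<cdot> (i \<cdot> m')) \<cdot> p')"
      using g(3) pm'(3-5) i(2-4) pa' ma' qa unfolding pm'(6)[symmetric] by simp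
    then have "is_epi C (q \<cdot> (i \<cdot> m'))"
      using pm'(3-5) i(2-4) pa' ma' qa by - (rule epi_left[of _ p'], auto)
    \<comment> \<open>The image of \<open>g\<close> also covers the target, so by minimality it
      loses no dimension; hence \<open>p\<close> factors through \<open>m'\<close>, and
      \<open>m'\<close> is epi because \<open>p\<close> is.\<close>
    then have "?d j \<le> ?d (i \<cdot> m')" using min[of "i \<cdot> m'"] im pm'(4) i(2-4) ma' by simp
    then have "vdim (hom_space C ?P (tgt C m')) \<le> vdim (hom_space C ?P (src C m'))"
      using di pm'(4) i(2-4) ma' by simp
    then obtain u where u: "u \<in> arr C" "src C u = ?P" "tgt C u = src C m'" "m' \<cdot> u = p"
      using mono_vdim_surj[OF pm'(2) P _ pa] pm pm' i by metis
    have "is_epi C m'"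
      using pm(1) u ma' unfolding u(4)[symmetric] by - (rule epi_left[of _ u], auto)
    then have "is_epi C (m' \<cdot> p')" using pm' by (intro epi_cmp) auto
    then show ?thesis using pm' by simp
  qed
  \<comment> \<open>The covering property, applied to \<open>p \<cdot> i\<close> itself, makes this
    endomorphism epi and hence invertible. So \<open>src C i\<close> is a retract of the projective
    \<open>?P\<close>.\<close>
  have "is_epi C (p \<cdot> i)"
  proof (rule local)
    have "(q \<cdot> i) \<cdot> (p \<cdot> i) = ((q \<cdot> i) \<cdot> p) \<cdot> i" using i pm pa qa by simp
    then show "is_epi C ((q \<cdot> i) \<cdot> (p \<cdot> i))" using qip qi by simp
  qed (use i pm pa in auto)
  then have iso: "is_iso C (p \<cdot> i)" using i pm pa by (intro epi_endo_iso) auto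
  have "projective C (src C i)"
  proof (rule projective_retract[OF q(3), of p "i \<cdot> inv_arr C (p \<cdot> i)"])
    have "p \<cdot> (i \<cdot> inv_arr C (p \<cdot> i)) = (p \<cdot> i) \<cdot> inv_arr C (p \<cdot> i)"
      using i pm pa is_isoD[OF iso] by simp
    also have "\<dots> = ident C (src C i)" using is_isoD(6)[OF iso] i pm pa by simp
    finally show "p \<cdot> (i \<cdot> inv_arr C (p \<cdot> i)) = ident C (src C i)" .
  qed (use i pm pa is_isoD[OF iso] in auto)
  then have "local_cover (src C i) (q \<cdot> i)" unfolding local_cover_def using local qi i qa by auto
  then show ?thesis using that[of "src C i" "q \<cdot> i"] i q qa by simp
qed

lemma ex_simple_quotient:
  assumes "A \<in> obj C" "\<not> zero_object C A"
  obtains p where "is_epi C p" "src C p = A" "simple_object C (tgt C p)"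
  using nonzero_simple_quotient[OF finite_length[OF assms(1)] assms] by blast

end

section \<open>Exactness of the tensor product and of duality\<close>

locale rigid_tensor = finite_tensor_category C + rigid_monoidal C ldual lev lcoev
  for C :: "('o, 'm, 'k :: field, 'z) moncat_scheme" (structure) and ldual lev lcoev
begin

lemma tens_mono_right: "\<lbrakk>is_mono C m; X \<in> obj C\<rbrakk> \<Longrightarrow> is_mono C (ident C X \<otimes>\<^sub>m m)"
  using tens_mono_right'[OF left_dual] by blast

lemma tens_kernel_right:
  "\<lbrakk>is_kernel C f k; X \<in> obj C\<rbrakk> \<Longrightarrow> is_kernel C (ident C X \<otimes>\<^sub>m f) (ident C X \<otimes>\<^sub>m k)"
  using tens_kernel_right'[OF left_dual] by blast

text \<open>\<open>X\<close> is itself a left dual of some object, so tensoring with it on the left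
  is a left adjoint as well as a right one. The versions for the other side come from the reversed
  category.\<close>

lemma tens_epi_right:
  assumes "is_epi C e" "X \<in> obj C" shows "is_epi C (ident C X \<otimes>\<^sub>m e)"
proof -
  obtain D ev coev where d: "D \<in> obj C" "is_left_dual C D X ev coev" using ex_right_dual assms by blast
  show ?thesis using tens_epi_right'[OF d(2,1) assms(1)] .
qed

lemma tens_epi_left:
  assumes "is_epi C e" "X \<in> obj C" shows "is_epi C (e \<otimes>\<^sub>m ident C X)"
  using linear_monoidal_category.tens_epi_right'[OF linear_monoidal_rev dual_rev[OF left_dual]] assms
  by (simp add: rev_cat_simps)

lemma tens_mono_left:
  assumes "is_mono C m" "X \<in> obj C" shows "is_mono C (m \<otimes>\<^sub>m ident C X)"
proof -
  obtain D ev coev where d: "D \<in> obj C" "is_left_dual C D X ev coev" using ex_right_dual assms by blast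
  note R = linear_monoidal_category.tens_mono_right'[OF linear_monoidal_rev dual_rev[OF d(2,1)],
      unfolded rev_cat_simps]
  show ?thesis by (rule R[OF assms(2,1)])
qed

lemma tens_kernel_left:
  assumes "is_kernel C f k" "X \<in> obj C"
  shows "is_kernel C (f \<otimes>\<^sub>m ident C X) (k \<otimes>\<^sub>m ident C X)"
proof -
  obtain D ev coev where d: "D \<in> obj C" "is_left_dual C D X ev coev" using ex_right_dual assms by blast
  note R = linear_monoidal_category.tens_kernel_right'[OF linear_monoidal_rev dual_rev[OF d(2,1)],
      unfolded rev_cat_simps]
  show ?thesis by (rule R[OF assms(2,1)])
qed

text \<open>For a right dual \<open>W\<close> of \<open>V\<close>, both \<open>V\<close> and
  \<open>ldual W\<close> are left duals of \<open>W\<close>; two left duals are isomorphic by the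
  arrows compatible with the coevaluations.\<close>

lemma ldual_ess_surj:
  assumes V: "V \<in> obj C"
  obtains W i where "W \<in> obj C" "is_iso C i" "src C i = V" "tgt C i = ldual W"
proof -
  obtain W ev coev where d: "W \<in> obj C" "is_left_dual C W V ev coev" using ex_right_dual[OF V] by blast
  note dt = is_left_dualD[OF d(2,1)]
  obtain i where i: "i \<in> arr C" "src C i = V" "tgt C i = ldual W" "(ident C W \<otimes>\<^sub>m i) \<cdot> coev = lcoev W"
    using dual_surj[OF d(2,1), of "lcoev W" "ldual W"] d(1) by auto
  obtain i' where i': "i' \<in> arr C" "src C i' = ldual W" "tgt C i' = V" "(ident C W \<otimes>\<^sub>m i') \<cdot> lcoev W =
        coev"
    using dual_surj[OF left_dual[OF d(1)] d(1), of coev V] dt by auto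
  have "(ident C W \<otimes>\<^sub>m (i' \<cdot> i)) \<cdot> coev = (ident C W \<otimes>\<^sub>m i') \<cdot> ((ident C W \<otimes>\<^sub>m i) \<cdot> coev)"
    using i(1-3) i'(1-3) dt d(1) by simp
  then have "(ident C W \<otimes>\<^sub>m (i' \<cdot> i)) \<cdot> coev = (ident C W \<otimes>\<^sub>m ident C V) \<cdot> coev"
    using i i' dt d(1) V by simp
  then have 1: "i' \<cdot> i = ident C V"
    using i(1-3) i'(1-3) V by - (rule dual_inj[OF d(2,1)], auto)
  have "(ident C W \<otimes>\<^sub>m (i \<cdot> i')) \<cdot> lcoev W = (ident C W \<otimes>\<^sub>m i) \<cdot> ((ident C W \<otimes>\<^sub>m i') \<cdot> lcoev W)"
    using i(1-3) i'(1-3) dt d(1) by simp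
  then have "(ident C W \<otimes>\<^sub>m (i \<cdot> i')) \<cdot> lcoev W = (ident C W \<otimes>\<^sub>m ident C (ldual W)) \<cdot> lcoev W"
    using i i' dt d(1) V by simp
  then have 2: "i \<cdot> i' = ident C (ldual W)"
    using i(1-3) i'(1-3) d(1) by - (rule dual_inj[OF left_dual[OF d(1)] d(1)], auto)
  have "is_iso C i" using 1 2 i i' by (intro isoI(1)[of _ i']) auto
  then show ?thesis using that d i by blast
qed

text \<open>Duality is contravariant and fully faithful. Once the source of the test arrows is
  replaced by an isomorphic dual \<open>ldual W\<close>, cancelling \<open>ldual_arr e\<close>
  becomes cancelling \<open>e\<close>. The next lemmas on epis and kernels use the same
  transport.\<close>

lemma ldual_mono:
  assumes e: "is_epi C e"
  shows "is_mono C (ldual_arr e)"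
proof (rule monoI)
  fix g h assume gh: "g \<in> arr C" "h \<in> arr C" "src C g = src C h" "tgt C g = src C (ldual_arr e)"
    "tgt C h = src C (ldual_arr e)" and eq: "ldual_arr e \<cdot> g = ldual_arr e \<cdot> h"
  obtain W i where i: "W \<in> obj C" "is_iso C i" "src C i = src C g" "tgt C i = ldual W"
    using ldual_ess_surj[of "src C g"] gh by auto
  obtain a where a: "a \<in> arr C" "src C a = tgt C e" "tgt C a = W" "ldual_arr a = g \<cdot> inv_arr C i"
    using ldual_arr_full[of "g \<cdot> inv_arr C i" W "tgt C e"] gh i e by auto
  obtain b where b: "b \<in> arr C" "src C b = tgt C e" "tgt C b = W" "ldual_arr b = h \<cdot> inv_arr C i"
    using ldual_arr_full[of "h \<cdot> inv_arr C i" W "tgt C e"] gh i e by auto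
  have "(ldual_arr e \<cdot> g) \<cdot> inv_arr C i = (ldual_arr e \<cdot> h) \<cdot> inv_arr C i" by (simp only: eq)
  then have "ldual_arr (a \<cdot> e) = ldual_arr (b \<cdot> e)"
    using a b gh i e by (simp add: ldual_arr_cmp)
  then have "a \<cdot> e = b \<cdot> e" using a(1-3) b(1-3) e by - (rule ldual_arr_faithful, auto)
  then have "a = b" using a(1-3) b(1-3) e by - (rule epiD[OF e], auto)
  then have "g \<cdot> inv_arr C i = h \<cdot> inv_arr C i" using a b by simp
  then show "g = h" using gh i by - (rule epiD[OF iso_epi[of "inv_arr C i"]], auto)
qed (use e in auto)

lemma ldual_epi:
  assumes m: "is_mono C m"
  shows "is_epi C (ldual_arr m)"
proof (rule epiI)
  fix g h assume gh: "g \<in> arr C" "h \<in> arr C" "tgt C g = tgt C h" "src C g = tgt C (ldual_arr m)"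
    "src C h = tgt C (ldual_arr m)" and eq: "g \<cdot> ldual_arr m = h \<cdot> ldual_arr m"
  obtain W i where i: "W \<in> obj C" "is_iso C i" "src C i = tgt C g" "tgt C i = ldual W"
    using ldual_ess_surj[of "tgt C g"] gh by auto
  obtain a where a: "a \<in> arr C" "src C a = W" "tgt C a = src C m" "ldual_arr a = i \<cdot> g"
    using ldual_arr_full[of "i \<cdot> g" "src C m" W] gh i m by auto
  obtain b where b: "b \<in> arr C" "src C b = W" "tgt C b = src C m" "ldual_arr b = i \<cdot> h"
    using ldual_arr_full[of "i \<cdot> h" "src C m" W] gh i m by auto
  have "i \<cdot> (g \<cdot> ldual_arr m) = i \<cdot> (h \<cdot> ldual_arr m)" by (simp only: eq)
  then have "ldual_arr (m \<cdot> a) = ldual_arr (m \<cdot> b)"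
    using a b gh i m by (simp add: ldual_arr_cmp)
  then have "m \<cdot> a = m \<cdot> b" using a(1-3) b(1-3) m by - (rule ldual_arr_faithful, auto)
  then have "a = b" using a(1-3) b(1-3) m by - (rule monoD[OF m], auto)
  then have "i \<cdot> g = i \<cdot> h" using a b by simp
  then show "g = h" using gh i by - (rule monoD[OF iso_mono[of i]], auto)
qed (use m in auto)

lemma epi_of_ldual_mono:
  assumes n: "is_mono C (ldual_arr n)" "n \<in> arr C"
  shows "is_epi C n"
proof (rule epiI)
  fix a b assume ab: "a \<in> arr C" "b \<in> arr C" "tgt C a = tgt C b" "src C a = tgt C n" "src C b = tgt C n"
    "a \<cdot> n = b \<cdot> n"
  then have "ldual_arr n \<cdot> ldual_arr a = ldual_arr n \<cdot> ldual_arr b"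
    using n(2) by (simp flip: ldual_arr_cmp)
  then have "ldual_arr a = ldual_arr b" using ab n(2) by - (rule monoD[OF n(1)], auto)
  then show "a = b" using ab by - (rule ldual_arr_faithful, auto)
qed (use n in auto)

lemma ldual_kernel:
  assumes p: "is_cokernel C f p"
  shows "is_kernel C (ldual_arr f) (ldual_arr p)"
proof (rule kernelI)
  note pD = cokernelD[OF p]
  have pa: "p \<in> arr C" using pD by simp
  show "is_mono C (ldual_arr p)" using ldual_mono pD by blast
  have "ldual_arr f \<cdot> ldual_arr p = ldual_arr (p \<cdot> f)" using pD(1,3) pa by (simp add: ldual_arr_cmp)
  also have "\<dots> = zero_arr C (src C (ldual_arr p)) (tgt C (ldual_arr f))"
    unfolding pD(4) using pD pa by simp
  finally show "ldual_arr f \<cdot> ldual_arr p = zero_arr C (src C (ldual_arr p)) (tgt C (ldual_arr f))" .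
  fix h assume h: "h \<in> arr C" "tgt C h = src C (ldual_arr f)"
    "ldual_arr f \<cdot> h = zero_arr C (src C h) (tgt C (ldual_arr f))"
  obtain W i where i: "W \<in> obj C" "is_iso C i" "src C i = src C h" "tgt C i = ldual W"
    using ldual_ess_surj[of "src C h"] h by auto
  obtain a where a: "a \<in> arr C" "src C a = tgt C f" "tgt C a = W" "ldual_arr a = h \<cdot> inv_arr C i"
    using ldual_arr_full[of "h \<cdot> inv_arr C i" W "tgt C f"] h i pD by auto
  have "ldual_arr (a \<cdot> f) = (ldual_arr f \<cdot> h) \<cdot> inv_arr C i"
    using a(1-3) pD(1) h(1,2) i by (simp add: ldual_arr_cmp a(4))
  also have "\<dots> = ldual_arr (zero_arr C (src C f) W)" using h pD(1) i by simp
  finally have "a \<cdot> f = zero_arr C (src C f) W"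
    using a(1-3) pD(1) i by - (rule ldual_arr_faithful, auto)
  then obtain u where u: "u \<in> arr C" "src C u = tgt C p" "tgt C u = W" "u \<cdot> p = a"
    using cokernel_factor[OF p, of a] a by auto
  have "ldual_arr p \<cdot> (ldual_arr u \<cdot> i) = ldual_arr (u \<cdot> p) \<cdot> i"
    using u(1-3) pa i by (simp add: ldual_arr_cmp)
  also have "\<dots> = h" using u(4) a(4) h(1) i by simp
  finally show "\<exists>u\<in>arr C. tgt C u = src C (ldual_arr p) \<and> ldual_arr p \<cdot> u = h"
    using u pa i by (intro bexI[of _ "ldual_arr u \<cdot> i"]) auto
qed (use cokernelD[OF p] in auto)

lemma zero_object_ldual:
  assumes "X \<in> obj C"
  shows "zero_object C (ldual X) \<longleftrightarrow> zero_object C X"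
proof -
  have "ident C (ldual X) = zero_arr C (ldual X) (ldual X) \<longleftrightarrow> ident C X = zero_arr C X X"
  proof
    assume "ident C (ldual X) = zero_arr C (ldual X) (ldual X)"
    then show "ident C X = zero_arr C X X" using assms by - (rule ldual_arr_faithful, auto)
  next
    assume "ident C X = zero_arr C X X"
    then have "ldual_arr (ident C X) = ldual_arr (zero_arr C X X)" by (rule arg_cong)
    then show "ident C (ldual X) = zero_arr C (ldual X) (ldual X)" using assms by simp
  qed
  then show ?thesis using assms by (simp add: zero_object_iff)
qed

text \<open>A subobject of the dual of \<open>S\<close> is, up to isomorphism, dual to a quotient
  \<open>n\<close> of \<open>S\<close>, which is zero or invertible because \<open>S\<close> is
  simple.\<close>

lemma simple_ldual:
  assumes S: "simple_object C S"
  shows "simple_object C (ldual S)"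
  unfolding simple_object_def
proof (intro conjI allI impI)
  note SD = simple_objectD[OF S]
  show "ldual S \<in> obj C" "\<not> zero_object C (ldual S)" using SD zero_object_ldual by auto
  fix f assume f: "is_mono C f \<and> tgt C f = ldual S"
  then have fa: "f \<in> arr C" by simp
  obtain V i where i: "V \<in> obj C" "is_iso C i" "src C i = src C f" "tgt C i = ldual V"
    using ldual_ess_surj[of "src C f"] fa by auto
  obtain n where n: "n \<in> arr C" "src C n = S" "tgt C n = V" "ldual_arr n = f \<cdot> inv_arr C i"
    using ldual_arr_full[of "f \<cdot> inv_arr C i" V S] f fa i SD by auto
  have "is_mono C (ldual_arr n)" unfolding n(4) using f fa i iso_mono by (intro mono_cmp) auto
  then have e: "is_epi C n" using epi_of_ldual_mono n by blast
  show "zero_object C (src C f) \<or> is_iso C f"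
  proof (cases "n = zero_arr C S V")
    case True
    then have "zero_object C V" using epi_zero_object[OF e] n by simp
    then have "zero_object C (ldual V)" using zero_object_ldual i by simp
    then have "inv_arr C i \<cdot> ident C (ldual V) \<cdot> i = inv_arr C i \<cdot> zero_arr C (ldual V) (ldual V) \<cdot> i"
      using zero_object_iff[of "ldual V"] i by simp
    then show ?thesis using i fa zero_object_iff[of "src C f"] by simp
  next
    case False
    then have "is_mono C n" using nonzero_from_simple_mono[of n] n S by simp
    then have "is_iso C (ldual_arr n)" using e mono_epi_iso ldual_iso by blast
    then have "is_iso C ((f \<cdot> inv_arr C i) \<cdot> i)" unfolding n(4) using i fa by - (rule iso_cmp, auto)
    then show ?thesis using i fa by simp
  qed
qed

text \<open>By the zigzag identity a vanishing coevaluation would make the identity of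
  \<open>X\<close> vanish.\<close>

lemma lcoev_nonzero:
  assumes [simp]: "X \<in> obj C" and "\<not> zero_object C X"
  shows "lcoev X \<noteq> zero_arr C \<I> (X \<otimes>\<^sub>o ldual X)"
proof
  assume "lcoev X = zero_arr C \<I> (X \<otimes>\<^sub>o ldual X)"
  then show False using zigzag_left[of X] assms zero_object_iff[of X] by simp
qed

lemma lev_nonzero:
  assumes [simp]: "X \<in> obj C" and "\<not> zero_object C X"
  shows "lev X \<noteq> zero_arr C (ldual X \<otimes>\<^sub>o X) \<I>"
proof
  assume "lev X = zero_arr C (ldual X \<otimes>\<^sub>o X) \<I>"
  then show False using zigzag_left[of X] assms zero_object_iff[of X] by simp
qed

section \<open>The unit object\<close>

lemma unit_nonzero: "ident C \<I> \<noteq> zero_arr C \<I> \<I>"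
proof
  assume "ident C \<I> = zero_arr C \<I> \<I>"
  then have "scale_arr C 0 (ident C \<I>) = scale_arr C 1 (ident C \<I>)" by simp
  moreover have "inj (\<lambda>a. scale_arr C a (ident C \<I>))" using End_unit by (simp add: bij_betw_def)
  ultimately have "(0 :: 'k) = 1" by (rule injD[rotated])
  then show False by simp
qed

lemma End_unit_scalar:
  assumes "f \<in> arr C" "src C f = \<I>" "tgt C f = \<I>"
  obtains a where "f = scale_arr C a (ident C \<I>)"
proof -
  have "f \<in> Hom C \<I> \<I>" using assms by (simp add: Hom_iff)
  then have "f \<in> (\<lambda>a. scale_arr C a (ident C \<I>)) ` UNIV" using End_unit by (simp add: bij_betw_def)
  then show ?thesis using that by blast
qed

lemma End_unit_iso:
  assumes f: "f \<in> arr C" "src C f = \<I>" "tgt C f = \<I>" "f \<noteq> zero_arr C \<I> \<I>"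
  shows "is_iso C f"
proof -
  obtain a where a: "f = scale_arr C a (ident C \<I>)" using End_unit_scalar f by blast
  then have "a \<noteq> 0" using f(4) by auto
  then show ?thesis unfolding a
    by (intro isoI(1)[of _ "scale_arr C (1 / a) (ident C \<I>)"]) (simp_all add: scale_scale)
qed

text \<open>
  For a simple subobject \<open>i : Y \<rightarrow> \<I>\<close>, the epimorphism \<open>id \<otimes> i\<^sup>* : Y \<cong> Y \<otimes> \<I>\<^sup>* \<rightarrow> Y \<otimes> Y\<^sup>*\<close> is invertible, so
  the coevaluation gives a nonzero \<open>\<I> \<rightarrow> Y\<close> and \<open>i\<close> splits.
\<close>

lemma unit_simple: "simple_object C \<I>"
proof -
  have "\<not> zero_object C \<I>" using unit_nonzero zero_object_iff[of \<I>] by simp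
  then obtain p where p: "is_epi C p" "src C p = \<I>" "simple_object C (tgt C p)"
    using ex_simple_quotient[OF unit_obj] by blast
  \<comment> \<open>Finite length directly provides a simple quotient of the unit; its dual
    \<open>Y\<close> is simple and embeds in the dual of the unit, which is a copy of the
    unit.\<close>
  define Y where "Y = ldual (tgt C p)"
  have Y: "simple_object C Y" using p simple_ldual by (simp add: Y_def)
  note YD = simple_objectD[OF Y]
  note YD(1)[simp]
  define k where "k = lunitor C (ldual \<I>) \<cdot> lcoev \<I>"
  have k: "is_iso C k" "k \<in> arr C" "src C k = \<I>" "tgt C k = ldual \<I>"
    using lcoev_unit_iso by (auto simp: k_def)
  define i where "i = inv_arr C k \<cdot> ldual_arr p"
  have i: "is_mono C i" "i \<in> arr C" "src C i = Y" "tgt C i = \<I>"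
    using mono_cmp[OF ldual_mono[OF p(1)] iso_mono, of "inv_arr C k"] p k by (auto simp: i_def Y_def)
  define e where "e = (ident C Y \<otimes>\<^sub>m ldual_arr i) \<cdot> (ident C Y \<otimes>\<^sub>m k) \<cdot> inv_arr C (runitor C Y)"
  have "is_epi C e" unfolding e_def using i k
    by - (intro epi_cmp tens_epi_right ldual_epi iso_epi, auto)
  then have e: "is_epi C e" "e \<in> arr C" "src C e = Y" "tgt C e = Y \<otimes>\<^sub>o ldual Y"
    using i k by (auto simp: e_def)
  have "e \<noteq> zero_arr C Y (Y \<otimes>\<^sub>o ldual Y)"
  proof
    assume "e = zero_arr C Y (Y \<otimes>\<^sub>o ldual Y)"
    then have "zero_object C (Y \<otimes>\<^sub>o ldual Y)" using epi_zero_object[OF e(1)] e by simp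
    then show False using zero_object_zero_arr(2)[of "lcoev Y"] lcoev_nonzero[OF YD(1,2)] by simp
  qed
  then have "is_iso C e" using nonzero_from_simple_mono[of e] e Y mono_epi_iso by simp
  define s where "s = inv_arr C e \<cdot> lcoev Y"
  have s: "s \<in> arr C" "src C s = \<I>" "tgt C s = Y" using e \<open>is_iso C e\<close> by (auto simp: s_def)
  have snz: "s \<noteq> zero_arr C \<I> Y"
  proof
    assume "s = zero_arr C \<I> Y"
    then have "e \<cdot> s = zero_arr C \<I> (Y \<otimes>\<^sub>o ldual Y)" using e by simp
    then show False using lcoev_nonzero[OF YD(1,2)] e \<open>is_iso C e\<close> by (simp add: s_def)
  qed
  have "i \<cdot> s \<noteq> zero_arr C \<I> \<I>" using mono_zero[OF i(1) s(1)] i(3,4) s(2,3) snz by auto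
  then have "is_iso C (i \<cdot> s)" using i s by (intro End_unit_iso) auto
  then have "is_epi C (i \<cdot> s)" by (rule iso_epi)
  then have "is_epi C i" using i s by - (rule epi_left[of _ s], auto)
  then have "is_iso C i" using i mono_epi_iso by blast
  then show ?thesis using simple_object_iso[OF Y] i by blast
qed

text \<open>The dual of the unit is isomorphic to the unit, so tensoring with it is faithful. This
  strips the last tensor factor in the splitting argument.\<close>

lemma tens_unit_zero:
  assumes f: "f \<in> arr C" and z: "f \<otimes>\<^sub>m ident C (ldual \<I>) =
        zero_arr C (src C f \<otimes>\<^sub>o ldual \<I>) (tgt C f \<otimes>\<^sub>o ldual \<I>)"
  shows "f = zero_arr C (src C f) (tgt C f)"
proof -
  define k where "k = lunitor C (ldual \<I>) \<cdot> lcoev \<I>"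
  have k: "is_iso C k" "k \<in> arr C" "src C k = \<I>" "tgt C k = ldual \<I>"
    using lcoev_unit_iso by (auto simp: k_def)
  let ?A = "ident C (src C f)" and ?B = "ident C (tgt C f)"
  have "(?B \<otimes>\<^sub>m inv_arr C k) \<cdot> (f \<otimes>\<^sub>m ident C (ldual \<I>)) \<cdot> (?A \<otimes>\<^sub>m k) = f \<otimes>\<^sub>m ident C \<I>"
    using f k by simp
  then have "f \<otimes>\<^sub>m ident C \<I> = zero_arr C (src C f \<otimes>\<^sub>o \<I>) (tgt C f \<otimes>\<^sub>o \<I>)"
    unfolding z using f k by simp
  then have "f \<cdot> runitor C (src C f) = zero_arr C (src C f) (tgt C f) \<cdot> runitor C (src C f)"
    using runitor_nat[OF f, symmetric] f by simp
  then show ?thesis using f by - (rule epiD[OF iso_epi[of "runitor C (src C f)"]], auto)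
qed

end

lemma lin_fun_comp: "\<lbrakk>linear_map V W T; lin_fun W t\<rbrakk> \<Longrightarrow> lin_fun V (\<lambda>x. t (T x))"
  unfolding lin_fun_def linear_map_def by (auto simp: Pi_def)

lemma linear_map_comp: "\<lbrakk>linear_map U V S; linear_map V W T\<rbrakk> \<Longrightarrow> linear_map U W (\<lambda>x. T (S x))"
  unfolding linear_map_def by (auto simp: Pi_def)

lemma (in vec_space) vsum_vsum_swap:
  assumes "\<And>i j. \<lbrakk>i < m; j < n\<rbrakk> \<Longrightarrow> F i j \<in> carrier V"
  shows "vsum V (\<lambda>i. vsum V (\<lambda>j. F i j) n) m = vsum V (\<lambda>j. vsum V (\<lambda>i. F i j) m) n"
  using assms
proof (induction m)
  case 0
  then show ?case by (auto intro: vsum_zero[symmetric])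
next
  case (Suc m)
  then have "vsum V (\<lambda>i. vsum V (\<lambda>j. F i j) n) m = vsum V (\<lambda>j. vsum V (\<lambda>i. F i j) m) n" by simp
  then show ?case using Suc.prems by (simp add: vsum_add)
qed

section \<open>Linear combinations of arrows\<close>

context linear_category
begin

lemma vsum_Hom:
  assumes "A \<in> obj C" "B \<in> obj C" "\<And>i. i < n \<Longrightarrow> f i \<in> Hom C A B"
  shows "vsum (hom_space C A B) f n \<in> Hom C A B"
  using vec_space.vsum_closed[OF vec_space_Hom[OF assms(1,2)], of n f] assms(3) by simp

lemma cmp_vsum:
  assumes "A \<in> obj C" "h \<in> Hom C B D" "\<And>i. i < n \<Longrightarrow> f i \<in> Hom C A B"
  shows "h \<cdot> vsum (hom_space C A B) f n = vsum (hom_space C A D) (\<lambda>i. h \<cdot> f i) n"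
proof -
  have BD: "B \<in> obj C" "D \<in> obj C" using assms(2) by (auto simp: Hom_iff)
  have "linear_map (hom_space C A B) (hom_space C A D) ((\<cdot>) h)"
    using assms(2) by (intro linear_map_cmp_left) (auto simp: Hom_iff)
  from vec_space.linear_map_vsum[OF vec_space_Hom[OF assms(1) BD(1)] this _ vec_space_Hom[OF assms(1)
      BD(2)]]
  show ?thesis using assms(3) by simp
qed

lemma vsum_cmp:
  assumes "D \<in> obj C" "h \<in> Hom C A B" "\<And>i. i < n \<Longrightarrow> f i \<in> Hom C B D"
  shows "vsum (hom_space C B D) f n \<cdot> h = vsum (hom_space C A D) (\<lambda>i. f i \<cdot> h) n"
proof -
  have AB: "A \<in> obj C" "B \<in> obj C" using assms(2) by (auto simp: Hom_iff)
  have "linear_map (hom_space C B D) (hom_space C A D) (\<lambda>x. x \<cdot> h)"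
    using assms(2) by (intro linear_map_cmp_right) (auto simp: Hom_iff)
  from vec_space.linear_map_vsum[OF vec_space_Hom[OF AB(2) assms(1)] this _ vec_space_Hom[OF AB(1)
      assms(1)]]
  show ?thesis using assms(3) by simp
qed

end

context linear_monoidal_category
begin

lemma tens_vsum:
  assumes "A \<in> obj C" "B \<in> obj C" "h \<in> Hom C X X'" "\<And>i. i < n \<Longrightarrow> f i \<in> Hom C A B"
  shows "h \<otimes>\<^sub>m vsum (hom_space C A B) f n = vsum (hom_space C (X \<otimes>\<^sub>o A) (X' \<otimes>\<^sub>o B)) (\<lambda>i. h \<otimes>\<^sub>m f i) n"
proof -
  have X: "X \<in> obj C" "X' \<in> obj C" using assms(3) by (auto simp: Hom_iff)
  have "linear_map (hom_space C A B) (hom_space C (X \<otimes>\<^sub>o A) (X' \<otimes>\<^sub>o B)) ((\<otimes>\<^sub>m) h)"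
    using assms by (intro linear_map_tens_left) (auto simp: Hom_iff)
  from vec_space.linear_map_vsum[OF vec_space_Hom[OF assms(1,2)] this _ vec_space_Hom]
  show ?thesis using assms X by simp
qed

lemma vsum_tens:
  assumes "A \<in> obj C" "B \<in> obj C" "h \<in> Hom C X X'" "\<And>i. i < n \<Longrightarrow> f i \<in> Hom C A B"
  shows "vsum (hom_space C A B) f n \<otimes>\<^sub>m h = vsum (hom_space C (A \<otimes>\<^sub>o X) (B \<otimes>\<^sub>o X')) (\<lambda>i. f i \<otimes>\<^sub>m h) n"
proof -
  have X: "X \<in> obj C" "X' \<in> obj C" using assms(3) by (auto simp: Hom_iff)
  have "linear_map (hom_space C A B) (hom_space C (A \<otimes>\<^sub>o X) (B \<otimes>\<^sub>o X')) (\<lambda>x. x \<otimes>\<^sub>m h)"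
    using assms by (intro linear_map_tens_right) (auto simp: Hom_iff)
  from vec_space.linear_map_vsum[OF vec_space_Hom[OF assms(1,2)] this _ vec_space_Hom]
  show ?thesis using assms X by simp
qed

end

section \<open>The pairing of Hom-spaces out of two covers\<close>

context rigid_tensor
begin

context
  fixes X Q q Q' q'
  assumes X: "simple_object C X" and q: "local_cover Q q" "tgt C q = X"
    and q': "local_cover Q' q'" "tgt C q' = ldual X"
begin

lemma cover_typing:
  "X \<in> obj C" "Q \<in> obj C" "Q' \<in> obj C" "q \<in> arr C" "q' \<in> arr C" "src C q = Q" "src C q' = Q'"
  "is_epi C q" "is_epi C q'" "\<not> zero_object C X" "projective C Q" "projective C Q'"
  using simple_objectD(1,2)[OF X] local_coverD(1-5)[OF q(1)] local_coverD(1-5)[OF q'(1)] by auto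

text \<open>\<open>q\<close> factors as \<open>u \<cdot> p\<close> through the image of
  \<open>g\<close>, and \<open>ldual_arr u \<cdot> q'\<close> lifts along the epi
  \<open>ldual_arr m\<close>. Dinaturality of \<open>lev\<close> at \<open>m\<close> and at
  \<open>u\<close> moves the evaluation to \<open>X\<close>. The resulting element does not depend
  on \<open>g\<close> or \<open>Z\<close>, so one functional \<open>t\<close> can serve all
  \<open>Z\<close>.\<close>

lemma pairing_nondegenerate_left:
  assumes g: "g \<in> arr C" "src C g = Q" "tgt C g = Z" "g \<noteq> zero_arr C Q Z"
  obtains f where "f \<in> arr C" "src C f = Q'" "tgt C f = ldual Z"
    "lev Z \<cdot> (f \<otimes>\<^sub>m g) = lev X \<cdot> (q' \<otimes>\<^sub>m q)"
proof -
  note ct = cover_typing(1-7)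
  obtain p m where pm: "is_epi C p" "is_mono C m" "src C p = Q" "tgt C m = Z" "tgt C p =
        src C m" "m \<cdot> p = g"
    using epi_mono_factorization[OF g(1)] g by metis
  have pa: "p \<in> arr C" and ma: "m \<in> arr C" using pm by auto
  have "\<not> zero_object C (tgt C p)" using zero_if_factor_zero[OF ma pa pm(5)] pm g(4) by metis
  then obtain u where u: "u \<in> arr C" "src C u = tgt C p" "tgt C u = X" "u \<cdot> p = q"
    using local_cover_quotient[OF q(1) _ pm(1,3)] X q(2) by auto
  obtain f where f: "f \<in> arr C" "src C f = Q'" "tgt C f = src C (ldual_arr m)"
    "ldual_arr m \<cdot> f = ldual_arr u \<cdot> q'"
    using projective_lift[OF cover_typing(12) ldual_epi[OF pm(2)], of "ldual_arr u \<cdot> q'"]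
      u pm pa ma ct q'(2) by auto
  have Z: "Z \<in> obj C" using g tgt_obj by blast
  let ?W = "src C m"
  have "lev Z \<cdot> (f \<otimes>\<^sub>m g) = (lev Z \<cdot> (ident C (ldual Z) \<otimes>\<^sub>m m)) \<cdot> (f \<otimes>\<^sub>m p)"
    unfolding pm(6)[symmetric] using f pm pa ma Z by simp
  also have "\<dots> = (lev ?W \<cdot> (ldual_arr m \<otimes>\<^sub>m ident C ?W)) \<cdot> (f \<otimes>\<^sub>m p)"
    using lev_dinatural[OF ma] pm by simp
  also have "\<dots> = lev ?W \<cdot> ((ldual_arr m \<cdot> f) \<otimes>\<^sub>m p)" using f(1-3) pm(3-5) pa ma by simp
  also have "\<dots> = (lev ?W \<cdot> (ldual_arr u \<otimes>\<^sub>m ident C ?W)) \<cdot> (q' \<otimes>\<^sub>m p)"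
    unfolding f(4) using u(1-3) pm(3-5) pa ma ct q'(2) by simp
  also have "\<dots> = (lev X \<cdot> (ident C (ldual X) \<otimes>\<^sub>m u)) \<cdot> (q' \<otimes>\<^sub>m p)"
    using lev_dinatural[OF u(1)] u(2,3) pm(5) by simp
  also have "\<dots> = lev X \<cdot> (q' \<otimes>\<^sub>m (u \<cdot> p))" using u(1-3) pm(3-5) pa ct q'(2) by simp
  finally show ?thesis using that f pm ma by (simp add: u(4))
qed

text \<open>Mirror image of the previous argument: the image of \<open>f\<close> is rewritten as a
  dual, \<open>q'\<close> factors through it, and projectivity of \<open>Q\<close> provides the
  lift.\<close>

lemma pairing_nondegenerate_right:
  assumes f: "f \<in> arr C" "src C f = Q'" "tgt C f = ldual Z" "f \<noteq> zero_arr C Q' (ldual Z)"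
      and Z: "Z \<in> obj C"
  obtains g where "g \<in> arr C" "src C g = Q" "tgt C g = Z"
    "lev Z \<cdot> (f \<otimes>\<^sub>m g) = lev X \<cdot> (q' \<otimes>\<^sub>m q)"
proof -
  note ct = cover_typing(1-7)
  obtain p0 m0 where pm0: "is_epi C p0" "is_mono C m0" "src C p0 = Q'" "tgt C m0 = ldual Z"
    "tgt C p0 = src C m0" "m0 \<cdot> p0 = f"
    using epi_mono_factorization[OF f(1)] f by metis
  have a0: "p0 \<in> arr C" "m0 \<in> arr C" using pm0 by auto
  obtain V i where i: "V \<in> obj C" "is_iso C i" "src C i = src C m0" "tgt C i = ldual V"
    using ldual_ess_surj[of "src C m0"] a0 by auto
  have ia: "i \<in> arr C" using i by simp
  define p where "p = i \<cdot> p0"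
  define m where "m = m0 \<cdot> inv_arr C i"
  have p: "is_epi C p" "p \<in> arr C" "src C p = Q'" "tgt C p = ldual V"
    using epi_cmp[OF pm0(1) iso_epi[OF i(2)]] i pm0 a0 by (auto simp: p_def)
  have m: "is_mono C m" "m \<in> arr C" "src C m = ldual V" "tgt C m = ldual Z"
    using mono_cmp[OF iso_mono pm0(2), of "inv_arr C i"] i pm0 a0 by (auto simp: m_def)
  have mp: "m \<cdot> p = f" using i pm0 a0 by (simp add: m_def p_def)
  have "\<not> zero_object C (tgt C p)" using zero_if_factor_zero[OF m(2) p(2)] mp m p f(4) by metis
  then obtain u' where u': "u' \<in> arr C" "src C u' = ldual V" "tgt C u' = ldual X" "u' \<cdot> p = q'"
    using local_cover_quotient[OF q'(1) _ p(1,3)] simple_ldual[OF X] q'(2) p(4) by auto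
  obtain n where n: "n \<in> arr C" "src C n = Z" "tgt C n = V" "ldual_arr n = m"
    using ldual_arr_full[OF m(2-4) Z i(1)] .
  obtain w where w: "w \<in> arr C" "src C w = X" "tgt C w = V" "ldual_arr w = u'"
    using ldual_arr_full[OF u'(1-3) ct(1) i(1)] .
  have "is_epi C n" using epi_of_ldual_mono n m(1) by metis
  then obtain g where g: "g \<in> arr C" "src C g = Q" "tgt C g = Z" "n \<cdot> g = w \<cdot> q"
    using projective_lift[OF cover_typing(11), of n "w \<cdot> q"] n(2,3) w ct q(2) by auto
  have "lev Z \<cdot> (f \<otimes>\<^sub>m g) = (lev Z \<cdot> (ldual_arr n \<otimes>\<^sub>m ident C Z)) \<cdot> (p \<otimes>\<^sub>m g)"
    unfolding mp[symmetric] n(4) using g(1-3) m p Z by simp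
  also have "\<dots> = (lev V \<cdot> (ident C (ldual V) \<otimes>\<^sub>m n)) \<cdot> (p \<otimes>\<^sub>m g)"
    using lev_dinatural[OF n(1)] n(2,3) by simp
  also have "\<dots> = lev V \<cdot> (p \<otimes>\<^sub>m (n \<cdot> g))" using g(1-3) p n(1-3) i(1) by simp
  also have "\<dots> = (lev V \<cdot> (ident C (ldual V) \<otimes>\<^sub>m w)) \<cdot> (p \<otimes>\<^sub>m q)"
    unfolding g(4) using w(1-3) p ct q(2) i(1) by simp
  also have "\<dots> = (lev X \<cdot> (ldual_arr w \<otimes>\<^sub>m ident C X)) \<cdot> (p \<otimes>\<^sub>m q)"
    using lev_dinatural[OF w(1)] w(2,3) by simp
  also have "\<dots> = lev X \<cdot> ((u' \<cdot> p) \<otimes>\<^sub>m q)" unfolding w(4) using u'(1-3) p ct q(2) by simp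
  finally show ?thesis using that g by (simp add: u'(4))
qed

lemma cover_tens_epi: "is_epi C (q \<otimes>\<^sub>m q')" "is_epi C (q' \<otimes>\<^sub>m q)"
proof -
  note ct = cover_typing
  have "is_epi C ((q \<otimes>\<^sub>m ident C (ldual X)) \<cdot> (ident C Q \<otimes>\<^sub>m q'))"
    using ct q(2) q'(2) by - (rule epi_cmp[OF tens_epi_right tens_epi_left], simp_all)
  moreover have "is_epi C ((q' \<otimes>\<^sub>m ident C X) \<cdot> (ident C Q' \<otimes>\<^sub>m q))"
    using ct q(2) q'(2) by - (rule epi_cmp[OF tens_epi_right tens_epi_left], simp_all)
  moreover have "(q \<otimes>\<^sub>m ident C (ldual X)) \<cdot> (ident C Q \<otimes>\<^sub>m q') = q \<otimes>\<^sub>m q'"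
    "(q' \<otimes>\<^sub>m ident C X) \<cdot> (ident C Q' \<otimes>\<^sub>m q) = q' \<otimes>\<^sub>m q"
    using ct(1-7) q(2) q'(2) by simp_all
  ultimately show "is_epi C (q \<otimes>\<^sub>m q')" "is_epi C (q' \<otimes>\<^sub>m q)" by metis+
qed

lemma lev_cover_nonzero: "lev X \<cdot> (q' \<otimes>\<^sub>m q) \<noteq> zero_arr C (Q' \<otimes>\<^sub>o Q) \<I>"
proof
  note ct = cover_typing
  assume "lev X \<cdot> (q' \<otimes>\<^sub>m q) = zero_arr C (Q' \<otimes>\<^sub>o Q) \<I>"
  then have "lev X = zero_arr C (ldual X \<otimes>\<^sub>o X) \<I>"
    using epi_zero[OF cover_tens_epi(2), of "lev X"] ct(1-7) q(2) q'(2) by simp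
  then show False using lev_nonzero ct by blast
qed

text \<open>
  The functional \<open>t\<close> makes \<open>Hom(Q, Z)\<close> and \<open>Hom(Q', Z\<^sup>*)\<close> dual to each other, naturally in \<open>Z\<close>: this is
  the duality between \<open>Hom(Q, Z)\<close> and \<open>Hom(Z, I)\<close> for the injective hull \<open>I\<close> of \<open>X\<close>. The canonical
  element \<open>\<Sum>\<^sub>i g\<^sub>i \<otimes> h\<^sub>i\<close> of the tensor product is therefore dinatural in \<open>Z\<close>.
\<close>

lemma character_wedge:
  obtains t n g h where
    "\<And>Z i. \<lbrakk>Z \<in> obj C; i < n Z\<rbrakk> \<Longrightarrow> g Z i \<in> Hom C Q Z"
    "\<And>Z i. \<lbrakk>Z \<in> obj C; i < n Z\<rbrakk> \<Longrightarrow> h Z i \<in> Hom C Q' (ldual Z)"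
    "lin_fun (hom_space C (Q' \<otimes>\<^sub>o Q) \<I>) t" "t (lev X \<cdot> (q' \<otimes>\<^sub>m q)) = 1"
    "\<And>Z x. \<lbrakk>Z \<in> obj C; x \<in> Hom C Q Z\<rbrakk>
      \<Longrightarrow> x = vsum (hom_space C Q Z) (\<lambda>i. scale_arr C (t (lev Z \<cdot> (h Z i \<otimes>\<^sub>m x))) (g Z i)) (n Z)"
    "\<And>Z y. \<lbrakk>Z \<in> obj C; y \<in> Hom C Q' (ldual Z)\<rbrakk>
      \<Longrightarrow> y = vsum (hom_space C Q' (ldual Z)) (\<lambda>i. scale_arr C (t (lev Z \<cdot> (y \<otimes>\<^sub>m g Z i))) (h Z i)) (n Z)"
    "is_wedge C C (\<lambda>X Y. Y \<otimes>\<^sub>o ldual X) (\<lambda>f Y. ident C Y \<otimes>\<^sub>m ldual_arr f) (\<lambda>X f. f \<otimes>\<^sub>m ident C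
          (ldual X))
      (Q \<otimes>\<^sub>o Q') (\<lambda>Z. vsum (hom_space C (Q \<otimes>\<^sub>o Q') (Z \<otimes>\<^sub>o ldual Z)) (\<lambda>i. g Z i \<otimes>\<^sub>m h Z i) (n Z))"
proof -
  note ct = cover_typing(1-7)
  note ct(1-3)[simp]
  let ?L = "lev X \<cdot> (q' \<otimes>\<^sub>m q)"
  interpret H: fd_space "hom_space C (Q' \<otimes>\<^sub>o Q) \<I>" using fd_Hom by simp
  have "?L \<in> carrier (hom_space C (Q' \<otimes>\<^sub>o Q) \<I>)" using ct q(2) q'(2) by (simp add: Hom_iff)
  \<comment> \<open>Any functional that does not vanish on \<open>?L\<close> gives nondegeneracy;
    the normalization to 1 keeps later coefficients free of denominators.\<close>
  then obtain t where t: "lin_fun (hom_space C (Q' \<otimes>\<^sub>o Q) \<I>) t" "t ?L = 1"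
    using H.ex_lin_fun_nonzero lev_cover_nonzero by auto
  define B where "B Z x y = t (lev Z \<cdot> (y \<otimes>\<^sub>m x))" for Z x y
  define P where "P Z n g h \<longleftrightarrow> (\<forall>i<n. g i \<in> Hom C Q Z \<and> h i \<in> Hom C Q' (ldual Z)) \<and>
    (\<forall>x\<in>Hom C Q Z. x = vsum (hom_space C Q Z) (\<lambda>i. scale_arr C (B Z x (h i)) (g i)) n) \<and>
    (\<forall>y\<in>Hom C Q' (ldual Z). y =
          vsum (hom_space C Q' (ldual Z)) (\<lambda>i. scale_arr C (B Z (g i) y) (h i)) n)"
    for Z n g h
  have "\<exists>n g h. P Z n g h" if Z [simp]: "Z \<in> obj C" for Z
  proof -
    have lev: "linear_map (hom_space C (Q' \<otimes>\<^sub>o Q) (ldual Z \<otimes>\<^sub>o Z)) (hom_space C (Q' \<otimes>\<^sub>o Q) \<I>)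
          (\<lambda>f. lev Z \<cdot> f)"
      by (intro linear_map_cmp_left) auto
    have B1: "lin_fun (hom_space C Q Z) (\<lambda>x. B Z x y)" if "y \<in> carrier (hom_space C Q' (ldual Z))" for y
    proof -
      have "linear_map (hom_space C Q Z) (hom_space C (Q' \<otimes>\<^sub>o Q) (ldual Z \<otimes>\<^sub>o Z)) (\<lambda>x. y \<otimes>\<^sub>m x)"
        using that by (intro linear_map_tens_left) (auto simp: Hom_iff)
      then show ?thesis unfolding B_def by (rule lin_fun_comp[OF linear_map_comp[OF _ lev] t(1)])
    qed
    have B2: "lin_fun (hom_space C Q' (ldual Z)) (B Z x)" if "x \<in> carrier (hom_space C Q Z)" for x
    proof -
      have "linear_map (hom_space C Q' (ldual Z)) (hom_space C (Q' \<otimes>\<^sub>o Q) (ldual Z \<otimes>\<^sub>o Z))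
            (\<lambda>y. y \<otimes>\<^sub>m x)"
        using that by (intro linear_map_tens_right) (auto simp: Hom_iff)
      then show ?thesis unfolding B_def[abs_def]
          by (rule lin_fun_comp[OF linear_map_comp[OF _ lev] t(1)])
    qed
    have nd1: "\<exists>y\<in>carrier (hom_space C Q' (ldual Z)). B Z x y \<noteq> 0"
      if x: "x \<in> carrier (hom_space C Q Z)" "x \<noteq> \<zero>\<^bsub>hom_space C Q Z\<^esub>" for x
    proof -
      obtain f where "f \<in> arr C" "src C f = Q'" "tgt C f = ldual Z" "lev Z \<cdot> (f \<otimes>\<^sub>m x) = ?L"
        using pairing_nondegenerate_left[of x Z] x by (auto simp: Hom_iff)
      then show ?thesis using t(2) by (intro bexI[of _ f]) (auto simp: B_def Hom_iff)
    qed
    have nd2: "\<exists>x\<in>carrier (hom_space C Q Z). B Z x y \<noteq> 0"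
      if y: "y \<in> carrier (hom_space C Q' (ldual Z))" "y \<noteq> \<zero>\<^bsub>hom_space C Q' (ldual Z)\<^esub>" for y
    proof -
      obtain g where "g \<in> arr C" "src C g = Q" "tgt C g = Z" "lev Z \<cdot> (y \<otimes>\<^sub>m g) = ?L"
        using pairing_nondegenerate_right[of y Z] y by (auto simp: Hom_iff)
      then show ?thesis using t(2) by (intro bexI[of _ g]) (auto simp: B_def Hom_iff)
    qed
    have fd: "fd_space (hom_space C Q Z)" "fd_space (hom_space C Q' (ldual Z))" using fd_Hom by simp_all
    obtain n g h where "\<And>i. i < n \<Longrightarrow> g i \<in> carrier (hom_space C Q Z)"
      "\<And>i. i < n \<Longrightarrow> h i \<in> carrier (hom_space C Q' (ldual Z))"
      "\<And>x. x \<in> carrier (hom_space C Q Z) \<Longrightarrow>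
        x = vsum (hom_space C Q Z) (\<lambda>i. B Z x (h i) \<odot>\<^bsub>hom_space C Q Z\<^esub> g i) n"
      "\<And>y. y \<in> carrier (hom_space C Q' (ldual Z)) \<Longrightarrow>
        y = vsum (hom_space C Q' (ldual Z)) (\<lambda>i. B Z (g i) y \<odot>\<^bsub>hom_space C Q' (ldual Z)\<^esub> h i) n"
      using perfect_pairing_dual_bases[OF fd B1 B2 nd1 nd2] by blast
    then have "P Z n g h" unfolding P_def hom_space_simps by blast
    then show ?thesis by blast
  qed
  \<comment> \<open>The data \<open>n\<close>, \<open>g\<close>, \<open>h\<close> are packed into
    one tuple, so that a single use of choice selects them for all \<open>Z\<close>.\<close>
  then have "\<forall>Z. \<exists>p. Z \<in> obj C \<longrightarrow> P Z (fst p) (fst (snd p)) (snd (snd p))" by (metis fst_conv snd_conv)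
  then obtain p where "\<forall>Z. Z \<in> obj C \<longrightarrow> P Z (fst (p Z)) (fst (snd (p Z))) (snd (snd (p Z)))"
    by (rule choice[THEN exE])
  moreover define n g h where "n Z = fst (p Z)" and "g Z = fst (snd (p Z))" and "h Z = snd (snd (p Z))"
      for Z
  ultimately have P: "\<And>Z. Z \<in> obj C \<Longrightarrow> P Z (n Z) (g Z) (h Z)" by simp
  have g: "g Z i \<in> Hom C Q Z" and h: "h Z i \<in> Hom C Q' (ldual Z)" if "Z \<in> obj C" "i < n Z" for Z i
    using P[OF that(1)] that(2) unfolding P_def by blast+
  have gx: "x = vsum (hom_space C Q Z) (\<lambda>i. scale_arr C (B Z x (h Z i)) (g Z i)) (n Z)"
    if "Z \<in> obj C" "x \<in> Hom C Q Z" for Z x using P[OF that(1)] that(2) unfolding P_def by blast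
  have hy: "y = vsum (hom_space C Q' (ldual Z)) (\<lambda>i. scale_arr C (B Z (g Z i) y) (h Z i)) (n Z)"
    if "Z \<in> obj C" "y \<in> Hom C Q' (ldual Z)" for Z y using P[OF that(1)] that(2) unfolding P_def by blast
  define \<tau> where "\<tau> Z = vsum (hom_space C (Q \<otimes>\<^sub>o Q') (Z \<otimes>\<^sub>o ldual Z)) (\<lambda>i. g Z i \<otimes>\<^sub>m h Z i) (n Z)" for Z
  have gh: "g Z i \<otimes>\<^sub>m h Z' j \<in> Hom C (Q \<otimes>\<^sub>o Q') (Z \<otimes>\<^sub>o ldual Z')"
    if "Z \<in> obj C" "Z' \<in> obj C" "i < n Z" "j < n Z'" for Z Z' i j
    using g[OF that(1,3)] h[OF that(2,4)] by (simp add: Hom_iff)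
  have wedge: "(f \<otimes>\<^sub>m ident C (ldual (src C f))) \<cdot> \<tau> (src C f) =
        (ident C (tgt C f) \<otimes>\<^sub>m ldual_arr f) \<cdot> \<tau> (tgt C f)"
    if f: "f \<in> arr C" for f
  proof -
    let ?Z = "src C f" and ?Y = "tgt C f"
    have obj [simp]: "?Z \<in> obj C" "?Y \<in> obj C" using f by auto
    let ?H = "hom_space C (Q \<otimes>\<^sub>o Q') (?Y \<otimes>\<^sub>o ldual ?Z)"
    interpret H: vec_space ?H using vec_space_Hom by simp
    \<comment> \<open>With respect to the pairings at \<open>?Y\<close> and \<open>?Z\<close>,
      composition with \<open>f\<close> is adjoint to composition with
      \<open>ldual_arr f\<close>.\<close>
    have Bf: "B ?Y (f \<cdot> x) y = B ?Z x (ldual_arr f \<cdot> y)" if "x \<in> Hom C Q ?Z" "y \<in> Hom C Q' (ldual ?Y)"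
        for x y
    proof -
      have "lev ?Y \<cdot> (y \<otimes>\<^sub>m (f \<cdot> x)) = (lev ?Y \<cdot> (ident C (ldual ?Y) \<otimes>\<^sub>m f)) \<cdot> (y \<otimes>\<^sub>m x)"
        using that f by (simp add: Hom_iff)
      also have "\<dots> = (lev ?Z \<cdot> (ldual_arr f \<otimes>\<^sub>m ident C ?Z)) \<cdot> (y \<otimes>\<^sub>m x)"
          by (simp only: lev_dinatural[OF f])
      also have "\<dots> = lev ?Z \<cdot> ((ldual_arr f \<cdot> y) \<otimes>\<^sub>m x)" using that f by (simp add: Hom_iff)
      finally show ?thesis by (simp add: B_def)
    qed
    \<comment> \<open>Here \<open>f \<cdot> g ?Z i\<close> is expanded in the basis at
      \<open>?Y\<close>, and in \<open>2\<close> the arrow \<open>ldual_arr f \<cdot> h ?Y j\<close>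
      in the basis at \<open>?Z\<close>. By \<open>Bf\<close> the coefficients agree, so both sides
      of the wedge condition are the same double sum.\<close>
    have 1: "(f \<cdot> g ?Z i) \<otimes>\<^sub>m h ?Z i =
        vsum ?H (\<lambda>j. scale_arr C (B ?Y (f \<cdot> g ?Z i) (h ?Y j)) (g ?Y j \<otimes>\<^sub>m h ?Z i)) (n ?Y)"
      if i: "i < n ?Z" for i
    proof -
      have fg: "f \<cdot> g ?Z i \<in> Hom C Q ?Y" using g[of ?Z i] i f by (simp add: Hom_iff)
      let ?v = "vsum (hom_space C Q ?Y) (\<lambda>j. scale_arr C (B ?Y (f \<cdot> g ?Z i) (h ?Y j)) (g ?Y j)) (n ?Y)"
      have "(f \<cdot> g ?Z i) \<otimes>\<^sub>m h ?Z i = ?v \<otimes>\<^sub>m h ?Z i"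
        by (rule arg_cong[where f = "\<lambda>x. x \<otimes>\<^sub>m h ?Z i", OF gx[OF obj(2) fg]])
      also have "\<dots> = vsum ?H (\<lambda>j. scale_arr C (B ?Y (f \<cdot> g ?Z i) (h ?Y j)) (g ?Y j) \<otimes>\<^sub>m h ?Z i) (n ?Y)"
        using g[of ?Y] h[of ?Z i] i by (intro vsum_tens) (auto simp: Hom_iff)
      also have "\<dots> = vsum ?H (\<lambda>j. scale_arr C (B ?Y (f \<cdot> g ?Z i) (h ?Y j)) (g ?Y j \<otimes>\<^sub>m h ?Z i)) (n ?Y)"
        using g[of ?Y] h[of ?Z i] i by (intro H.vsum_cong) (auto simp: Hom_iff)
      finally show ?thesis .
    qed
    have 2: "g ?Y j \<otimes>\<^sub>m (ldual_arr f \<cdot> h ?Y j) =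
        vsum ?H (\<lambda>i. scale_arr C (B ?Z (g ?Z i) (ldual_arr f \<cdot> h ?Y j)) (g ?Y j \<otimes>\<^sub>m h ?Z i)) (n ?Z)"
      if j: "j < n ?Y" for j
    proof -
      have fh: "ldual_arr f \<cdot> h ?Y j \<in> Hom C Q' (ldual ?Z)" using h[of ?Y j] j f by (simp add: Hom_iff)
      let ?v = "vsum (hom_space C Q' (ldual ?Z)) (\<lambda>i. scale_arr C (B ?Z (g ?Z i) (ldual_arr f \<cdot> h ?Y j))
            (h ?Z i)) (n ?Z)"
      have "g ?Y j \<otimes>\<^sub>m (ldual_arr f \<cdot> h ?Y j) = g ?Y j \<otimes>\<^sub>m ?v"
        by (rule arg_cong[where f = "\<lambda>x. g ?Y j \<otimes>\<^sub>m x", OF hy[OF obj(1) fh]])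
      also have "\<dots> = vsum ?H (\<lambda>i. g ?Y j \<otimes>\<^sub>m scale_arr C (B ?Z (g ?Z i) (ldual_arr f \<cdot> h ?Y j))
            (h ?Z i)) (n ?Z)"
        using h[of ?Z] g[of ?Y j] j by (intro tens_vsum) (auto simp: Hom_iff)
      also have "\<dots> = vsum ?H (\<lambda>i. scale_arr C (B ?Z (g ?Z i) (ldual_arr f \<cdot> h ?Y j))
            (g ?Y j \<otimes>\<^sub>m h ?Z i)) (n ?Z)"
        using h[of ?Z] g[of ?Y j] j by (intro H.vsum_cong) (auto simp: Hom_iff)
      finally show ?thesis .
    qed
    have "(f \<otimes>\<^sub>m ident C (ldual ?Z)) \<cdot> \<tau> ?Z =
          vsum ?H (\<lambda>i. (f \<otimes>\<^sub>m ident C (ldual ?Z)) \<cdot> (g ?Z i \<otimes>\<^sub>m h ?Z i)) (n ?Z)"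
      unfolding \<tau>_def using gh f by (intro cmp_vsum) (auto simp: Hom_iff)
    also have "\<dots> = vsum ?H (\<lambda>i. vsum ?H (\<lambda>j. scale_arr C (B ?Y (f \<cdot> g ?Z i) (h ?Y j))
          (g ?Y j \<otimes>\<^sub>m h ?Z i)) (n ?Y)) (n ?Z)"
    proof (rule H.vsum_cong)
      fix i assume i: "i < n ?Z"
      have "(f \<otimes>\<^sub>m ident C (ldual ?Z)) \<cdot> (g ?Z i \<otimes>\<^sub>m h ?Z i) = (f \<cdot> g ?Z i) \<otimes>\<^sub>m h ?Z i"
        using g[of ?Z i] h[of ?Z i] f i by (simp add: Hom_iff)
      then show "(f \<otimes>\<^sub>m ident C (ldual ?Z)) \<cdot> (g ?Z i \<otimes>\<^sub>m h ?Z i) =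
          vsum ?H (\<lambda>j. scale_arr C (B ?Y (f \<cdot> g ?Z i) (h ?Y j)) (g ?Y j \<otimes>\<^sub>m h ?Z i)) (n ?Y)"
        using 1[OF i] by (rule trans)
    qed
    also have "\<dots> = vsum ?H (\<lambda>j. vsum ?H (\<lambda>i. scale_arr C (B ?Y (f \<cdot> g ?Z i) (h ?Y j))
          (g ?Y j \<otimes>\<^sub>m h ?Z i)) (n ?Z)) (n ?Y)"
      using gh by (intro H.vsum_vsum_swap) (auto simp: Hom_iff)
    also have "\<dots> = vsum ?H (\<lambda>j. (ident C ?Y \<otimes>\<^sub>m ldual_arr f) \<cdot> (g ?Y j \<otimes>\<^sub>m h ?Y j)) (n ?Y)"
    proof (rule H.vsum_cong)
      fix j assume j: "j < n ?Y"
      have "(ident C ?Y \<otimes>\<^sub>m ldual_arr f) \<cdot> (g ?Y j \<otimes>\<^sub>m h ?Y j) = g ?Y j \<otimes>\<^sub>m (ldual_arr f \<cdot> h ?Y j)"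
        using g[of ?Y j] h[of ?Y j] f j by (simp add: Hom_iff)
      also have "\<dots> = vsum ?H (\<lambda>i. scale_arr C (B ?Z (g ?Z i) (ldual_arr f \<cdot> h ?Y j))
            (g ?Y j \<otimes>\<^sub>m h ?Z i)) (n ?Z)"
        by (rule 2[OF j])
      also have "\<dots> = vsum ?H (\<lambda>i. scale_arr C (B ?Y (f \<cdot> g ?Z i) (h ?Y j)) (g ?Y j \<otimes>\<^sub>m h ?Z i)) (n ?Z)"
        using Bf g h j by (intro H.vsum_cong) auto
      finally show "vsum ?H (\<lambda>i. scale_arr C (B ?Y (f \<cdot> g ?Z i) (h ?Y j)) (g ?Y j \<otimes>\<^sub>m h ?Z i)) (n ?Z) =
          (ident C ?Y \<otimes>\<^sub>m ldual_arr f) \<cdot> (g ?Y j \<otimes>\<^sub>m h ?Y j)" by (rule sym)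
    qed
    also have "\<dots> = (ident C ?Y \<otimes>\<^sub>m ldual_arr f) \<cdot> \<tau> ?Y"
      unfolding \<tau>_def using gh f by (intro cmp_vsum[symmetric]) (auto simp: Hom_iff)
    finally show ?thesis .
  qed
  have \<tau>: "\<tau> Z \<in> Hom C (Q \<otimes>\<^sub>o Q') (Z \<otimes>\<^sub>o ldual Z)" if "Z \<in> obj C" for Z
    unfolding \<tau>_def using gh that by (intro vsum_Hom) auto
  have "is_wedge C C (\<lambda>X Y. Y \<otimes>\<^sub>o ldual X) (\<lambda>f Y. ident C Y \<otimes>\<^sub>m ldual_arr f) (\<lambda>X f. f \<otimes>\<^sub>m ident C
        (ldual X))
      (Q \<otimes>\<^sub>o Q') \<tau>"
    unfolding is_wedge_def using wedge \<tau> by auto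
  then show thesis using that[of n g h t] g h t gx hy unfolding B_def \<tau>_def[abs_def] by blast
qed

end

end

text \<open>A nonconstant polynomial relation for \<open>u\<close> has a linear factor \<open>u - a\<close> that is not invertible.\<close>

lemma schur:
  fixes C :: "('o, 'm, 'k :: alg_closed_field, 'z) lcat_scheme" (structure)
  assumes "finite_abelian_category C" and S: "simple_object C S" and u: "u \<in> Hom C S S"
  shows "\<exists>a. u = scale_arr C a (ident C S)"
proof -
  interpret finite_abelian_category C by fact
  note SD = simple_objectD(1,2)[OF S]
  note SD(1)[simp]
  have ua [simp]: "u \<in> arr C" "src C u = S" "tgt C u = S" using u by (auto simp: Hom_iff)
  let ?V = "hom_space C S S"
  interpret V: fd_space ?V using fd_Hom by simp
  define pw where "pw k = ((\<cdot>) u ^^ k) (ident C S)" for k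
  have pw [simp]: "pw k \<in> arr C" "src C (pw k) = S" "tgt C (pw k) = S" for k
    by (induction k) (auto simp: pw_def)
  have pw_Suc: "u \<cdot> pw k = pw (Suc k)" for k by (simp add: pw_def)
  \<comment> \<open>\<open>E p N\<close> is the value of \<open>p\<close> at \<open>u\<close>, cut
    off before the power \<open>N\<close>; it is the full value as soon as
    \<open>degree p < N\<close>. One \<open>N\<close> serves the whole induction.\<close>
  define E where "E p N = vsum ?V (\<lambda>i. scale_arr C (coeff p i) (pw i)) N" for p N
  have E [simp]: "E p N \<in> arr C" "src C (E p N) = S" "tgt C (E p N) = S" for p N
    using vsum_Hom[of S S N "\<lambda>i. scale_arr C (coeff p i) (pw i)"] by (auto simp: E_def Hom_iff)
  have E_Suc: "E p (Suc N) = add_arr C (E p N) (scale_arr C (coeff p N) (pw N))" for p N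
    by (simp add: E_def)
  \<comment> \<open>Induction on the degree of a polynomial that annihilates \<open>u\<close>: for a
    root \<open>a\<close>, the arrow \<open>u - a\<close> is zero or, by simplicity, invertible, and
    in the latter case it cancels.\<close>
  have main: "\<exists>a. u = scale_arr C a (ident C S)"
    if "p \<noteq> 0" "degree p < N" "E p N = zero_arr C S S" for p N
    using that
  proof (induction "degree p" arbitrary: p rule: less_induct)
    case less
    show ?case
    proof (cases "degree p = 0")
      case True
      then obtain c where c: "p = [:c:]" by (metis degree_eq_zeroE)
      have "E p N = vsum ?V (\<lambda>i. (if i = 0 then c else 0) \<odot>\<^bsub>?V\<^esub> pw i) N"
        unfolding E_def c by (intro V.vsum_cong) (auto simp: coeff_pCons split: nat.split)
      also have "\<dots> = (if (0::nat) = 0 then c else 0) \<odot>\<^bsub>?V\<^esub> pw 0"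
        using less.prems by (intro V.vsum_single[of 0 N]) (auto simp: Hom_iff)
      finally have "scale_arr C c (ident C S) = zero_arr C S S"
        using less.prems by (simp add: pw_def)
      then have "scale_arr C (1 / c) (scale_arr C c (ident C S)) = zero_arr C S S" by simp
      then have "ident C S = zero_arr C S S" using c less.prems by (simp add: scale_scale)
      then show ?thesis using SD zero_object_iff[of S] by simp
    next
      case False
      then obtain a where "poly p a = 0" using alg_closed_imp_poly_has_root[of p] by auto
      then obtain r where r: "p = [:-a, 1:] * r" using poly_eq_0_iff_dvd by (metis dvdE)
      then have r0: "r \<noteq> 0" using less.prems by auto
      have deg: "degree p = Suc (degree r)" unfolding r using r0 by (subst degree_mult_eq) auto
      have c0: "coeff p 0 = - a * coeff r 0" and cS: "coeff p (Suc k) = coeff r k - a * coeff r (Suc k)"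
          for k
        unfolding r by (simp_all add: mult_pCons_left)
      let ?w = "sub_arr C u (scale_arr C a (ident C S))"
      have w [simp]: "?w \<in> arr C" "src C ?w = S" "tgt C ?w = S" by auto
      have wpw: "?w \<cdot> pw k = add_arr C (pw (Suc k)) (scale_arr C (- a) (pw k))" for k
        by (simp add: cmp_add_arr_left pw_Suc sub_arr_def scale_scale)
      \<comment> \<open>The correction term accounts for the cut-off: the top coefficient
        \<open>coeff p N\<close> of the left sum already contains \<open>- a * coeff r N\<close>,
        although \<open>E r N\<close> stops before the power \<open>N\<close>.\<close>
      have tele: "add_arr C (E p (Suc N)) (scale_arr C (a * coeff r N) (pw N)) = ?w \<cdot> E r N" for N
      proof (induction N)
        case 0
        have "add_arr C (scale_arr C (coeff p 0) (pw 0)) (scale_arr C (a * coeff r 0) (pw 0)) =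
          scale_arr C (coeff p 0 + a * coeff r 0) (pw 0)"
          using V.smult_add_scalar[of "pw 0"] by (simp add: Hom_iff)
        also have "\<dots> = zero_arr C S S" using c0 by simp
        finally show ?case by (simp add: E_def)
      next
        case (Suc N)
        let ?s = "\<lambda>c k. scale_arr C c (pw k)"
        have sc: "?s c k \<in> carrier ?V" "E p N \<in> carrier ?V" for c k p N by (auto simp: Hom_iff)
        have add: "add_arr C x y = x \<oplus>\<^bsub>?V\<^esub> y" for x y by simp
        have "?w \<cdot> E r (Suc N) = add_arr C (?w \<cdot> E r N) (?w \<cdot> ?s (coeff r N) N)"
          by (simp add: E_Suc cmp_add_arr_right)
        also have "?w \<cdot> ?s (coeff r N) N =
              scale_arr C (coeff r N) (add_arr C (pw (Suc N)) (?s (- a) N))"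
          by (simp add: wpw)
        also have "\<dots> = add_arr C (?s (coeff r N) (Suc N)) (?s (- (a * coeff r N)) N)"
          using V.smult_add_vec[of "pw (Suc N)" "?s (- a) N" "coeff r N"]
          by (simp add: Hom_iff scale_scale mult.commute)
        also have "add_arr C (?w \<cdot> E r N) \<dots> =
          add_arr C (add_arr C (E p (Suc N)) (?s (a * coeff r N) N)) (add_arr C (?s (coeff r N) (Suc N))
                (?s (- (a * coeff r N)) N))"
          by (simp only: Suc)
        also have "\<dots> = add_arr C (add_arr C (E p (Suc N)) (?s (coeff r N) (Suc N)))
            (add_arr C (?s (a * coeff r N) N) (?s (- (a * coeff r N)) N))"
          unfolding add using sc by (simp only: V.V.M.a_ac V.V.M.a_closed)
        also have "add_arr C (?s (a * coeff r N) N) (?s (- (a * coeff r N)) N) = zero_arr C S S"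
          using V.smult_add_scalar[of "pw N" "a * coeff r N" "- (a * coeff r N)"] by (simp add: Hom_iff)
        also have "?s (coeff r N) (Suc N) =
              add_arr C (?s (coeff p (Suc N)) (Suc N)) (?s (a * coeff r (Suc N)) (Suc N))"
          using V.smult_add_scalar[of "pw (Suc N)" "coeff p (Suc N)" "a * coeff r (Suc N)"]
          by (simp add: cS Hom_iff)
        also have "add_arr C (add_arr C (E p (Suc N)) (add_arr C (?s (coeff p (Suc N)) (Suc N))
              (?s (a * coeff r (Suc N)) (Suc N)))) (zero_arr C S S) =
          add_arr C (add_arr C (E p (Suc N)) (?s (coeff p (Suc N)) (Suc N))) (?s (a * coeff r (Suc N))
                (Suc N))"
          using V.V.M.a_assoc[OF sc(2) sc(1,1)] by simp
        finally show ?case by (simp add: E_Suc)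
      qed
      \<comment> \<open>\<open>degree r\<close> is one less than \<open>degree p\<close>, so
        \<open>coeff r (N - 1) = 0\<close> and the correction term vanishes when \<open>tele\<close>
        is used at \<open>N - 1\<close>.\<close>
      have "N = Suc (N - 1)" "coeff r (N - 1) = 0" "degree r < N - 1 \<or> degree r = N - 1 \<or> True"
        using less.prems deg by (auto intro!: coeff_eq_0)
      moreover have "coeff r (N - 1) = 0" using less.prems deg by (intro coeff_eq_0) auto
      ultimately have "?w \<cdot> E r (N - 1) = zero_arr C S S"
        using tele[of "N - 1"] less.prems(3) by simp
      show ?thesis
      proof (cases "?w = zero_arr C S S")
        case True
        then show ?thesis using sub_eq_zero_iff[of u "scale_arr C a (ident C S)"] by auto
      next
        case False
        then have "is_iso C ?w" using nonzero_between_simples_iso[of ?w] S by simp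
        then have "inv_arr C ?w \<cdot> (?w \<cdot> E r (N - 1)) = E r (N - 1)" by simp
        then have "E r (N - 1) = zero_arr C S S"
          unfolding \<open>?w \<cdot> E r (N - 1) = zero_arr C S S\<close> using \<open>is_iso C ?w\<close> by simp
        moreover have "E r N = E r (N - 1)"
        proof -
          have "E r (Suc (N - 1)) = E r (N - 1)"
            unfolding E_Suc[of r "N - 1"] \<open>coeff r (N - 1) = 0\<close> by simp
          then show ?thesis using \<open>N = Suc (N - 1)\<close> by simp
        qed
        ultimately show ?thesis using less.hyps[of r] deg r0 less.prems by simp
      qed
    qed
  qed
  \<comment> \<open>One more power of \<open>u\<close> than the dimension of the endomorphism space,
    so the powers are dependent; the relation is turned into the polynomial
    \<open>p\<close>.\<close>
  let ?n = "Suc (vdim ?V)"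
  have "\<not> indep ?V pw ?n" using V.indep_le_vdim by fastforce
  then obtain x i where x: "vsum ?V (\<lambda>i. x i \<odot>\<^bsub>?V\<^esub> pw i) ?n = \<zero>\<^bsub>?V\<^esub>" "i < ?n" "x i \<noteq> 0"
    unfolding indep_def by (auto simp: Hom_iff simp del: vsum.simps)
  define p where "p = (\<Sum>j<?n. monom (x j) j)"
  have cp: "coeff p j = (if j < ?n then x j else 0)" for j
    by (simp add: p_def coeff_sum coeff_monom del: sum.lessThan_Suc)
  have "p \<noteq> 0" using cp[of i] x by auto
  moreover have "degree p < ?n"
    using le_degree[of p "degree p"] cp[of "degree p"] \<open>p \<noteq> 0\<close> leading_coeff_0_iff by metis
  moreover have "E p ?n = zero_arr C S S"
    unfolding E_def using x(1) cp
        by (subst V.vsum_cong[where g = "\<lambda>i. x i \<odot>\<^bsub>?V\<^esub> pw i"]) (auto simp del: vsum.simps)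
  ultimately show ?thesis by (rule main)
qed

section \<open>Braided module categories\<close>

sublocale finite_module_category \<subseteq> A?: lin_action C M
proof unfold_locales
  show "is_iso M (massociator M X Y A)" "src M (massociator M X Y A) = (X \<otimes>\<^sub>o\<^bsub>C\<^esub> Y) \<rhd>\<^sub>o\<^bsub>M\<^esub> A"
    "tgt M (massociator M X Y A) = X \<rhd>\<^sub>o\<^bsub>M\<^esub> (Y \<rhd>\<^sub>o\<^bsub>M\<^esub> A)"
    if "X \<in> obj C" "Y \<in> obj C" "A \<in> obj M" for X Y A
    using massociator_Iso[OF that] by (auto simp: Iso_def Hom_iff)
  show "is_iso M (munitor M A)" "src M (munitor M A) = \<I>\<^bsub>C\<^esub> \<rhd>\<^sub>o\<^bsub>M\<^esub> A" "tgt M (munitor M A) = A"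
    if "A \<in> obj M" for A
    using munitor_Iso[OF that] by (auto simp: Iso_def Hom_iff)
  show "f \<rhd>\<^sub>m\<^bsub>M\<^esub> g \<in> arr M" "src M (f \<rhd>\<^sub>m\<^bsub>M\<^esub> g) = src C f \<rhd>\<^sub>o\<^bsub>M\<^esub> src M g"
    "tgt M (f \<rhd>\<^sub>m\<^bsub>M\<^esub> g) = tgt C f \<rhd>\<^sub>o\<^bsub>M\<^esub> tgt M g"
    if "f \<in> arr C" "g \<in> arr M" for f g
    using act_arr[of f "src C f" "tgt C f" g "src M g" "tgt M g"] that by (auto simp: Hom_iff)
  show "X \<rhd>\<^sub>o\<^bsub>M\<^esub> A \<in> obj M" if "X \<in> obj C" "A \<in> obj M" for X A
    using act_obj that by blast
  show "ident C X \<rhd>\<^sub>m\<^bsub>M\<^esub> ident M A = ident M (X \<rhd>\<^sub>o\<^bsub>M\<^esub> A)" if "X \<in> obj C" "A \<in> obj M" for X A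
    using act_ident that by blast
  show "(f' \<rhd>\<^sub>m\<^bsub>M\<^esub> g') \<cdot>\<^bsub>M\<^esub> (f \<rhd>\<^sub>m\<^bsub>M\<^esub> g) = (f' \<cdot>\<^bsub>C\<^esub> f) \<rhd>\<^sub>m\<^bsub>M\<^esub> (g' \<cdot>\<^bsub>M\<^esub> g)"
    if "f \<in> arr C" "f' \<in> arr C" "g \<in> arr M" "g' \<in> arr M" "tgt C f = src C f'" "tgt M g = src M g'"
    for f f' g g'
    using act_cmp[of f "src C f" "tgt C f" f' "tgt C f'" g "src M g" "tgt M g" g' "tgt M g'"] that
    by (auto simp: Hom_iff)
  show "f \<rhd>\<^sub>m\<^bsub>M\<^esub> scale_arr M a g = scale_arr M a (f \<rhd>\<^sub>m\<^bsub>M\<^esub> g)" if "f \<in> arr C" "g \<in> arr M" for f g a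
    using act_scale_right[of f "src C f" "tgt C f" g "src M g" "tgt M g"] that by (auto simp: Hom_iff)
  show "massociator M (tgt C f) (tgt C h) (tgt M g) \<cdot>\<^bsub>M\<^esub> ((f \<otimes>\<^sub>m\<^bsub>C\<^esub> h) \<rhd>\<^sub>m\<^bsub>M\<^esub> g) =
      (f \<rhd>\<^sub>m\<^bsub>M\<^esub> (h \<rhd>\<^sub>m\<^bsub>M\<^esub> g)) \<cdot>\<^bsub>M\<^esub> massociator M (src C f) (src C h) (src M g)"
    if "f \<in> arr C" "h \<in> arr C" "g \<in> arr M" for f h g
    using massociator_natural[of f "src C f" "tgt C f" h "src C h" "tgt C h" g "src M g" "tgt M g"] that
    by (auto simp: Hom_iff)
  show "munitor M (tgt M g) \<cdot>\<^bsub>M\<^esub> (ident C \<I>\<^bsub>C\<^esub> \<rhd>\<^sub>m\<^bsub>M\<^esub> g) = g \<cdot>\<^bsub>M\<^esub> munitor M (src M g)"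
    if "g \<in> arr M" for g
    using munitor_natural[of g "src M g" "tgt M g"] that by (auto simp: Hom_iff)
qed (fact module_pentagon module_triangle)+

context finite_module_category
begin

lemma act_right_short_exact:
  "\<lbrakk>short_exact C f g; A \<in> obj M\<rbrakk> \<Longrightarrow> short_exact M (f \<rhd>\<^sub>m\<^bsub>M\<^esub> ident M A) (g \<rhd>\<^sub>m\<^bsub>M\<^esub> ident M A)"
  using act_exact[of A] unfolding exact_functor_def by simp

end

context braided_finite_module_category
begin

lemma mbraiding_typing [simp]:
  assumes "X \<in> obj C" "A \<in> obj M"
  shows "is_iso M (mbraiding M X A)" "mbraiding M X A \<in> arr M" "src M (mbraiding M X A) = X \<rhd>\<^sub>o\<^bsub>M\<^esub> A"
    "tgt M (mbraiding M X A) = X \<rhd>\<^sub>o\<^bsub>M\<^esub> A"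
  using mbraiding_Iso[OF assms] by (auto simp: Iso_def Hom_iff)

lemma mbraiding_nat:
  "\<lbrakk>f \<in> arr C; A \<in> obj M\<rbrakk> \<Longrightarrow> mbraiding M (tgt C f) A \<cdot>\<^bsub>M\<^esub> (f \<rhd>\<^sub>m\<^bsub>M\<^esub> ident M A) =
    (f \<rhd>\<^sub>m\<^bsub>M\<^esub> ident M A) \<cdot>\<^bsub>M\<^esub> mbraiding M (src C f) A"
  using mbraiding_natural[of f "src C f" "tgt C f" "ident M A" A A] by (simp add: Hom_iff)

text \<open>
  Transported along \<open>\<I> \<otimes> \<I> \<cong> \<I>\<close>, the braiding axiom for \<open>\<I> \<otimes> \<I>\<close> says that \<open>e\<^sub>\<I>\<close> is idempotent.
\<close>

lemma mbraiding_unit: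
  assumes c: "is_iso C (braiding C \<I>\<^bsub>C\<^esub> \<I>\<^bsub>C\<^esub>)" "src C (braiding C \<I>\<^bsub>C\<^esub> \<I>\<^bsub>C\<^esub>) = \<I>\<^bsub>C\<^esub> \<otimes>\<^sub>o\<^bsub>C\<^esub> \<I>\<^bsub>C\<^esub>"
      "tgt C (braiding C \<I>\<^bsub>C\<^esub> \<I>\<^bsub>C\<^esub>) = \<I>\<^bsub>C\<^esub> \<otimes>\<^sub>o\<^bsub>C\<^esub> \<I>\<^bsub>C\<^esub>"
    and A [simp]: "A \<in> obj M"
  shows "mbraiding M \<I>\<^bsub>C\<^esub> A = ident M (\<I>\<^bsub>C\<^esub> \<rhd>\<^sub>o\<^bsub>M\<^esub> A)"
proof -
  let ?I = "\<I>\<^bsub>C\<^esub>" and ?A = "ident M A"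
  let ?e = "mbraiding M ?I A" and ?E = "mbraiding M (?I \<otimes>\<^sub>o\<^bsub>C\<^esub> ?I) A"
  let ?R = "runitor C ?I \<rhd>\<^sub>m\<^bsub>M\<^esub> ?A" and ?a = "massociator M ?I ?I A" and ?m = "munitor M (?I \<rhd>\<^sub>o\<^bsub>M\<^esub> A)"
  let ?c = "braiding C ?I ?I" and ?i = "ident C ?I"
  have ca: "?c \<in> arr C" using c by simp
  \<comment> \<open>Naturality at the right unitor shows that \<open>?E\<close> is \<open>?e\<close>
    conjugated by \<open>?R\<close>; according to \<open>key\<close>, each braiding factor in the
    axiom for \<open>\<I> \<otimes> \<I>\<close> is the same arrow.\<close>
  have E: "?E = inv_arr M ?R \<cdot>\<^bsub>M\<^esub> ?e \<cdot>\<^bsub>M\<^esub> ?R"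
  proof -
    have "inv_arr M ?R \<cdot>\<^bsub>M\<^esub> (?e \<cdot>\<^bsub>M\<^esub> ?R) = inv_arr M ?R \<cdot>\<^bsub>M\<^esub> (?R \<cdot>\<^bsub>M\<^esub> ?E)"
      using mbraiding_nat[of "runitor C ?I" A] by simp
    also have "\<dots> = ?E" by (rule M.iso_cancel) auto
    finally show ?thesis by simp
  qed
  have ma: "?m \<cdot>\<^bsub>M\<^esub> ?a = ?R" using munit_massoc[of ?I A] lunitor_unit_eq by simp
  have e: "?i \<rhd>\<^sub>m\<^bsub>M\<^esub> ?e = inv_arr M ?m \<cdot>\<^bsub>M\<^esub> ?e \<cdot>\<^bsub>M\<^esub> ?m"
  proof -
    have "inv_arr M ?m \<cdot>\<^bsub>M\<^esub> (?e \<cdot>\<^bsub>M\<^esub> ?m) = inv_arr M ?m \<cdot>\<^bsub>M\<^esub> (?m \<cdot>\<^bsub>M\<^esub> (?i \<rhd>\<^sub>m\<^bsub>M\<^esub> ?e))"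
      using munit_nat[of ?e] by simp
    also have "\<dots> = ?i \<rhd>\<^sub>m\<^bsub>M\<^esub> ?e" by (rule M.iso_cancel) auto
    finally show ?thesis by simp
  qed
  have key: "inv_arr M ?a \<cdot>\<^bsub>M\<^esub> (?i \<rhd>\<^sub>m\<^bsub>M\<^esub> ?e) \<cdot>\<^bsub>M\<^esub> ?a = ?E"
  proof -
    have "inv_arr M ?a \<cdot>\<^bsub>M\<^esub> (?i \<rhd>\<^sub>m\<^bsub>M\<^esub> ?e) \<cdot>\<^bsub>M\<^esub> ?a = (inv_arr M ?a \<cdot>\<^bsub>M\<^esub> inv_arr M ?m) \<cdot>\<^bsub>M\<^esub> ?e \<cdot>\<^bsub>M\<^esub>
          (?m \<cdot>\<^bsub>M\<^esub> ?a)"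
      unfolding e by simp
    also have "inv_arr M ?a \<cdot>\<^bsub>M\<^esub> inv_arr M ?m = inv_arr M (?m \<cdot>\<^bsub>M\<^esub> ?a)" by simp
    finally show ?thesis unfolding ma E .
  qed
  \<comment> \<open>By naturality \<open>?E\<close> commutes with the braiding \<open>?c\<close> of
    the unit, which therefore cancels from the axiom and leaves idempotency.\<close>
  have Ec: "?E \<cdot>\<^bsub>M\<^esub> (?c \<rhd>\<^sub>m\<^bsub>M\<^esub> ?A) = (?c \<rhd>\<^sub>m\<^bsub>M\<^esub> ?A) \<cdot>\<^bsub>M\<^esub> ?E"
    using mbraiding_nat[OF ca A] c by simp
  have "?E = (inv_arr M ?a \<cdot>\<^bsub>M\<^esub> (?i \<rhd>\<^sub>m\<^bsub>M\<^esub> ?e) \<cdot>\<^bsub>M\<^esub> ?a) \<cdot>\<^bsub>M\<^esub> (?c \<rhd>\<^sub>m\<^bsub>M\<^esub> ?A) \<cdot>\<^bsub>M\<^esub>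
      (inv_arr M ?a \<cdot>\<^bsub>M\<^esub> (?i \<rhd>\<^sub>m\<^bsub>M\<^esub> ?e) \<cdot>\<^bsub>M\<^esub> ?a) \<cdot>\<^bsub>M\<^esub> (inv_arr C ?c \<rhd>\<^sub>m\<^bsub>M\<^esub> ?A)"
    using mbraiding_tens[of ?I ?I A] c ca by simp
  then have "?E = ?E \<cdot>\<^bsub>M\<^esub> ((?c \<rhd>\<^sub>m\<^bsub>M\<^esub> ?A) \<cdot>\<^bsub>M\<^esub> ?E) \<cdot>\<^bsub>M\<^esub> (inv_arr C ?c \<rhd>\<^sub>m\<^bsub>M\<^esub> ?A)"
    unfolding key using c ca by simp
  also have "\<dots> = ?E \<cdot>\<^bsub>M\<^esub> ?E" unfolding Ec[symmetric] using c ca by simp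
  finally have "?E \<cdot>\<^bsub>M\<^esub> ident M ((?I \<otimes>\<^sub>o\<^bsub>C\<^esub> ?I) \<rhd>\<^sub>o\<^bsub>M\<^esub> A) = ?E \<cdot>\<^bsub>M\<^esub> ?E" by simp
  then have "?E = ident M ((?I \<otimes>\<^sub>o\<^bsub>C\<^esub> ?I) \<rhd>\<^sub>o\<^bsub>M\<^esub> A)"
    by - (rule M.monoD[OF M.iso_mono[of ?E]], auto)
  then have "?e \<cdot>\<^bsub>M\<^esub> ?R = ident M (?I \<rhd>\<^sub>o\<^bsub>M\<^esub> A) \<cdot>\<^bsub>M\<^esub> ?R"
    using mbraiding_nat[of "runitor C ?I" A] by simp
  then show ?thesis by - (rule M.epiD[OF M.iso_epi[of ?R]], auto)
qed

end

section \<open>Internal Homs and the components of the copairing\<close>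

locale braided_module_data =
  C?: braided_finite_tensor_category C +
  braided_finite_module_category C M +
  copairing_data C M ldual lev lcoev ihom iev E\<^sub>C \<pi>\<^sub>C E\<^sub>M \<pi>\<^sub>M
  for C :: "('o, 'm, 'k :: field) braided_moncat" (structure)
    and M :: "('o, 'm, 'p, 'q, 'k) braided_modcat" (structure)
    and ldual lev lcoev ihom iev E\<^sub>C \<pi>\<^sub>C E\<^sub>M \<pi>\<^sub>M

sublocale braided_module_data \<subseteq> rigid_tensor C ldual lev lcoev
  by unfold_locales

context braided_module_data
begin

lemma braiding_typing [simp]:
  assumes "X \<in> obj C" "Y \<in> obj C"
  shows "is_iso C (braiding C X Y)" "braiding C X Y \<in> arr C" "src C (braiding C X Y) = X \<otimes>\<^sub>o Y"
    "tgt C (braiding C X Y) = Y \<otimes>\<^sub>o X"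
  using braiding_Iso[OF assms] by (auto simp: Iso_def Hom_iff)

lemma iev_typing [simp]:
  assumes "A \<in> obj M" "B \<in> obj M"
  shows "ihom A B \<in> obj C" "iev A B \<in> arr M" "src M (iev A B) = ihom A B \<rhd>\<^sub>o\<^bsub>M\<^esub> A" "tgt M (iev A B) = B"
  using ihom_obj[OF assms] iev_Hom[OF assms] by (auto simp: Hom_iff)

lemma adjunct_props:
  assumes "A \<in> obj M" "B \<in> obj M" "X \<in> obj C" "g \<in> arr M" "src M g = X \<rhd>\<^sub>o\<^bsub>M\<^esub> A" "tgt M g = B"
  shows "adjunct X A B g \<in> arr C" "src C (adjunct X A B g) = X" "tgt C (adjunct X A B g) = ihom A B"
    "iev A B \<cdot>\<^bsub>M\<^esub> (adjunct X A B g \<rhd>\<^sub>m\<^bsub>M\<^esub> ident M A) = g"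
proof -
  have "\<exists>!f. f \<in> Hom C X (ihom A B) \<and> iev A B \<cdot>\<^bsub>M\<^esub> (f \<rhd>\<^sub>m\<^bsub>M\<^esub> ident M A) = g"
    using iev_universal[of A B X g] assms by (simp add: Hom_iff)
  from theI'[OF this] show "adjunct X A B g \<in> arr C" "src C (adjunct X A B g) = X"
    "tgt C (adjunct X A B g) = ihom A B" "iev A B \<cdot>\<^bsub>M\<^esub> (adjunct X A B g \<rhd>\<^sub>m\<^bsub>M\<^esub> ident M A) = g"
    by (auto simp: adjunct_def Hom_iff)
qed

lemma iev_inj:
  assumes "A \<in> obj M" "B \<in> obj M" "f \<in> arr C" "f' \<in> arr C" "src C f = src C f'"
    "tgt C f = ihom A B" "tgt C f' = ihom A B"
    "iev A B \<cdot>\<^bsub>M\<^esub> (f \<rhd>\<^sub>m\<^bsub>M\<^esub> ident M A) = iev A B \<cdot>\<^bsub>M\<^esub> (f' \<rhd>\<^sub>m\<^bsub>M\<^esub> ident M A)"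
  shows "f = f'"
proof -
  have "\<exists>!k. k \<in> Hom C (src C f) (ihom A B) \<and> iev A B \<cdot>\<^bsub>M\<^esub> (k \<rhd>\<^sub>m\<^bsub>M\<^esub> ident M A) =
        iev A B \<cdot>\<^bsub>M\<^esub> (f \<rhd>\<^sub>m\<^bsub>M\<^esub> ident M A)"
    using iev_universal[of A B "src C f" "iev A B \<cdot>\<^bsub>M\<^esub> (f \<rhd>\<^sub>m\<^bsub>M\<^esub> ident M A)"] assms(1-7)
        by (simp add: Hom_iff)
  moreover have "f \<in> Hom C (src C f) (ihom A B)" "f' \<in> Hom C (src C f) (ihom A B)"
    using assms(3-7) by (auto simp: Hom_iff)
  ultimately show ?thesis using assms(8) by metis
qed

lemma ihom_right_typing [simp]:
  assumes "A \<in> obj M" "g \<in> arr M"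
  shows "ihom_right A g \<in> arr C" "src C (ihom_right A g) = ihom A (src M g)"
    "tgt C (ihom_right A g) = ihom A (tgt M g)"
  using assms by (auto simp: ihom_right_def adjunct_props)

lemma ihom_left_typing [simp]:
  assumes "B \<in> obj M" "f \<in> arr M"
  shows "ihom_left f B \<in> arr C" "src C (ihom_left f B) = ihom (tgt M f) B"
    "tgt C (ihom_left f B) = ihom (src M f) B"
  using assms by (auto simp: ihom_left_def adjunct_props)

lemma ihom_right_ident:
  assumes "A \<in> obj M" "B \<in> obj M"
  shows "ihom_right A (ident M B) = ident C (ihom A B)"
  using assms adjunct_props[of A B "ihom A B" "iev A B"]
  by - (rule iev_inj[of A B], auto simp: ihom_right_def)

lemma icoev_typing [simp]:
  assumes "A \<in> obj M"
  shows "icoev A \<in> arr C" "src C (icoev A) = \<I>" "tgt C (icoev A) = ihom A A"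
  using assms adjunct_props[of A A "\<I>" "munitor M A"] by (auto simp: icoev_def)

lemma ihom_act_props:
  assumes "X \<in> obj C" "A \<in> obj M" "B \<in> obj M"
  shows "ihom_act X A B \<in> arr C" "src C (ihom_act X A B) = X \<otimes>\<^sub>o ihom A B"
    "tgt C (ihom_act X A B) = ihom A (X \<rhd>\<^sub>o\<^bsub>M\<^esub> B)"
    "iev A (X \<rhd>\<^sub>o\<^bsub>M\<^esub> B) \<cdot>\<^bsub>M\<^esub> (ihom_act X A B \<rhd>\<^sub>m\<^bsub>M\<^esub> ident M A) =
      (ident C X \<rhd>\<^sub>m\<^bsub>M\<^esub> iev A B) \<cdot>\<^bsub>M\<^esub> massociator M X (ihom A B) A"
  using assms adjunct_props[of A "X \<rhd>\<^sub>o\<^bsub>M\<^esub> B" "X \<otimes>\<^sub>o ihom A B" "(ident C X \<rhd>\<^sub>m\<^bsub>M\<^esub> iev A B) \<cdot>\<^bsub>M\<^esub>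
        massociator M X (ihom A B) A"]
  by (auto simp: ihom_act_def)

text \<open>
  Under the adjunctions for \<open>X\<close> on \<open>C\<close> and on \<open>M\<close>, composition with \<open>ihom_act\<close> becomes the universal
  property of the internal Hom for \<open>X\<^sup>* \<otimes> Y\<close>.
\<close>

lemma ihom_act_transpose:
  assumes [simp]: "X \<in> obj C" "A \<in> obj M" "B \<in> obj M" "Y \<in> obj C"
    and g: "g \<in> arr C" "src C g = ldual X \<otimes>\<^sub>o Y" "tgt C g = ihom A B"
  shows "iev A (X \<rhd>\<^sub>o\<^bsub>M\<^esub> B) \<cdot>\<^bsub>M\<^esub>
      ((ihom_act X A B \<cdot> (ident C X \<otimes>\<^sub>m g) \<cdot> associator C X (ldual X) Y \<cdot> (lcoev X \<otimes>\<^sub>m ident C Y) \<cdot>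
            inv_arr C (lunitor C Y)) \<rhd>\<^sub>m\<^bsub>M\<^esub> ident M A) =
    (ident C X \<rhd>\<^sub>m\<^bsub>M\<^esub> ((iev A B \<cdot>\<^bsub>M\<^esub> (g \<rhd>\<^sub>m\<^bsub>M\<^esub> ident M A)) \<cdot>\<^bsub>M\<^esub>
          inv_arr M (massociator M (ldual X) Y A))) \<cdot>\<^bsub>M\<^esub>
      adj_unit X (ldual X) (lcoev X) (Y \<rhd>\<^sub>o\<^bsub>M\<^esub> A)"
proof -
  let ?D = "ldual X" and ?x = "ident C X" and ?A = "ident M A" and ?y = "ident C Y"
  let ?s = "associator C X ?D Y" and ?l = "inv_arr C (lunitor C Y)" and ?c = "lcoev X"
  let ?b = "massociator M ?D Y A"
  note ip = ihom_act_props[of X A B]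
  have pent: "massociator M X (?D \<otimes>\<^sub>o Y) A \<cdot>\<^bsub>M\<^esub> (?s \<rhd>\<^sub>m\<^bsub>M\<^esub> ?A) =
    (?x \<rhd>\<^sub>m\<^bsub>M\<^esub> inv_arr M ?b) \<cdot>\<^bsub>M\<^esub> massociator M X ?D (Y \<rhd>\<^sub>o\<^bsub>M\<^esub> A) \<cdot>\<^bsub>M\<^esub> massociator M (X \<otimes>\<^sub>o ?D) Y A"
    using act_pentagon[of X ?D Y A] by simp
  have kelly: "massociator M \<I> Y A \<cdot>\<^bsub>M\<^esub> (?l \<rhd>\<^sub>m\<^bsub>M\<^esub> ?A) = inv_arr M (munitor M (Y \<rhd>\<^sub>o\<^bsub>M\<^esub> A))"
  proof -
    have "massociator M \<I> Y A \<cdot>\<^bsub>M\<^esub> (?l \<rhd>\<^sub>m\<^bsub>M\<^esub> ?A) =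
      inv_arr M (munitor M (Y \<rhd>\<^sub>o\<^bsub>M\<^esub> A)) \<cdot>\<^bsub>M\<^esub> (munitor M (Y \<rhd>\<^sub>o\<^bsub>M\<^esub> A) \<cdot>\<^bsub>M\<^esub> massociator M \<I> Y A) \<cdot>\<^bsub>M\<^esub>
            (?l \<rhd>\<^sub>m\<^bsub>M\<^esub> ?A)"
      by simp
    also have "\<dots> = inv_arr M (munitor M (Y \<rhd>\<^sub>o\<^bsub>M\<^esub> A))"
      unfolding munit_massoc[OF assms(4,2)] by simp
    finally show ?thesis .
  qed
  have "iev A (X \<rhd>\<^sub>o\<^bsub>M\<^esub> B) \<cdot>\<^bsub>M\<^esub>
      ((ihom_act X A B \<cdot> (?x \<otimes>\<^sub>m g) \<cdot> ?s \<cdot> (?c \<otimes>\<^sub>m ?y) \<cdot> ?l) \<rhd>\<^sub>m\<^bsub>M\<^esub> ?A) =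
    (iev A (X \<rhd>\<^sub>o\<^bsub>M\<^esub> B) \<cdot>\<^bsub>M\<^esub> (ihom_act X A B \<rhd>\<^sub>m\<^bsub>M\<^esub> ?A)) \<cdot>\<^bsub>M\<^esub> ((?x \<otimes>\<^sub>m g) \<rhd>\<^sub>m\<^bsub>M\<^esub> ?A) \<cdot>\<^bsub>M\<^esub>
          (?s \<rhd>\<^sub>m\<^bsub>M\<^esub> ?A) \<cdot>\<^bsub>M\<^esub> ((?c \<otimes>\<^sub>m ?y) \<rhd>\<^sub>m\<^bsub>M\<^esub> ?A) \<cdot>\<^bsub>M\<^esub> (?l \<rhd>\<^sub>m\<^bsub>M\<^esub> ?A)"
    using g ip(1-3) by simp
  also have "\<dots> = (?x \<rhd>\<^sub>m\<^bsub>M\<^esub> iev A B) \<cdot>\<^bsub>M\<^esub> (massociator M X (ihom A B) A \<cdot>\<^bsub>M\<^esub> ((?x \<otimes>\<^sub>m g) \<rhd>\<^sub>m\<^bsub>M\<^esub> ?A))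
        \<cdot>\<^bsub>M\<^esub> (?s \<rhd>\<^sub>m\<^bsub>M\<^esub> ?A) \<cdot>\<^bsub>M\<^esub> ((?c \<otimes>\<^sub>m ?y) \<rhd>\<^sub>m\<^bsub>M\<^esub> ?A) \<cdot>\<^bsub>M\<^esub> (?l \<rhd>\<^sub>m\<^bsub>M\<^esub> ?A)"
    unfolding ip(4)[OF assms(1-3)] using g by (simp del: act_interchange act_interchange')
  also have "\<dots> = (?x \<rhd>\<^sub>m\<^bsub>M\<^esub> iev A B) \<cdot>\<^bsub>M\<^esub> ((?x \<rhd>\<^sub>m\<^bsub>M\<^esub> (g \<rhd>\<^sub>m\<^bsub>M\<^esub> ?A)) \<cdot>\<^bsub>M\<^esub> massociator M X (?D \<otimes>\<^sub>o Y) A)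
        \<cdot>\<^bsub>M\<^esub> (?s \<rhd>\<^sub>m\<^bsub>M\<^esub> ?A) \<cdot>\<^bsub>M\<^esub> ((?c \<otimes>\<^sub>m ?y) \<rhd>\<^sub>m\<^bsub>M\<^esub> ?A) \<cdot>\<^bsub>M\<^esub> (?l \<rhd>\<^sub>m\<^bsub>M\<^esub> ?A)"
    using massoc_nat[of ?x g ?A] g by simp
  also have "\<dots> = (?x \<rhd>\<^sub>m\<^bsub>M\<^esub> iev A B) \<cdot>\<^bsub>M\<^esub> (?x \<rhd>\<^sub>m\<^bsub>M\<^esub> (g \<rhd>\<^sub>m\<^bsub>M\<^esub> ?A)) \<cdot>\<^bsub>M\<^esub>
        (massociator M X (?D \<otimes>\<^sub>o Y) A \<cdot>\<^bsub>M\<^esub> (?s \<rhd>\<^sub>m\<^bsub>M\<^esub> ?A)) \<cdot>\<^bsub>M\<^esub> ((?c \<otimes>\<^sub>m ?y) \<rhd>\<^sub>m\<^bsub>M\<^esub> ?A) \<cdot>\<^bsub>M\<^esub>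
        (?l \<rhd>\<^sub>m\<^bsub>M\<^esub> ?A)"
    using g by (simp del: act_interchange act_interchange')
  also have "\<dots> = (?x \<rhd>\<^sub>m\<^bsub>M\<^esub> iev A B) \<cdot>\<^bsub>M\<^esub> (?x \<rhd>\<^sub>m\<^bsub>M\<^esub> (g \<rhd>\<^sub>m\<^bsub>M\<^esub> ?A)) \<cdot>\<^bsub>M\<^esub> (?x \<rhd>\<^sub>m\<^bsub>M\<^esub> inv_arr M ?b) \<cdot>\<^bsub>M\<^esub>
        massociator M X ?D (Y \<rhd>\<^sub>o\<^bsub>M\<^esub> A) \<cdot>\<^bsub>M\<^esub>
      (massociator M (X \<otimes>\<^sub>o ?D) Y A \<cdot>\<^bsub>M\<^esub> ((?c \<otimes>\<^sub>m ?y) \<rhd>\<^sub>m\<^bsub>M\<^esub> ?A)) \<cdot>\<^bsub>M\<^esub> (?l \<rhd>\<^sub>m\<^bsub>M\<^esub> ?A)"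
    unfolding pent using g by (simp del: act_interchange act_interchange')
  also have "\<dots> = (?x \<rhd>\<^sub>m\<^bsub>M\<^esub> iev A B) \<cdot>\<^bsub>M\<^esub> (?x \<rhd>\<^sub>m\<^bsub>M\<^esub> (g \<rhd>\<^sub>m\<^bsub>M\<^esub> ?A)) \<cdot>\<^bsub>M\<^esub> (?x \<rhd>\<^sub>m\<^bsub>M\<^esub> inv_arr M ?b) \<cdot>\<^bsub>M\<^esub>
        massociator M X ?D (Y \<rhd>\<^sub>o\<^bsub>M\<^esub> A) \<cdot>\<^bsub>M\<^esub>
      (?c \<rhd>\<^sub>m\<^bsub>M\<^esub> ident M (Y \<rhd>\<^sub>o\<^bsub>M\<^esub> A)) \<cdot>\<^bsub>M\<^esub> (massociator M \<I> Y A \<cdot>\<^bsub>M\<^esub> (?l \<rhd>\<^sub>m\<^bsub>M\<^esub> ?A))"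
    using massoc_nat[of ?c ?y ?A] g by simp
  also have "\<dots> = (?x \<rhd>\<^sub>m\<^bsub>M\<^esub> ((iev A B \<cdot>\<^bsub>M\<^esub> (g \<rhd>\<^sub>m\<^bsub>M\<^esub> ?A)) \<cdot>\<^bsub>M\<^esub> inv_arr M ?b)) \<cdot>\<^bsub>M\<^esub>
        adj_unit X ?D ?c (Y \<rhd>\<^sub>o\<^bsub>M\<^esub> A)"
    unfolding kelly adj_unit_def using g by simp
  finally show ?thesis .
qed

text \<open>By \<open>ihom_act_transpose\<close>, composing with \<open>ihom_act\<close> amounts to
  a chain of bijections: two duality adjunctions and the universal property of the internal Hom.
  Their injectivity makes \<open>ihom_act\<close> mono, their surjectivity gives it a right
  inverse.\<close>

lemma ihom_act_iso:
  assumes X [simp]: "X \<in> obj C" and AB [simp]: "A \<in> obj M" "B \<in> obj M"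
  shows "is_iso C (ihom_act X A B)"
proof -
  note ip = ihom_act_props[OF assms]
  let ?H = "ihom A B" and ?K = "ihom A (X \<rhd>\<^sub>o\<^bsub>M\<^esub> B)"
  let ?u = "\<lambda>Y. associator C X (ldual X) Y \<cdot> (lcoev X \<otimes>\<^sub>m ident C Y) \<cdot> inv_arr C (lunitor C Y)"
  note d = left_dual[OF X]
  have mono: "is_mono C (ihom_act X A B)"
  proof (rule monoI)
    fix g h assume gh: "g \<in> arr C" "h \<in> arr C" "src C g = src C h" "tgt C g = src C (ihom_act X A B)"
      "tgt C h = src C (ihom_act X A B)" and eq: "ihom_act X A B \<cdot> g = ihom_act X A B \<cdot> h"
    let ?Y = "src C h"
    have Y [simp]: "?Y \<in> obj C" using gh by simp
    obtain g' where g': "g' \<in> arr C" "src C g' = ldual X \<otimes>\<^sub>o ?Y" "tgt C g' =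
          ?H" "(ident C X \<otimes>\<^sub>m g') \<cdot> ?u ?Y = g"
      using left_adj_surj[OF d X gh(1), of ?Y ?H] gh ip by auto
    obtain h' where h': "h' \<in> arr C" "src C h' = ldual X \<otimes>\<^sub>o ?Y" "tgt C h' =
          ?H" "(ident C X \<otimes>\<^sub>m h') \<cdot> ?u ?Y = h"
      using left_adj_surj[OF d X gh(2), of ?Y ?H] gh ip by auto
    let ?b = "massociator M (ldual X) ?Y A"
    have "(ident C X \<rhd>\<^sub>m\<^bsub>M\<^esub> ((iev A B \<cdot>\<^bsub>M\<^esub> (g' \<rhd>\<^sub>m\<^bsub>M\<^esub> ident M A)) \<cdot>\<^bsub>M\<^esub> inv_arr M ?b)) \<cdot>\<^bsub>M\<^esub>
          adj_unit X (ldual X) (lcoev X) (?Y \<rhd>\<^sub>o\<^bsub>M\<^esub> A) =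
      (ident C X \<rhd>\<^sub>m\<^bsub>M\<^esub> ((iev A B \<cdot>\<^bsub>M\<^esub> (h' \<rhd>\<^sub>m\<^bsub>M\<^esub> ident M A)) \<cdot>\<^bsub>M\<^esub> inv_arr M ?b)) \<cdot>\<^bsub>M\<^esub>
            adj_unit X (ldual X) (lcoev X) (?Y \<rhd>\<^sub>o\<^bsub>M\<^esub> A)"
      unfolding ihom_act_transpose[OF X AB Y g'(1-3), symmetric] ihom_act_transpose[OF X AB Y h'(1-3),
          symmetric]
        g'(4) h'(4) eq ..
    then have "(iev A B \<cdot>\<^bsub>M\<^esub> (g' \<rhd>\<^sub>m\<^bsub>M\<^esub> ident M A)) \<cdot>\<^bsub>M\<^esub> inv_arr M ?b =
          (iev A B \<cdot>\<^bsub>M\<^esub> (h' \<rhd>\<^sub>m\<^bsub>M\<^esub> ident M A)) \<cdot>\<^bsub>M\<^esub> inv_arr M ?b"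
      using g'(1-3) h'(1-3) by - (rule adj_inj[OF d X, where A = "?Y \<rhd>\<^sub>o\<^bsub>M\<^esub> A"], auto)
    then have "iev A B \<cdot>\<^bsub>M\<^esub> (g' \<rhd>\<^sub>m\<^bsub>M\<^esub> ident M A) = iev A B \<cdot>\<^bsub>M\<^esub> (h' \<rhd>\<^sub>m\<^bsub>M\<^esub> ident M A)"
      using g'(1-3) h'(1-3) by - (rule M.epiD[OF M.iso_epi[of "inv_arr M ?b"]], auto)
    then have "g' = h'" using g'(1-3) h'(1-3) by - (rule iev_inj[of A B], auto)
    then show "g = h" using g'(4) h'(4) by metis
  qed (use ip in simp)
  have K [simp]: "?K \<in> obj C" by simp
  \<comment> \<open>The evaluation corresponds to the identity of \<open>?K\<close>; its transpose
    \<open>h\<close> is carried back through the bijections to the right inverse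
    \<open>r\<close>.\<close>
  obtain h where h: "h \<in> arr M" "src M h = ldual X \<rhd>\<^sub>o\<^bsub>M\<^esub> (?K \<rhd>\<^sub>o\<^bsub>M\<^esub> A)" "tgt M h = B"
    "(ident C X \<rhd>\<^sub>m\<^bsub>M\<^esub> h) \<cdot>\<^bsub>M\<^esub> adj_unit X (ldual X) (lcoev X) (?K \<rhd>\<^sub>o\<^bsub>M\<^esub> A) = iev A (X \<rhd>\<^sub>o\<^bsub>M\<^esub> B)"
    using adj_surj[OF d X, of "iev A (X \<rhd>\<^sub>o\<^bsub>M\<^esub> B)" B] by auto
  let ?b = "massociator M (ldual X) ?K A"
  define g where "g = adjunct (ldual X \<otimes>\<^sub>o ?K) A B (h \<cdot>\<^bsub>M\<^esub> ?b)"
  have g: "g \<in> arr C" "src C g = ldual X \<otimes>\<^sub>o ?K" "tgt C g = ?H" "iev A B \<cdot>\<^bsub>M\<^esub> (g \<rhd>\<^sub>m\<^bsub>M\<^esub> ident M A) =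
        h \<cdot>\<^bsub>M\<^esub> ?b"
    using adjunct_props[of A B "ldual X \<otimes>\<^sub>o ?K" "h \<cdot>\<^bsub>M\<^esub> ?b"] h by (auto simp: g_def)
  define r where "r = (ident C X \<otimes>\<^sub>m g) \<cdot> ?u ?K"
  have r: "r \<in> arr C" "src C r = ?K" "tgt C r = X \<otimes>\<^sub>o ?H" using g by (auto simp: r_def)
  have "iev A (X \<rhd>\<^sub>o\<^bsub>M\<^esub> B) \<cdot>\<^bsub>M\<^esub> ((ihom_act X A B \<cdot> r) \<rhd>\<^sub>m\<^bsub>M\<^esub> ident M A) =
    (ident C X \<rhd>\<^sub>m\<^bsub>M\<^esub> ((h \<cdot>\<^bsub>M\<^esub> ?b) \<cdot>\<^bsub>M\<^esub> inv_arr M ?b)) \<cdot>\<^bsub>M\<^esub>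
          adj_unit X (ldual X) (lcoev X) (?K \<rhd>\<^sub>o\<^bsub>M\<^esub> A)"
    unfolding r_def using ihom_act_transpose[OF X AB K g(1-3)] by (simp only: g(4))
  also have "\<dots> = iev A (X \<rhd>\<^sub>o\<^bsub>M\<^esub> B)" using h by simp
  finally have "ihom_act X A B \<cdot> r = ident C ?K"
    using r ip by - (rule iev_inj[of A "X \<rhd>\<^sub>o\<^bsub>M\<^esub> B"], auto)
  then show ?thesis using mono_split_epi_iso[OF mono, of r] r ip by simp
qed

text \<open>With trivial braiding the middle factor \<open>ihom_right\<close> is an identity, and
  the canonical isomorphisms around it cancel. The last step relies on
  \<open>ihom_act_iso\<close>.\<close>

lemma copairing_component_trivial:
  assumes [simp]: "D \<in> obj C" "A \<in> obj M" and e: "mbraiding M (ldual D) A = ident M (ldual D \<rhd>\<^sub>o\<^bsub>M\<^esub> A)"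
  shows "copairing_component D A = (lcoev D \<otimes>\<^sub>m icoev A) \<cdot> inv_arr C (lunitor C \<I>)"
  using ihom_act_iso[of "ldual D" A A] ihom_act_props[of "ldual D" A A]
  by (simp add: copairing_component_def e ihom_right_ident)

end

section \<open>Weak factorizability\<close>

locale weakly_nondegenerate =
  braided_module_data C M ldual lev lcoev ihom iev E\<^sub>C \<pi>\<^sub>C E\<^sub>M \<pi>\<^sub>M
  for C :: "('o, 'm, 'k :: field) braided_moncat" (structure)
    and M :: "('o, 'm, 'p, 'q, 'k) braided_modcat" (structure)
    and ldual lev lcoev ihom iev E\<^sub>C \<pi>\<^sub>C E\<^sub>M \<pi>\<^sub>M +
  fixes \<omega> :: 'm
  assumes copairing: "universal_copairing \<omega>"
    and Omega_inj: "inj_on (Omega \<omega>) (Hom C E\<^sub>C \<I>)"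
begin

lemma pi_C_typing [simp]:
  "E\<^sub>C \<in> obj C" "X \<in> obj C \<Longrightarrow> \<pi>\<^sub>C X \<in> arr C" "X \<in> obj C \<Longrightarrow> src C (\<pi>\<^sub>C X) = E\<^sub>C"
  "X \<in> obj C \<Longrightarrow> tgt C (\<pi>\<^sub>C X) = X \<otimes>\<^sub>o ldual X"
  using end_C by (auto simp: is_end_C_def is_end_def is_wedge_def Hom_iff)

lemma pi_M_typing [simp]:
  "E\<^sub>M \<in> obj C" "A \<in> obj M \<Longrightarrow> \<pi>\<^sub>M A \<in> arr C" "A \<in> obj M \<Longrightarrow> src C (\<pi>\<^sub>M A) = E\<^sub>M"
  "A \<in> obj M \<Longrightarrow> tgt C (\<pi>\<^sub>M A) = ihom A A"
  using end_M by (auto simp: is_end_M_def is_end_def is_wedge_def Hom_iff)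

lemma omega_typing [simp]:
  "\<omega> \<in> arr C" "src C \<omega> = \<I>" "tgt C \<omega> = E\<^sub>C \<otimes>\<^sub>o E\<^sub>M"
  using copairing by (auto simp: universal_copairing_def Hom_iff)

lemma pi_C_dinatural:
  "f \<in> arr C \<Longrightarrow> (f \<otimes>\<^sub>m ident C (ldual (src C f))) \<cdot> \<pi>\<^sub>C (src C f) =
        (ident C (tgt C f) \<otimes>\<^sub>m ldual_arr f) \<cdot> \<pi>\<^sub>C (tgt C f)"
  using end_C unfolding is_end_C_def is_end_def is_wedge_def by blast

lemma pi_C_factor:
  assumes "is_wedge C C (\<lambda>X Y. Y \<otimes>\<^sub>o ldual X) (\<lambda>f Y. ident C Y \<otimes>\<^sub>m ldual_arr f)
       (\<lambda>X f. f \<otimes>\<^sub>m ident C (ldual X)) T \<tau>"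
  obtains u where "u \<in> arr C" "src C u = T" "tgt C u = E\<^sub>C" "\<And>X. X \<in> obj C \<Longrightarrow> \<pi>\<^sub>C X \<cdot> u = \<tau> X"
proof -
  have "\<exists>u. u \<in> Hom C T E\<^sub>C \<and> (\<forall>x\<in>obj C. \<pi>\<^sub>C x \<cdot> u = \<tau> x)"
    using end_C assms unfolding is_end_C_def is_end_def by blast
  then show ?thesis using that by (auto simp: Hom_iff)
qed

lemma pi_M_inj:
  assumes u: "u \<in> arr C" "v \<in> arr C" "src C u = src C v" "tgt C u = E\<^sub>M" "tgt C v = E\<^sub>M"
    and eq: "\<And>A. A \<in> obj M \<Longrightarrow> \<pi>\<^sub>M A \<cdot> u = \<pi>\<^sub>M A \<cdot> v"
  shows "u = v"
proof -
  have w: "ihom_right (src M f) f \<cdot> \<pi>\<^sub>M (src M f) = ihom_left f (tgt M f) \<cdot> \<pi>\<^sub>M (tgt M f)"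
      if "f \<in> arr M" for f
    using end_M that unfolding is_end_M_def is_end_def is_wedge_def by blast
  have "is_wedge C M ihom ihom_left ihom_right (src C v) (\<lambda>A. \<pi>\<^sub>M A \<cdot> v)"
    unfolding is_wedge_def
  proof (intro conjI ballI)
    fix f assume f: "f \<in> arr M"
    have "ihom_right (src M f) f \<cdot> \<pi>\<^sub>M (src M f) \<cdot> v = (ihom_right (src M f) f \<cdot> \<pi>\<^sub>M (src M f)) \<cdot> v"
      using f u by simp
    also have "\<dots> = ihom_left f (tgt M f) \<cdot> \<pi>\<^sub>M (tgt M f) \<cdot> v" unfolding w[OF f] using f u by simp
    finally show "ihom_right (src M f) f \<cdot> \<pi>\<^sub>M (src M f) \<cdot> v =
          ihom_left f (tgt M f) \<cdot> \<pi>\<^sub>M (tgt M f) \<cdot> v" .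
  qed (use u in \<open>auto simp: Hom_iff\<close>)
  then have "\<exists>!x. x \<in> Hom C (src C v) E\<^sub>M \<and> (\<forall>A\<in>obj M. \<pi>\<^sub>M A \<cdot> x = \<pi>\<^sub>M A \<cdot> v)"
    using end_M unfolding is_end_M_def is_end_def by blast
  moreover have "u \<in> Hom C (src C v) E\<^sub>M" "v \<in> Hom C (src C v) E\<^sub>M" using u by (auto simp: Hom_iff)
  ultimately show ?thesis using eq by metis
qed

text \<open>Tensoring with \<open>V\<close> is a right adjoint, so joint monicity of the
  \<open>\<pi>\<^sub>M A\<close> survives it: the claim is transposed to arrows into
  \<open>E\<^sub>M\<close>. The copairing is specified only after applying
  \<open>\<pi>\<^sub>M A\<close>, so this is how equations for it are checked.\<close>

lemma tens_pi_M_inj: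
  assumes V [simp]: "V \<in> obj C" and u: "u \<in> arr C" "v \<in> arr C" "src C u = src C v" "tgt C u =
        V \<otimes>\<^sub>o E\<^sub>M" "tgt C v = V \<otimes>\<^sub>o E\<^sub>M"
    and eq: "\<And>A. A \<in> obj M \<Longrightarrow> (ident C V \<otimes>\<^sub>m \<pi>\<^sub>M A) \<cdot> u = (ident C V \<otimes>\<^sub>m \<pi>\<^sub>M A) \<cdot> v"
  shows "u = v"
proof -
  let ?T = "src C v"
  have T [simp]: "?T \<in> obj C" using u by simp
  let ?n = "associator C V (ldual V) ?T \<cdot> (lcoev V \<otimes>\<^sub>m ident C ?T) \<cdot> inv_arr C (lunitor C ?T)"
  obtain u' where u': "u' \<in> arr C" "src C u' = ldual V \<otimes>\<^sub>o ?T" "tgt C u' =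
        E\<^sub>M" "(ident C V \<otimes>\<^sub>m u') \<cdot> ?n = u"
    using left_adj_surj[OF left_dual[OF V] V u(1), of ?T E\<^sub>M] u by auto
  obtain v' where v': "v' \<in> arr C" "src C v' = ldual V \<otimes>\<^sub>o ?T" "tgt C v' =
        E\<^sub>M" "(ident C V \<otimes>\<^sub>m v') \<cdot> ?n = v"
    using left_adj_surj[OF left_dual[OF V] V u(2), of ?T E\<^sub>M] u by auto
  have "\<pi>\<^sub>M A \<cdot> u' = \<pi>\<^sub>M A \<cdot> v'" if A: "A \<in> obj M" for A
  proof -
    have "(ident C V \<otimes>\<^sub>m (\<pi>\<^sub>M A \<cdot> u')) \<cdot> ?n = (ident C V \<otimes>\<^sub>m \<pi>\<^sub>M A) \<cdot> ((ident C V \<otimes>\<^sub>m u') \<cdot> ?n)"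
      using u'(1-3) A by simp
    also have "\<dots> = (ident C V \<otimes>\<^sub>m \<pi>\<^sub>M A) \<cdot> ((ident C V \<otimes>\<^sub>m v') \<cdot> ?n)"
      using eq[OF A] by (simp only: u'(4) v'(4))
    also have "\<dots> = (ident C V \<otimes>\<^sub>m (\<pi>\<^sub>M A \<cdot> v')) \<cdot> ?n" using v'(1-3) A by simp
    finally show ?thesis using u'(1-3) v'(1-3) A by - (rule left_adj_inj[OF left_dual[OF V] V,
        where A = ?T], auto)
  qed
  then have "u' = v'" using u'(1-3) v'(1-3) by - (rule pi_M_inj, auto)
  then show ?thesis using u'(4) v'(4) by metis
qed

text \<open>For morphisms with target \<open>\<I>\<close>, this is equality of the images under \<open>\<Omega>\<close>.\<close>

definition same_copairing :: "'m \<Rightarrow> 'm \<Rightarrow> bool" where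
  "same_copairing d d' \<longleftrightarrow> (d \<otimes>\<^sub>m ident C E\<^sub>M) \<cdot> \<omega> = (d' \<otimes>\<^sub>m ident C E\<^sub>M) \<cdot> \<omega>"

lemma same_copairing_cmp:
  assumes "same_copairing d d'" "d \<in> arr C" "d' \<in> arr C" "src C d = E\<^sub>C" "src C d' = E\<^sub>C" "tgt C d =
        tgt C d'"
    "g \<in> arr C" "src C g = tgt C d'"
  shows "same_copairing (g \<cdot> d) (g \<cdot> d')"
proof -
  have "(g \<otimes>\<^sub>m ident C E\<^sub>M) \<cdot> ((d \<otimes>\<^sub>m ident C E\<^sub>M) \<cdot> \<omega>) =
        (g \<otimes>\<^sub>m ident C E\<^sub>M) \<cdot> ((d' \<otimes>\<^sub>m ident C E\<^sub>M) \<cdot> \<omega>)"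
    using assms(1) unfolding same_copairing_def by (rule arg_cong)
  then show ?thesis unfolding same_copairing_def using assms(2-) by simp
qed

text \<open>Exactness of the tensor product keeps \<open>m \<otimes> id\<close> mono. Together with
  \<open>same_copairing_cmp\<close> this moves the relation between targets until it reaches one
  that embeds in the unit.\<close>

lemma same_copairing_mono:
  assumes m: "is_mono C m" and "same_copairing (m \<cdot> d) (m \<cdot> d')" "d \<in> arr C" "d' \<in> arr C" "src C d =
        E\<^sub>C" "src C d' = E\<^sub>C"
    "tgt C d = src C m" "tgt C d' = src C m"
  shows "same_copairing d d'"
proof -
  have ma: "m \<in> arr C" using m by simp
  have "(m \<otimes>\<^sub>m ident C E\<^sub>M) \<cdot> ((d \<otimes>\<^sub>m ident C E\<^sub>M) \<cdot> \<omega>) =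
        (m \<otimes>\<^sub>m ident C E\<^sub>M) \<cdot> ((d' \<otimes>\<^sub>m ident C E\<^sub>M) \<cdot> \<omega>)"
    using assms(2-) ma by (simp add: same_copairing_def)
  then show ?thesis unfolding same_copairing_def using assms(3-) ma
    by - (rule monoD[OF tens_mono_left[OF m, of E\<^sub>M]], auto)
qed

lemma same_copairing_unit:
  assumes "same_copairing d d'" "d \<in> arr C" "d' \<in> arr C" "src C d = E\<^sub>C" "src C d' = E\<^sub>C" "tgt C d =
        \<I>" "tgt C d' = \<I>"
  shows "d = d'"
proof (rule inj_onD[OF Omega_inj])
  show "Omega \<omega> d = Omega \<omega> d'" using assms(1) by (simp add: Omega_def same_copairing_def)
qed (use assms in \<open>auto simp: Hom_iff\<close>)

text \<open>Injectivity of \<open>\<Omega>\<close> extends to every target that embeds in the unit;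
  the relevant one is \<open>\<I> \<otimes> \<I>\<^sup>*\<close>.\<close>

lemma same_copairing_unit_mono:
  assumes m: "is_mono C m" "tgt C m = \<I>" and s: "same_copairing d d'" "d \<in> arr C" "d' \<in> arr C"
      "src C d = E\<^sub>C" "src C d' = E\<^sub>C"
    "tgt C d = src C m" "tgt C d' = src C m"
  shows "d = d'"
proof -
  have "same_copairing (m \<cdot> d) (m \<cdot> d')" using same_copairing_cmp[OF s(1)] s m by simp
  then have "m \<cdot> d = m \<cdot> d'" using s m by - (rule same_copairing_unit, auto)
  then show ?thesis using s m by - (rule monoD[OF m(1)], auto)
qed

text \<open>The copairing at \<open>D\<close> involves the braiding of \<open>D\<^sup>*\<close>, whence the dual in this definition.\<close>

definition center_dual :: "'o \<Rightarrow> bool" where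
  "center_dual D \<longleftrightarrow> D \<in> obj C \<and> (\<forall>A\<in>obj M. mbraiding M (ldual D) A = ident M (ldual D \<rhd>\<^sub>o\<^bsub>M\<^esub> A))"

section \<open>Subobjects and quotients with trivial module braiding\<close>

lemma act_right_mono:
  assumes "is_mono C m" "A \<in> obj M" shows "is_mono M (m \<rhd>\<^sub>m\<^bsub>M\<^esub> ident M A)"
proof -
  obtain q where "short_exact C m q" using mono_short_exact[OF assms(1)] .
  from act_right_short_exact[OF this assms(2)] show ?thesis
    using M.kernel_mono by (auto simp: short_exact_def)
qed

lemma act_right_epi:
  assumes "is_epi C e" "A \<in> obj M" shows "is_epi M (e \<rhd>\<^sub>m\<^bsub>M\<^esub> ident M A)"
proof -
  obtain k where "short_exact C k e" using epi_short_exact[OF assms(1)] .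
  from act_right_short_exact[OF this assms(2)] show ?thesis
    using M.cokernel_epi by (auto simp: short_exact_def)
qed

text \<open>Naturality along \<open>m\<close>, combined with exactness of the action in its first
  variable, which keeps \<open>m \<rhd> id\<close> mono.\<close>

lemma mbraiding_mono:
  assumes m: "is_mono C m" and A [simp]: "A \<in> obj M"
    and e: "mbraiding M (tgt C m) A = ident M (tgt C m \<rhd>\<^sub>o\<^bsub>M\<^esub> A)"
  shows "mbraiding M (src C m) A = ident M (src C m \<rhd>\<^sub>o\<^bsub>M\<^esub> A)"
proof -
  have ma [simp]: "m \<in> arr C" using m by simp
  have "(m \<rhd>\<^sub>m\<^bsub>M\<^esub> ident M A) \<cdot>\<^bsub>M\<^esub> mbraiding M (src C m) A =
        (m \<rhd>\<^sub>m\<^bsub>M\<^esub> ident M A) \<cdot>\<^bsub>M\<^esub> ident M (src C m \<rhd>\<^sub>o\<^bsub>M\<^esub> A)"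
    using mbraiding_nat[OF ma A] e by simp
  then show ?thesis by - (rule M.monoD[OF act_right_mono[OF m A]], auto)
qed

lemma mbraiding_epi:
  assumes m: "is_epi C m" and A [simp]: "A \<in> obj M"
    and e: "mbraiding M (src C m) A = ident M (src C m \<rhd>\<^sub>o\<^bsub>M\<^esub> A)"
  shows "mbraiding M (tgt C m) A = ident M (tgt C m \<rhd>\<^sub>o\<^bsub>M\<^esub> A)"
proof -
  have ma [simp]: "m \<in> arr C" using m by simp
  have "mbraiding M (tgt C m) A \<cdot>\<^bsub>M\<^esub> (m \<rhd>\<^sub>m\<^bsub>M\<^esub> ident M A) =
        ident M (tgt C m \<rhd>\<^sub>o\<^bsub>M\<^esub> A) \<cdot>\<^bsub>M\<^esub> (m \<rhd>\<^sub>m\<^bsub>M\<^esub> ident M A)"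
    using mbraiding_nat[OF ma A] e by simp
  then show ?thesis by - (rule M.epiD[OF act_right_epi[OF m A]], auto)
qed

text \<open>Duality turns a subobject into a quotient, so \<open>mbraiding_epi\<close> applies;
  \<open>center_dual_quot\<close> is the opposite case.\<close>

lemma center_dual_sub:
  assumes "center_dual (tgt C m)" "is_mono C m"
  shows "center_dual (src C m)"
  unfolding center_dual_def
proof (intro conjI ballI)
  have ma: "m \<in> arr C" using assms by simp
  then show "src C m \<in> obj C" by simp
  fix A assume "A \<in> obj M"
  then show "mbraiding M (ldual (src C m)) A = ident M (ldual (src C m) \<rhd>\<^sub>o\<^bsub>M\<^esub> A)"
    using mbraiding_epi[OF ldual_epi[OF assms(2)], of A] assms(1) ma by (simp add: center_dual_def)
qed

lemma center_dual_quot: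
  assumes "center_dual (src C e)" "is_epi C e"
  shows "center_dual (tgt C e)"
  unfolding center_dual_def
proof (intro conjI ballI)
  have ea: "e \<in> arr C" using assms by simp
  then show "tgt C e \<in> obj C" by simp
  fix A assume "A \<in> obj M"
  then show "mbraiding M (ldual (tgt C e)) A = ident M (ldual (tgt C e) \<rhd>\<^sub>o\<^bsub>M\<^esub> A)"
    using mbraiding_mono[OF ldual_mono[OF assms(2)], of A] assms(1) ea by (simp add: center_dual_def)
qed

definition unit_iso :: 'm where
  "unit_iso = lunitor C (ldual \<I>) \<cdot> lcoev \<I>"

lemma unit_iso [simp]:
  "is_iso C unit_iso" "unit_iso \<in> arr C" "src C unit_iso = \<I>" "tgt C unit_iso = ldual \<I>"
  using lcoev_unit_iso by (auto simp: unit_iso_def)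

lemma mbraiding_unit': "A \<in> obj M \<Longrightarrow> mbraiding M \<I> A = ident M (\<I> \<rhd>\<^sub>o\<^bsub>M\<^esub> A)"
  by (rule mbraiding_unit) auto

text \<open>The braiding is trivial on the unit, whereas the condition concerns the dual of the
  unit; \<open>unit_iso\<close> connects the two.\<close>

lemma center_dual_unit: "center_dual \<I>"
  using mbraiding_epi[OF iso_epi[OF unit_iso(1)]] mbraiding_unit' by (simp add: center_dual_def)

text \<open>The morphism \<open>\<epsilon>\<close> of the overview, arranged so that
  \<open>\<pi>\<^sub>C \<I>\<close> is the coevaluation of the unit after
  \<open>counit_C\<close>.\<close>

definition counit_C :: 'm where
  "counit_C = inv_arr C (lcoev \<I>) \<cdot> \<pi>\<^sub>C \<I>"

lemma counit_C_typing [simp]: "counit_C \<in> arr C" "src C counit_C = E\<^sub>C" "tgt C counit_C = \<I>"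
  using lcoev_unit_iso by (auto simp: counit_C_def)

lemma lcoev_counit: "lcoev \<I> \<cdot> counit_C = \<pi>\<^sub>C \<I>"
  using lcoev_unit_iso by (simp add: counit_C_def)

text \<open>At \<open>D\<close> and at the unit the copairing components are plain tensor products
  of coevaluations. Hence composing the component at the unit with
  \<open>lcoev D \<cdot> inv_arr C (lcoev \<I>)\<close> in the first factor gives the component at
  \<open>D\<close>.\<close>

lemma center_dual_same_copairing:
  assumes D: "center_dual D"
  shows "same_copairing (\<pi>\<^sub>C D) (lcoev D \<cdot> counit_C)"
proof -
  have [simp]: "D \<in> obj C" using D by (simp add: center_dual_def)
  have *: "(\<pi>\<^sub>C X \<otimes>\<^sub>m \<pi>\<^sub>M A) \<cdot> \<omega> = (lcoev X \<otimes>\<^sub>m icoev A) \<cdot> inv_arr C (lunitor C \<I>)"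
    if "center_dual X" "A \<in> obj M" for X A
    using copairing copairing_component_trivial[of X A] that
    by (simp add: universal_copairing_def center_dual_def)
  show ?thesis unfolding same_copairing_def
  proof (rule tens_pi_M_inj[where V = "D \<otimes>\<^sub>o ldual D"])
    fix A assume A: "A \<in> obj M"
    let ?n = "inv_arr C (lcoev \<I>)" and ?V = "ident C (D \<otimes>\<^sub>o ldual D)"
    have n: "?n \<in> arr C" "src C ?n = \<I> \<otimes>\<^sub>o ldual \<I>" "tgt C ?n = \<I>" "?n \<cdot> lcoev \<I> = ident C \<I>"
      using lcoev_unit_iso by auto
    have "(?V \<otimes>\<^sub>m \<pi>\<^sub>M A) \<cdot> ((lcoev D \<cdot> counit_C) \<otimes>\<^sub>m ident C E\<^sub>M) \<cdot> \<omega> =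
      ((lcoev D \<cdot> ?n) \<otimes>\<^sub>m ident C (ihom A A)) \<cdot> ((\<pi>\<^sub>C \<I> \<otimes>\<^sub>m \<pi>\<^sub>M A) \<cdot> \<omega>)"
      using A n(1-3) by (simp add: counit_C_def)
    also have "\<dots> = ((lcoev D \<cdot> ?n) \<otimes>\<^sub>m ident C (ihom A A)) \<cdot> (lcoev \<I> \<otimes>\<^sub>m icoev A) \<cdot>
          inv_arr C (lunitor C \<I>)"
      unfolding *[OF center_dual_unit A] ..
    also have "\<dots> = ((lcoev D \<cdot> ?n \<cdot> lcoev \<I>) \<otimes>\<^sub>m icoev A) \<cdot> inv_arr C (lunitor C \<I>)" using A n(1-3)
        by simp
    also have "\<dots> = (\<pi>\<^sub>C D \<otimes>\<^sub>m \<pi>\<^sub>M A) \<cdot> \<omega>" unfolding *[OF D A] n(4) by simp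
    finally show "(?V \<otimes>\<^sub>m \<pi>\<^sub>M A) \<cdot> (\<pi>\<^sub>C D \<otimes>\<^sub>m ident C E\<^sub>M) \<cdot> \<omega> =
      (?V \<otimes>\<^sub>m \<pi>\<^sub>M A) \<cdot> ((lcoev D \<cdot> counit_C) \<otimes>\<^sub>m ident C E\<^sub>M) \<cdot> \<omega>"
      using A by simp
  qed auto
qed

end

section \<open>Arrows from covers to simple objects\<close>

context abelian_category
begin

text \<open>A nonzero arrow to a simple object is a quotient of \<open>Q\<close>, and
  \<open>local_cover_quotient\<close> compares that quotient with the top of
  \<open>Q\<close>.\<close>

lemma cover_to_simple:
  assumes q: "local_cover Q q" "simple_object C (tgt C q)"
    and x: "x \<in> arr C" "src C x = Q" "simple_object C (tgt C x)" "x \<noteq> zero_arr C Q (tgt C x)"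
  obtains u where "is_iso C u" "src C u = tgt C x" "tgt C u = tgt C q" "u \<cdot> x = q"
proof -
  have e: "is_epi C x" using nonzero_into_simple_epi[of x] x by simp
  obtain u where u: "u \<in> arr C" "src C u = tgt C x" "tgt C u = tgt C q" "u \<cdot> x = q"
    using local_cover_quotient[OF q e x(2)] simple_objectD(2)[OF x(3)] by blast
  have "u \<noteq> zero_arr C (tgt C x) (tgt C q)"
  proof
    assume "u = zero_arr C (tgt C x) (tgt C q)"
    then have "q = zero_arr C (src C q) (tgt C q)" using u x local_coverD(3,4)[OF q(1)] by simp
    then show False using epi_zero_object[OF local_coverD(2)[OF q(1)]] simple_objectD(2)[OF q(2)]
        by blast
  qed
  then have "is_iso C u" using nonzero_between_simples_iso[of u] u x q by simp
  then show ?thesis using that u by blast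
qed

text \<open>Schur's lemma is a hypothesis because it has two sources: for the unit it is the axiom
  on its endomorphisms, for other simple objects it rests on algebraic closedness.\<close>

lemma cover_multiple:
  assumes q: "local_cover Q q" "simple_object C (tgt C q)"
    and schur: "\<And>u. u \<in> Hom C (tgt C q) (tgt C q) \<Longrightarrow> \<exists>a. u = scale_arr C a (ident C (tgt C q))"
    and x: "x \<in> Hom C Q (tgt C q)"
  shows "\<exists>a. x = scale_arr C a q"
proof (cases "x = zero_arr C Q (tgt C q)")
  case True
  then show ?thesis using local_coverD(3,4)[OF q(1)] by (intro exI[of _ 0]) simp
next
  case False
  have xa: "x \<in> arr C" "src C x = Q" "tgt C x = tgt C q" using x by (auto simp: Hom_iff)
  then obtain u where u: "is_iso C u" "src C u = tgt C q" "tgt C u = tgt C q" "u \<cdot> x = q"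
    using cover_to_simple[OF q xa(1,2)] q False by auto
  then obtain a where a: "u = scale_arr C a (ident C (tgt C q))" using schur[of u]
      by (auto simp: Hom_iff)
  have "a \<noteq> 0" using iso_nonzero[OF u(1)] u simple_objectD[OF q(2)] a by auto
  moreover have "q = scale_arr C a x" using u(4) a xa local_coverD(4)[OF q(1)] by simp
  ultimately have "x = scale_arr C (1 / a) q" using xa by (simp add: scale_scale)
  then show ?thesis by blast
qed

end

text \<open>A multiple of the unit, given by the inclusions \<open>a i\<close> and projections
  \<open>b i\<close> of an \<open>n\<close>-fold biproduct; \<open>n = 0\<close> describes zero
  objects. Carrying these arrows along replaces iterated biproduct objects and gives coordinates for
  arrows at once.\<close>

definition trivial_object :: "('o, 'm, 'k :: field, 'z) moncat_scheme \<Rightarrow> 'o \<Rightarrow> nat \<Rightarrow> (nat \<Rightarrow> 'm) \<Rightarrow>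
      (nat \<Rightarrow> 'm) \<Rightarrow> bool" where
  "trivial_object C D n a b \<longleftrightarrow> D \<in> obj C \<and>
     (\<forall>i<n. a i \<in> Hom C \<I>\<^bsub>C\<^esub> D \<and> b i \<in> Hom C D \<I>\<^bsub>C\<^esub>) \<and>
     (\<forall>i<n. \<forall>j<n. b i \<cdot>\<^bsub>C\<^esub> a j = (if i = j then ident C \<I>\<^bsub>C\<^esub> else zero_arr C \<I>\<^bsub>C\<^esub> \<I>\<^bsub>C\<^esub>)) \<and>
     vsum (hom_space C D D) (\<lambda>i. a i \<cdot>\<^bsub>C\<^esub> b i) n = ident C D"

section \<open>Multiples of the unit object\<close>

context linear_monoidal_category
begin

lemma trivial_objectD:
  assumes "trivial_object C D n a b"
  shows "D \<in> obj C" "\<And>i. i < n \<Longrightarrow> a i \<in> arr C" "\<And>i. i < n \<Longrightarrow> src C (a i) = \<I>" "\<And>i. i < n \<Longrightarrow> tgt C (a i) =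
        D"
    "\<And>i. i < n \<Longrightarrow> b i \<in> arr C" "\<And>i. i < n \<Longrightarrow> src C (b i) = D" "\<And>i. i < n \<Longrightarrow> tgt C (b i) = \<I>"
    "\<And>i j. \<lbrakk>i < n; j < n\<rbrakk> \<Longrightarrow> b i \<cdot> a j = (if i = j then ident C \<I> else zero_arr C \<I> \<I>)"
    "vsum (hom_space C D D) (\<lambda>i. a i \<cdot> b i) n = ident C D"
  using assms unfolding trivial_object_def Hom_iff by blast+

lemma trivial_object_joint_mono:
  assumes D: "trivial_object C D n a b"
    and fg: "f \<in> arr C" "g \<in> arr C" "src C f = src C g" "tgt C f = D" "tgt C g = D"
    and eq: "\<And>i. i < n \<Longrightarrow> b i \<cdot> f = b i \<cdot> g"
  shows "f = g"
proof -
  note DD = trivial_objectD[OF D]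
  have *: "vsum (hom_space C (src C h) D) (\<lambda>i. a i \<cdot> (b i \<cdot> h)) n = h"
    if h: "h \<in> arr C" "tgt C h = D" for h
  proof -
    interpret H: vec_space "hom_space C (src C h) D" using vec_space_Hom h DD by simp
    have "vsum (hom_space C D D) (\<lambda>i. a i \<cdot> b i) n \<cdot> h =
          vsum (hom_space C (src C h) D) (\<lambda>i. (a i \<cdot> b i) \<cdot> h) n"
      using DD h by (intro vsum_cmp) (auto simp: Hom_iff)
    also have "\<dots> = vsum (hom_space C (src C h) D) (\<lambda>i. a i \<cdot> (b i \<cdot> h)) n"
      using DD h by (intro H.vsum_cong) auto
    finally show ?thesis using DD(9) h by simp
  qed
  interpret H: vec_space "hom_space C (src C g) D" using vec_space_Hom fg DD by simp
  have "vsum (hom_space C (src C g) D) (\<lambda>i. a i \<cdot> (b i \<cdot> f)) n =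
        vsum (hom_space C (src C g) D) (\<lambda>i. a i \<cdot> (b i \<cdot> g)) n"
    by (rule H.vsum_cong) (simp only: eq)
  then show ?thesis
    using *[OF fg(1,4), unfolded fg(3)] *[OF fg(2,5)] by (metis (no_types, lifting))
qed

text \<open>Tensoring with \<open>X\<close> preserves the expansion of the identity of
  \<open>D\<close>, so the projections \<open>b i\<close> remain jointly mono.\<close>

lemma trivial_object_tens_joint_mono:
  assumes D: "trivial_object C D n a b" and X: "X \<in> obj C"
    and fg: "f \<in> arr C" "g \<in> arr C" "src C f = src C g" "tgt C f = D \<otimes>\<^sub>o X" "tgt C g = D \<otimes>\<^sub>o X"
    and eq: "\<And>i. i < n \<Longrightarrow> (b i \<otimes>\<^sub>m ident C X) \<cdot> f = (b i \<otimes>\<^sub>m ident C X) \<cdot> g"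
  shows "f = g"
proof -
  note DD = trivial_objectD[OF D]
  let ?X = "ident C X"
  have *: "vsum (hom_space C (src C h) (D \<otimes>\<^sub>o X)) (\<lambda>i. (a i \<otimes>\<^sub>m ?X) \<cdot> ((b i \<otimes>\<^sub>m ?X) \<cdot> h)) n = h"
    if h: "h \<in> arr C" "tgt C h = D \<otimes>\<^sub>o X" for h
  proof -
    interpret H: vec_space "hom_space C (src C h) (D \<otimes>\<^sub>o X)" using vec_space_Hom h DD X by simp
    have "vsum (hom_space C D D) (\<lambda>i. a i \<cdot> b i) n \<otimes>\<^sub>m ?X =
      vsum (hom_space C (D \<otimes>\<^sub>o X) (D \<otimes>\<^sub>o X)) (\<lambda>i. (a i \<cdot> b i) \<otimes>\<^sub>m ?X) n"
      using DD X by (intro vsum_tens) (auto simp: Hom_iff)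
    then have "vsum (hom_space C (D \<otimes>\<^sub>o X) (D \<otimes>\<^sub>o X)) (\<lambda>i. (a i \<cdot> b i) \<otimes>\<^sub>m ?X) n = ident C (D \<otimes>\<^sub>o X)"
      using DD(9) DD(1) X by simp
    moreover have "vsum (hom_space C (D \<otimes>\<^sub>o X) (D \<otimes>\<^sub>o X)) (\<lambda>i. (a i \<cdot> b i) \<otimes>\<^sub>m ?X) n \<cdot> h =
      vsum (hom_space C (src C h) (D \<otimes>\<^sub>o X)) (\<lambda>i. ((a i \<cdot> b i) \<otimes>\<^sub>m ?X) \<cdot> h) n"
      using DD h X by (intro vsum_cmp) (auto simp: Hom_iff)
    moreover have "vsum (hom_space C (src C h) (D \<otimes>\<^sub>o X)) (\<lambda>i. ((a i \<cdot> b i) \<otimes>\<^sub>m ?X) \<cdot> h) n =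
      vsum (hom_space C (src C h) (D \<otimes>\<^sub>o X)) (\<lambda>i. (a i \<otimes>\<^sub>m ?X) \<cdot> ((b i \<otimes>\<^sub>m ?X) \<cdot> h)) n"
      using DD h X by (intro H.vsum_cong) auto
    ultimately show ?thesis using h by simp
  qed
  interpret H: vec_space "hom_space C (src C g) (D \<otimes>\<^sub>o X)" using vec_space_Hom fg DD X by simp
  have "vsum (hom_space C (src C g) (D \<otimes>\<^sub>o X)) (\<lambda>i. (a i \<otimes>\<^sub>m ?X) \<cdot> ((b i \<otimes>\<^sub>m ?X) \<cdot> f)) n =
    vsum (hom_space C (src C g) (D \<otimes>\<^sub>o X)) (\<lambda>i. (a i \<otimes>\<^sub>m ?X) \<cdot> ((b i \<otimes>\<^sub>m ?X) \<cdot> g)) n"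
    by (rule H.vsum_cong) (simp only: eq)
  then show ?thesis
    using *[OF fg(1,4), unfolded fg(3)] *[OF fg(2,5)] by (metis (no_types, lifting))
qed

lemma trivial_object_iso:
  assumes D: "trivial_object C D n a b" and j: "is_iso C j" "src C j = D" "tgt C j = D'"
  shows "trivial_object C D' n (\<lambda>i. j \<cdot> a i) (\<lambda>i. b i \<cdot> inv_arr C j)"
proof -
  note DD = trivial_objectD[OF D]
  have D': "D' \<in> obj C" and ja: "j \<in> arr C" using j by auto
  interpret H: vec_space "hom_space C D' D'" using vec_space_Hom D' by simp
  have "vsum (hom_space C D' D') (\<lambda>i. (j \<cdot> a i) \<cdot> (b i \<cdot> inv_arr C j)) n =
    vsum (hom_space C D' D') (\<lambda>i. j \<cdot> ((a i \<cdot> b i) \<cdot> inv_arr C j)) n"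
    using DD j by (intro H.vsum_cong) auto
  also have "\<dots> = j \<cdot> vsum (hom_space C D' D) (\<lambda>i. (a i \<cdot> b i) \<cdot> inv_arr C j) n"
    using DD j D' ja by (intro cmp_vsum[symmetric]) (auto simp: Hom_iff)
  also have "vsum (hom_space C D' D) (\<lambda>i. (a i \<cdot> b i) \<cdot> inv_arr C j) n =
        vsum (hom_space C D D) (\<lambda>i. a i \<cdot> b i) n \<cdot> inv_arr C j"
    using DD j by (intro vsum_cmp[symmetric]) (auto simp: Hom_iff)
  also have "j \<cdot> \<dots> = ident C D'" unfolding DD(9) using j ja by simp
  finally show ?thesis unfolding trivial_object_def using DD(2-8) D' ja j by (auto simp: Hom_iff)
qed
lemma trivial_object_biproduct:
  assumes T: "trivial_object C D n a b" and P: "is_biproduct C D \<I> P i j p q"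
  shows "trivial_object C P (Suc n) (\<lambda>k. if k < n then i \<cdot> a k else j) (\<lambda>k. if k < n then b k \<cdot>
        p else q)"
proof -
  note TD = trivial_objectD[OF T]
  have D: "D \<in> obj C" by (rule TD(1))
  have ij [simp]: "i \<in> arr C" "src C i = D" "tgt C i = P" "j \<in> arr C" "src C j = \<I>" "tgt C j = P"
    "p \<in> arr C" "src C p = P" "tgt C p = D" "q \<in> arr C" "src C q = P" "tgt C q = \<I>"
    using P by (auto simp: is_biproduct_def Hom_iff)
  have PO [simp]: "P \<in> obj C" using tgt_obj[of i] by simp
  have pi: "p \<cdot> i = ident C D" and qj: "q \<cdot> j = ident C \<I>" and qi: "q \<cdot> i = zero_arr C D \<I>"
    and pj: "p \<cdot> j = zero_arr C \<I> D" and sum: "add_arr C (i \<cdot> p) (j \<cdot> q) = ident C P"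
    using P by (auto simp: is_biproduct_def)
  let ?a = "\<lambda>k. if k < n then i \<cdot> a k else j" and ?b = "\<lambda>k. if k < n then b k \<cdot> p else q"
  interpret H: vec_space "hom_space C P P" using vec_space_Hom by simp
  have "vsum (hom_space C P P) (\<lambda>k. ?a k \<cdot> ?b k) n =
        vsum (hom_space C P P) (\<lambda>k. i \<cdot> ((a k \<cdot> b k) \<cdot> p)) n"
    using TD(1-7) by (intro H.vsum_cong) auto
  also have "\<dots> = i \<cdot> vsum (hom_space C P D) (\<lambda>k. (a k \<cdot> b k) \<cdot> p) n"
    using TD(1-7) by (intro cmp_vsum[symmetric]) (auto simp: Hom_iff)
  also have "vsum (hom_space C P D) (\<lambda>k. (a k \<cdot> b k) \<cdot> p) n = vsum (hom_space C D D) (\<lambda>k. a k \<cdot> b k) n \<cdot>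
        p"
    using TD(1-7) by (intro vsum_cmp[symmetric]) (auto simp: Hom_iff)
  also have "i \<cdot> \<dots> = i \<cdot> p" unfolding TD(9) by simp
  finally have "vsum (hom_space C P P) (\<lambda>k. ?a k \<cdot> ?b k) (Suc n) = ident C P" using sum by simp
  moreover have "?b k \<cdot> ?a l = (if k = l then ident C \<I> else zero_arr C \<I> \<I>)" if "k < Suc n" "l < Suc n"
      for k l
  proof -
    have pix: "p \<cdot> (i \<cdot> x) = x" if "x \<in> arr C" "tgt C x = D" for x
      using cmp_reduce[OF pi, of x] that by simp
    have qix: "q \<cdot> (i \<cdot> x) = zero_arr C (src C x) \<I>" if "x \<in> arr C" "tgt C x = D" for x
      using cmp_reduce[OF qi, of x] that D by simp
    show ?thesis using that TD(2-8) D pix qix pj qj by (auto simp: less_Suc_eq)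
  qed
  ultimately show ?thesis unfolding trivial_object_def using TD(2-7) by (auto simp: Hom_iff)
qed

end

section \<open>Multiples of the unit seen by the end, and their extensions\<close>

context weakly_nondegenerate
begin

text \<open>Along each projection \<open>b i\<close> to the unit both \<open>\<pi>\<^sub>C\<close>
  and the coevaluations are dinatural, so the claim is pulled back from the unit, where it is the
  definition of \<open>counit_C\<close>.\<close>

lemma pi_C_trivial_object:
  assumes D: "trivial_object C D n a b"
  shows "\<pi>\<^sub>C D = lcoev D \<cdot> counit_C"
proof (rule trivial_object_tens_joint_mono[OF D])
  note DD = trivial_objectD[OF D]
  note DD(1)[simp]
  fix i assume i: "i < n"
  have "(b i \<otimes>\<^sub>m ident C (ldual D)) \<cdot> \<pi>\<^sub>C D = (ident C \<I> \<otimes>\<^sub>m ldual_arr (b i)) \<cdot> lcoev \<I> \<cdot> counit_C"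
    using pi_C_dinatural[of "b i"] DD(5-7)[OF i] lcoev_counit by simp
  also have "\<dots> = ((ident C \<I> \<otimes>\<^sub>m ldual_arr (b i)) \<cdot> lcoev \<I>) \<cdot> counit_C" using DD(5-7)[OF i] by simp
  also have "(ident C \<I> \<otimes>\<^sub>m ldual_arr (b i)) \<cdot> lcoev \<I> = (b i \<otimes>\<^sub>m ident C (ldual D)) \<cdot> lcoev D"
    using ldual_arr_coev[of "b i"] DD(5-7)[OF i] by simp
  finally show "(b i \<otimes>\<^sub>m ident C (ldual D)) \<cdot> \<pi>\<^sub>C D = (b i \<otimes>\<^sub>m ident C (ldual D)) \<cdot> lcoev D \<cdot> counit_C"
    using DD(5-7)[OF i] by simp
qed (use trivial_objectD(1)[OF D] in auto)

text \<open>
  The difference of both sides factors through \<open>src f \<otimes> D\<^sup>*\<close>, where \<open>D\<close> is the target of \<open>f\<close>; after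
  composition with a coordinate \<open>src f \<rightarrow> \<I>\<close> it factors through \<open>\<I> \<otimes> \<I>\<^sup>*\<close>, where \<open>\<Omega>\<close> detects it.
\<close>

lemma center_dual_pi_C_extension:
  assumes se: "short_exact C f p" and D: "center_dual (tgt C f)" and p: "tgt C p = \<I>"
    and T: "trivial_object C (src C f) n a b"
  shows "\<pi>\<^sub>C (tgt C f) = lcoev (tgt C f) \<cdot> counit_C"
proof -
  let ?D = "tgt C f" and ?D' = "src C f"
  have ker: "is_kernel C p f" and coker: "is_cokernel C f p" using se by (auto simp: short_exact_def)
  note kD = kernelD[OF ker] and cD = cokernelD[OF coker]
  have fa [simp]: "f \<in> arr C" and pa [simp]: "p \<in> arr C" using kD cD by auto
  have sp [simp]: "src C p = ?D" "tgt C p = \<I>" using cD p by auto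
  have [simp]: "?D \<in> obj C" "?D' \<in> obj C" by auto
  note TD = trivial_objectD[OF T]
  let ?DD = "ident C (ldual ?D)"
  define d where "d = sub_arr C (\<pi>\<^sub>C ?D) (lcoev ?D \<cdot> counit_C)"
  have d [simp]: "d \<in> arr C" "src C d = E\<^sub>C" "tgt C d = ?D \<otimes>\<^sub>o ldual ?D" by (auto simp: d_def)
  have zero_sub: "sub_arr C x x = zero_arr C (src C x) (tgt C x)" if "x \<in> arr C" for x
    using sub_eq_zero_iff[of x x] that by simp
  \<comment> \<open>Dinaturality along \<open>p\<close> leads to the unit, where the two morphisms
    agree by \<open>lcoev_counit\<close>.\<close>
  have pd: "(p \<otimes>\<^sub>m ?DD) \<cdot> d = zero_arr C E\<^sub>C (\<I> \<otimes>\<^sub>o ldual ?D)"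
  proof -
    have "(p \<otimes>\<^sub>m ?DD) \<cdot> \<pi>\<^sub>C ?D = ((ident C \<I> \<otimes>\<^sub>m ldual_arr p) \<cdot> lcoev \<I>) \<cdot> counit_C"
      using pi_C_dinatural[of p] lcoev_counit by simp
    also have "\<dots> = (p \<otimes>\<^sub>m ?DD) \<cdot> (lcoev ?D \<cdot> counit_C)" using ldual_arr_coev[of p] by simp
    finally show ?thesis by (simp add: d_def cmp_sub_right zero_sub)
  qed
  \<comment> \<open>Dinaturality along \<open>f\<close> leads to \<open>?D'\<close>, a multiple of
    the unit, where they agree by \<open>pi_C_trivial_object\<close>.\<close>
  have fd: "(ident C ?D \<otimes>\<^sub>m ldual_arr f) \<cdot> d = zero_arr C E\<^sub>C (?D \<otimes>\<^sub>o ldual ?D')"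
  proof -
    have "(ident C ?D \<otimes>\<^sub>m ldual_arr f) \<cdot> \<pi>\<^sub>C ?D = ((f \<otimes>\<^sub>m ident C (ldual ?D')) \<cdot> lcoev ?D') \<cdot> counit_C"
      using pi_C_dinatural[of f, symmetric] pi_C_trivial_object[OF T] by simp
    also have "\<dots> = (ident C ?D \<otimes>\<^sub>m ldual_arr f) \<cdot> (lcoev ?D \<cdot> counit_C)"
      using ldual_arr_coev[of f, symmetric] by simp
    finally show ?thesis by (simp add: d_def cmp_sub_right zero_sub)
  qed
  have zero_E: "zero_arr C A B \<otimes>\<^sub>m ident C E\<^sub>M = zero_arr C (A \<otimes>\<^sub>o E\<^sub>M) (B \<otimes>\<^sub>o E\<^sub>M)"
    if "A \<in> obj C" "B \<in> obj C" for A B using that by simp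
  have "same_copairing d (zero_arr C E\<^sub>C (?D \<otimes>\<^sub>o ldual ?D))"
    using center_dual_same_copairing[OF D]
    by (simp add: same_copairing_def d_def tens_sub_left cmp_sub_left zero_sub)
  \<comment> \<open>\<open>d\<close> is killed by \<open>p \<otimes> id\<close>, so it comes from
    the kernel \<open>f \<otimes> id\<close>; the copairing does not distinguish \<open>d'\<close>
    from zero either, because that arrow is mono.\<close>
  moreover obtain d' where d' [simp]: "d' \<in> arr C" "src C d' = E\<^sub>C" "tgt C d' = ?D' \<otimes>\<^sub>o ldual ?D"
    and dd': "(f \<otimes>\<^sub>m ?DD) \<cdot> d' = d"
    using kernel_factor[OF tens_kernel_left[OF ker, of "ldual ?D"], of d] pd by auto
  ultimately have s': "same_copairing d' (zero_arr C E\<^sub>C (?D' \<otimes>\<^sub>o ldual ?D))"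
    using tens_mono_left[OF kD(2), of "ldual ?D"]
    by - (rule same_copairing_mono[of "f \<otimes>\<^sub>m ?DD"], auto)
  have fd': "(ident C ?D' \<otimes>\<^sub>m ldual_arr f) \<cdot> d' = zero_arr C E\<^sub>C (?D' \<otimes>\<^sub>o ldual ?D')"
  proof -
    have "(f \<otimes>\<^sub>m ident C (ldual ?D')) \<cdot> ((ident C ?D' \<otimes>\<^sub>m ldual_arr f) \<cdot> d') =
          (ident C ?D \<otimes>\<^sub>m ldual_arr f) \<cdot> ((f \<otimes>\<^sub>m ?DD) \<cdot> d')"
      by simp
    then show ?thesis unfolding dd' fd
      using mono_zero[OF tens_mono_left[OF kD(2), of "ldual ?D'"], of "(ident C ?D' \<otimes>\<^sub>m ldual_arr f) \<cdot>
            d'"] by simp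
  qed
  have "d' = zero_arr C E\<^sub>C (?D' \<otimes>\<^sub>o ldual ?D)"
  proof (rule trivial_object_tens_joint_mono[OF T, of "ldual ?D"])
    fix i assume i: "i < n"
    note bi [simp] = TD(5-7)[OF i]
    let ?t = "(b i \<otimes>\<^sub>m ?DD) \<cdot> d'"
    have "(ident C \<I> \<otimes>\<^sub>m ldual_arr f) \<cdot> ?t =
          (b i \<otimes>\<^sub>m ident C (ldual ?D')) \<cdot> ((ident C ?D' \<otimes>\<^sub>m ldual_arr f) \<cdot> d')"
      by simp
    then have "(ident C \<I> \<otimes>\<^sub>m ldual_arr f) \<cdot> ?t = zero_arr C E\<^sub>C (\<I> \<otimes>\<^sub>o ldual ?D')" unfolding fd'
        by simp
    \<comment> \<open>The dual of \<open>p\<close> is a kernel of the dual of \<open>f\<close>, so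
      each coordinate of \<open>d'\<close> comes from an arrow into
      \<open>\<I> \<otimes> \<I>\<^sup>*\<close>, where the copairing does detect zero.\<close>
    then obtain s where s: "s \<in> arr C" "src C s = E\<^sub>C" "tgt C s = \<I> \<otimes>\<^sub>o ldual \<I>"
      "(ident C \<I> \<otimes>\<^sub>m ldual_arr p) \<cdot> s = ?t"
      using kernel_factor[OF tens_kernel_right[OF ldual_kernel[OF coker], of "\<I>"], of ?t] by auto
    have "same_copairing ?t (zero_arr C E\<^sub>C (\<I> \<otimes>\<^sub>o ldual ?D))"
      using same_copairing_cmp[OF s', of "b i \<otimes>\<^sub>m ?DD"] by simp
    then have "same_copairing s (zero_arr C E\<^sub>C (\<I> \<otimes>\<^sub>o ldual \<I>))"
      using s tens_mono_right[OF ldual_mono[OF cD(2)], of "\<I>"]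
      by - (rule same_copairing_mono[of "ident C \<I> \<otimes>\<^sub>m ldual_arr p"], auto)
    then have "s = zero_arr C E\<^sub>C (\<I> \<otimes>\<^sub>o ldual \<I>)"
      using s lcoev_unit_iso
          by - (rule same_copairing_unit_mono[OF iso_mono[of "inv_arr C (lcoev \<I>)"]], auto)
    then have "?t = zero_arr C E\<^sub>C (\<I> \<otimes>\<^sub>o ldual ?D)" using s(4)[symmetric] by simp
    then show "?t = (b i \<otimes>\<^sub>m ?DD) \<cdot> zero_arr C E\<^sub>C (?D' \<otimes>\<^sub>o ldual ?D)" by simp
  qed auto
  then have "d = zero_arr C E\<^sub>C (?D \<otimes>\<^sub>o ldual ?D)" using dd'[symmetric] by simp
  then show ?thesis using sub_eq_zero_iff[of "\<pi>\<^sub>C ?D" "lcoev ?D \<cdot> counit_C"] by (simp add: d_def)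
qed

text \<open>
  Restricted along the kernel \<open>k\<close> of the cover \<open>q : Q \<rightarrow> \<I>\<close>, the wedge vanishes at \<open>\<I>\<close> and hence at \<open>D\<close>.
  There it equals \<open>r k \<otimes> p\<^sup>* q'\<close> for a lift \<open>r : Q \<rightarrow> D\<close> of \<open>q\<close>, so \<open>r\<close> factors through \<open>q\<close>.
\<close>

lemma center_dual_extension_splits:
  assumes se: "short_exact C f p" and D: "center_dual (tgt C f)" and p: "tgt C p = \<I>"
    and T: "trivial_object C (src C f) n a b"
  obtains s where "s \<in> arr C" "src C s = \<I>" "tgt C s = tgt C f" "p \<cdot> s = ident C \<I>"
proof -
  let ?D = "tgt C f" and ?D' = "src C f" and ?I = "\<I>"
  have ker: "is_kernel C p f" and coker: "is_cokernel C f p" using se by (auto simp: short_exact_def)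
  note kD = kernelD[OF ker] and cD = cokernelD[OF coker]
  have fa [simp]: "f \<in> arr C" and pa [simp]: "p \<in> arr C" using kD cD by auto
  have sp [simp]: "src C p = ?D" "tgt C p = ?I" using cD p by auto
  have [simp]: "?D \<in> obj C" "?D' \<in> obj C" by auto
  note TD = trivial_objectD[OF T]
  obtain Q q where q: "local_cover Q q" "tgt C q = ?I" using ex_local_cover[OF unit_obj] .
  obtain Q' q' where q': "local_cover Q' q'" "tgt C q' = ldual ?I" using ex_local_cover[of "ldual ?I"]
      by auto
  note ct = cover_typing[OF unit_simple q q']
  note ct(2-7)[simp] q(2)[simp] q'(2)[simp]
  obtain t m g h where
    g: "\<And>Z i. \<lbrakk>Z \<in> obj C; i < m Z\<rbrakk> \<Longrightarrow> g Z i \<in> Hom C Q Z" and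
    h: "\<And>Z i. \<lbrakk>Z \<in> obj C; i < m Z\<rbrakk> \<Longrightarrow> h Z i \<in> Hom C Q' (ldual Z)" and
    t: "lin_fun (hom_space C (Q' \<otimes>\<^sub>o Q) ?I) t" "t (lev ?I \<cdot> (q' \<otimes>\<^sub>m q)) = 1" and
    hy: "\<And>Z y. \<lbrakk>Z \<in> obj C; y \<in> Hom C Q' (ldual Z)\<rbrakk>
      \<Longrightarrow> y = vsum (hom_space C Q' (ldual Z)) (\<lambda>i. scale_arr C (t (lev Z \<cdot> (y \<otimes>\<^sub>m g Z i))) (h Z i)) (m Z)"
          and
    wedge: "is_wedge C C (\<lambda>X Y. Y \<otimes>\<^sub>o ldual X) (\<lambda>f Y. ident C Y \<otimes>\<^sub>m ldual_arr f) (\<lambda>X f. f \<otimes>\<^sub>m ident C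
          (ldual X))
      (Q \<otimes>\<^sub>o Q') (\<lambda>Z. vsum (hom_space C (Q \<otimes>\<^sub>o Q') (Z \<otimes>\<^sub>o ldual Z)) (\<lambda>i. g Z i \<otimes>\<^sub>m h Z i) (m Z))"
    by (rule character_wedge[OF unit_simple q q']) blast
  let ?\<tau> = "\<lambda>Z. vsum (hom_space C (Q \<otimes>\<^sub>o Q') (Z \<otimes>\<^sub>o ldual Z)) (\<lambda>i. g Z i \<otimes>\<^sub>m h Z i) (m Z)"
  obtain u where u: "u \<in> arr C" "src C u = Q \<otimes>\<^sub>o Q'" "tgt C u = E\<^sub>C" "\<And>X. X \<in> obj C \<Longrightarrow> \<pi>\<^sub>C X \<cdot> u = ?\<tau> X"
    using pi_C_factor[OF wedge] by blast
  obtain k where k: "is_kernel C q k" using ex_kernel by force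
  note kk = kernelD[OF k]
  have ka [simp]: "k \<in> arr C" "tgt C k = Q" using kk by auto
  let ?K = "src C k"
  have K [simp]: "?K \<in> obj C" by simp
  have End_scalar: "\<exists>a. v = scale_arr C a (ident C ?I)" if "v \<in> Hom C ?I ?I" for v
    using End_unit_scalar[of v] that unfolding Hom_iff by metis
  note multiple = cover_multiple[OF q(1), unfolded q(2), OF unit_simple End_scalar]
  \<comment> \<open>Every arrow from the cover to the unit is a multiple of \<open>q\<close>, hence
    vanishes on its kernel.\<close>
  have mult: "x \<cdot> k = zero_arr C ?K ?I" if x: "x \<in> Hom C Q ?I" for x
  proof -
    have "\<exists>a. x = scale_arr C a q" using multiple[of x] x by blast
    then show ?thesis using kk by auto
  qed
  have gk: "g Z i \<otimes>\<^sub>m h Z j \<in> Hom C (Q \<otimes>\<^sub>o Q') (Z \<otimes>\<^sub>o ldual Z)" if "Z \<in> obj C" "i < m Z" "j < m Z"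
      for Z i j
    using g[OF that(1,2)] h[OF that(1,3)] by (simp add: Hom_iff)
  have \<tau>k: "?\<tau> Z \<cdot> (k \<otimes>\<^sub>m ident C Q') =
        vsum (hom_space C (?K \<otimes>\<^sub>o Q') (Z \<otimes>\<^sub>o ldual Z)) (\<lambda>i. (g Z i \<cdot> k) \<otimes>\<^sub>m h Z i) (m Z)"
    if Z: "Z \<in> obj C" for Z
  proof -
    interpret H: vec_space "hom_space C (?K \<otimes>\<^sub>o Q') (Z \<otimes>\<^sub>o ldual Z)" using vec_space_Hom Z by simp
    have "?\<tau> Z \<cdot> (k \<otimes>\<^sub>m ident C Q') =
          vsum (hom_space C (?K \<otimes>\<^sub>o Q') (Z \<otimes>\<^sub>o ldual Z)) (\<lambda>i. (g Z i \<otimes>\<^sub>m h Z i) \<cdot> (k \<otimes>\<^sub>m ident C Q'))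
          (m Z)"
      using gk Z by (intro vsum_cmp) (auto simp: Hom_iff)
    also have "\<dots> = vsum (hom_space C (?K \<otimes>\<^sub>o Q') (Z \<otimes>\<^sub>o ldual Z)) (\<lambda>i. (g Z i \<cdot> k) \<otimes>\<^sub>m h Z i) (m Z)"
      using g h Z by (intro H.vsum_cong) (auto simp: Hom_iff)
    finally show ?thesis .
  qed
  have "?\<tau> ?I \<cdot> (k \<otimes>\<^sub>m ident C Q') = zero_arr C (?K \<otimes>\<^sub>o Q') (?I \<otimes>\<^sub>o ldual ?I)"
  proof -
    interpret H: vec_space "hom_space C (?K \<otimes>\<^sub>o Q') (?I \<otimes>\<^sub>o ldual ?I)" using vec_space_Hom by simp
    show ?thesis unfolding \<tau>k[OF unit_obj]
      using mult g h H.vsum_zero[of "m ?I" "\<lambda>i. (g ?I i \<cdot> k) \<otimes>\<^sub>m h ?I i"] by (auto simp: Hom_iff)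
  qed
  \<comment> \<open>The previous lemma expresses the wedge at \<open>?D\<close> through the wedge at
    the unit, so it too vanishes on \<open>k \<otimes> id\<close>.\<close>
  moreover have "?\<tau> ?D = lcoev ?D \<cdot> inv_arr C (lcoev ?I) \<cdot> ?\<tau> ?I"
    unfolding u(4)[OF \<open>?D \<in> obj C\<close>, symmetric] u(4)[OF unit_obj, symmetric]
      center_dual_pi_C_extension[OF se D p T]
    using u(1-3) lcoev_unit_iso by (simp add: counit_C_def)
  moreover have "?\<tau> ?I \<in> Hom C (Q \<otimes>\<^sub>o Q') (?I \<otimes>\<^sub>o ldual ?I)" using gk by (intro vsum_Hom) auto
  ultimately have \<tau>D: "?\<tau> ?D \<cdot> (k \<otimes>\<^sub>m ident C Q') = zero_arr C (?K \<otimes>\<^sub>o Q') (?D \<otimes>\<^sub>o ldual ?D)"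
    using lcoev_unit_iso by (simp add: Hom_iff)
  obtain r where r: "r \<in> arr C" "src C r = Q" "tgt C r = ?D" "p \<cdot> r = q"
    using projective_lift[OF ct(11) cD(2), of q] by auto
  have "\<exists>c. p \<cdot> g ?D i = scale_arr C c q" if "i < m ?D" for i
    by (rule multiple) (use g[of ?D i] that in \<open>auto simp: Hom_iff\<close>)
  then obtain c where c: "\<And>i. i < m ?D \<Longrightarrow> p \<cdot> g ?D i = scale_arr C (c i) q" by metis
  \<comment> \<open>\<open>g ?D i\<close> and \<open>c i\<close> times \<open>r\<close> agree after
    \<open>p\<close>, so they differ by an arrow through \<open>?D'\<close>; its coordinates are
    arrows from the cover to the unit and vanish on \<open>k\<close>.\<close>
  have gik: "g ?D i \<cdot> k = scale_arr C (c i) (r \<cdot> k)" if i: "i < m ?D" for i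
  proof -
    have gi [simp]: "g ?D i \<in> arr C" "src C (g ?D i) = Q" "tgt C (g ?D i) = ?D" using g[of ?D i] i
        by (auto simp: Hom_iff)
    let ?x = "sub_arr C (g ?D i) (scale_arr C (c i) r)"
    have "p \<cdot> ?x = zero_arr C Q ?I"
      using c[OF i] r sub_eq_zero_iff[of "p \<cdot> g ?D i" "scale_arr C (c i) q"]
          by (simp add: cmp_sub_right)
    then obtain y where y: "y \<in> arr C" "src C y = Q" "tgt C y = ?D'" "f \<cdot> y = ?x"
      using kernel_factor[OF ker, of ?x] r by auto
    have "y \<cdot> k = zero_arr C ?K ?D'"
    proof (rule trivial_object_joint_mono[OF T])
      fix l assume l: "l < n"
      have "(b l \<cdot> y) \<cdot> k = zero_arr C ?K ?I" using mult[of "b l \<cdot> y"] y TD(5-7)[OF l]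
          by (simp add: Hom_iff)
      then show "b l \<cdot> (y \<cdot> k) = b l \<cdot> zero_arr C ?K ?D'" using y TD(5-7)[OF l] by simp
    qed (use y in auto)
    then have "f \<cdot> (y \<cdot> k) = zero_arr C ?K ?D" by simp
    moreover have "f \<cdot> (y \<cdot> k) = ?x \<cdot> k" unfolding y(4)[symmetric] using y(1-3) by simp
    ultimately have "sub_arr C (g ?D i \<cdot> k) (scale_arr C (c i) (r \<cdot> k)) = zero_arr C ?K ?D"
      using r by (simp add: cmp_sub_left)
    then show ?thesis using sub_eq_zero_iff[of "g ?D i \<cdot> k" "scale_arr C (c i) (r \<cdot> k)"] r by simp
  qed
  let ?pq = "ldual_arr p \<cdot> q'"
  \<comment> \<open>The coefficient of \<open>h ?D i\<close> in the dual-basis expansion is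
    \<open>t\<close> of the evaluation against \<open>g ?D i\<close>; dinaturality of
    \<open>lev\<close> at \<open>p\<close> reduces it to \<open>c i\<close> times the normalized
    value 1.\<close>
  have pq: "?pq = vsum (hom_space C Q' (ldual ?D)) (\<lambda>i. scale_arr C (c i) (h ?D i)) (m ?D)"
  proof -
    interpret H: vec_space "hom_space C Q' (ldual ?D)" using vec_space_Hom by simp
    have ti: "t (lev ?D \<cdot> (?pq \<otimes>\<^sub>m g ?D i)) = c i" if i: "i < m ?D" for i
    proof -
      have gi [simp]: "g ?D i \<in> arr C" "src C (g ?D i) = Q" "tgt C (g ?D i) = ?D" using g[of ?D i] i
          by (auto simp: Hom_iff)
      have "lev ?D \<cdot> (?pq \<otimes>\<^sub>m g ?D i) = (lev ?D \<cdot> (ldual_arr p \<otimes>\<^sub>m ident C ?D)) \<cdot> (q' \<otimes>\<^sub>m g ?D i)"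
          by simp
      also have "\<dots> = (lev ?I \<cdot> (ident C (ldual ?I) \<otimes>\<^sub>m p)) \<cdot> (q' \<otimes>\<^sub>m g ?D i)" using lev_dinatural[of p]
          by simp
      also have "\<dots> = scale_arr C (c i) (lev ?I \<cdot> (q' \<otimes>\<^sub>m q))" using c[OF i] by simp
      finally have "t (lev ?D \<cdot> (?pq \<otimes>\<^sub>m g ?D i)) = t (scale_arr C (c i) (lev ?I \<cdot> (q' \<otimes>\<^sub>m q)))" by simp
      also have "\<dots> = c i" using t by (simp add: lin_fun_def Hom_iff)
      finally show ?thesis .
    qed
    have "?pq = vsum (hom_space C Q' (ldual ?D)) (\<lambda>i. scale_arr C (t (lev ?D \<cdot> (?pq \<otimes>\<^sub>m g ?D i)))
          (h ?D i)) (m ?D)"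
      by (rule hy) (auto simp: Hom_iff)
    also have "\<dots> = vsum (hom_space C Q' (ldual ?D)) (\<lambda>i. scale_arr C (c i) (h ?D i)) (m ?D)"
      using ti by (intro H.vsum_cong) simp
    finally show ?thesis .
  qed
  \<comment> \<open>Replacing each \<open>c i\<close> times \<open>r \<cdot> k\<close> by
    \<open>g ?D i \<cdot> k\<close> turns this tensor product into the wedge at \<open>?D\<close>
    restricted along \<open>k\<close>, which is zero.\<close>
  have rk: "(r \<cdot> k) \<otimes>\<^sub>m ?pq = zero_arr C (?K \<otimes>\<^sub>o Q') (?D \<otimes>\<^sub>o ldual ?D)"
  proof -
    interpret H: vec_space "hom_space C (?K \<otimes>\<^sub>o Q') (?D \<otimes>\<^sub>o ldual ?D)" using vec_space_Hom by simp
    have "(r \<cdot> k) \<otimes>\<^sub>m ?pq =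
          vsum (hom_space C (?K \<otimes>\<^sub>o Q') (?D \<otimes>\<^sub>o ldual ?D)) (\<lambda>i. (r \<cdot> k) \<otimes>\<^sub>m scale_arr C (c i) (h ?D i))
          (m ?D)"
      unfolding pq using r h by (intro tens_vsum) (auto simp: Hom_iff)
    also have "\<dots> = vsum (hom_space C (?K \<otimes>\<^sub>o Q') (?D \<otimes>\<^sub>o ldual ?D)) (\<lambda>i. (g ?D i \<cdot> k) \<otimes>\<^sub>m h ?D i)
          (m ?D)"
      using r h gik by (intro H.vsum_cong) (auto simp: Hom_iff)
    also have "\<dots> = zero_arr C (?K \<otimes>\<^sub>o Q') (?D \<otimes>\<^sub>o ldual ?D)" using \<tau>D \<tau>k[of ?D] by simp
    finally show ?thesis .
  qed
  \<comment> \<open>The epi \<open>q'\<close>, the mono dual of \<open>p\<close> and the tensor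
    factor \<open>ldual \<I>\<close> are cancelled one after the other, leaving
    \<open>r \<cdot> k = 0\<close>.\<close>
  have "(r \<cdot> k) \<otimes>\<^sub>m ldual_arr p = zero_arr C (?K \<otimes>\<^sub>o ldual ?I) (?D \<otimes>\<^sub>o ldual ?D)"
    using epi_zero[OF tens_epi_right[OF ct(9) K], of "(r \<cdot> k) \<otimes>\<^sub>m ldual_arr p"] rk r by simp
  then have "(r \<cdot> k) \<otimes>\<^sub>m ident C (ldual ?I) = zero_arr C (?K \<otimes>\<^sub>o ldual ?I) (?D \<otimes>\<^sub>o ldual ?I)"
    using mono_zero[OF tens_mono_right[OF ldual_mono[OF cD(2)], of ?D], of
        "(r \<cdot> k) \<otimes>\<^sub>m ident C (ldual ?I)"] r by simp
  then have "r \<cdot> k = zero_arr C ?K ?D" using tens_unit_zero[of "r \<cdot> k"] r by simp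
  then obtain s where s: "s \<in> arr C" "src C s = ?I" "tgt C s = ?D" "s \<cdot> q = r"
    using cokernel_factor[OF epi_cokernel_of_kernel[OF ct(8) k], of r] r by auto
  have "(p \<cdot> s) \<cdot> q = ident C ?I \<cdot> q" using s r by simp
  then have "p \<cdot> s = ident C ?I" using s by - (rule epiD[OF ct(8)], auto)
  then show ?thesis using that s by blast
qed

text \<open>The section \<open>s\<close> determines a retraction \<open>r\<close> of
  \<open>f\<close> by \<open>f \<cdot> r = id - s \<cdot> p\<close>, so \<open>tgt C f\<close> is a
  biproduct of \<open>src C f\<close> and the unit.\<close>

lemma trivial_object_extension:
  assumes se: "short_exact C f p" and T: "trivial_object C (src C f) n a b"
    and s: "s \<in> arr C" "src C s = \<I>" "tgt C s = tgt C f" "p \<cdot> s = ident C \<I>"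
  shows "\<exists>n a b. trivial_object C (tgt C f) n a b"
proof -
  let ?D = "tgt C f" and ?D' = "src C f" and ?I = "\<I>"
  have ker: "is_kernel C p f" and coker: "is_cokernel C f p" using se by (auto simp: short_exact_def)
  note kD = kernelD[OF ker] and cD = cokernelD[OF coker]
  have fa [simp]: "f \<in> arr C" and pa [simp]: "p \<in> arr C" using kD cD by auto
  note TD = trivial_objectD[OF T]
  have sp [simp]: "src C p = ?D" using cD by simp
  have tp [simp]: "tgt C p = ?I"
  proof -
    have "tgt C (p \<cdot> s) = tgt C p" using s(1-3) by simp
    then show ?thesis unfolding s(4) by simp
  qed
  have pf: "p \<cdot> f = zero_arr C ?D' ?I" using cD by simp
  have zero_sub: "sub_arr C x x = zero_arr C (src C x) (tgt C x)" if "x \<in> arr C" for x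
    using sub_eq_zero_iff[of x x] that by simp
  have sub_zero: "sub_arr C x (zero_arr C (src C x) (tgt C x)) = x" if "x \<in> arr C" for x
    using that by (simp add: sub_arr_def)
  let ?e = "sub_arr C (ident C ?D) (s \<cdot> p)"
  have e [simp]: "?e \<in> arr C" "src C ?e = ?D" "tgt C ?e = ?D" using s by auto
  have "p \<cdot> (s \<cdot> p) = (p \<cdot> s) \<cdot> p" using s(1-3) by simp
  then have psp: "p \<cdot> (s \<cdot> p) = p" unfolding s(4) by simp
  have "p \<cdot> ?e = zero_arr C ?D ?I" using s(1-3) psp zero_sub[of p] by (simp add: cmp_sub_right)
  then obtain r where r: "r \<in> arr C" "src C r = ?D" "tgt C r = ?D'" "f \<cdot> r = ?e"
    using kernel_factor[OF ker, of ?e] by auto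
  have "f \<cdot> (r \<cdot> f) = ?e \<cdot> f" unfolding r(4)[symmetric] using r(1-3) by simp
  also have "\<dots> = f \<cdot> ident C ?D'" using s(1-3) pf sub_zero[of f] by (simp add: cmp_sub_left)
  finally have rf: "r \<cdot> f = ident C ?D'" using r(1-3) by - (rule monoD[OF kD(2)], auto)
  have "f \<cdot> (r \<cdot> s) = ?e \<cdot> s" unfolding r(4)[symmetric] using r(1-3) s(1-3) by simp
  also have "\<dots> = f \<cdot> zero_arr C ?I ?D'" using s zero_sub[of s] by (simp add: cmp_sub_left)
  finally have rs: "r \<cdot> s = zero_arr C ?I ?D'" using r(1-3) s(1-3) by - (rule monoD[OF kD(2)], auto)
  interpret H: vec_space "hom_space C ?D ?D" using vec_space_Hom by simp
  have ident: "add_arr C ?e (s \<cdot> p) = ident C ?D"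
  proof -
    have sp': "ident C ?D \<in> carrier (hom_space C ?D ?D)" "s \<cdot> p \<in> carrier (hom_space C ?D ?D)"
      "scale_arr C (- 1) (s \<cdot> p) \<in> carrier (hom_space C ?D ?D)" using s by (auto simp: Hom_iff)
    have "add_arr C ?e (s \<cdot> p) = add_arr C (ident C ?D) (add_arr C (scale_arr C (- 1) (s \<cdot> p)) (s \<cdot> p))"
      unfolding sub_arr_def using H.V.M.a_assoc[OF sp'(1,3,2)] by simp
    also have "add_arr C (scale_arr C (- 1) (s \<cdot> p)) (s \<cdot> p) = zero_arr C ?D ?D"
      using H.add_neg[OF sp'(2)] H.V.M.a_comm[OF sp'(2,3)] by simp
    finally show ?thesis by simp
  qed
  have "is_biproduct C ?D' ?I ?D f s r p"
    unfolding is_biproduct_def using r(1-3) s ident rf rs pf by (simp add: Hom_iff r(4))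
  from trivial_object_biproduct[OF T this] show ?thesis by blast
qed

end

locale weakly_nondegenerate_closed = weakly_nondegenerate C M ldual lev lcoev ihom iev E\<^sub>C \<pi>\<^sub>C E\<^sub>M \<pi>\<^sub>M \<omega>
  for C :: "('o, 'm, 'k :: alg_closed_field) braided_moncat" (structure)
    and M :: "('o, 'm, 'p, 'q, 'k) braided_modcat" (structure)
    and ldual lev lcoev ihom iev E\<^sub>C \<pi>\<^sub>C E\<^sub>M \<pi>\<^sub>M \<omega>
begin

text \<open>
  If \<open>S\<close> were not isomorphic to \<open>\<I>\<close>, the character of \<open>S\<close>, i.e. \<open>E\<^sub>C \<rightarrow> S \<otimes> S\<^sup>*\<close> followed by the braided evaluation, would be a
  multiple of the counit of \<open>E\<^sub>C\<close>, contradicting the wedge attached to \<open>S\<close>: it vanishes at \<open>\<I>\<close> and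
  is an epimorphism onto \<open>S \<otimes> S\<^sup>*\<close>.
\<close>

lemma center_dual_simple:
  assumes S: "simple_object C S" and D: "center_dual S"
  obtains j where "is_iso C j" "src C j = S" "tgt C j = \<I>"
proof (rule ccontr)
  assume "\<not> thesis"
  then have noiso: "\<not> (is_iso C j \<and> src C j = S \<and> tgt C j = \<I>)" for j using that by blast
  let ?I = "\<I>"
  note SD = simple_objectD(1,2)[OF S]
  note SD(1)[simp]
  obtain Q q where q: "local_cover Q q" "tgt C q = S" using ex_local_cover[OF SD(1)] .
  obtain Q' q' where q': "local_cover Q' q'" "tgt C q' = ldual S" using ex_local_cover[of "ldual S"]
      by auto
  note ct = cover_typing[OF S q q']
  note ct(2-7)[simp] q(2)[simp] q'(2)[simp]
  obtain t m g h where
    g: "\<And>Z i. \<lbrakk>Z \<in> obj C; i < m Z\<rbrakk> \<Longrightarrow> g Z i \<in> Hom C Q Z" and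
    h: "\<And>Z i. \<lbrakk>Z \<in> obj C; i < m Z\<rbrakk> \<Longrightarrow> h Z i \<in> Hom C Q' (ldual Z)" and
    t: "lin_fun (hom_space C (Q' \<otimes>\<^sub>o Q) ?I) t" "t (lev S \<cdot> (q' \<otimes>\<^sub>m q)) = 1" and
    gx: "\<And>Z x. \<lbrakk>Z \<in> obj C; x \<in> Hom C Q Z\<rbrakk>
      \<Longrightarrow> x = vsum (hom_space C Q Z) (\<lambda>i. scale_arr C (t (lev Z \<cdot> (h Z i \<otimes>\<^sub>m x))) (g Z i)) (m Z)" and
    wedge: "is_wedge C C (\<lambda>X Y. Y \<otimes>\<^sub>o ldual X) (\<lambda>f Y. ident C Y \<otimes>\<^sub>m ldual_arr f) (\<lambda>X f. f \<otimes>\<^sub>m ident C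
          (ldual X))
      (Q \<otimes>\<^sub>o Q') (\<lambda>Z. vsum (hom_space C (Q \<otimes>\<^sub>o Q') (Z \<otimes>\<^sub>o ldual Z)) (\<lambda>i. g Z i \<otimes>\<^sub>m h Z i) (m Z))"
    by (rule character_wedge[OF S q q']) blast
  let ?\<tau> = "\<lambda>Z. vsum (hom_space C (Q \<otimes>\<^sub>o Q') (Z \<otimes>\<^sub>o ldual Z)) (\<lambda>i. g Z i \<otimes>\<^sub>m h Z i) (m Z)"
  obtain u where u: "u \<in> arr C" "src C u = Q \<otimes>\<^sub>o Q'" "tgt C u = E\<^sub>C" "\<And>X. X \<in> obj C \<Longrightarrow> \<pi>\<^sub>C X \<cdot> u = ?\<tau> X"
    using pi_C_factor[OF wedge] by blast
  \<comment> \<open>A nonzero arrow from \<open>Q\<close> to the unit would identify the unit with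
    the simple top \<open>S\<close> of \<open>Q\<close>.\<close>
  have \<tau>I: "?\<tau> ?I = zero_arr C (Q \<otimes>\<^sub>o Q') (?I \<otimes>\<^sub>o ldual ?I)"
  proof -
    interpret H: vec_space "hom_space C (Q \<otimes>\<^sub>o Q') (?I \<otimes>\<^sub>o ldual ?I)" using vec_space_Hom by simp
    have zero: "x = zero_arr C Q ?I" if x: "x \<in> Hom C Q ?I" for x
    proof (rule ccontr)
      assume nz: "x \<noteq> zero_arr C Q ?I"
      have xa: "x \<in> arr C" "src C x = Q" "tgt C x = ?I" using x by (auto simp: Hom_iff)
      obtain v where v: "is_iso C v" "src C v = tgt C x" "tgt C v = S"
        using cover_to_simple[OF q(1) _ xa(1,2)] q(2) S unit_simple nz xa(3) by metis
      then show False using noiso[of "inv_arr C v"] xa by simp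
    qed
    have "g ?I i \<otimes>\<^sub>m h ?I i = zero_arr C (Q \<otimes>\<^sub>o Q') (?I \<otimes>\<^sub>o ldual ?I)" if i: "i < m ?I" for i
      unfolding zero[OF g[OF unit_obj i]] using h[OF unit_obj i] by (simp add: Hom_iff)
    then show ?thesis using H.vsum_zero[of "m ?I" "\<lambda>i. g ?I i \<otimes>\<^sub>m h ?I i"] by simp
  qed
  \<comment> \<open>By Schur's lemma the arrows from \<open>Q\<close> to \<open>S\<close>, and those
    from \<open>Q'\<close> to \<open>ldual S\<close>, form one-dimensional spaces.\<close>
  have "\<exists>a. x = scale_arr C a q" if "x \<in> Hom C Q S" for x
    using cover_multiple[OF q(1), of x] schur[OF finite_abelian_category_axioms S] S that by auto
  then have "\<exists>a. g S i = scale_arr C a q" if "i < m S" for i using g that by simp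
  then obtain a where a: "\<And>i. i < m S \<Longrightarrow> g S i = scale_arr C (a i) q" by metis
  have "\<exists>a. x = scale_arr C a q'" if "x \<in> Hom C Q' (ldual S)" for x
    using cover_multiple[OF q'(1), of x] schur[OF finite_abelian_category_axioms simple_ldual[OF S]]
      simple_ldual[OF S] that by auto
  then have "\<exists>a. h S i = scale_arr C a q'" if "i < m S" for i using h that by simp
  then obtain b where b: "\<And>i. i < m S \<Longrightarrow> h S i = scale_arr C (b i) q'" by metis
  \<comment> \<open>Expanding \<open>q\<close> itself in the dual basis gives the coefficient
    \<open>b i\<close> at \<open>g S i\<close>, by the normalization of \<open>t\<close>; so
    \<open>q\<close> equals \<open>q\<close> times this sum.\<close>
  have sum1: "(\<Sum>i<m S. b i * a i) = 1"
  proof -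
    interpret H: vec_space "hom_space C Q S" using vec_space_Hom by simp
    have qc: "q \<in> carrier (hom_space C Q S)" by (simp add: Hom_iff)
    have lc: "vsum (hom_space C Q S) (\<lambda>i. scale_arr C (x i) q) n = scale_arr C (\<Sum>i<n. x i) q" for x n
    proof (induction n)
      case (Suc n)
      then show ?case using H.smult_add_scalar[OF qc, of "\<Sum>i<n. x i" "x n"] by simp
    qed simp
    have tb: "t (lev S \<cdot> (h S i \<otimes>\<^sub>m q)) = b i" if "i < m S" for i
    proof -
      have "t (lev S \<cdot> (h S i \<otimes>\<^sub>m q)) = t (scale_arr C (b i) (lev S \<cdot> (q' \<otimes>\<^sub>m q)))" using b[OF that]
          by simp
      also have "\<dots> = b i" using t by (simp add: lin_fun_def Hom_iff)
      finally show ?thesis .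
    qed
    have "q = vsum (hom_space C Q S) (\<lambda>i. scale_arr C (t (lev S \<cdot> (h S i \<otimes>\<^sub>m q))) (g S i)) (m S)"
      by (rule gx) (auto simp: Hom_iff)
    also have "\<dots> = vsum (hom_space C Q S) (\<lambda>i. scale_arr C (b i * a i) q) (m S)"
      using a tb by (intro H.vsum_cong) (auto simp: scale_scale)
    also have "\<dots> = scale_arr C (\<Sum>i<m S. b i * a i) q" by (rule lc)
    finally have q1: "q = scale_arr C (\<Sum>i<m S. b i * a i) q" .
    show ?thesis
    proof (rule ccontr)
      assume ne: "(\<Sum>i<m S. b i * a i) \<noteq> 1"
      let ?c = "(\<Sum>i<m S. b i * a i) + - 1"
      have "scale_arr C ?c q = add_arr C (scale_arr C (\<Sum>i<m S. b i * a i) q) (scale_arr C (- 1) q)"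
        using H.smult_add_scalar[OF qc, of "\<Sum>i<m S. b i * a i" "- 1"]
            by (simp del: add_uminus_conv_diff)
      also have "\<dots> = add_arr C q (scale_arr C (- 1) q)" by (simp only: q1[symmetric])
      also have "\<dots> = zero_arr C Q S" using H.add_neg[OF qc] by simp
      finally have "scale_arr C (1 / ?c) (scale_arr C ?c q) = scale_arr C (1 / ?c) (zero_arr C Q S)"
          by (rule arg_cong)
      then have "q = zero_arr C (src C q) (tgt C q)" using ne by (simp add: scale_scale)
      then show False using epi_zero_object[OF ct(8)] SD(2) by simp
    qed
  qed
  have \<tau>S: "?\<tau> S = q \<otimes>\<^sub>m q'"
  proof -
    interpret H: vec_space "hom_space C (Q \<otimes>\<^sub>o Q') (S \<otimes>\<^sub>o ldual S)" using vec_space_Hom by simp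
    have qc: "q \<otimes>\<^sub>m q' \<in> carrier (hom_space C (Q \<otimes>\<^sub>o Q') (S \<otimes>\<^sub>o ldual S))" by (simp add: Hom_iff)
    have lc: "vsum (hom_space C (Q \<otimes>\<^sub>o Q') (S \<otimes>\<^sub>o ldual S)) (\<lambda>i. scale_arr C (x i) (q \<otimes>\<^sub>m q')) n =
          scale_arr C (\<Sum>i<n. x i) (q \<otimes>\<^sub>m q')" for x n
    proof (induction n)
      case (Suc n)
      then show ?case using H.smult_add_scalar[OF qc, of "\<Sum>i<n. x i" "x n"] by simp
    qed simp
    have "?\<tau> S = vsum (hom_space C (Q \<otimes>\<^sub>o Q') (S \<otimes>\<^sub>o ldual S)) (\<lambda>i. scale_arr C (b i * a i) (q \<otimes>\<^sub>m q'))
          (m S)"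
      using a b by (intro H.vsum_cong) (auto simp: scale_scale mult.commute)
    then show ?thesis by (simp add: lc sum1)
  qed
  \<comment> \<open>The braided evaluation moves the comparison to arrows into the unit, where equal
    copairings mean equality.\<close>
  let ?\<phi> = "lev S \<cdot> braiding C S (ldual S)"
  have "same_copairing (?\<phi> \<cdot> \<pi>\<^sub>C S) (?\<phi> \<cdot> (lcoev S \<cdot> counit_C))"
    using same_copairing_cmp[OF center_dual_same_copairing[OF D], of ?\<phi>] by simp
  then have "?\<phi> \<cdot> \<pi>\<^sub>C S = ?\<phi> \<cdot> (lcoev S \<cdot> counit_C)" by - (rule same_copairing_unit, auto)
  \<comment> \<open>Precomposition with \<open>u\<close> evaluates the wedge: it is
    \<open>q \<otimes> q'\<close> at \<open>S\<close> and zero at the unit.\<close>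
  then have "(?\<phi> \<cdot> \<pi>\<^sub>C S) \<cdot> u = (?\<phi> \<cdot> (lcoev S \<cdot> counit_C)) \<cdot> u" by (rule arg_cong)
  then have "?\<phi> \<cdot> (\<pi>\<^sub>C S \<cdot> u) = ?\<phi> \<cdot> (lcoev S \<cdot> inv_arr C (lcoev ?I) \<cdot> (\<pi>\<^sub>C ?I \<cdot> u))"
    using u(1-3) lcoev_unit_iso by (simp add: counit_C_def)
  then have "?\<phi> \<cdot> (q \<otimes>\<^sub>m q') = zero_arr C (Q \<otimes>\<^sub>o Q') ?I"
    unfolding u(4)[OF SD(1)] u(4)[OF unit_obj] \<tau>S \<tau>I using lcoev_unit_iso by simp
  then have "?\<phi> = zero_arr C (S \<otimes>\<^sub>o ldual S) ?I"
    using epi_zero[OF cover_tens_epi(1)[OF S q q'], of ?\<phi>] by simp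
  then have "lev S = zero_arr C (ldual S \<otimes>\<^sub>o S) ?I"
    using epi_zero[OF iso_epi[OF braiding_typing(1)[of S "ldual S"]], of "lev S"] by simp
  then show False using lev_nonzero SD by blast
qed

text \<open>In a step of a composition series both the subobject and the simple quotient inherit
  \<open>center_dual\<close>, so the induction hypothesis covers the first and
  \<open>center_dual_simple\<close> the second.\<close>

lemma center_dual_trivial_object:
  assumes "center_dual D"
  shows "\<exists>n a b. trivial_object C D n a b"
proof -
  have "has_finite_length C D" using finite_length assms by (simp add: center_dual_def)
  then show ?thesis using assms
  proof (induction rule: has_finite_length.induct)
    case (zero Z)
    then have "Z \<in> obj C" by (simp add: center_dual_def)
    \<comment> \<open>For \<open>n = 0\<close> the families have no relevant entries, so any values
      serve.\<close>
    with zero have "trivial_object C Z 0 undefined undefined"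
      by (simp add: trivial_object_def zero_object_iff)
    then show ?case by blast
  next
    case (extend f g)
    have ker: "is_kernel C g f" and coker: "is_cokernel C f g" using extend
        by (auto simp: short_exact_def)
    note kD = kernelD[OF ker] and cD = cokernelD[OF coker]
    have ga: "g \<in> arr C" and fa: "f \<in> arr C" using kD by auto
    have "center_dual (src C f)" using center_dual_sub[OF extend.prems kD(2)] .
    then obtain n a b where T: "trivial_object C (src C f) n a b" using extend.IH by blast
    have "center_dual (tgt C g)" using center_dual_quot[of g] extend.prems cD by simp
    then obtain j where j: "is_iso C j" "src C j = tgt C g" "tgt C j = \<I>"
      using center_dual_simple[OF extend.hyps(3)] by blast
    have ja: "j \<in> arr C" using j by simp
    \<comment> \<open>The simple quotient is only isomorphic to the unit; composing with
      \<open>j\<close> makes the target literally the unit, as the splitting lemma requires.\<close>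
    have "short_exact C f (j \<cdot> g)"
      unfolding short_exact_def
    proof
      have jz: "j \<cdot> (g \<cdot> h) = zero_arr C (src C h) \<I> \<longleftrightarrow> g \<cdot> h = zero_arr C (src C h) (tgt C g)"
        if "h \<in> arr C" "tgt C h = src C g" for h
        using mono_zero[OF iso_mono[OF j(1)], of "g \<cdot> h"] that ga j ja by auto
      show "is_kernel C (j \<cdot> g) f"
      proof (rule kernelI[OF kD(2)])
        show "(j \<cdot> g) \<cdot> f = zero_arr C (src C f) (tgt C (j \<cdot> g))" using jz[OF fa] kD ga j ja fa by simp
        fix h assume h: "h \<in> arr C" "tgt C h = src C (j \<cdot> g)" "(j \<cdot> g) \<cdot> h =
              zero_arr C (src C h) (tgt C (j \<cdot> g))"
        then have "g \<cdot> h = zero_arr C (src C h) (tgt C g)" using jz[of h] ga j ja by simp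
        then show "\<exists>u\<in>arr C. tgt C u = src C f \<and> f \<cdot> u = h"
          using kernel_factor[OF ker, of h] h ga j ja by (metis cmp_typing(2))
      qed (use kD ga j ja in auto)
      show "is_cokernel C f (j \<cdot> g)"
      proof (rule cokernelI)
        show "is_epi C (j \<cdot> g)" using cD j iso_epi ga by (intro epi_cmp) auto
        show "(j \<cdot> g) \<cdot> f = zero_arr C (src C f) (tgt C (j \<cdot> g))" using jz[OF fa] kD ga j ja fa by simp
        fix h assume h: "h \<in> arr C" "src C h = tgt C f" "h \<cdot> f = zero_arr C (src C f) (tgt C h)"
        obtain w where w: "w \<in> arr C" "src C w = tgt C g" "tgt C w = tgt C h" "w \<cdot> g = h"
          using cokernel_factor[OF coker h] .
        then have "(w \<cdot> inv_arr C j) \<cdot> (j \<cdot> g) = h" using j ja ga by simp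
        then show "\<exists>u\<in>arr C. src C u = tgt C (j \<cdot> g) \<and> u \<cdot> (j \<cdot> g) = h"
          using w j ja ga by (intro bexI[of _ "w \<cdot> inv_arr C j"]) auto
      qed (use cD ga j ja fa in auto)
    qed
    moreover from this obtain s where "s \<in> arr C" "src C s = \<I>" "tgt C s = tgt C f" "(j \<cdot> g) \<cdot> s =
          ident C \<I>"
      using center_dual_extension_splits[OF _ extend.prems _ T, of "j \<cdot> g"] j ja ga by auto
    ultimately show ?case using trivial_object_extension[OF _ T] by blast
  qed
qed

text \<open>Duality exchanges inclusions and projections; \<open>unit_iso\<close> replaces the dual
  of the unit by the unit.\<close>

lemma ldual_trivial_object:
  assumes T: "trivial_object C D n a b"
  shows "trivial_object C (ldual D) n (\<lambda>i. ldual_arr (b i) \<cdot> unit_iso) (\<lambda>i. inv_arr C unit_iso \<cdot>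
        ldual_arr (a i))"
proof -
  note TD = trivial_objectD[OF T]
  note TD(1)[simp]
  have sum: "vsum (hom_space C (ldual D) (ldual D)) (\<lambda>i. ldual_arr (a i \<cdot> b i)) k =
        ldual_arr (vsum (hom_space C D D) (\<lambda>i. a i \<cdot> b i) k)"
    if "k \<le> n" for k
    using that
  proof (induction k)
    case (Suc k)
    have "vsum (hom_space C D D) (\<lambda>i. a i \<cdot> b i) k \<in> Hom C D D"
      using TD Suc.prems by (intro vsum_Hom) (auto simp: Hom_iff)
    then show ?case using Suc TD by (simp add: ldual_arr_add Hom_iff)
  qed simp
  interpret H: vec_space "hom_space C (ldual D) (ldual D)" using vec_space_Hom by simp
  have "vsum (hom_space C (ldual D) (ldual D)) (\<lambda>i. (ldual_arr (b i) \<cdot> unit_iso) \<cdot> (inv_arr C unit_iso \<cdot>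
        ldual_arr (a i))) n =
    vsum (hom_space C (ldual D) (ldual D)) (\<lambda>i. ldual_arr (a i \<cdot> b i)) n"
    using TD by (intro H.vsum_cong) (auto simp: ldual_arr_cmp)
  then have "vsum (hom_space C (ldual D) (ldual D)) (\<lambda>i. (ldual_arr (b i) \<cdot> unit_iso) \<cdot>
        (inv_arr C unit_iso \<cdot> ldual_arr (a i))) n = ident C (ldual D)"
    using sum[of n] TD(9) by simp
  moreover have "(inv_arr C unit_iso \<cdot> ldual_arr (a i)) \<cdot> (ldual_arr (b j) \<cdot> unit_iso) =
      (if i = j then ident C \<I> else zero_arr C \<I> \<I>)" if ij: "i < n" "j < n" for i j
  proof -
    have "(inv_arr C unit_iso \<cdot> ldual_arr (a i)) \<cdot> (ldual_arr (b j) \<cdot> unit_iso) =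
          inv_arr C unit_iso \<cdot> ldual_arr (b j \<cdot> a i) \<cdot> unit_iso"
      using TD(2-7) ij by (simp add: ldual_arr_cmp)
    also have "\<dots> = (if i = j then ident C \<I> else zero_arr C \<I> \<I>)"
      unfolding TD(8)[OF ij(2,1)] by auto
    finally show ?thesis .
  qed
  ultimately show ?thesis unfolding trivial_object_def using TD(1-7) by (auto simp: Hom_iff)
qed

text \<open>Up to isomorphism \<open>X\<close> is the dual of some \<open>W\<close>, and
  \<open>W\<close> then satisfies \<open>center_dual\<close>. Being a multiple of the unit passes to
  duals and along isomorphisms.\<close>

lemma center_trivial_object:
  assumes X: "X \<in> obj C" and e: "\<And>A. A \<in> obj M \<Longrightarrow> mbraiding M X A = ident M (X \<rhd>\<^sub>o\<^bsub>M\<^esub> A)"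
  shows "\<exists>n a b. trivial_object C X n a b"
proof -
  obtain W i where W: "W \<in> obj C" "is_iso C i" "src C i = X" "tgt C i = ldual W"
      using ldual_ess_surj[OF X] .
  have "mbraiding M (ldual W) A = ident M (ldual W \<rhd>\<^sub>o\<^bsub>M\<^esub> A)" if "A \<in> obj M" for A
    using mbraiding_epi[OF iso_epi[OF W(2)] that] W(3,4) e[OF that] by simp
  then have "center_dual W" using W(1) by (simp add: center_dual_def)
  then obtain n a b where "trivial_object C W n a b" using center_dual_trivial_object by blast
  from trivial_object_iso[OF ldual_trivial_object[OF this], of "inv_arr C i" X] W show ?thesis by auto
qed

end

section \<open>The category of finite-dimensional vector spaces\<close>

definition linear_iso ::
  "('k :: field, 'v) module \<Rightarrow> ('k, 'w) module \<Rightarrow> ('v \<Rightarrow> 'w) \<Rightarrow> ('w \<Rightarrow> 'v) \<Rightarrow> bool" where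
  "linear_iso V W f g \<longleftrightarrow> linear_map V W f \<and> linear_map W V g \<and>
     (\<forall>v\<in>carrier V. g (f v) = v) \<and> (\<forall>w\<in>carrier W. f (g w) = w)"

text \<open>A basis together with its dual basis. The explicit length lets spaces over different
  carrier types be compared through \<open>n\<close> alone.\<close>

definition coordinate_system ::
  "('k :: field, 'v) module \<Rightarrow> nat \<Rightarrow> (nat \<Rightarrow> 'v) \<Rightarrow> (nat \<Rightarrow> 'v \<Rightarrow> 'k) \<Rightarrow> bool" where
  "coordinate_system V n b c \<longleftrightarrow> (\<forall>i<n. b i \<in> carrier V \<and> lin_fun V (c i)) \<and>
     (\<forall>i<n. \<forall>j<n. c i (b j) = (if i = j then 1 else 0)) \<and>
     (\<forall>v\<in>carrier V. v = vsum V (\<lambda>i. c i v \<odot>\<^bsub>V\<^esub> b i) n)"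

lemma coordinate_systemD:
  assumes "coordinate_system V n b c"
  shows "\<And>i. i < n \<Longrightarrow> b i \<in> carrier V" "\<And>i. i < n \<Longrightarrow> lin_fun V (c i)"
    "\<And>i j. \<lbrakk>i < n; j < n\<rbrakk> \<Longrightarrow> c i (b j) = (if i = j then 1 else 0)"
    "\<And>v. v \<in> carrier V \<Longrightarrow> v = vsum V (\<lambda>i. c i v \<odot>\<^bsub>V\<^esub> b i) n"
  using assms unfolding coordinate_system_def by blast+

lemma (in fd_space) ex_coordinate_system: "\<exists>b c. coordinate_system V (vdim V) b c"
  by (rule coordinates) (unfold coordinate_system_def, blast)

lemma coordinate_map_linear:
  assumes V: "vec_space V" and W: "vec_space W"
    and c: "\<And>i. i < n \<Longrightarrow> lin_fun V (c i)" and b: "\<And>i. i < n \<Longrightarrow> b i \<in> carrier W"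
  shows "linear_map V W (\<lambda>v. vsum W (\<lambda>i. c i v \<odot>\<^bsub>W\<^esub> b i) n)"
proof -
  interpret V: vec_space V by fact
  interpret W: vec_space W by fact
  have "vsum W (\<lambda>i. c i (x \<oplus>\<^bsub>V\<^esub> y) \<odot>\<^bsub>W\<^esub> b i) n =
      vsum W (\<lambda>i. c i x \<odot>\<^bsub>W\<^esub> b i) n \<oplus>\<^bsub>W\<^esub> vsum W (\<lambda>i. c i y \<odot>\<^bsub>W\<^esub> b i) n"
    if "x \<in> carrier V" "y \<in> carrier V" for x y
    using b c that by (subst W.vsum_add[symmetric]) (auto simp: lin_fun_def W.smult_add_scalar intro!:
        W.vsum_cong)
  moreover have "vsum W (\<lambda>i. c i (a \<odot>\<^bsub>V\<^esub> x) \<odot>\<^bsub>W\<^esub> b i) n = a \<odot>\<^bsub>W\<^esub> vsum W (\<lambda>i. c i x \<odot>\<^bsub>W\<^esub> b i) n"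
    if "x \<in> carrier V" for a x
    using b c that by (subst W.vsum_smult) (auto simp: lin_fun_def W.smult_smult intro!: W.vsum_cong)
  ultimately show ?thesis using b by (auto simp: linear_map_def)
qed

lemma coordinate_vsum:
  assumes V: "vec_space V" and "coordinate_system V n b c" "i < n"
  shows "c i (vsum V (\<lambda>j. x j \<odot>\<^bsub>V\<^esub> b j) n) = x i"
proof -
  interpret V: vec_space V by fact
  note cD = coordinate_systemD[OF assms(2)]
  have "c i (vsum V (\<lambda>j. x j \<odot>\<^bsub>V\<^esub> b j) n) = (\<Sum>j<n. c i (x j \<odot>\<^bsub>V\<^esub> b j))"
    using cD(1-3) assms(3) by (intro V.lin_fun_vsum) auto
  also have "\<dots> = (\<Sum>j<n. x j * (if i = j then 1 else 0))"
    using cD(1-3) assms(3) by (intro sum.cong) (auto simp: lin_fun_def)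
  finally show ?thesis using assms(3) by (simp add: if_distrib cong: if_cong)
qed

lemma coordinate_systems_iso:
  assumes V: "vec_space V" and W: "vec_space W"
    and c: "coordinate_system V n b c" and c': "coordinate_system W n b' c'"
  shows "\<exists>f g. linear_iso V W f g"
proof -
  interpret V: vec_space V by fact
  interpret W: vec_space W by fact
  note cD = coordinate_systemD[OF c] and cD' = coordinate_systemD[OF c']
  let ?f = "\<lambda>v. vsum W (\<lambda>i. c i v \<odot>\<^bsub>W\<^esub> b' i) n" and ?g = "\<lambda>w. vsum V (\<lambda>i. c' i w \<odot>\<^bsub>V\<^esub> b i) n"
  have "?g (?f v) = v" if "v \<in> carrier V" for v
  proof -
    have "?g (?f v) = vsum V (\<lambda>i. c i v \<odot>\<^bsub>V\<^esub> b i) n"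
      by (intro V.vsum_cong) (simp add: coordinate_vsum[OF W c'])
    then show ?thesis using cD(4)[OF that] by (rule trans[OF _ sym])
  qed
  moreover have "?f (?g w) = w" if "w \<in> carrier W" for w
  proof -
    have "?f (?g w) = vsum W (\<lambda>i. c' i w \<odot>\<^bsub>W\<^esub> b' i) n"
      by (intro W.vsum_cong) (simp add: coordinate_vsum[OF V c])
    then show ?thesis using cD'(4)[OF that] by (rule trans[OF _ sym])
  qed
  moreover have "linear_map V W ?f" "linear_map W V ?g"
    using coordinate_map_linear[OF V W cD(2) cD'(1)] coordinate_map_linear[OF W V cD'(2) cD(1)]
        by simp_all
  ultimately have "linear_iso V W ?f ?g" unfolding linear_iso_def by simp
  then show ?thesis by blast
qed

text \<open>Sequences vanishing from position \<open>n\<close> on, so that the carrier has the type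
  prescribed by \<open>FdVec\<close>; ring multiplication and unit are dummies, as in
  \<open>hom_space\<close>.\<close>

definition std_space :: "nat \<Rightarrow> ('k :: field, nat \<Rightarrow> 'k) module" where
  "std_space n = \<lparr>carrier = {x. \<forall>i\<ge>n. x i = 0}, monoid.mult = (\<lambda>_ _. undefined), one = undefined,
     zero = (\<lambda>_. 0), add = (\<lambda>x y i. x i + y i), module.smult = (\<lambda>a x i. a * x i)\<rparr>"

lemma std_space_simps [simp]:
  "x \<in> carrier (std_space n) \<longleftrightarrow> (\<forall>i\<ge>n. x i = 0)"
  "\<zero>\<^bsub>std_space n\<^esub> = (\<lambda>_. 0)" "x \<oplus>\<^bsub>std_space n\<^esub> y = (\<lambda>i. x i + y i)" "a \<odot>\<^bsub>std_space n\<^esub> x = (\<lambda>i. a * x i)"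
  by (simp_all add: std_space_def)

lemma cring_scalar_ring: "cring (scalar_ring :: 'k :: field ring)"
proof (rule cringI)
  show "abelian_group (scalar_ring :: 'k ring)"
  proof (rule abelian_groupI)
    fix x :: 'k
    have "- x \<oplus>\<^bsub>scalar_ring\<^esub> x = \<zero>\<^bsub>scalar_ring\<^esub>" by simp
    then show "\<exists>y\<in>carrier scalar_ring. y \<oplus>\<^bsub>scalar_ring\<^esub> x = \<zero>\<^bsub>scalar_ring\<^esub>"
        by (intro bexI[of _ "- x"]) simp_all
  qed (simp_all add: ac_simps)
  show "Group.comm_monoid (scalar_ring :: 'k ring)"
    by (rule comm_monoidI) (simp_all add: ac_simps)
qed (simp add: distrib_right)

lemma vec_space_std_space: "vec_space (std_space n :: ('k :: field, nat \<Rightarrow> 'k) module)"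
proof (rule vec_space.intro, rule Module.moduleI)
  show "abelian_group (std_space n :: ('k, nat \<Rightarrow> 'k) module)"
  proof (rule abelian_groupI)
    fix x :: "nat \<Rightarrow> 'k" assume "x \<in> carrier (std_space n)"
    then show "\<exists>y\<in>carrier (std_space n). y \<oplus>\<^bsub>std_space n\<^esub> x = \<zero>\<^bsub>std_space n\<^esub>"
      by (intro bexI[of _ "\<lambda>i. - x i"]) simp_all
  qed (auto simp: fun_eq_iff add.assoc add.commute)
next
  show "cring (scalar_ring :: 'k ring)" by (rule cring_scalar_ring)
qed (auto simp: fun_eq_iff distrib_left distrib_right mult.assoc)

lemma coordinate_system_std_space:
  "coordinate_system (std_space n) n (\<lambda>j i. if i = j then 1 else 0) (\<lambda>i x. x i)"
proof -
  have eq: "vsum (std_space n) (\<lambda>i. x i \<odot>\<^bsub>std_space n\<^esub> (\<lambda>l. if l = i then 1 else 0)) m =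
        (\<lambda>l. if l < m then x l else 0)"
    for m and x :: "nat \<Rightarrow> 'a"
  proof (induction m)
    case (Suc m)
    have "vsum (std_space n) (\<lambda>i. x i \<odot>\<^bsub>std_space n\<^esub> (\<lambda>l. if l = i then 1 else 0)) (Suc m) =
      (\<lambda>l. (if l < m then x l else 0) + x m * (if l = m then 1 else 0))"
      unfolding vsum.simps Suc.IH by simp
    then show ?case by (auto simp: less_Suc_eq)
  qed simp
  show ?thesis unfolding coordinate_system_def eq lin_fun_def by (auto simp: fun_eq_iff)
qed

text \<open>\<open>fin_dim\<close> asks for a spanning set and \<open>finsum\<close>. The
  functionals separate the entries of \<open>b\<close>, so \<open>b\<close> is injective and the sum
  can be reindexed.\<close>

lemma coordinate_system_fin_dim:
  assumes V: "vec_space V" and c: "coordinate_system V n b c"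
  shows "fin_dim V"
proof -
  interpret V: vec_space V by fact
  note cD = coordinate_systemD[OF c]
  have inj: "inj_on b {..<n}"
    by (rule inj_onI) (metis cD(3) lessThan_iff zero_neq_one)
  have "\<exists>a. v = (\<Oplus>\<^bsub>V\<^esub>w\<in>b ` {..<n}. a w \<odot>\<^bsub>V\<^esub> w)" if v: "v \<in> carrier V" for v
  proof -
    let ?a = "\<lambda>w. c (inv_into {..<n} b w) v"
    have "(\<Oplus>\<^bsub>V\<^esub>w\<in>b ` {..<n}. ?a w \<odot>\<^bsub>V\<^esub> w) = (\<Oplus>\<^bsub>V\<^esub>i\<in>{..<n}. ?a (b i) \<odot>\<^bsub>V\<^esub> b i)"
      by (rule V.M.finsum_reindex) (use cD(1) inj in auto)
    also have "\<dots> = vsum V (\<lambda>i. ?a (b i) \<odot>\<^bsub>V\<^esub> b i) n" using cD(1) by (intro V.finsum_eq_vsum) auto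
    also have "\<dots> = vsum V (\<lambda>i. c i v \<odot>\<^bsub>V\<^esub> b i) n" using inj by (intro V.vsum_cong) simp
    finally show ?thesis using cD(4)[OF v] by (intro exI[of _ ?a]) (rule trans[OF _ sym])
  qed
  then show ?thesis unfolding fin_dim_def using cD(1) by (intro exI[of _ "b ` {..<n}"]) auto
qed

section \<open>Arrows of \<open>FdVec\<close> and its linear structure\<close>

lemma FdVec_obj: "V \<in> obj FdVec \<longleftrightarrow> fd_space V"
  by (auto simp: FdVec_def Let_def fd_space_def fd_space_axioms_def vec_space_def)

text \<open>The carrier type is arbitrary here; this is what moves the spaces of arrows out of the
  unit into \<open>FdVec\<close>.\<close>

lemma (in fd_space) ex_FdVec_iso: "\<exists>W\<in>obj FdVec. \<exists>f g. linear_iso V W f g"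
proof -
  obtain b c where "coordinate_system V (vdim V) b c" using ex_coordinate_system by blast
  from coordinate_systems_iso[OF vec_space_axioms vec_space_std_space this coordinate_system_std_space]
  moreover have "std_space (vdim V) \<in> obj FdVec"
    using coordinate_system_fin_dim[OF vec_space_std_space coordinate_system_std_space]
    by (auto simp: FdVec_obj fd_space_def fd_space_axioms_def vec_space_std_space)
  ultimately show ?thesis by blast
qed

lemma FdVec_Hom_iff:
  "h \<in> Hom FdVec V W \<longleftrightarrow> (\<exists>f. h = (V, f, W) \<and> fd_space V \<and> fd_space W \<and> linear_map V W f
        \<and> f \<in> extensional (carrier V))"
  using FdVec_obj[of V] FdVec_obj[of W] by (auto simp: Hom_def FdVec_def Let_def)

lemma FdVec_HomE:
  assumes "h \<in> Hom FdVec V W"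
  obtains f where "h = (V, f, W)" "fd_space V" "fd_space W" "linear_map V W f"
      "f \<in> extensional (carrier V)"
  using assms unfolding FdVec_Hom_iff by blast

lemma FdVec_simps:
  "ident FdVec V = (V, \<lambda>x\<in>carrier V. x, V)"
  "cmp FdVec (V, g, W) (U, f, V') = (U, compose (carrier U) g f, W)"
  "add_arr FdVec (V, f, W) (V', g, W') = (V, \<lambda>x\<in>carrier V. f x \<oplus>\<^bsub>W\<^esub> g x, W)"
  "scale_arr FdVec a (V, f, W) = (V, \<lambda>x\<in>carrier V. a \<odot>\<^bsub>W\<^esub> f x, W)"
  "zero_arr FdVec V W = (V, \<lambda>x\<in>carrier V. \<zero>\<^bsub>W\<^esub>, W)"
  by (simp_all add: FdVec_def Let_def)

lemma FdVec_arrD: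
  assumes "linear_map V W f" "x \<in> carrier V"
  shows "f x \<in> carrier W" "y \<in> carrier V \<Longrightarrow> f (x \<oplus>\<^bsub>V\<^esub> y) = f x \<oplus>\<^bsub>W\<^esub> f y" "f (a \<odot>\<^bsub>V\<^esub> x) = a \<odot>\<^bsub>W\<^esub> f x"
  using assms by (auto simp: linear_map_def)

lemma linear_map_restrict:
  assumes "vec_space V" "linear_map V W f"
  shows "linear_map V W (restrict f (carrier V))"
proof -
  interpret V: vec_space V by fact
  show ?thesis using assms(2) by (auto simp: linear_map_def)
qed

lemma FdVec_HomI:
  assumes "fd_space V" "fd_space W" "linear_map V W f"
  shows "(V, restrict f (carrier V), W) \<in> Hom FdVec V W"
  using assms linear_map_restrict[OF fd_space.axioms(1)] by (auto simp: FdVec_Hom_iff)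

lemma module_hom_space_FdVec:
  assumes "fd_space V" "fd_space W"
  shows "Module.module scalar_ring (hom_space FdVec V W)"
proof -
  interpret V: fd_space V by fact
  interpret W: fd_space W by fact
  note [simp] = hom_space_simps FdVec_simps
  \<comment> \<open>Extensionality of the maps reduces every module axiom to a pointwise identity in
    \<open>W\<close>.\<close>
  have ext: "x = y" if "x \<in> Hom FdVec V W" "y \<in> Hom FdVec V W" "\<And>v. v \<in> carrier V \<Longrightarrow> fst (snd x) v =
        fst (snd y) v" for x y
    using that by (auto simp: FdVec_Hom_iff intro: extensionalityI)
  have ev: "fst (snd x) v \<in> carrier W" if "x \<in> Hom FdVec V W" "v \<in> carrier V" for x v
    using that by (auto simp: FdVec_Hom_iff linear_map_def)
  then have ev': "f v \<in> carrier W" if "(U, f, U') \<in> Hom FdVec V W" "v \<in> carrier V" for U f U' v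
    using that by fastforce
  have add: "add_arr FdVec x y \<in> Hom FdVec V W" if xy: "x \<in> Hom FdVec V W" "y \<in> Hom FdVec V W" for x y
  proof -
    obtain f g where f: "x = (V, f, W)" "linear_map V W f" and g: "y = (V, g, W)" "linear_map V W g"
      using xy by (auto simp: FdVec_Hom_iff)
    have "linear_map V W (\<lambda>v. f v \<oplus>\<^bsub>W\<^esub> g v)"
      using f(2) g(2) by (auto simp: linear_map_def Pi_iff W.smult_add_vec W.V.M.a_ac)
    then show ?thesis using FdVec_HomI[OF assms] f g by simp
  qed
  have scale: "scale_arr FdVec a x \<in> Hom FdVec V W" if x: "x \<in> Hom FdVec V W" for a x
  proof -
    obtain f where f: "x = (V, f, W)" "linear_map V W f" using x by (auto simp: FdVec_Hom_iff)
    have "linear_map V W (\<lambda>v. a \<odot>\<^bsub>W\<^esub> f v)"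
      using f(2) by (auto simp: linear_map_def Pi_iff W.smult_add_vec W.smult_smult mult.commute)
    then show ?thesis using FdVec_HomI[OF assms] f by simp
  qed
  have zero: "zero_arr FdVec V W \<in> Hom FdVec V W"
    using FdVec_HomI[OF assms, of "\<lambda>_. \<zero>\<^bsub>W\<^esub>"] by (simp add: linear_map_def)
  have sadd: "fst (snd (add_arr FdVec x y)) v = fst (snd x) v \<oplus>\<^bsub>W\<^esub> fst (snd y) v"
    if "x \<in> Hom FdVec V W" "y \<in> Hom FdVec V W" "v \<in> carrier V" for x y v
    using that by (auto simp: FdVec_Hom_iff)
  have sscale: "fst (snd (scale_arr FdVec a x)) v = a \<odot>\<^bsub>W\<^esub> fst (snd x) v"
    if "x \<in> Hom FdVec V W" "v \<in> carrier V" for a x v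
    using that by (auto simp: FdVec_Hom_iff)
  have szero: "fst (snd (zero_arr FdVec V W)) v = \<zero>\<^bsub>W\<^esub>" if "v \<in> carrier V" for v using that by simp
  note laws = ev ev' add scale zero sadd sscale szero
  have "abelian_group (hom_space FdVec V W)"
  proof (rule abelian_groupI)
    fix x assume "x \<in> carrier (hom_space FdVec V W)"
    then have x: "x \<in> Hom FdVec V W" by (simp add: hom_space_def)
    have "add_arr FdVec (scale_arr FdVec (- 1) x) x = zero_arr FdVec V W"
      by (rule ext) (use laws x W.add_neg W.V.M.a_comm in \<open>simp_all del: FdVec_simps\<close>)
    then show "\<exists>y\<in>carrier (hom_space FdVec V W). y \<oplus>\<^bsub>hom_space FdVec V W\<^esub> x = \<zero>\<^bsub>hom_space FdVec V W\<^esub>"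
      using scale[OF x] by (auto simp: hom_space_def)
  qed (auto intro!: ext simp: laws W.V.M.a_ac simp del: FdVec_simps)
  then show ?thesis
    by (rule Module.moduleI[OF cring_scalar_ring])
      (auto intro!: ext simp: laws W.smult_add_scalar W.smult_add_vec W.smult_smult simp del:
          FdVec_simps)
qed

lemma linear_category_FdVec: "linear_category (FdVec :: (_, _, 'k :: field) lcat)"
proof (rule linear_category.intro)
  fix f :: "('k, nat \<Rightarrow> 'k) module \<times> ((nat \<Rightarrow> 'k) \<Rightarrow> nat \<Rightarrow> 'k) \<times> ('k, nat \<Rightarrow> 'k) module"
  assume "f \<in> arr FdVec"
  then show "src FdVec f \<in> obj FdVec" "tgt FdVec f \<in> obj FdVec"
    by (auto simp: FdVec_def Let_def)
next
  fix A :: "('k, nat \<Rightarrow> 'k) module" assume "A \<in> obj FdVec"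
  then show "ident FdVec A \<in> Hom FdVec A A"
    using FdVec_HomI[of A A "\<lambda>x. x"] by (simp add: FdVec_obj FdVec_simps linear_map_def)
next
  fix f g and A B D :: "('k, nat \<Rightarrow> 'k) module" assume "f \<in> Hom FdVec A B" "g \<in> Hom FdVec B D"
  then obtain f' g' where "f = (A, f', B)" "g = (B, g', D)" "fd_space A" "fd_space D"
      "linear_map A B f'" "linear_map B D g'"
    unfolding FdVec_Hom_iff by blast
  then show "cmp FdVec g f \<in> Hom FdVec A D"
    using FdVec_HomI[of A D] linear_map_comp[of A B f' D g'] by (simp add: FdVec_simps compose_def)
next
  fix A B :: "('k, nat \<Rightarrow> 'k) module" assume "A \<in> obj FdVec" "B \<in> obj FdVec"
  then show "Module.module (scalar_ring :: 'k ring) (hom_space FdVec A B)"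
    by (simp add: FdVec_obj module_hom_space_FdVec)
next
  fix f and A B :: "('k, nat \<Rightarrow> 'k) module" assume "f \<in> Hom FdVec A B"
  then obtain f' where "f = (A, f', B)" "f' \<in> carrier A \<rightarrow> carrier B" "f' \<in> extensional (carrier A)"
    unfolding FdVec_Hom_iff linear_map_def by blast
  then show "cmp FdVec f (ident FdVec A) = f" "cmp FdVec (ident FdVec B) f = f"
    by (simp_all add: FdVec_simps compose_Id Id_compose)
next
  fix f g h and A B D E :: "('k, nat \<Rightarrow> 'k) module"
  assume "f \<in> Hom FdVec A B" "g \<in> Hom FdVec B D" "h \<in> Hom FdVec D E"
  then obtain f' g' h' where "f = (A, f', B)" "g = (B, g', D)" "h =
        (D, h', E)" "f' \<in> carrier A \<rightarrow> carrier B"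
    unfolding FdVec_Hom_iff linear_map_def by blast
  then show "cmp FdVec (cmp FdVec h g) f = cmp FdVec h (cmp FdVec g f)"
    by (simp add: FdVec_simps compose_assoc)
next
  fix f g h and A B D :: "('k, nat \<Rightarrow> 'k) module"
  assume "f \<in> Hom FdVec A B" "g \<in> Hom FdVec B D" "h \<in> Hom FdVec B D"
  then obtain f' g' h' where f: "f = (A, f', B)" "g = (B, g', D)" "h = (B, h', D)" "linear_map A B f'"
    unfolding FdVec_Hom_iff by blast
  show "cmp FdVec (add_arr FdVec g h) f = add_arr FdVec (cmp FdVec g f) (cmp FdVec h f)"
    by (simp add: f(1-3) FdVec_simps compose_def FdVec_arrD(1)[OF f(4)] cong: restrict_cong)
next
  fix f g h and A B D :: "('k, nat \<Rightarrow> 'k) module"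
  assume "f \<in> Hom FdVec A B" "g \<in> Hom FdVec A B" "h \<in> Hom FdVec B D"
  then obtain f' g' h' where f: "f = (A, f', B)" "g = (A, g', B)" "h = (B, h', D)"
    "linear_map A B f'" "linear_map A B g'" "linear_map B D h'"
    unfolding FdVec_Hom_iff by blast
  show "cmp FdVec h (add_arr FdVec f g) = add_arr FdVec (cmp FdVec h f) (cmp FdVec h g)"
    by (simp add: f(1-3) FdVec_simps compose_def FdVec_arrD(1)[OF f(4)] FdVec_arrD(1)[OF f(5)]
        FdVec_arrD(2)[OF f(6)]
        cong: restrict_cong)
next
  fix f g a and A B D :: "('k, nat \<Rightarrow> 'k) module" assume "f \<in> Hom FdVec A B" "g \<in> Hom FdVec B D"
  then obtain f' g' where f: "f = (A, f', B)" "g = (B, g', D)" "linear_map A B f'" "linear_map B D g'"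
    unfolding FdVec_Hom_iff by blast
  show "cmp FdVec (scale_arr FdVec a g) f = scale_arr FdVec a (cmp FdVec g f)"
    "cmp FdVec g (scale_arr FdVec a f) = scale_arr FdVec a (cmp FdVec g f)"
    by (simp_all add: f(1-2) FdVec_simps compose_def FdVec_arrD(1)[OF f(3)] FdVec_arrD(3)[OF f(4)] cong:
        restrict_cong)
qed

lemma linear_iso_sym: "linear_iso V W f g \<Longrightarrow> linear_iso W V g f"
  by (simp add: linear_iso_def)

lemma linear_iso_compose:
  "\<lbrakk>linear_iso U V f f'; linear_iso V W g g'\<rbrakk> \<Longrightarrow> linear_iso U W (\<lambda>x. g (f x)) (\<lambda>x. f' (g' x))"
  by (auto simp: linear_iso_def linear_map_comp) (auto simp: linear_map_def Pi_iff)

lemma linear_iso_Iso_FdVec: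
  assumes V: "fd_space V" "fd_space W" and f: "linear_iso V W f g"
  shows "Iso FdVec V W \<noteq> {}"
proof -
  let ?f = "(V, restrict f (carrier V), W)" and ?g = "(W, restrict g (carrier W), V)"
  note fD = f[unfolded linear_iso_def]
  have H: "?f \<in> Hom FdVec V W" "?g \<in> Hom FdVec W V" using V fD by (auto intro: FdVec_HomI)
  have fc: "f x \<in> carrier W" if "x \<in> carrier V" for x using fD that by (auto simp: linear_map_def)
  have gc: "g x \<in> carrier V" if "x \<in> carrier W" for x using fD that by (auto simp: linear_map_def)
  have "cmp FdVec ?g ?f = ident FdVec V" "cmp FdVec ?f ?g = ident FdVec W"
    using fD fc gc by (auto simp: FdVec_simps compose_def intro!: restrict_ext)
  then have "is_inverse FdVec ?f ?g" using H by (simp add: is_inverse_def Hom_def)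
  then show ?thesis using H unfolding Iso_def is_iso_def by blast
qed

section \<open>Equivalences from fully faithful functors\<close>

lemma full_subcategory_simps [simp]:
  "obj (full_subcategory C S) = S" "src (full_subcategory C S) = src C" "tgt (full_subcategory C S) =
        tgt C"
  "arr (full_subcategory C S) = {f \<in> arr C. src C f \<in> S \<and> tgt C f \<in> S}"
  "ident (full_subcategory C S) = ident C" "cmp (full_subcategory C S) = cmp C"
  "zero_arr (full_subcategory C S) = zero_arr C" "add_arr (full_subcategory C S) = add_arr C"
  "scale_arr (full_subcategory C S) = scale_arr C"
  by (simp_all add: full_subcategory_def)

lemma Hom_full_subcategory: "Hom (full_subcategory C S) A B = (if A \<in> S \<and> B \<in> S then Hom C A B else {})"
  by (auto simp: Hom_def)

lemma (in linear_category) linear_category_full_subcategory: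
  assumes "S \<subseteq> obj C"
  shows "linear_category (full_subcategory C S)"
proof -
  have eq: "hom_space (full_subcategory C S) A B = hom_space C A B" if "A \<in> S" "B \<in> S" for A B
    using that by (simp add: hom_space_def Hom_full_subcategory)
  show ?thesis
    by (rule linear_category.intro)
      (use assms in \<open>auto simp: Hom_full_subcategory eq ident_Hom cmp_ident_right cmp_ident_left
          cmp_assoc cmp_add_left cmp_add_right cmp_scale_left
        cmp_scale_right intro: cmp_Hom hom_space_module split: if_splits\<close>)
qed

text \<open>For each \<open>V\<close> a preimage \<open>A V\<close> and an isomorphism
  \<open>t V\<close> are chosen; arrows are conjugated by these and lifted through the
  Hom-bijections. Identities in \<open>C\<close> are verified after applying \<open>F\<close>, where
  the conjugations cancel.\<close>

lemma fully_faithful_equivalence: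
  assumes C: "linear_category C" and D: "linear_category D" and F: "linear_functor C D F"
    and ff: "\<And>A B. \<lbrakk>A \<in> obj C; B \<in> obj C\<rbrakk>
      \<Longrightarrow> bij_betw (on_arr F) (Hom C A B) (Hom D (on_obj F A) (on_obj F B))"
    and es: "\<And>V. V \<in> obj D \<Longrightarrow> \<exists>A\<in>obj C. Iso D (on_obj F A) V \<noteq> {}"
  shows "equivalence C D F"
proof -
  interpret C: linear_category C by fact
  interpret D: linear_category D by fact
  have FD: "on_obj F A \<in> obj D" "on_arr F (ident C A) = ident D (on_obj F A)" if "A \<in> obj C" for A
    using F that by (auto simp: linear_functor_def)
  have FA: "on_arr F f \<in> Hom D (on_obj F A) (on_obj F B)"
    "on_arr F (scale_arr C a f) = scale_arr D a (on_arr F f)"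
    "g \<in> Hom C A B \<Longrightarrow> on_arr F (add_arr C f g) = add_arr D (on_arr F f) (on_arr F g)"
    "h \<in> Hom C B E \<Longrightarrow> on_arr F (h \<cdot>\<^bsub>C\<^esub> f) = on_arr F h \<cdot>\<^bsub>D\<^esub> on_arr F f"
    if "f \<in> Hom C A B" for A B E f g h a
  proof -
    have "A \<in> obj C" "B \<in> obj C" and E: "h \<in> Hom C B E \<Longrightarrow> E \<in> obj C" using that C.src_obj C.tgt_obj
        by (auto simp: Hom_def)
    then show "on_arr F f \<in> Hom D (on_obj F A) (on_obj F B)"
      "on_arr F (scale_arr C a f) = scale_arr D a (on_arr F f)"
      "g \<in> Hom C A B \<Longrightarrow> on_arr F (add_arr C f g) = add_arr D (on_arr F f) (on_arr F g)"
      using F that by (auto simp: linear_functor_def)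
    show "on_arr F (h \<cdot>\<^bsub>C\<^esub> f) = on_arr F h \<cdot>\<^bsub>D\<^esub> on_arr F f" if "h \<in> Hom C B E"
      using F \<open>f \<in> Hom C A B\<close> that E[OF that] \<open>A \<in> obj C\<close> \<open>B \<in> obj C\<close> unfolding linear_functor_def
          by blast
  qed
  have faithful: "f = g" if "f \<in> Hom C A B" "g \<in> Hom C A B" "on_arr F f = on_arr F g" for A B f g
    using that ff[of A B] C.src_obj C.tgt_obj by (auto simp: Hom_def bij_betw_def dest: inj_onD)
  define lift where "lift A B h = inv_into (Hom C A B) (on_arr F) h" for A B h
  have lift: "lift A B h \<in> Hom C A B" "on_arr F (lift A B h) = h"
    if "A \<in> obj C" "B \<in> obj C" "h \<in> Hom D (on_obj F A) (on_obj F B)" for A B h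
    using ff[OF that(1,2)] that(3) unfolding lift_def bij_betw_def
        by (metis inv_into_into f_inv_into_f)+
  have "\<exists>A t t'. A \<in> obj C \<and> t \<in> Hom D (on_obj F A) V \<and> t' \<in> Hom D V (on_obj F A) \<and>
      t' \<cdot>\<^bsub>D\<^esub> t = ident D (on_obj F A) \<and> t \<cdot>\<^bsub>D\<^esub> t' = ident D V" if V: "V \<in> obj D" for V
  proof -
    obtain A f where A: "A \<in> obj C" and f: "f \<in> Hom D (on_obj F A) V" "is_iso D f" using es[OF V]
        by (auto simp: Iso_def)
    then obtain g where "is_inverse D f g" by (auto simp: is_iso_def)
    with A f show ?thesis
        by (intro exI[of _ A] exI[of _ f] exI[of _ g]) (auto simp: is_inverse_def Hom_def)
  qed
  then obtain A t t' where At: "A V \<in> obj C" "t V \<in> Hom D (on_obj F (A V)) V"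
      "t' V \<in> Hom D V (on_obj F (A V))"
    "t' V \<cdot>\<^bsub>D\<^esub> t V = ident D (on_obj F (A V))" "t V \<cdot>\<^bsub>D\<^esub> t' V = ident D V" if "V \<in> obj D" for V
    by metis
  have t [simp]: "t V \<in> arr D" "src D (t V) = on_obj F (A V)" "tgt D (t V) = V"
    "t' V \<in> arr D" "src D (t' V) = V" "tgt D (t' V) = on_obj F (A V)" if "V \<in> obj D" for V
    using At[OF that] by (auto simp: Hom_def)
  have tt [simp]: "t' V \<cdot>\<^bsub>D\<^esub> (t V \<cdot>\<^bsub>D\<^esub> x) = x" if "V \<in> obj D" "x \<in> arr D" "tgt D x = on_obj F (A V)"
      for V x
    using D.cmp_reduce[OF At(4)[OF that(1)], of x] that by simp
  have tt' [simp]: "t V \<cdot>\<^bsub>D\<^esub> (t' V \<cdot>\<^bsub>D\<^esub> x) = x" if "V \<in> obj D" "x \<in> arr D" "tgt D x = V" for V x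
    using D.cmp_reduce[OF At(5)[OF that(1)], of x] that by simp
  define G where "G = \<lparr>on_obj = A, on_arr =
        (\<lambda>g. lift (A (src D g)) (A (tgt D g)) (t' (tgt D g) \<cdot>\<^bsub>D\<^esub> g \<cdot>\<^bsub>D\<^esub> t (src D g)))\<rparr>"
  have G: "on_arr G g \<in> Hom C (A V) (A W)" "on_arr F (on_arr G g) = t' W \<cdot>\<^bsub>D\<^esub> g \<cdot>\<^bsub>D\<^esub> t V"
    if "g \<in> Hom D V W" for g V W
  proof -
    have "V \<in> obj D" "W \<in> obj D" using that D.src_obj D.tgt_obj by (auto simp: Hom_def)
    then show "on_arr G g \<in> Hom C (A V) (A W)" "on_arr F (on_arr G g) = t' W \<cdot>\<^bsub>D\<^esub> g \<cdot>\<^bsub>D\<^esub> t V"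
      using lift[of "A V" "A W" "t' W \<cdot>\<^bsub>D\<^esub> g \<cdot>\<^bsub>D\<^esub> t V"] At(1) that by (auto simp: G_def Hom_def)
  qed
  have linG: "linear_functor D C G"
    unfolding linear_functor_def
  proof (intro conjI ballI allI)
    fix V assume V: "V \<in> obj D"
    then show "on_obj G V \<in> obj C" by (simp add: G_def At(1))
    show "on_arr G (ident D V) = ident C (on_obj G V)"
    proof (rule faithful)
      show "on_arr G (ident D V) \<in> Hom C (A V) (A V)" using G(1) D.ident_Hom[OF V] .
      show "ident C (on_obj G V) \<in> Hom C (A V) (A V)" using C.ident_Hom At(1)[OF V] by (simp add: G_def)
      show "on_arr F (on_arr G (ident D V)) = on_arr F (ident C (on_obj G V))"
        unfolding G(2)[OF D.ident_Hom[OF V]] using V At(1,4)[OF V] FD(2) by (simp add: G_def)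
    qed
  next
    fix V W f assume V: "V \<in> obj D" "W \<in> obj D" and f: "f \<in> Hom D V W"
    note Gf = G[OF f]
    have fa: "f \<in> arr D" "src D f = V" "tgt D f = W" using f by (auto simp: Hom_def)
    show "on_arr G f \<in> Hom C (on_obj G V) (on_obj G W)" using Gf(1) by (simp add: G_def)
    fix a
    have sf: "scale_arr D a f \<in> Hom D V W" using fa by (simp add: Hom_def)
    show "on_arr G (scale_arr D a f) = scale_arr C a (on_arr G f)"
    proof (rule faithful[OF G(1)[OF sf]])
      show "scale_arr C a (on_arr G f) \<in> Hom C (A V) (A W)" using Gf(1) by (auto simp: Hom_def)
      show "on_arr F (on_arr G (scale_arr D a f)) = on_arr F (scale_arr C a (on_arr G f))"
        unfolding G(2)[OF sf] FA(2)[OF Gf(1)] Gf(2) using V fa by simp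
    qed
  next
    fix V W f g assume V: "V \<in> obj D" "W \<in> obj D" and f: "f \<in> Hom D V W" and g: "g \<in> Hom D V W"
    have fa: "f \<in> arr D" "src D f = V" "tgt D f = W" "g \<in> arr D" "src D g = V" "tgt D g = W" using f g
        by (auto simp: Hom_def)
    have sf: "add_arr D f g \<in> Hom D V W" using fa by (simp add: Hom_def)
    show "on_arr G (add_arr D f g) = add_arr C (on_arr G f) (on_arr G g)"
    proof (rule faithful[OF G(1)[OF sf]])
      show "add_arr C (on_arr G f) (on_arr G g) \<in> Hom C (A V) (A W)" using G(1)[OF f] G(1)[OF g]
          by (auto simp: Hom_def)
      show "on_arr F (on_arr G (add_arr D f g)) = on_arr F (add_arr C (on_arr G f) (on_arr G g))"
        unfolding G(2)[OF sf] FA(3)[OF G(1)[OF f] G(1)[OF g]] G(2)[OF f] G(2)[OF g]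
        using V fa by (simp add: D.cmp_add_arr_left D.cmp_add_arr_right)
    qed
  next
    fix V W U f g assume V: "V \<in> obj D" "W \<in> obj D" "U \<in> obj D" and f: "f \<in> Hom D V W"
        and g: "g \<in> Hom D W U"
    have fa: "f \<in> arr D" "src D f = V" "tgt D f = W" "g \<in> arr D" "src D g = W" "tgt D g = U" using f g
        by (auto simp: Hom_def)
    have sf: "g \<cdot>\<^bsub>D\<^esub> f \<in> Hom D V U" using fa by (simp add: Hom_def)
    show "on_arr G (g \<cdot>\<^bsub>D\<^esub> f) = on_arr G g \<cdot>\<^bsub>C\<^esub> on_arr G f"
    proof (rule faithful[OF G(1)[OF sf]])
      show "on_arr G g \<cdot>\<^bsub>C\<^esub> on_arr G f \<in> Hom C (A V) (A U)" using C.cmp_Hom[OF G(1)[OF f] G(1)[OF g]] .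
      show "on_arr F (on_arr G (g \<cdot>\<^bsub>D\<^esub> f)) = on_arr F (on_arr G g \<cdot>\<^bsub>C\<^esub> on_arr G f)"
        unfolding G(2)[OF sf] FA(4)[OF G(1)[OF f] G(1)[OF g]] G(2)[OF f] G(2)[OF g] using V fa by simp
    qed
  qed
  \<comment> \<open>The unit of the equivalence and its inverse are the lifts of \<open>t'\<close>
    and \<open>t\<close> at the object \<open>on_obj F X\<close>; the counit is \<open>t\<close>
    itself.\<close>
  define \<eta> where "\<eta> X = lift X (A (on_obj F X)) (t' (on_obj F X))" for X
  define \<eta>' where "\<eta>' X = lift (A (on_obj F X)) X (t (on_obj F X))" for X
  have \<eta>: "\<eta> X \<in> Hom C X (A (on_obj F X))" "on_arr F (\<eta> X) = t' (on_obj F X)"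
    "\<eta>' X \<in> Hom C (A (on_obj F X)) X" "on_arr F (\<eta>' X) = t (on_obj F X)" if "X \<in> obj C" for X
    using lift[of X "A (on_obj F X)" "t' (on_obj F X)"] lift[of "A (on_obj F X)" X "t (on_obj F X)"]
      At(1-3)[of "on_obj F X"] FD(1)[OF that] that by (auto simp: \<eta>_def \<eta>'_def)
  have "natural_iso C C id_ftor (comp_ftor G F) \<eta>"
    unfolding natural_iso_def
  proof (intro conjI ballI)
    fix X assume X: "X \<in> obj C"
    note FX = FD(1)[OF X]
    have "\<eta>' X \<cdot>\<^bsub>C\<^esub> \<eta> X = ident C X"
      by (rule faithful[OF C.cmp_Hom[OF \<eta>(1)[OF X] \<eta>(3)[OF X]] C.ident_Hom[OF X]])
        (simp add: FA(4)[OF \<eta>(1)[OF X] \<eta>(3)[OF X]] \<eta>(2,4)[OF X] FD(2)[OF X] At(5)[OF FX])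
    moreover have "\<eta> X \<cdot>\<^bsub>C\<^esub> \<eta>' X = ident C (A (on_obj F X))"
      by (rule faithful[OF C.cmp_Hom[OF \<eta>(3)[OF X] \<eta>(1)[OF X]] C.ident_Hom[OF At(1)[OF FX]]])
        (simp add: FA(4)[OF \<eta>(3)[OF X] \<eta>(1)[OF X]] \<eta>(2,4)[OF X] FD(2)[OF At(1)[OF FX]] At(4)[OF FX])
    ultimately have "is_inverse C (\<eta> X) (\<eta>' X)"
      using \<eta>(1,3)[OF X] by (simp add: is_inverse_def Hom_def)
    then show "\<eta> X \<in> Iso C (on_obj id_ftor X) (on_obj (comp_ftor G F) X)"
      using \<eta>(1)[OF X] unfolding Iso_def is_iso_def by (simp add: id_ftor_def comp_ftor_def G_def) blast
  next
    fix f assume f: "f \<in> arr C"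
    let ?X = "src C f" and ?Y = "tgt C f"
    have X: "?X \<in> obj C" "?Y \<in> obj C" and fH: "f \<in> Hom C ?X ?Y" using f C.src_obj C.tgt_obj
        by (auto simp: Hom_def)
    note FX = FD(1)[OF X(1)] FD(1)[OF X(2)] and Ff = FA(1)[OF fH]
    have Fa: "on_arr F f \<in> arr D" "src D (on_arr F f) = on_obj F ?X" "tgt D (on_arr F f) = on_obj F ?Y"
      using Ff by (auto simp: Hom_def)
    have "on_arr G (on_arr F f) \<cdot>\<^bsub>C\<^esub> \<eta> ?X = \<eta> ?Y \<cdot>\<^bsub>C\<^esub> f"
    proof (rule faithful[OF C.cmp_Hom[OF \<eta>(1)[OF X(1)] G(1)[OF Ff]] C.cmp_Hom[OF fH \<eta>(1)[OF X(2)]]])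
      show "on_arr F (on_arr G (on_arr F f) \<cdot>\<^bsub>C\<^esub> \<eta> ?X) = on_arr F (\<eta> ?Y \<cdot>\<^bsub>C\<^esub> f)"
        unfolding FA(4)[OF \<eta>(1)[OF X(1)] G(1)[OF Ff]] FA(4)[OF fH \<eta>(1)[OF X(2)]] G(2)[OF Ff]
            \<eta>(2)[OF X(1)] \<eta>(2)[OF X(2)]
        using FX Fa At(5)[OF FX(1)] by simp
    qed
    then show "on_arr (comp_ftor G F) f \<cdot>\<^bsub>C\<^esub> \<eta> ?X = \<eta> ?Y \<cdot>\<^bsub>C\<^esub> on_arr id_ftor f"
      by (simp add: comp_ftor_def id_ftor_def)
  qed
  moreover have "natural_iso D D (comp_ftor F G) id_ftor t"
    unfolding natural_iso_def
  proof (intro conjI ballI)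
    fix V assume V: "V \<in> obj D"
    have "is_inverse D (t V) (t' V)" using V At[OF V] by (simp add: is_inverse_def)
    then show "t V \<in> Iso D (on_obj (comp_ftor F G) V) (on_obj id_ftor V)"
      using At(2)[OF V] unfolding Iso_def is_iso_def
          by (simp add: id_ftor_def comp_ftor_def G_def) blast
  next
    fix g assume g: "g \<in> arr D"
    then have gH: "g \<in> Hom D (src D g) (tgt D g)" "src D g \<in> obj D" "tgt D g \<in> obj D"
      using D.src_obj D.tgt_obj by (auto simp: Hom_def)
    then have "on_arr id_ftor g \<cdot>\<^bsub>D\<^esub> t (src D g) = t (tgt D g) \<cdot>\<^bsub>D\<^esub> on_arr F (on_arr G g)"
      unfolding G(2)[OF gH(1)] using g by (simp add: id_ftor_def)
    then show "on_arr id_ftor g \<cdot>\<^bsub>D\<^esub> t (src D g) = t (tgt D g) \<cdot>\<^bsub>D\<^esub> on_arr (comp_ftor F G) g"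
      by (simp add: comp_ftor_def)
  qed
  ultimately show ?thesis unfolding equivalence_def using F linG by blast
qed

section \<open>Triviality of the symmetric center\<close>

context finite_tensor_category
begin

text \<open>Inverse of the bijection in \<open>End_unit\<close>, meaningful on endomorphisms of the
  unit only.\<close>

definition unit_scalar :: "'m \<Rightarrow> 'k" where
  "unit_scalar = inv_into UNIV (\<lambda>a. scale_arr C a (ident C \<I>))"

lemma scale_unit_scalar: "\<lbrakk>f \<in> arr C; src C f = \<I>; tgt C f = \<I>\<rbrakk>
      \<Longrightarrow> scale_arr C (unit_scalar f) (ident C \<I>) = f"
  using f_inv_into_f[of f "\<lambda>a. scale_arr C a (ident C \<I>)" UNIV] End_unit
  by (simp add: unit_scalar_def bij_betw_def Hom_iff)

lemma unit_scalar_scale [simp]: "unit_scalar (scale_arr C a (ident C \<I>)) = a"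
  using inv_into_f_f[OF bij_betw_imp_inj_on[OF End_unit], of a] by (simp add: unit_scalar_def)

lemma unit_scalar_linear:
  assumes "f \<in> arr C" "src C f = \<I>" "tgt C f = \<I>"
  shows "unit_scalar (scale_arr C a f) = a * unit_scalar f"
    and "\<lbrakk>g \<in> arr C; src C g = \<I>; tgt C g = \<I>\<rbrakk> \<Longrightarrow> unit_scalar (add_arr C f g) =
          unit_scalar f + unit_scalar g"
proof -
  interpret H: vec_space "hom_space C \<I> \<I>" using vec_space_Hom by simp
  have i: "ident C \<I> \<in> carrier (hom_space C \<I> \<I>)" by (simp add: Hom_iff)
  have "scale_arr C a f = scale_arr C a (scale_arr C (unit_scalar f) (ident C \<I>))"
    using scale_unit_scalar[OF assms] by simp
  also have "\<dots> = scale_arr C (a * unit_scalar f) (ident C \<I>)" using H.smult_smult[OF i] by simp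
  finally show "unit_scalar (scale_arr C a f) = a * unit_scalar f" by simp
  assume g: "g \<in> arr C" "src C g = \<I>" "tgt C g = \<I>"
  have "add_arr C f g =
        add_arr C (scale_arr C (unit_scalar f) (ident C \<I>)) (scale_arr C (unit_scalar g) (ident C \<I>))"
    by (simp only: scale_unit_scalar[OF assms] scale_unit_scalar[OF g])
  also have "\<dots> = scale_arr C (unit_scalar f + unit_scalar g) (ident C \<I>)" using H.smult_add_scalar[OF i]
      by simp
  finally show "unit_scalar (add_arr C f g) = unit_scalar f + unit_scalar g" by simp
qed

lemma unit_scalar_ident_zero [simp]: "unit_scalar (ident C \<I>) = 1" "unit_scalar (zero_arr C \<I> \<I>) = 0"
  using unit_scalar_scale[of 1] unit_scalar_scale[of 0] by simp_all

lemma trivial_object_expand: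
  assumes T: "trivial_object C X n a b" and f: "f \<in> Hom C X Y"
  shows "f = vsum (hom_space C X Y) (\<lambda>i. (f \<cdot> a i) \<cdot> b i) n"
proof -
  note TD = trivial_objectD[OF T]
  have fa: "f \<in> arr C" "src C f = X" "tgt C f = Y" and Y: "Y \<in> obj C" using f by (auto simp: Hom_iff)
  interpret H: vec_space "hom_space C X Y" using vec_space_Hom TD(1) Y by simp
  have "f = f \<cdot> vsum (hom_space C X X) (\<lambda>i. a i \<cdot> b i) n" using fa TD(9) by simp
  also have "\<dots> = vsum (hom_space C X Y) (\<lambda>i. f \<cdot> (a i \<cdot> b i)) n"
    using TD(1-7) f by (intro cmp_vsum) (auto simp: Hom_iff)
  also have "\<dots> = vsum (hom_space C X Y) (\<lambda>i. (f \<cdot> a i) \<cdot> b i) n"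
    using TD(1-7) fa by (intro H.vsum_cong) simp
  finally show ?thesis .
qed

lemma trivial_object_coordinates:
  assumes T: "trivial_object C X n a b"
  shows "coordinate_system (hom_space C \<I> X) n a (\<lambda>i x. unit_scalar (b i \<cdot> x))"
  unfolding coordinate_system_def
proof (intro conjI allI impI ballI)
  note TD = trivial_objectD[OF T]
  fix i assume i: "i < n"
  show "a i \<in> carrier (hom_space C \<I> X)" using TD i by (simp add: Hom_iff)
  show "lin_fun (hom_space C \<I> X) (\<lambda>x. unit_scalar (b i \<cdot> x))"
    using TD(5-7)[OF i] unfolding lin_fun_def
        by (auto simp: Hom_iff cmp_add_arr_right unit_scalar_linear)
  fix j assume "j < n"
  then show "unit_scalar (b i \<cdot> a j) = (if i = j then 1 else 0)" using TD(8)[OF i] by simp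
next
  note TD = trivial_objectD[OF T]
  fix x assume "x \<in> carrier (hom_space C \<I> X)"
  then have x: "x \<in> arr C" "src C x = \<I>" "tgt C x = X" by (auto simp: Hom_iff)
  interpret H: vec_space "hom_space C \<I> X" using vec_space_Hom TD(1) by simp
  have "x = vsum (hom_space C X X) (\<lambda>i. a i \<cdot> b i) n \<cdot> x" using x TD(9) by simp
  also have "\<dots> = vsum (hom_space C \<I> X) (\<lambda>i. (a i \<cdot> b i) \<cdot> x) n"
    using TD(1-7) x by (intro vsum_cmp) (auto simp: Hom_iff)
  also have "\<dots> = vsum (hom_space C \<I> X) (\<lambda>i. unit_scalar (b i \<cdot> x) \<odot>\<^bsub>hom_space C \<I> X\<^esub> a i) n"
  proof (rule H.vsum_cong)
    fix i assume i: "i < n"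
    have "(a i \<cdot> b i) \<cdot> x = a i \<cdot> scale_arr C (unit_scalar (b i \<cdot> x)) (ident C \<I>)"
      using TD(2-7)[OF i] x scale_unit_scalar[of "b i \<cdot> x"] by simp
    then show "(a i \<cdot> b i) \<cdot> x = unit_scalar (b i \<cdot> x) \<odot>\<^bsub>hom_space C \<I> X\<^esub> a i"
      using TD(2-4)[OF i] by simp
  qed
  finally show "x = vsum (hom_space C \<I> X) (\<lambda>i. unit_scalar (b i \<cdot> x) \<odot>\<^bsub>hom_space C \<I> X\<^esub> a i) n" .
qed

text \<open>An arrow out of a multiple of the unit is determined by its composites with the
  inclusions \<open>a i\<close>, which are among the test arrows.\<close>

lemma trivial_object_faithful:
  assumes T: "trivial_object C X n a b" and f: "f \<in> Hom C X Y" "g \<in> Hom C X Y"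
    and eq: "\<And>x. x \<in> Hom C \<I> X \<Longrightarrow> f \<cdot> x = g \<cdot> x"
  shows "f = g"
proof -
  note TD = trivial_objectD[OF T]
  have "Y \<in> obj C" using f by (auto simp: Hom_iff)
  then interpret H: vec_space "hom_space C X Y" using vec_space_Hom TD(1) by simp
  have "vsum (hom_space C X Y) (\<lambda>i. (f \<cdot> a i) \<cdot> b i) n = vsum (hom_space C X Y) (\<lambda>i. (g \<cdot> a i) \<cdot> b i) n"
  proof (rule H.vsum_cong)
    fix i assume "i < n"
    then have "f \<cdot> a i = g \<cdot> a i" using TD by (intro eq) (simp add: Hom_iff)
    then show "(f \<cdot> a i) \<cdot> b i = (g \<cdot> a i) \<cdot> b i" by (rule arg_cong)
  qed
  then show ?thesis
    using trivial_object_expand[OF T f(1)] trivial_object_expand[OF T f(2)]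
        by (rule box_equals[OF _ sym sym])
qed

text \<open>The arrow is the sum of the composites \<open>\<psi> (a i) \<cdot> b i\<close>; it
  induces \<open>\<psi>\<close> on the basis \<open>a i\<close>, hence everywhere by
  linearity.\<close>

lemma trivial_object_full:
  assumes T: "trivial_object C X n a b" and Y: "Y \<in> obj C"
    and psi: "linear_map (hom_space C \<I> X) (hom_space C \<I> Y) \<psi>"
  obtains f where "f \<in> Hom C X Y" "\<And>x. x \<in> Hom C \<I> X \<Longrightarrow> f \<cdot> x = \<psi> x"
proof -
  note TD = trivial_objectD[OF T] and cs = coordinate_systemD[OF trivial_object_coordinates[OF T]]
  interpret X: vec_space "hom_space C \<I> X" using vec_space_Hom TD(1) by simp
  interpret Y: vec_space "hom_space C \<I> Y" using vec_space_Hom Y by simp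
  have pa: "\<psi> (a i) \<in> arr C" "src C (\<psi> (a i)) = \<I>" "tgt C (\<psi> (a i)) = Y" if "i < n" for i
    using psi cs(1)[OF that] by (auto simp: linear_map_def Pi_iff Hom_iff)
  let ?f = "vsum (hom_space C X Y) (\<lambda>i. \<psi> (a i) \<cdot> b i) n"
  have f: "?f \<in> Hom C X Y" using TD Y pa by (intro vsum_Hom) (auto simp: Hom_iff)
  have "?f \<cdot> x = \<psi> x" if xH: "x \<in> Hom C \<I> X" for x
  proof -
    have x: "x \<in> arr C" "src C x = \<I>" "tgt C x = X" using xH by (auto simp: Hom_iff)
    have "?f \<cdot> x = vsum (hom_space C \<I> Y) (\<lambda>i. (\<psi> (a i) \<cdot> b i) \<cdot> x) n"
      using TD(1-7) xH Y pa by (intro vsum_cmp) (auto simp: Hom_iff)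
    also have "\<dots> = vsum (hom_space C \<I> Y) (\<lambda>i. \<psi> (unit_scalar (b i \<cdot> x) \<odot>\<^bsub>hom_space C \<I> X\<^esub> a i)) n"
    proof (rule Y.vsum_cong)
      fix i assume i: "i < n"
      have "(\<psi> (a i) \<cdot> b i) \<cdot> x = \<psi> (a i) \<cdot> scale_arr C (unit_scalar (b i \<cdot> x)) (ident C \<I>)"
        using TD(2-7)[OF i] x pa[OF i] scale_unit_scalar[of "b i \<cdot> x"] by simp
      also have "\<dots> = scale_arr C (unit_scalar (b i \<cdot> x)) (\<psi> (a i))" using pa[OF i] by simp
      also have "\<dots> = \<psi> (unit_scalar (b i \<cdot> x) \<odot>\<^bsub>hom_space C \<I> X\<^esub> a i)"
        using psi cs(1)[OF i] by (simp add: linear_map_def)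
      finally show "(\<psi> (a i) \<cdot> b i) \<cdot> x = \<psi> (unit_scalar (b i \<cdot> x) \<odot>\<^bsub>hom_space C \<I> X\<^esub> a i)" .
    qed
    also have "\<dots> = \<psi> (vsum (hom_space C \<I> X) (\<lambda>i. unit_scalar (b i \<cdot> x) \<odot>\<^bsub>hom_space C \<I> X\<^esub> a i) n)"
      using Y.vec_space_axioms X.smult_in[OF cs(1)]
          by (intro X.linear_map_vsum[OF psi, symmetric]) simp_all
    also have "\<dots> = \<psi> x" using cs(4)[of x] xH by (intro arg_cong[of _ _ \<psi>]) (rule sym, simp)
    finally show ?thesis .
  qed
  with f show ?thesis using that by blast
qed

text \<open>The functor is \<open>Hom(\<I>, -)\<close>, transported along linear isomorphisms to spaces of sequences.\<close>

lemma trivial_objects_equivalence: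
  assumes S: "S \<subseteq> obj C" and triv: "\<And>X. X \<in> S \<Longrightarrow> \<exists>n a b. trivial_object C X n a b"
    and ex: "\<And>n. \<exists>X\<in>S. \<exists>a b. trivial_object C X n a b"
  shows "\<exists>F. equivalence (full_subcategory C S) (FdVec :: (_, _, 'k) lcat) F"
proof -
  let ?H = "\<lambda>X. hom_space C \<I> X"
  have fd: "fd_space (?H X)" if "X \<in> S" for X using fd_Hom[of \<I> X] S that by auto
  \<comment> \<open>Spaces of arrows of \<open>C\<close> do not have the carrier type of
    \<open>FdVec\<close>, so a copy \<open>V X\<close> with mutually inverse linear maps is chosen
    for each object.\<close>
  have "\<exists>V f g. V \<in> obj (FdVec :: (_, _, 'k) lcat) \<and> linear_iso (?H X) V f g" if "X \<in> S" for X
    using fd_space.ex_FdVec_iso[OF fd[OF that]] by blast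
  then obtain V \<kappa> \<kappa>' where V: "V X \<in> obj (FdVec :: (_, _, 'k) lcat)"
      "linear_iso (?H X) (V X) (\<kappa> X) (\<kappa>' X)" if "X \<in> S" for X
    by metis
  have VD: "fd_space (V X)" "linear_map (?H X) (V X) (\<kappa> X)" "linear_map (V X) (?H X) (\<kappa>' X)" if "X \<in> S"
      for X
    using V[OF that] by (auto simp: FdVec_obj linear_iso_def)
  have \<kappa>'H: "\<kappa>' X v \<in> Hom C \<I> X" if "X \<in> S" "v \<in> carrier (V X)" for X v
    using VD(3)[OF that(1)] that(2) by (auto simp: linear_map_def)
  have \<kappa>V: "\<kappa> X x \<in> carrier (V X)" if "X \<in> S" "x \<in> Hom C \<I> X" for X x
    using VD(2)[OF that(1)] that(2) by (auto simp: linear_map_def)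
  have \<kappa>\<kappa>': "\<kappa> X (\<kappa>' X v) = v" if "X \<in> S" "v \<in> carrier (V X)" for X v
    using V(2)[OF that(1)] that(2) by (simp add: linear_iso_def)
  have \<kappa>'\<kappa>: "\<kappa>' X (\<kappa> X x) = x" if "X \<in> S" "x \<in> Hom C \<I> X" for X x
    using V(2)[OF that(1)] that(2) by (simp add: linear_iso_def)
  define F where "F = \<lparr>on_obj = V, on_arr =
        (\<lambda>f. (V (src C f), \<lambda>v\<in>carrier (V (src C f)). \<kappa> (tgt C f) (f \<cdot> \<kappa>' (src C f) v), V (tgt C f)))\<rparr>"
  have FH: "on_arr F f \<in> Hom FdVec (V X) (V Y)" if "X \<in> S" "Y \<in> S" "f \<in> Hom C X Y" for X Y f
  proof -
    have f: "f \<in> arr C" "src C f = X" "tgt C f = Y" using that(3) by (auto simp: Hom_iff)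
    have "linear_map (V X) (?H Y) (\<lambda>v. f \<cdot> \<kappa>' X v)"
      using linear_map_comp[OF VD(3)[OF that(1)] linear_map_cmp_left[OF f]] .
    from FdVec_HomI[OF VD(1)[OF that(1)] VD(1)[OF that(2)] linear_map_comp[OF this VD(2)[OF that(2)]]]
    show ?thesis using f by (simp add: F_def)
  qed
  have linF: "linear_functor (full_subcategory C S) FdVec F"
    unfolding linear_functor_def full_subcategory_simps Hom_full_subcategory
  proof (intro conjI ballI allI)
    fix X assume X: "X \<in> S"
    then show "on_obj F X \<in> obj FdVec" using V(1) by (simp add: F_def)
    show "on_arr F (ident C X) = ident FdVec (on_obj F X)"
    proof -
      have "\<kappa> X (ident C X \<cdot> \<kappa>' X v) = v" if "v \<in> carrier (V X)" for v
        using \<kappa>'H[OF X that] \<kappa>\<kappa>'[OF X that] by (simp add: cmp_ident_left)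
      moreover have "X \<in> obj C" using X S by auto
      ultimately show ?thesis by (simp add: F_def FdVec_simps cong: restrict_cong)
    qed
  next
    fix X Y f assume X: "X \<in> S" and Y: "Y \<in> S" and "f \<in> (if X \<in> S \<and> Y \<in> S then Hom C X Y else {})"
    then have f: "f \<in> Hom C X Y" by simp
    then show "on_arr F f \<in> Hom FdVec (on_obj F X) (on_obj F Y)" using FH X Y by (simp add: F_def)
    have fa: "f \<in> arr C" "src C f = X" "tgt C f = Y" using f by (auto simp: Hom_iff)
    fix a
    have "\<kappa> Y (scale_arr C a f \<cdot> \<kappa>' X v) = a \<odot>\<^bsub>V Y\<^esub> \<kappa> Y (f \<cdot> \<kappa>' X v)" if v: "v \<in> carrier (V X)" for v
      using \<kappa>'H[OF X v] fa VD(2)[OF Y] by (simp add: linear_map_def Hom_iff)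
    then show "on_arr F (scale_arr C a f) = scale_arr FdVec a (on_arr F f)"
      using fa by (simp add: F_def FdVec_simps cong: restrict_cong)
  next
    fix X Y f g assume X: "X \<in> S" and Y: "Y \<in> S" and "f \<in> (if X \<in> S \<and> Y \<in> S then Hom C X Y else {})"
      and "g \<in> (if X \<in> S \<and> Y \<in> S then Hom C X Y else {})"
    then have fa: "f \<in> arr C" "src C f = X" "tgt C f = Y" "g \<in> arr C" "src C g = X" "tgt C g = Y"
        by (auto simp: Hom_iff)
    have "\<kappa> Y (add_arr C f g \<cdot> \<kappa>' X v) = \<kappa> Y (f \<cdot> \<kappa>' X v) \<oplus>\<^bsub>V Y\<^esub> \<kappa> Y (g \<cdot> \<kappa>' X v)"
        if v: "v \<in> carrier (V X)" for v
      using \<kappa>'H[OF X v] fa VD(2)[OF Y] by (simp add: linear_map_def Hom_iff cmp_add_arr_left)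
    then show "on_arr F (add_arr C f g) = add_arr FdVec (on_arr F f) (on_arr F g)"
      using fa by (simp add: F_def FdVec_simps cong: restrict_cong)
  next
    fix X Y Z f g assume X: "X \<in> S" and Y: "Y \<in> S" and Z: "Z \<in> S"
        and "f \<in> (if X \<in> S \<and> Y \<in> S then Hom C X Y else {})"
      and "g \<in> (if Y \<in> S \<and> Z \<in> S then Hom C Y Z else {})"
    then have fa: "f \<in> arr C" "src C f = X" "tgt C f = Y" "g \<in> arr C" "src C g = Y" "tgt C g = Z"
        by (auto simp: Hom_iff)
    have "\<kappa> Z ((g \<cdot> f) \<cdot> \<kappa>' X v) = \<kappa> Z (g \<cdot> \<kappa>' Y (\<kappa> Y (f \<cdot> \<kappa>' X v)))"
      "\<kappa> Y (f \<cdot> \<kappa>' X v) \<in> carrier (V Y)" if v: "v \<in> carrier (V X)" for v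
      using \<kappa>'H[OF X v] fa \<kappa>'\<kappa>[OF Y, of "f \<cdot> \<kappa>' X v"] \<kappa>V[OF Y, of "f \<cdot> \<kappa>' X v"]
          by (simp_all add: Hom_iff)
    then show "on_arr F (g \<cdot> f) = cmp FdVec (on_arr F g) (on_arr F f)"
      using fa by (simp add: F_def FdVec_simps compose_def cong: restrict_cong)
  qed
  have ff: "bij_betw (on_arr F) (Hom (full_subcategory C S) X Y) (Hom FdVec (on_obj F X) (on_obj F Y))"
    if "X \<in> obj (full_subcategory C S)" "Y \<in> obj (full_subcategory C S)" for X Y
  proof -
    have X: "X \<in> S" and Y: "Y \<in> S" using that by simp_all
    have YO: "Y \<in> obj C" using Y S by auto
    obtain n a b where T: "trivial_object C X n a b" using triv[OF X] by blast
    have "inj_on (on_arr F) (Hom C X Y)"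
    proof (rule inj_onI)
      fix f g assume f: "f \<in> Hom C X Y" and g: "g \<in> Hom C X Y" and eq: "on_arr F f = on_arr F g"
      have fa: "f \<in> arr C" "src C f = X" "tgt C f = Y" "g \<in> arr C" "src C g = X" "tgt C g = Y" using f g
          by (auto simp: Hom_iff)
      show "f = g"
      proof (rule trivial_object_faithful[OF T f g])
        fix x assume x: "x \<in> Hom C \<I> X"
        have "(\<lambda>v\<in>carrier (V X). \<kappa> Y (f \<cdot> \<kappa>' X v)) (\<kappa> X x) =
              (\<lambda>v\<in>carrier (V X). \<kappa> Y (g \<cdot> \<kappa>' X v)) (\<kappa> X x)"
          using eq fa by (simp add: F_def)
        then have "\<kappa> Y (f \<cdot> x) = \<kappa> Y (g \<cdot> x)" using \<kappa>V[OF X x] \<kappa>'\<kappa>[OF X x] by simp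
        then have "\<kappa>' Y (\<kappa> Y (f \<cdot> x)) = \<kappa>' Y (\<kappa> Y (g \<cdot> x))" by (rule arg_cong)
        then show "f \<cdot> x = g \<cdot> x" using \<kappa>'\<kappa>[OF Y] cmp_Hom[OF x f] cmp_Hom[OF x g] by simp
      qed
    qed
    moreover have "\<exists>f\<in>Hom C X Y. on_arr F f = h" if h: "h \<in> Hom FdVec (V X) (V Y)" for h
    proof -
      obtain \<phi> where \<phi>: "h = (V X, \<phi>, V Y)" "linear_map (V X) (V Y) \<phi>" "\<phi> \<in> extensional (carrier (V X))"
        using h by (rule FdVec_HomE)
      have "linear_map (?H X) (?H Y) (\<lambda>x. \<kappa>' Y (\<phi> (\<kappa> X x)))"
        using linear_map_comp[OF linear_map_comp[OF VD(2)[OF X] \<phi>(2)] VD(3)[OF Y]] .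
      then obtain f where f: "f \<in> Hom C X Y" "\<And>x. x \<in> Hom C \<I> X \<Longrightarrow> f \<cdot> x = \<kappa>' Y (\<phi> (\<kappa> X x))"
        using trivial_object_full[OF T YO] by blast
      have fa: "src C f = X" "tgt C f = Y" using f(1) by (auto simp: Hom_iff)
      have "\<kappa> Y (f \<cdot> \<kappa>' X v) = \<phi> v" if v: "v \<in> carrier (V X)" for v
        using f(2)[OF \<kappa>'H[OF X v]] \<kappa>\<kappa>'[OF X v] \<kappa>\<kappa>'[OF Y, of "\<phi> v"] FdVec_arrD(1)[OF \<phi>(2) v] by simp
      then have "on_arr F f = h"
        using \<phi>(3) by (simp add: F_def fa \<phi>(1) extensional_restrict cong: restrict_cong)
      then show ?thesis using f(1) by blast
    qed
    ultimately have "bij_betw (on_arr F) (Hom C X Y) (Hom FdVec (V X) (V Y))"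
      unfolding bij_betw_def using FH[OF X Y] by blast
    then show ?thesis using X Y by (simp add: Hom_full_subcategory F_def)
  qed
  \<comment> \<open>A multiple of the unit whose length is the dimension of \<open>W\<close> is sent
    to a copy of \<open>W\<close>, because both spaces have coordinate systems of that
    length.\<close>
  have es: "\<exists>X\<in>obj (full_subcategory C S). Iso FdVec (on_obj F X) W \<noteq> {}"
    if "W \<in> obj (FdVec :: (_, _, 'k) lcat)" for W
  proof -
    interpret W: fd_space W using that by (simp add: FdVec_obj)
    obtain b c where bc: "coordinate_system W (vdim W) b c" using W.ex_coordinate_system by blast
    obtain X a' b' where X: "X \<in> S" and T: "trivial_object C X (vdim W) a' b'" using ex by blast
    obtain f g where "linear_iso (?H X) W f g"
      using coordinate_systems_iso[OF fd_space.axioms(1)[OF fd[OF X]] W.vec_space_axioms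
          trivial_object_coordinates[OF T] bc] by blast
    from linear_iso_compose[OF linear_iso_sym[OF V(2)[OF X]] this]
    have "Iso FdVec (V X) W \<noteq> {}" using linear_iso_Iso_FdVec[OF VD(1)[OF X] W.fd_space_axioms] by blast
    then show ?thesis using X by (auto simp: F_def)
  qed
  show ?thesis
    using fully_faithful_equivalence[OF linear_category_full_subcategory[OF S] linear_category_FdVec
        linF ff es] by blast
qed

end

section \<open>Multiples of the unit inside the symmetric center\<close>

context weakly_nondegenerate
begin

text \<open>By naturality the braiding fixes the actions of \<open>i \<cdot> p\<close> and
  \<open>j \<cdot> q\<close>, and these sum to the identity.\<close>

lemma mbraiding_biproduct:
  assumes P: "is_biproduct C X Y P i j p q" and A: "A \<in> obj M"
    and X: "mbraiding M X A = ident M (X \<rhd>\<^sub>o\<^bsub>M\<^esub> A)" and Y: "mbraiding M Y A = ident M (Y \<rhd>\<^sub>o\<^bsub>M\<^esub> A)"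
  shows "mbraiding M P A = ident M (P \<rhd>\<^sub>o\<^bsub>M\<^esub> A)"
proof -
  have ij: "i \<in> arr C" "src C i = X" "tgt C i = P" "j \<in> arr C" "src C j = Y" "tgt C j = P"
    "p \<in> arr C" "src C p = P" "tgt C p = X" "q \<in> arr C" "src C q = P" "tgt C q = Y"
    and sum: "add_arr C (i \<cdot> p) (j \<cdot> q) = ident C P"
    using P by (auto simp: is_biproduct_def Hom_iff)
  have PO [simp]: "P \<in> obj C" using tgt_obj[of i] ij by simp
  let ?f = "\<lambda>h. h \<rhd>\<^sub>m\<^bsub>M\<^esub> ident M A"
  have ident: "ident M (P \<rhd>\<^sub>o\<^bsub>M\<^esub> A) = add_arr M (?f (i \<cdot> p)) (?f (j \<cdot> q))"
    using act_add_left[of "i \<cdot> p" P P "j \<cdot> q" "ident M A" A A] ij A by (simp add: sum Hom_iff)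
  have "mbraiding M P A \<cdot>\<^bsub>M\<^esub> ?f (i \<cdot> p) = (mbraiding M P A \<cdot>\<^bsub>M\<^esub> ?f i) \<cdot>\<^bsub>M\<^esub> ?f p" using ij A by simp
  also have "\<dots> = ?f (i \<cdot> p)" using mbraiding_nat[of i A] X ij A by simp
  finally have ip: "mbraiding M P A \<cdot>\<^bsub>M\<^esub> ?f (i \<cdot> p) = ?f (i \<cdot> p)" .
  have "mbraiding M P A \<cdot>\<^bsub>M\<^esub> ?f (j \<cdot> q) = (mbraiding M P A \<cdot>\<^bsub>M\<^esub> ?f j) \<cdot>\<^bsub>M\<^esub> ?f q" using ij A by simp
  also have "\<dots> = ?f (j \<cdot> q)" using mbraiding_nat[of j A] Y ij A by simp
  finally have jq: "mbraiding M P A \<cdot>\<^bsub>M\<^esub> ?f (j \<cdot> q) = ?f (j \<cdot> q)" .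
  have "mbraiding M P A = mbraiding M P A \<cdot>\<^bsub>M\<^esub> add_arr M (?f (i \<cdot> p)) (?f (j \<cdot> q))"
    unfolding ident[symmetric] using A by simp
  also have "\<dots> = add_arr M (mbraiding M P A \<cdot>\<^bsub>M\<^esub> ?f (i \<cdot> p)) (mbraiding M P A \<cdot>\<^bsub>M\<^esub> ?f (j \<cdot> q))"
    using ij A by (intro M.cmp_add_arr_right) simp_all
  also have "\<dots> = ident M (P \<rhd>\<^sub>o\<^bsub>M\<^esub> A)" unfolding ip jq by (rule ident[symmetric])
  finally show ?thesis .
qed

text \<open>Needed for essential surjectivity: every dimension must be realized by an object on
  which the module braiding is trivial.\<close>

lemma ex_trivial_object_in_center:
  "\<exists>X\<in>obj C. (\<forall>A\<in>obj M. mbraiding M X A = ident M (X \<rhd>\<^sub>o\<^bsub>M\<^esub> A)) \<and> (\<exists>a b. trivial_object C X n a b)"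
proof (induction n)
  case 0
  obtain Z where Z: "zero_object C Z" using ex_zero_object by blast
  then have ZO: "Z \<in> obj C" by (simp add: zero_object_def)
  with Z have id: "ident C Z = zero_arr C Z Z" by (simp add: zero_object_iff)
  have "trivial_object C Z 0 a b" for a b using ZO id by (simp add: trivial_object_def)
  moreover have "mbraiding M Z A = ident M (Z \<rhd>\<^sub>o\<^bsub>M\<^esub> A)" if "A \<in> obj M" for A
  proof -
    \<comment> \<open>The zero object embeds in the unit, so triviality of the braiding is inherited
      from there.\<close>
    have "is_mono C (zero_arr C Z \<I>)"
      using Z ZO by (auto simp: is_mono_def zero_object_def)
    from mbraiding_mono[OF this that] show ?thesis using mbraiding_unit'[OF that] ZO by simp
  qed
  ultimately show ?case using ZO by blast
next
  case (Suc n)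
  then obtain D a b where D: "D \<in> obj C" "\<And>A. A \<in> obj M \<Longrightarrow> mbraiding M D A = ident M (D \<rhd>\<^sub>o\<^bsub>M\<^esub> A)"
    and T: "trivial_object C D n a b" by blast
  obtain P i j p q where P: "P \<in> obj C" "is_biproduct C D \<I> P i j p q"
      using ex_biproduct[OF D(1) unit_obj] by blast
  show ?case
    using P(1) trivial_object_biproduct[OF T P(2)] mbraiding_biproduct[OF P(2) _ D(2) mbraiding_unit']
        by blast
qed

end

theorem theorem5p21:
  fixes C :: "('o, 'm, 'k :: alg_closed_field) braided_moncat"
    and M :: "('o, 'm, 'p, 'q, 'k) braided_modcat"
  assumes "braided_finite_tensor_category C"
    and "braided_finite_module_category C M"
    and "nonzero_category M"
    and "exact_module_category C M"
    and "indecomposable_module_category C M"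
    and "weakly_factorizable C M"
  shows "trivial_symmetric_center C M"
proof -
  obtain ldual lev lcoev ihom iev E\<^sub>C \<pi>\<^sub>C E\<^sub>M \<pi>\<^sub>M \<omega> where
    cd: "copairing_data C M ldual lev lcoev ihom iev E\<^sub>C \<pi>\<^sub>C E\<^sub>M \<pi>\<^sub>M"
    and \<omega>: "copairing_data.universal_copairing C M ldual lcoev ihom iev E\<^sub>C \<pi>\<^sub>C E\<^sub>M \<pi>\<^sub>M \<omega>"
    and bij: "bij_betw (copairing_data.Omega C E\<^sub>M \<omega>) (Hom C E\<^sub>C \<I>\<^bsub>C\<^esub>) (Hom C \<I>\<^bsub>C\<^esub> E\<^sub>M)"
    using assms(6) unfolding weakly_factorizable_def by blast
  interpret weakly_nondegenerate_closed C M ldual lev lcoev ihom iev E\<^sub>C \<pi>\<^sub>C E\<^sub>M \<pi>\<^sub>M \<omega>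
    by (intro weakly_nondegenerate_closed.intro weakly_nondegenerate.intro braided_module_data.intro
        weakly_nondegenerate_axioms.intro assms(1,2) cd \<omega> bij_betw_imp_inj_on[OF bij])
  let ?S = "{X \<in> obj C. \<forall>A\<in>obj M. mbraiding M X A = ident M (X \<rhd>\<^sub>o\<^bsub>M\<^esub> A)}"
  have "\<exists>F. equivalence (full_subcategory C ?S) (FdVec :: (_, _, 'k) lcat) F"
  proof (rule trivial_objects_equivalence)
    show "\<exists>X\<in>?S. \<exists>a b. trivial_object C X n a b" for n
      using ex_trivial_object_in_center[of n] by blast
  qed (use center_trivial_object in auto)
  then show ?thesis by (simp add: trivial_symmetric_center_def symmetric_center_def)
qed

end
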